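(* Let $n\ge 2$ and $0<s<1$. Let $\Omega\subset\mathbb{R}^n$ be a connected set with smooth boundary $\Gamma=\partial\Omega$, let $d$ be the signed distance function associated to $\Omega$ (positive in $\Omega$), and assume there is some $\rho>0$ such that $d$ is smooth in $Q_{2\rho}$ (in particular $|\nabla d|=1$ in $Q_{2\rho}$). Then $$ \lim_{\varepsilon\to0}\bar a_\varepsilon(x)= \begin{cases} \kappa[x,d] & \text{if } s\in(0,\tfrac12),\\[4pt] \dfrac12\,\dfrac{|S^{n-2}|}{n-1}\,\Delta d(x) & \text{if } s=\tfrac12,\\[8pt] \dfrac{c_\star}{2}\,\dfrac{|S^{n-2}|}{n-1}\,\Delta d(x) & \text{if } s\in(\tfrac12,1), \end{cases} $$ uniformly in $Q_\rho$, where, for $s\in(\tfrac12,1)$, the constant $c_\star>0$ is given explicitly by $$ c_\star=\frac{n+2s}{2}\left[\int_0^\infty\frac{q^{n-2}\big((n-1)-q^2\big)}{(1+q^2)^{\frac{n+2s+2}{2}}}\,dq\right]\left[\int_{\mathbb{R}}\int_{\mathbb{R}}\frac{(\phi(\xi+w)-\phi(\xi))^2}{|w|^{1+2s}}\,dw\,d\xi\right]. $$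
   Context: Signed distance and neighborhoods: $d(x)=\operatorname{dist}(x,\Gamma)$ if $x\in\Omega$ and $d(x)=-\operatorname{dist}(x,\Gamma)$ otherwise; $Q_\rho=\{x\in\mathbb{R}^n:|d(x)|<\rho\}$ (and similarly $Q_{2\rho}$). Fractional mean curvature: with $\nu(dz)=\dfrac{dz}{|z|^{n+2s}}$, $$\kappa[x,d]=\nu(\{z:d(x+z)>d(x),\ \nabla d(x)\cdot z<0\})-\nu(\{z:d(x+z)<d(x),\ \nabla d(x)\cdot z>0\}).$$ Potential: $W$ is a fixed double-well potential with $W\in C^{2,\beta}(\mathbb{R})$ for some $0<\beta<1$, $W(0)=W(1)=0$, $W(u)>0$ for all $u\in(0,1)$, $W'(0)=W'(1)=0$, $W''(0)=W''(1)>0$. Phase transition: $\phi:\mathbb{R}\to(0,1)$ is the unique solution (it belongs to $C^{2,\beta}(\mathbb{R})$) of $$\mathcal{I}_1^s[\phi]=W'(\phi)\ \text{in }\mathbb{R},\quad \dot\phi>0\ \text{in }\mathbb{R},\quad \phi(-\infty)=0,\ \phi(+\infty)=1,\ \phi(0)=\tfrac12,$$ where $\mathcal{I}_1^s u(x)=\operatorname{P.V.}\int_{\mathbb{R}}(u(x+y)-u(x))\frac{dy}{|y|^{1+2s}}$. The functions $a_\varepsilon$ and $\bar a_\varepsilon$ ($\varepsilon>0$): for $(\xi,x)\in\mathbb{R}\times\mathbb{R}^n$, $$a_\varepsilon(\xi;x)=\int_{\mathbb{R}^n}\left(\phi\Big(\xi+\frac{d(x+\varepsilon z)-d(x)}{\varepsilon}\Big)-\phi\big(\xi+\nabla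 d(x)\cdot z\big)\right)\frac{dz}{|z|^{n+2s}},\qquad \bar a_\varepsilon(x)=\frac1{\eta_\varepsilon}\int_{\mathbb{R}}a_\varepsilon(\xi;x)\,\dot\phi(\xi)\,d\xi,$$ where $\eta_\varepsilon=\varepsilon^{2s}$ if $s\in(0,\frac12)$, $\eta_\varepsilon=\varepsilon|\ln\varepsilon|$ if $s=\frac12$, and $\eta_\varepsilon=\varepsilon$ if $s\in(\frac12,1)$. $S^{n-2}$ is the unit sphere in $\mathbb{R}^{n-1}$ and $|S^{n-2}|$ its $(n-2)$-dimensional Hausdorff measure (so $|S^0|=2$).
   Formalization: For s ≥ 1/2 and unbounded Γ, uniformity on all of Q_ρ fails for merely smooth d (e.g. Ω={y>g(t)}, g''=c sin t²); it is proved when all derivatives of d are bounded on each Q_r, r<2ρ, and otherwise on bounded subsets of Q_ρ. *)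

theory Defs
  imports "HOL-Analysis.Analysis"
begin

subsection \<open>Differential calculus in Euclidean space\<close>

definition grad :: "(real^'n \<Rightarrow> real) \<Rightarrow> real^'n \<Rightarrow> real^'n" where
  "grad f x = (THE D. GDERIV f x :> D)"

definition partial :: "'n \<Rightarrow> (real^'n \<Rightarrow> real) \<Rightarrow> real^'n \<Rightarrow> real" where
  "partial i f x = grad f x $ i"

definition laplacian :: "(real^'n \<Rightarrow> real) \<Rightarrow> real^'n \<Rightarrow> real" where
  "laplacian f x = (\<Sum>i\<in>UNIV. partial i (partial i f) x)"

fun iter_partial :: "'n list \<Rightarrow> (real^'n \<Rightarrow> real) \<Rightarrow> real^'n \<Rightarrow> real" where
  "iter_partial [] f = f"
| "iter_partial (i # is) f = partial i (iter_partial is f)"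

text \<open>For open \<open>S\<close> this is membership in \<open>C\<^sup>\<infinity>(S)\<close>: differentiability of every iterated
  partial derivative gives the continuity of all of them.\<close>

definition smooth_on :: "(real^'n) set \<Rightarrow> (real^'n \<Rightarrow> real) \<Rightarrow> bool" where
  "smooth_on S f \<longleftrightarrow> (\<forall>is. \<forall>x\<in>S. iter_partial is f differentiable (at x))"

text \<open>Smoothness of the signed distance in a tube around an unbounded hypersurface bounds its
  second derivatives on smaller tubes, but not their modulus of continuity: for
  \<open>\<Omega> = {(t, y). y > g t}\<close> with \<open>g'' t = c sin (t\<^sup>2)\<close>, \<open>c\<close> small, the Laplacian oscillates ever
  faster along the boundary, so for \<open>s \<ge> 1/2\<close> the averages at a fixed scale tend to 0 at
  infinity while the Laplacian does not. Convergence that is uniform on an unbounded tube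
  therefore needs bounded derivatives; over a bounded boundary they are automatic on smaller
  tubes.\<close>

definition bounded_derivs_on :: "(real^'n) set \<Rightarrow> (real^'n \<Rightarrow> real) \<Rightarrow> bool" where
  "bounded_derivs_on S f \<longleftrightarrow> (\<forall>is. bounded (iter_partial is f ` S))"

subsection \<open>Sets with smooth boundary and the signed distance\<close>

text \<open>Near each boundary point, \<open>\<Omega>\<close> lies on one side of the boundary, which is a regular level
  set of a smooth function. \<open>\<Omega>\<close> may or may not contain its boundary points; the signed distance
  vanishes there in either case.\<close>

definition smooth_boundary :: "(real^'n) set \<Rightarrow> bool" where
  "smooth_boundary \<Omega> \<longleftrightarrow>
    (\<forall>p\<in>frontier \<Omega>. \<exists>U g. open U \<and> p \<in> U \<and> smooth_on U g \<and> (\<forall>x\<in>U. grad g x \<noteq> 0) \<and>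
       {x\<in>U. g x > 0} \<subseteq> \<Omega> \<and> {x\<in>U. g x < 0} \<subseteq> - \<Omega> \<and> {x\<in>U. g x = 0} = U \<inter> frontier \<Omega>)"

definition signed_dist :: "(real^'n) set \<Rightarrow> real^'n \<Rightarrow> real" where
  "signed_dist \<Omega> x =
    (if x \<in> \<Omega> then infdist x (frontier \<Omega>) else - infdist x (frontier \<Omega>))"

definition tube :: "(real^'n) set \<Rightarrow> real \<Rightarrow> (real^'n) set" where
  "tube \<Omega> \<rho> = {x. \<bar>signed_dist \<Omega> x\<bar> < \<rho>}"

subsection \<open>Fractional mean curvature\<close>

definition frac_measure :: "real \<Rightarrow> (real^'n) measure" where
  "frac_measure s =
    density lborel (\<lambda>z. ennreal (1 / norm z powr (real CARD('n) + 2 * s)))"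

definition frac_curvature :: "real \<Rightarrow> real^'n \<Rightarrow> (real^'n \<Rightarrow> real) \<Rightarrow> real" where
  "frac_curvature s x d =
     measure (frac_measure s) {z. d (x + z) > d x \<and> grad d x \<bullet> z < 0}
   - measure (frac_measure s) {z. d (x + z) < d x \<and> grad d x \<bullet> z > 0}"

subsection \<open>Double-well potential and phase transition\<close>

definition C2_holder_on :: "real set \<Rightarrow> real \<Rightarrow> (real \<Rightarrow> real) \<Rightarrow> bool" where
  "C2_holder_on S \<beta> f \<longleftrightarrow>
     (\<forall>x\<in>S. f field_differentiable (at x) \<and> deriv f field_differentiable (at x)) \<and>
     bounded (f ` S) \<and> bounded (deriv f ` S) \<and> bounded (deriv (deriv f) ` S) \<and>
     (\<exists>C. \<forall>x\<in>S. \<forall>y\<in>S. \<bar>deriv (deriv f) x - deriv (deriv f) y\<bar> \<le> C * \<bar>x - y\<bar> powr \<beta>)"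

text \<open>The Hoelder condition on the potential is local, so that for example
  \<open>u\<^sup>2 (1 - u)\<^sup>2\<close> is admitted; the phase transition below is required to have finite
  \<open>C\<^sup>2\<^sup>,\<^sup>\<beta>\<close> norm on the whole line.\<close>

definition double_well :: "real \<Rightarrow> (real \<Rightarrow> real) \<Rightarrow> bool" where
  "double_well \<beta> W \<longleftrightarrow>
     (\<forall>R. C2_holder_on {-R..R} \<beta> W) \<and>
     W 0 = 0 \<and> W 1 = 0 \<and> (\<forall>u. 0 < u \<and> u < 1 \<longrightarrow> W u > 0) \<and>
     deriv W 0 = 0 \<and> deriv W 1 = 0 \<and>
     deriv (deriv W) 0 = deriv (deriv W) 1 \<and> deriv (deriv W) 1 > 0"

definition has_frac_laplacian_at :: "real \<Rightarrow> (real \<Rightarrow> real) \<Rightarrow> real \<Rightarrow> real \<Rightarrow> bool" where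
  "has_frac_laplacian_at s u x l \<longleftrightarrow>
     (\<forall>\<delta>>0. set_integrable lborel {y. \<bar>y\<bar> > \<delta>} (\<lambda>y. (u (x + y) - u x) / \<bar>y\<bar> powr (1 + 2 * s))) \<and>
     ((\<lambda>\<delta>. set_lebesgue_integral lborel {y. \<bar>y\<bar> > \<delta>}
             (\<lambda>y. (u (x + y) - u x) / \<bar>y\<bar> powr (1 + 2 * s))) \<longlongrightarrow> l) (at_right 0)"

definition phase_transition :: "real \<Rightarrow> real \<Rightarrow> (real \<Rightarrow> real) \<Rightarrow> (real \<Rightarrow> real) \<Rightarrow> bool" where
  "phase_transition s \<beta> W \<phi> \<longleftrightarrow>
     C2_holder_on UNIV \<beta> \<phi> \<and>
     (\<forall>\<xi>. 0 < \<phi> \<xi> \<and> \<phi> \<xi> < 1) \<and>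
     (\<forall>\<xi>. has_frac_laplacian_at s \<phi> \<xi> (deriv W (\<phi> \<xi>))) \<and>
     (\<forall>\<xi>. deriv \<phi> \<xi> > 0) \<and>
     (\<phi> \<longlongrightarrow> 0) at_bot \<and> (\<phi> \<longlongrightarrow> 1) at_top \<and> \<phi> 0 = 1 / 2"

subsection \<open>The functions \<open>a\<^sub>\<epsilon>\<close> and their averages\<close>

definition a_eps ::
  "real \<Rightarrow> (real \<Rightarrow> real) \<Rightarrow> (real^'n \<Rightarrow> real) \<Rightarrow> real \<Rightarrow> real \<Rightarrow> real^'n \<Rightarrow> real" where
  "a_eps s \<phi> d \<epsilon> \<xi> x =
     (LINT z|lborel. (\<phi> (\<xi> + (d (x + \<epsilon> *\<^sub>R z) - d x) / \<epsilon>) - \<phi> (\<xi> + grad d x \<bullet> z))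
                       / norm z powr (real CARD('n) + 2 * s))"

definition eta :: "real \<Rightarrow> real \<Rightarrow> real" where
  "eta s \<epsilon> = (if s < 1/2 then \<epsilon> powr (2 * s) else if s = 1/2 then \<epsilon> * \<bar>ln \<epsilon>\<bar> else \<epsilon>)"

definition a_bar ::
  "real \<Rightarrow> (real \<Rightarrow> real) \<Rightarrow> (real^'n \<Rightarrow> real) \<Rightarrow> real \<Rightarrow> real^'n \<Rightarrow> real" where
  "a_bar s \<phi> d \<epsilon> x = 1 / eta s \<epsilon> * (LINT \<xi>|lborel. a_eps s \<phi> d \<epsilon> \<xi> x * deriv \<phi> \<xi>)"

subsection \<open>Constants\<close>

text \<open>Hausdorff measure, normalised to agree with Lebesgue measure on \<open>k\<close>-dimensional
  Euclidean space. Empty covering sets have weight 0, other sets of diameter 0 have weight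
  \<open>0 ^ k\<close>; so for \<open>k = 0\<close> this is the counting measure.\<close>

definition hausdorff_premeasure :: "nat \<Rightarrow> real \<Rightarrow> 'a::metric_space set \<Rightarrow> ennreal" where
  "hausdorff_premeasure k \<delta> A =
     (INF U \<in> {U :: nat \<Rightarrow> 'a set. A \<subseteq> (\<Union>i. U i) \<and> (\<forall>i. bounded (U i) \<and> diameter (U i) \<le> \<delta>)}.
        (\<Sum>i. if U i = {} then 0
             else ennreal (unit_ball_vol (real k) * (diameter (U i) / 2) ^ k)))"

definition hausdorff_measure :: "nat \<Rightarrow> 'a::metric_space set \<Rightarrow> ennreal" where
  "hausdorff_measure k A = (SUP \<delta>\<in>{0<..}. hausdorff_premeasure k \<delta> A)"

text \<open>The surface measure of the unit sphere of \<open>\<real>\<^sup>m\<close>, \<open>m = CARD('m)\<close>.\<close>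

definition unit_sphere_area :: "'m::finite itself \<Rightarrow> real" where
  "unit_sphere_area _ =
     enn2real (hausdorff_measure (CARD('m) - 1) (sphere (0 :: real^'m) 1))"

definition c_star :: "nat \<Rightarrow> real \<Rightarrow> (real \<Rightarrow> real) \<Rightarrow> real" where
  "c_star n s \<phi> =
     (real n + 2 * s) / 2
     * (LINT q:{0<..}|lborel.
          q ^ (n - 2) * ((real n - 1) - q\<^sup>2) / (1 + q\<^sup>2) powr ((real n + 2 * s + 2) / 2))
     * (LINT \<xi>|lborel. LINT w|lborel. (\<phi> (\<xi> + w) - \<phi> \<xi>)\<^sup>2 / \<bar>w\<bar> powr (1 + 2 * s))"

text \<open>The limit function; \<open>A\<close> stands for the area of the unit sphere of \<open>\<real>\<^sup>n\<^sup>-\<^sup>1\<close>.\<close>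

definition limit_curvature ::
  "real \<Rightarrow> real \<Rightarrow> (real \<Rightarrow> real) \<Rightarrow> (real^'n \<Rightarrow> real) \<Rightarrow> real^'n \<Rightarrow> real" where
  "limit_curvature A s \<phi> d x =
     (if s < 1/2 then frac_curvature s x d
      else if s = 1/2 then 1 / 2 * (A / (real CARD('n) - 1)) * laplacian d x
      else c_star CARD('n) s \<phi> / 2 * (A / (real CARD('n) - 1)) * laplacian d x)"

end

theory Submission
  imports Defs "HOL-Probability.Probability_Measure"
begin

text \<open>Fix a point \<open>x\<close> of the tube, put \<open>e = grad d x\<close> and \<open>P = n + 2 s\<close>, and let \<open>E(t)\<close> be the integral of
\<open>1_{d (x + y) - d x > t} - 1_{e \<bullet> y > t}\<close> against \<open>norm y powr - P\<close> over all \<open>y\<close>: the weighted amount by which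
a level set of \<open>d\<close> near \<open>x\<close> exceeds the tangent half-space. This is \<open>level_excess\<close>.

Since \<open>\<phi>\<close> increases from 0 to 1, its derivative is a probability density and \<open>\<phi> u\<close> is the
mass of \<open>{..<u}\<close>. Writing \<open>\<phi>\<close> in the definition of \<open>a_eps\<close> as such a mass, exchanging the integrals
and dilating \<open>y = \<epsilon> z\<close> gives \<open>a_bar = \<epsilon> powr (2 s) / eta * (LINT t|gap. E (\<epsilon> * t))\<close>, where \<open>gap\<close> is the law
of the difference of two independent variables with density \<open>deriv \<phi>\<close>
(\<open>a_bar_eq_gap_integral\<close>). So the theorem is a statement about \<open>E\<close> near 0, uniformly in \<open>x\<close>.

The geometry enters through two facts about a 1-Lipschitz function with unit gradient on a tube
(locale \<open>eikonal\<close>): its gradient lines are straight, whence the bound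
\<open>\<bar>d (x + y) - d x - e \<bullet> y\<bar> \<le> (norm y)\<^sup>2 / (2 t)\<close> for every \<open>y\<close>, near or far, in which \<open>t\<close> measures only the room of
\<open>x\<close> inside the tube (\<open>quadratic_bound\<close>); and thin neighbourhoods of level sets have uniformly small
volume on balls of a given radius (\<open>thin_level_set\<close>).

For \<open>s < 1/2\<close> the quadratic bound makes the part of \<open>E\<close> near the origin uniformly small, and
the thinness of level sets controls the rest. Hence \<open>E\<close> is bounded and continuous at 0,
uniformly in \<open>x\<close>. Moreover \<open>E 0\<close> is the fractional mean curvature and
the prefactor is 1, so averaging \<open>E (\<epsilon> * t)\<close> over \<open>gap\<close> gives the curvature in the limit.

For \<open>s \<ge> 1/2\<close> the function \<open>E\<close> is unbounded near 0, and the rate is what matters. In coordinates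
\<open>(t, y)\<close> with \<open>t\<close> along \<open>e\<close>, the two sets compared differ over \<open>y\<close> by an interval near \<open>\<tau>\<close>
whose signed length is half the value at \<open>(\<tau>, y)\<close> of the second
derivative of \<open>d\<close>, up to a cubic error. The second derivative along \<open>e\<close> vanishes,
the mixed terms are odd in \<open>y\<close>, and what is left of the quadratic form after averaging over
spheres is its trace, the Laplacian. Therefore \<open>E(\<tau>)\<close> is
\<open>laplacian d x / 2 * unit_ball_vol (n - 1) * g(\<tau>)\<close> up to a bounded error, with \<open>g(\<tau>)\<close> a multiple of
\<open>\<bar>\<tau>\<bar> powr (1 - 2 s)\<close> or the positive part of \<open>ln (1 / \<bar>\<tau>\<bar>)\<close> (\<open>level_excess_expansion\<close>). The prefactor
tends to 0 and removes the error. The average of \<open>g(\<epsilon> * t)\<close> over \<open>gap\<close>, multiplied by the prefactor, tends to 1 for \<open>s = 1/2\<close>;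
for \<open>s > 1/2\<close> it equals \<open>c_star\<close>, by the identity \<open>energy_eq\<close> between the moment of \<open>gap\<close> of order \<open>1 - 2 s\<close> and the
energy of \<open>\<phi>\<close>, together with an integration by parts in \<open>c_star_profile_factor\<close>.

It remains to know that the unit sphere of \<open>\<real>\<^sup>m\<close> has Hausdorff measure \<open>m\<close> times the volume of
the unit ball (\<open>hausdorff_measure_unit_sphere\<close>). The upper bound comes from a Vitali covering by
small caps. The lower bound needs that a small piece of the sphere is hardly larger than a flat disc of the same
diameter, an isodiametric inequality; it follows from the Prekopa-Leindler
inequality, by which a compact set has at most the volume of half its difference body.\<close>

section \<open>Isometries and radial functions\<close>

lemma isometry_surj:
  fixes T :: "'a::euclidean_space \<Rightarrow> 'b::euclidean_space"
  assumes "linear T" "\<And>x. norm (T x) = norm x" "DIM('a) = DIM('b)"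
  shows "surj T"
proof -
  interpret linear T by fact
  have inj: "inj T"
    using assms(2) by (auto simp: linear_injective_0[OF assms(1)]) (metis norm_eq_zero)
  have "dim (range T) = dim (UNIV::'a set)"
    using inj by (intro dim_image_eq[OF assms(1)]) auto
  then have "dim (range T) = dim (UNIV :: 'b set)"
    using assms(3) by (simp add: dim_UNIV)
  moreover have "subspace (range T)"
    using assms(1) by (simp add: linear_subspace_image subspace_UNIV)
  ultimately show ?thesis
    by (metis dim_eq_full span_eq_iff dim_UNIV)
qed

text \<open>The image measure is translation invariant, because an isometry onto the space turns translations into
translations. Comparing it with Lebesgue measure through the double integral of
\<open>1_A(x) 1_B(y - x)\<close> shows that the two are proportional, and the unit ball fixes the factor.\<close>

lemma lborel_distr_isometry:
  fixes T :: "'a::euclidean_space \<Rightarrow> 'b::euclidean_space"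
  assumes lin: "linear T" and iso: "\<And>x. norm (T x) = norm x" and dim: "DIM('a) = DIM('b)"
  shows "distr lborel borel T = (lborel :: 'b measure)"
proof -
  interpret T: linear T by fact
  have cT: "continuous_on UNIV T"
    using lin linear_continuous_on linear_conv_bounded_linear by blast
  have T[measurable]: "T \<in> borel_measurable borel"
    using cT by (rule borel_measurable_continuous_onI)
  define \<mu> where "\<mu> = distr lborel borel T"
  have smu[measurable_cong]: "sets \<mu> = sets borel" by (simp add: \<mu>_def)
  have sl[measurable_cong]: "sets lborel = sets (borel :: 'b measure)" by simp
  have nn_mu: "(\<integral>\<^sup>+x. f x \<partial>\<mu>) = (\<integral>\<^sup>+x. f (T x) \<partial>lborel)" if "f \<in> borel_measurable borel" for f
    unfolding \<mu>_def using that by (subst nn_integral_distr) auto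
  have fin_ball: "emeasure \<mu> (ball 0 r) = emeasure lborel (ball (0::'b) r)" if "r \<ge> 0" for r
  proof -
    have "emeasure \<mu> (ball 0 r) = emeasure lborel (T -` ball 0 r)"
      unfolding \<mu>_def by (subst emeasure_distr) auto
    also have "T -` ball 0 r = ball 0 r" by (auto simp: iso)
    finally show ?thesis using that dim by (simp add: emeasure_ball)
  qed
  have sf: "sigma_finite_measure \<mu>"
  proof
    have "range (\<lambda>n::nat. ball (0::'b) (real n)) \<subseteq> sets \<mu>" by (auto simp: smu)
    moreover have "(\<Union>n::nat. ball (0::'b) (real n)) = space \<mu>"
      by (auto simp: \<mu>_def) (meson reals_Archimedean2)
    moreover have "\<forall>n. emeasure \<mu> (ball 0 (real n)) \<noteq> \<infinity>"
      by (simp add: fin_ball emeasure_ball)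
    ultimately show "\<exists>A. countable A \<and> A \<subseteq> sets \<mu> \<and> \<Union> A = space \<mu> \<and> (\<forall>a\<in>A. emeasure \<mu> a \<noteq> \<infinity>)"
      by (intro exI[of _ "range (\<lambda>n::nat. ball (0::'b) (real n))"]) auto
  qed
  interpret P: pair_sigma_finite \<mu> "lborel :: 'b measure"
    using sf by (simp add: pair_sigma_finite_def sigma_finite_lborel)
  have tl: "(\<integral>\<^sup>+y. f (c + y) \<partial>lborel) = (\<integral>\<^sup>+y. f y \<partial>lborel)"
    if "f \<in> borel_measurable borel" for f and c :: "'b"
    using that by (subst (2) lborel_distr_plus[of c, symmetric], subst nn_integral_distr) auto
  have tl': "(\<integral>\<^sup>+y. f (c + y) \<partial>lborel) = (\<integral>\<^sup>+y. f y \<partial>lborel)"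
    if "f \<in> borel_measurable borel" for f and c :: "'a"
    using that by (subst (2) lborel_distr_plus[of c, symmetric], subst nn_integral_distr) auto
  have tm: "(\<integral>\<^sup>+y. f (c + y) \<partial>\<mu>) = (\<integral>\<^sup>+y. f y \<partial>\<mu>)"
    if [measurable]: "f \<in> borel_measurable borel" for f and c :: "'b"
  proof -
    obtain a where a: "c = T a"
      using isometry_surj[OF lin iso dim] by (metis surjD)
    show ?thesis
      using tl'[of "\<lambda>y. f (T y)" a] by (simp add: nn_mu a T.add)
  qed
  have key: "emeasure \<mu> A * emeasure lborel B = emeasure \<mu> (uminus -` B) * emeasure lborel A"
    if [measurable]: "A \<in> sets borel" "B \<in> sets borel" for A B :: "'b set"
  proof -
    have "emeasure \<mu> A * emeasure lborel B = (\<integral>\<^sup>+x. indicator A x * emeasure lborel B \<partial>\<mu>)"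
      by (simp add: nn_integral_multc smu)
    also have "\<dots> = (\<integral>\<^sup>+x. (\<integral>\<^sup>+y. indicator A x * indicator B y \<partial>lborel) \<partial>\<mu>)"
      by (simp add: nn_integral_cmult)
    also have "\<dots> = (\<integral>\<^sup>+x. (\<integral>\<^sup>+y. indicator A x * indicator B (y - x) \<partial>lborel) \<partial>\<mu>)"
    proof (rule nn_integral_cong)
      fix x
      show "(\<integral>\<^sup>+y. indicator A x * indicator B y \<partial>lborel)
          = (\<integral>\<^sup>+y. indicator A x * indicator B (y - x) \<partial>lborel)"
        by (subst tl[of "\<lambda>y. indicator A x * indicator B (y - x)" x, symmetric]) simp_all
    qed
    also have "\<dots> = (\<integral>\<^sup>+y. (\<integral>\<^sup>+x. indicator A x * indicator B (y - x) \<partial>\<mu>) \<partial>lborel)"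
      by (rule P.Fubini'[symmetric]) measurable
    also have "\<dots> = (\<integral>\<^sup>+y. (\<integral>\<^sup>+x. indicator A (y + x) * indicator B (- x) \<partial>\<mu>) \<partial>lborel)"
    proof (rule nn_integral_cong)
      fix y
      show "(\<integral>\<^sup>+x. indicator A x * indicator B (y - x) \<partial>\<mu>)
          = (\<integral>\<^sup>+x. indicator A (y + x) * indicator B (- x) \<partial>\<mu>)"
        by (subst tm[of "\<lambda>x. indicator A x * indicator B (y - x)" y, symmetric]) simp_all
    qed
    also have "\<dots> = (\<integral>\<^sup>+x. (\<integral>\<^sup>+y. indicator A (y + x) * indicator B (- x) \<partial>lborel) \<partial>\<mu>)"
      by (rule P.Fubini') measurable
    also have "\<dots> = (\<integral>\<^sup>+x. (\<integral>\<^sup>+y. indicator A y * indicator B (- x) \<partial>lborel) \<partial>\<mu>)"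
    proof (rule nn_integral_cong)
      fix x
      show "(\<integral>\<^sup>+y. indicator A (y + x) * indicator B (- x) \<partial>lborel)
          = (\<integral>\<^sup>+y. indicator A y * indicator B (- x) \<partial>lborel)"
        using tl[of "\<lambda>y. indicator A y * indicator B (-x)" x] by (simp add: add.commute)
    qed
    also have "\<dots> = (\<integral>\<^sup>+x. indicator (uminus -` B) x * emeasure lborel A \<partial>\<mu>)"
    proof (rule nn_integral_cong)
      fix x
      have "(\<integral>\<^sup>+y. indicator A y * indicator B (- x) \<partial>lborel) = emeasure lborel A * indicator B (- x)"
        by (subst nn_integral_multc) auto
      then show "(\<integral>\<^sup>+y. indicator A y * indicator B (- x) \<partial>lborel)
          = indicator (uminus -` B) x * emeasure lborel A"
        by (simp add: mult.commute indicator_def)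
    qed
    also have "\<dots> = emeasure \<mu> (uminus -` B) * emeasure lborel A"
    proof -
      have "uminus -` B \<in> sets \<mu>"
        using measurable_sets[of "uminus :: 'b \<Rightarrow> 'b" borel borel B] smu by simp
      then show ?thesis by (simp add: nn_integral_multc)
    qed
    finally show ?thesis .
  qed
  have "\<mu> = lborel"
  proof (rule measure_eqI)
    fix A assume "A \<in> sets \<mu>"
    then have A: "A \<in> sets borel" by (simp add: smu)
    have "uminus -` ball (0::'b) 1 = ball 0 1" by auto
    with key[OF A, of "ball 0 1"] fin_ball[of 1]
    have "emeasure lborel (ball (0::'b) 1) * emeasure \<mu> A
        = emeasure lborel (ball (0::'b) 1) * emeasure lborel A"
      by (simp add: mult.commute)
    moreover have "emeasure lborel (ball (0::'b) 1) \<noteq> 0" "emeasure lborel (ball (0::'b) 1) \<noteq> \<infinity>"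
      by (auto simp: emeasure_ball) (metis less_numeral_extra(3) of_nat_0_le_iff unit_ball_vol_pos order.antisym less_eq_real_def)
    ultimately show "emeasure \<mu> A = emeasure lborel A"
      by (simp add: ennreal_mult_cancel_left)
  qed (simp add: smu)
  then show ?thesis by (simp add: \<mu>_def)
qed

text \<open>Both sides are integrals against the law of the norm, whose distribution function \<open>unit_ball_vol n * r ^ n\<close> is
known; its density appears on the right.\<close>

lemma nn_integral_radial:
  fixes f :: "real \<Rightarrow> ennreal"
  assumes [measurable]: "f \<in> borel_measurable borel"
  shows "(\<integral>\<^sup>+x. f (norm (x::'a::euclidean_space)) \<partial>lborel) =
    (\<integral>\<^sup>+r. ennreal (indicator {0<..} r * (real DIM('a) * unit_ball_vol (real DIM('a)) * r ^ (DIM('a) - 1))) * f r \<partial>lborel)"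
proof -
  let ?n = "DIM('a)"
  let ?g = "\<lambda>r::real. indicator {0<..} r * (real ?n * unit_ball_vol (real ?n) * r ^ (?n - 1))"
  define D where "D = density lborel (\<lambda>r. ennreal (?g r))"
  have "distr lborel borel (norm :: 'a \<Rightarrow> real) = D"
  proof (rule measure_eqI_generator_eq[where E="range atMost" and \<Omega>=UNIV and A="\<lambda>i::nat. {..real i}"])
    show "Int_stable (range (atMost :: real \<Rightarrow> _))"
      by (auto simp: Int_stable_def)
    show "sets (distr lborel borel (norm :: 'a \<Rightarrow> real)) = sigma_sets UNIV (range atMost)"
      "sets D = sigma_sets UNIV (range atMost)"
      by (simp_all add: D_def) (simp_all add: borel_eq_atMost)
    show "(\<Union>i. {..real i}) = UNIV" by (auto intro: real_arch_simple)
    have em: "emeasure (distr lborel borel (norm :: 'a \<Rightarrow> real)) {..R}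
        = (if R < 0 then 0 else ennreal (unit_ball_vol (real ?n) * R ^ ?n))" for R
    proof -
      have "norm -` {..R} = (cball 0 R :: 'a set)" by auto
      then show ?thesis by (subst emeasure_distr) (auto simp: emeasure_cball)
    qed
    have emD: "emeasure D {..R} = (if R < 0 then 0 else ennreal (unit_ball_vol (real ?n) * R ^ ?n))" for R
    proof (cases "R < 0")
      case True
      then have "(\<integral>\<^sup>+x. ennreal (?g x) * indicator {..R} x \<partial>lborel) = (\<integral>\<^sup>+x. 0 \<partial>(lborel :: real measure))"
        by (intro nn_integral_cong) (auto simp: indicator_def)
      with True show ?thesis by (simp add: D_def emeasure_density)
    next
      case False
      have "emeasure D {..R} = (\<integral>\<^sup>+x. ennreal (?g x) * indicator {..R} x \<partial>lborel)"
        by (simp add: D_def emeasure_density)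
      also have "\<dots> = (\<integral>\<^sup>+x. ennreal (real ?n * unit_ball_vol (real ?n) * x ^ (?n - 1)) * indicator {0..R} x \<partial>lborel)"
        by (intro nn_integral_cong_AE eventually_mono[OF AE_lborel_singleton[of 0]]) (auto simp: indicator_def)
      also have "\<dots> = ennreal (unit_ball_vol (real ?n) * R ^ ?n - unit_ball_vol (real ?n) * 0 ^ ?n)"
        using False by (intro nn_integral_FTC_Icc[where F="\<lambda>x. unit_ball_vol (real ?n) * x ^ ?n"]) (auto intro!: derivative_eq_intros)
      finally show ?thesis using False by simp
    qed
    show "emeasure (distr lborel borel (norm :: 'a \<Rightarrow> real)) X = emeasure D X" if "X \<in> range atMost" for X
      using that em emD by auto
    show "emeasure (distr lborel borel (norm :: 'a \<Rightarrow> real)) {..real i} \<noteq> \<infinity>" for i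
      by (simp add: em)
  qed auto
  then have "(\<integral>\<^sup>+r. f r \<partial>D) = (\<integral>\<^sup>+x. f (norm (x::'a)) \<partial>lborel)"
    by (simp flip: \<open>_ = D\<close> add: nn_integral_distr)
  then show ?thesis unfolding D_def by (subst (asm) nn_integral_density) auto
qed

section \<open>The Prekopa-Leindler inequality\<close>

lemma lborel_inner_compact:
  fixes S :: "'a::euclidean_space set"
  assumes S: "S \<in> sets borel" and c: "c < emeasure lborel S"
  obtains K where "compact K" "K \<subseteq> S" "c < emeasure lborel K"
proof -
  have "c \<noteq> \<infinity>" using c by (auto simp: infinity_ennreal_def)
  obtain e :: real where e: "e > 0" "c + ennreal e < emeasure lborel S"
  proof -
    have "0 < emeasure lborel S - c" using c \<open>c \<noteq> \<infinity>\<close>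
      by (simp add: diff_gr0_ennreal)
    then obtain d where d: "0 < d" "d < emeasure lborel S - c" using dense by blast
    then have "d \<noteq> \<infinity>" by auto
    with d have "0 < enn2real d" "ennreal (enn2real d) = d"
      by (auto simp: enn2real_positive_iff less_top)
    moreover have "c + d < emeasure lborel S"
      using d by (metis less_diff_eq_ennreal c less_imp_le add.commute \<open>c \<noteq> \<infinity>\<close> less_top infinity_ennreal_def)
    ultimately show ?thesis using that by metis
  qed
  obtain T where T: "closed T" "T \<subseteq> S" "S - T \<in> lmeasurable" "emeasure lebesgue (S - T) < ennreal e"
    using sets_lebesgue_inner_closed[of S e] S e by (metis sets_completionI_sets sets_lborel)
  have Tb: "T \<in> sets borel" using T by simp
  have ST: "emeasure lborel (S - T) < ennreal e"
    using T S Tb by (simp add: emeasure_completion)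
  have "c < emeasure lborel T"
  proof (rule ccontr)
    assume "\<not> ?thesis"
    then have "emeasure lborel T \<le> c" by simp
    have "emeasure lborel S \<le> emeasure lborel (T \<union> (S - T))"
      using S Tb by (intro emeasure_mono) auto
    also have "\<dots> \<le> emeasure lborel T + emeasure lborel (S - T)"
      using S Tb by (intro emeasure_subadditive) auto
    also have "\<dots> \<le> c + ennreal e"
      using ST \<open>emeasure lborel T \<le> c\<close> by (intro add_mono) auto
    finally show False using e by simp
  qed
  also have "T = (\<Union>n::nat. T \<inter> cball 0 (real n))"
    by (auto) (metis real_arch_simple)
  also have "emeasure lborel \<dots> = (SUP n. emeasure lborel (T \<inter> cball 0 (real n)))"
    using T by (intro SUP_emeasure_incseq[symmetric]) (auto simp: incseq_def)
  finally obtain n where n: "c < emeasure lborel (T \<inter> cball 0 (real n))"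
    by (auto simp: less_SUP_iff)
  then show ?thesis
    using that[of "T \<inter> cball 0 (real n)"] T by (auto simp: closed_Int_compact)
qed

lemma emeasure_lborel_translate:
  fixes c :: "'a::euclidean_space"
  assumes "A \<in> sets borel"
  shows "emeasure lborel ((+) c ` A) = emeasure lborel A"
proof -
  have "emeasure lborel A = emeasure (distr lborel borel ((+) (-c))) A"
    by (simp add: lborel_distr_plus)
  also have "\<dots> = emeasure lborel ((+) (-c) -` A)"
    using assms by (subst emeasure_distr) auto
  also have "(+) (-c) -` A = (+) c ` A"
    by (auto simp: image_iff) (metis add.left_commute add.right_inverse add_0_right uminus_add_conv_diff)
  finally show ?thesis by simp
qed

text \<open>The translates \<open>b + A\<close> and \<open>a + B\<close>, with \<open>a\<close> the maximum of \<open>A\<close> and \<open>b\<close> the minimum of \<open>B\<close>, lie in the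
sumset and share only the point \<open>a + b\<close>.\<close>

lemma emeasure_compact_sum_real:
  fixes A B :: "real set"
  assumes "compact A" "compact B" "A \<noteq> {}" "B \<noteq> {}"
  shows "emeasure lborel A + emeasure lborel B \<le> emeasure lborel {x + y |x y. x \<in> A \<and> y \<in> B}"
proof -
  define C where "C = {x + y |x y. x \<in> A \<and> y \<in> B}"
  have "compact C" unfolding C_def using assms compact_sums by blast
  then have C: "C \<in> sets borel" by (simp add: borel_compact)
  have AB: "A \<in> sets borel" "B \<in> sets borel" using assms by (auto simp: borel_compact)
  obtain a where a: "a \<in> A" "\<And>x. x \<in> A \<Longrightarrow> x \<le> a" using assms compact_attains_sup by metis
  obtain b where b: "b \<in> B" "\<And>x. x \<in> B \<Longrightarrow> b \<le> x" using assms compact_attains_inf by metis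
  have m: "(+) c ` A \<in> sets borel" "(+) c ` B \<in> sets borel" for c
    using assms by (auto intro!: borel_compact compact_translation)
  have "emeasure lborel A + emeasure lborel B = emeasure lborel ((+) b ` A) + emeasure lborel ((+) a ` B)"
    using AB by (simp add: emeasure_lborel_translate)
  also have "\<dots> = emeasure lborel ((+) b ` A) + emeasure lborel ((+) a ` B - {a + b})"
    using m[of a] by (subst emeasure_Diff_null_set) (auto simp: null_sets_def)
  also have "\<dots> = emeasure lborel (((+) b ` A) \<union> ((+) a ` B - {a + b}))"
    using m a b by (intro plus_emeasure) (fastforce)+
  also have "\<dots> \<le> emeasure lborel C"
    using a b C unfolding C_def by (intro emeasure_mono) (auto simp: add.commute, metis add.commute)
  finally show ?thesis unfolding C_def .
qed

text \<open>The one-dimensional Brunn-Minkowski inequality for possibly nonconvex sets; the set of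
midpoints need not be measurable, so the conclusion is phrased for a measurable superset \<open>U\<close>.\<close>

lemma emeasure_midpoints_real:
  fixes S T U :: "real set"
  assumes S: "S \<in> sets borel" "S \<noteq> {}" and T: "T \<in> sets borel" "T \<noteq> {}" and U: "U \<in> sets borel"
    and mid: "\<And>x y. x \<in> S \<Longrightarrow> y \<in> T \<Longrightarrow> (x + y) / 2 \<in> U"
  shows "emeasure lborel S + emeasure lborel T \<le> 2 * emeasure lborel U"
proof (rule ccontr)
  assume *: "\<not> ?thesis"
  have scale: "emeasure lborel ((*) 2 -` (X::real set)) * 2 = emeasure lborel X" if "X \<in> sets borel" for X
  proof -
    have "emeasure lborel X = emeasure (density (distr lborel borel ((*) 2)) (\<lambda>_. ennreal \<bar>2\<bar>)) X"
      by (metis lborel_distr_mult' zero_neq_numeral)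
    also have "\<dots> = 2 * emeasure lborel ((*) 2 -` X)"
      using that by (subst emeasure_density_const) (auto simp: emeasure_distr)
    finally show ?thesis by (simp add: mult.commute)
  qed
  have step: "emeasure lborel K + emeasure lborel L \<le> 2 * emeasure lborel U"
    if "compact K" "K \<subseteq> S" "compact L" "L \<subseteq> T" "K \<noteq> {}" "L \<noteq> {}" for K L
  proof -
    let ?C = "{x + y |x y. x \<in> K \<and> y \<in> L}"
    have C: "?C \<in> sets borel" using that compact_sums borel_compact by blast
    have "emeasure lborel K + emeasure lborel L \<le> emeasure lborel ?C"
      using that emeasure_compact_sum_real by blast
    also have "\<dots> = emeasure lborel ((*) 2 -` ?C) * 2" using scale[OF C] by simp
    also have "\<dots> \<le> emeasure lborel U * 2"
    proof (intro mult_right_mono emeasure_mono)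
      show "(*) 2 -` ?C \<subseteq> U"
      proof
        fix z assume "z \<in> (*) 2 -` ?C"
        then obtain x y where "2 * z = x + y" "x \<in> K" "y \<in> L" by auto
        then show "z \<in> U" using mid[of x y] that by (metis (no_types, lifting) nonzero_mult_div_cancel_left subsetD zero_neq_numeral)
      qed
    qed (use U in auto)
    finally show ?thesis by (simp add: mult.commute)
  qed
  obtain s t where st: "s \<in> S" "t \<in> T" using S T by blast
  \<comment> \<open>The sumset of a set with the empty set is empty; adding a point to each compact set avoids this.\<close>
  have step': "emeasure lborel K + emeasure lborel L \<le> 2 * emeasure lborel U"
    if "compact K" "K \<subseteq> S" "compact L" "L \<subseteq> T" for K L
  proof -
    have "emeasure lborel K + emeasure lborel L \<le> emeasure lborel (insert s K) + emeasure lborel (insert t L)"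
      using that by (intro add_mono emeasure_mono) (auto simp: borel_compact)
    also have "\<dots> \<le> 2 * emeasure lborel U"
      using that st by (intro step) auto
    finally show ?thesis .
  qed
  let ?c = "2 * emeasure lborel U"
  have "?c < emeasure lborel S + emeasure lborel T" using * by simp
  then obtain c where c: "?c < c" "c < emeasure lborel S + emeasure lborel T" using dense by blast
  have half: "emeasure lborel X \<le> c'" if "X \<in> sets borel" "\<And>K. compact K \<Longrightarrow> K \<subseteq> X \<Longrightarrow> emeasure lborel K \<le> c'"
    for X :: "real set" and c'
    using that lborel_inner_compact[of X c'] by (metis not_le)
  have "emeasure lborel L + emeasure lborel S \<le> ?c" if L: "compact L" "L \<subseteq> T" for L
  proof (cases "emeasure lborel L = \<infinity>")
    case True
    have "emeasure lborel L < \<infinity>" using L emeasure_compact_finite by auto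
    with True show ?thesis by simp
  next
    case fin: False
    have Lc: "emeasure lborel L \<le> ?c" using step'[of "{}" L] L by simp
    have "emeasure lborel S \<le> ?c - emeasure lborel L"
    proof (rule half[OF S(1)])
      fix K assume "compact K" "K \<subseteq> S"
      then show "emeasure lborel K \<le> ?c - emeasure lborel L"
        using step'[of K L] L fin by (simp add: ennreal_le_minus_iff add.commute)
    qed
    then have "emeasure lborel L + emeasure lborel S \<le> emeasure lborel L + (?c - emeasure lborel L)"
      by (intro add_left_mono)
    also have "\<dots> = ?c" using Lc fin by (simp add: add_diff_inverse_ennreal)
    finally show ?thesis .
  qed note 1 = this
  have Sc: "emeasure lborel S \<le> ?c" using 1[of "{}"] by simp
  have "emeasure lborel S + emeasure lborel T \<le> ?c"
  proof (cases "?c = \<infinity>")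
    case False
    then have fin: "emeasure lborel S \<noteq> \<infinity>" using Sc by (metis infinity_ennreal_def neq_top_trans)
    have "emeasure lborel T \<le> ?c - emeasure lborel S"
    proof (rule half[OF T(1)])
      fix L assume "compact L" "L \<subseteq> T"
      then show "emeasure lborel L \<le> ?c - emeasure lborel S"
        using 1[of L] fin by (simp add: ennreal_le_minus_iff add.commute)
    qed
    then have "emeasure lborel S + emeasure lborel T \<le> emeasure lborel S + (?c - emeasure lborel S)"
      by (intro add_left_mono)
    also have "\<dots> = ?c" using Sc fin by (simp add: add_diff_inverse_ennreal)
    finally show ?thesis .
  qed auto
  with * show False by simp
qed

lemma ennreal_mult_le_square:
  fixes p q c :: ennreal
  assumes "p + q \<le> 2 * c"
  shows "p * q \<le> c\<^sup>2"
proof (cases "c = \<infinity>")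
  case True
  then show ?thesis by (simp add: power2_eq_square)
next
  case False
  then obtain c' where c': "c = ennreal c'" "c' \<ge> 0" by (cases c) auto
  have "p + q < \<infinity>" using assms c' by (metis ennreal_less_top ennreal_mult_less_top ennreal_numeral infinity_ennreal_def le_less_trans)
  then have "p < \<infinity>" "q < \<infinity>" by auto
  then obtain p' q' where pq: "p = ennreal p'" "p' \<ge> 0" "q = ennreal q'" "q' \<ge> 0"
    by (metis ennreal_cases infinity_ennreal_def less_irrefl)
  have "p' + q' \<le> 2 * c'"
    using assms pq c' by (simp flip: ennreal_plus ennreal_numeral ennreal_mult'')
  then have "p' * q' \<le> c'\<^sup>2"
  proof -
    have "4 * (p' * q') \<le> (p' + q')\<^sup>2" using zero_le_power2[of "p' - q'"] by (simp add: power2_eq_square algebra_simps)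
    also have "\<dots> \<le> (2 * c')\<^sup>2" using \<open>p' + q' \<le> 2 * c'\<close> pq by (intro power_mono) auto
    finally show ?thesis by (simp add: power2_eq_square)
  qed
  then show ?thesis using pq c' by (simp flip: ennreal_mult add: ennreal_power)
qed

lemma nn_integral_layer_unit:
  fixes u :: ennreal
  shows "(\<integral>\<^sup>+t. indicator {t. 0 < t \<and> t < 1 \<and> ennreal t < u} t \<partial>lborel) = min u 1"
proof (cases u)
  case (real r)
  have "{t. 0 < t \<and> t < 1 \<and> ennreal t < u} = {0<..<min r 1}"
    using real by (auto simp: ennreal_less_iff)
  then show ?thesis using real by (simp add: min_def)
next
  case top
  then have "{t. 0 < t \<and> t < 1 \<and> ennreal t < u} = {0<..<1}" by auto
  then show ?thesis using top by simp
qed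

lemma nn_integral_layer_cake_unit:
  fixes f :: "real \<Rightarrow> ennreal"
  assumes [measurable]: "f \<in> borel_measurable borel"
  shows "(\<integral>\<^sup>+x. min (f x) 1 \<partial>lborel) = (\<integral>\<^sup>+t. indicator {0<..<1} t * emeasure lborel {x. ennreal t < f x} \<partial>lborel)"
proof -
  have "(\<integral>\<^sup>+x. min (f x) 1 \<partial>lborel) =
    (\<integral>\<^sup>+x. (\<integral>\<^sup>+t. indicator {t. 0 < t \<and> t < 1 \<and> ennreal t < f x} t \<partial>lborel) \<partial>lborel)"
    by (simp add: nn_integral_layer_unit)
  also have "\<dots> = (\<integral>\<^sup>+x. (\<integral>\<^sup>+t. indicator {0<..<1} t * indicator {(x,t). ennreal t < f x} (x, t) \<partial>lborel) \<partial>lborel)"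
    by (intro nn_integral_cong) (auto simp: indicator_def)
  also have "\<dots> = (\<integral>\<^sup>+t. (\<integral>\<^sup>+x. indicator {0<..<1} t * indicator {(x,t). ennreal t < f x} (x, t) \<partial>lborel) \<partial>lborel)"
    by (rule lborel_pair.Fubini'[symmetric]) measurable
  also have "\<dots> = (\<integral>\<^sup>+t. indicator {0<..<1} t * emeasure lborel {x. ennreal t < f x} \<partial>lborel)"
  proof (rule nn_integral_cong)
    fix t :: real
    have "(\<integral>\<^sup>+x. indicator {0<..<1} t * indicator {(x,t). ennreal t < f x} (x, t) \<partial>lborel)
      = (\<integral>\<^sup>+x. indicator {0<..<1} t * indicator {x. ennreal t < f x} x \<partial>lborel)"
      by (intro nn_integral_cong) (auto simp: indicator_def)
    then show "(\<integral>\<^sup>+x. indicator {0<..<1} t * indicator {(x,t). ennreal t < f x} (x, t) \<partial>lborel)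
       = indicator {0<..<1} t * emeasure lborel {x. ennreal t < f x}"
      by (subst (asm) nn_integral_cmult) auto
  qed
  finally show ?thesis .
qed

text \<open>When both suprema are 1, all superlevel sets of \<open>f\<close> and \<open>g\<close> at heights in \<open>(0, 1)\<close> are nonempty and
their midpoints lie in those of \<open>h\<close>. Integrating the one-dimensional Brunn-Minkowski inequality over the heights
gives the sum of the integrals, and the arithmetic-geometric mean gives the product.\<close>

lemma prekopa_leindler_normalized:
  fixes f g h :: "real \<Rightarrow> ennreal"
  assumes [measurable]: "f \<in> borel_measurable borel" "g \<in> borel_measurable borel" "h \<in> borel_measurable borel"
    and fg: "\<And>x y. f x * g y \<le> (h ((x + y) / 2))\<^sup>2"
    and sup: "(SUP x. f x) = 1" "(SUP x. g x) = 1"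
  shows "(\<integral>\<^sup>+x. f x \<partial>lborel) * (\<integral>\<^sup>+x. g x \<partial>lborel) \<le> (\<integral>\<^sup>+x. h x \<partial>lborel)\<^sup>2"
proof (rule ennreal_mult_le_square)
  have le1: "f x \<le> 1" "g x \<le> 1" for x
    using sup by (metis SUP_upper UNIV_I)+
  then have min: "min (f x) 1 = f x" "min (g x) 1 = g x" for x by (auto simp: min_def)
  have level: "emeasure lborel {x. ennreal t < f x} + emeasure lborel {x. ennreal t < g x}
      \<le> 2 * emeasure lborel {x. ennreal t < h x}" if t: "0 < t" "t < 1" for t
  proof (rule emeasure_midpoints_real)
    have "ennreal t < 1" using t by simp
    then show "{x. ennreal t < f x} \<noteq> {}" "{x. ennreal t < g x} \<noteq> {}"
      using sup by (metis (mono_tags, lifting) less_SUP_iff empty_Collect_eq)+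
    fix x y assume "x \<in> {x. ennreal t < f x}" "y \<in> {x. ennreal t < g x}"
    then have *: "ennreal t < f x" "ennreal t < g y" by auto
    show "(x + y) / 2 \<in> {x. ennreal t < h x}"
    proof (rule ccontr)
      assume "\<not> ?thesis"
      then have "h ((x+y)/2) \<le> ennreal t" by auto
      then have "(h ((x+y)/2))\<^sup>2 \<le> (ennreal t)\<^sup>2" by (intro power_mono) auto
      also have "\<dots> < f x * g y"
      proof -
        have "(ennreal t)\<^sup>2 < ennreal t * g y"
          unfolding power2_eq_square using * t by (subst ennreal_mult_strict_left_mono) auto
        also have "\<dots> \<le> f x * g y" using * by (intro mult_right_mono) auto
        finally show ?thesis .
      qed
      finally show False using fg[of x y] by simp
    qed
  qed auto
  have "(\<integral>\<^sup>+x. f x \<partial>lborel) + (\<integral>\<^sup>+x. g x \<partial>lborel)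
    = (\<integral>\<^sup>+t. indicator {0<..<1} t * emeasure lborel {x. ennreal t < f x} \<partial>lborel)
    + (\<integral>\<^sup>+t. indicator {0<..<1} t * emeasure lborel {x. ennreal t < g x} \<partial>lborel)"
    using nn_integral_layer_cake_unit[of f] nn_integral_layer_cake_unit[of g] by (simp add: min)
  also have "\<dots> = (\<integral>\<^sup>+t. indicator {0<..<1} t * emeasure lborel {x. ennreal t < f x}
                  + indicator {0<..<1} t * emeasure lborel {x. ennreal t < g x} \<partial>lborel)"
    by (rule nn_integral_add[symmetric]) measurable
  also have "\<dots> \<le> (\<integral>\<^sup>+t. 2 * (indicator {0<..<1} t * emeasure lborel {x. ennreal t < h x}) \<partial>lborel)"
    using level by (intro nn_integral_mono) (auto simp: indicator_def)
  also have "\<dots> = 2 * (\<integral>\<^sup>+x. min (h x) 1 \<partial>lborel)"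
    by (subst nn_integral_layer_cake_unit, simp, rule nn_integral_cmult) measurable
  also have "\<dots> \<le> 2 * (\<integral>\<^sup>+x. h x \<partial>lborel)"
    by (intro mult_left_mono nn_integral_mono) auto
  finally show "(\<integral>\<^sup>+x. f x \<partial>lborel) + (\<integral>\<^sup>+x. g x \<partial>lborel) \<le> 2 * (\<integral>\<^sup>+x. h x \<partial>lborel)" .
qed

lemma prekopa_leindler_bounded:
  fixes f g h :: "real \<Rightarrow> ennreal"
  assumes [measurable]: "f \<in> borel_measurable borel" "g \<in> borel_measurable borel" "h \<in> borel_measurable borel"
    and fg: "\<And>x y. f x * g y \<le> (h ((x + y) / 2))\<^sup>2"
    and bd: "\<And>x. f x \<le> ennreal C" "\<And>x. g x \<le> ennreal C"
  shows "(\<integral>\<^sup>+x. f x \<partial>lborel) * (\<integral>\<^sup>+x. g x \<partial>lborel) \<le> (\<integral>\<^sup>+x. h x \<partial>lborel)\<^sup>2"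
proof -
  define a where "a = enn2real (SUP x. f x)"
  define b where "b = enn2real (SUP x. g x)"
  have "(SUP x. f x) \<le> ennreal C" "(SUP x. g x) \<le> ennreal C" using bd by (auto intro: SUP_least)
  then have a: "ennreal a = (SUP x. f x)" and b: "ennreal b = (SUP x. g x)"
    unfolding a_def b_def by (auto intro!: ennreal_enn2real_if simp: top_unique) (metis ennreal_enn2real ennreal_less_top le_less_trans)+
  have ab0: "a \<ge> 0" "b \<ge> 0" by (auto simp: a_def b_def)
  show ?thesis
  proof (cases "a = 0 \<or> b = 0")
    case True
    then have "(\<forall>x. f x = 0) \<or> (\<forall>x. g x = 0)"
      using a b by (metis SUP_upper UNIV_I ennreal_0 le_zero_eq)
    then show ?thesis by auto
  next
    case False
    with ab0 have ab: "a > 0" "b > 0" by auto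
    define r where "r = sqrt (a * b)"
    have r: "r > 0" "r\<^sup>2 = a * b" using ab by (auto simp: r_def)
    have cancel: "ennreal c * ennreal (1 / c) = 1" if "c > 0" for c
      using that by (simp flip: ennreal_mult'')
    have main: "(\<integral>\<^sup>+x. ennreal (1/a) * f x \<partial>lborel) * (\<integral>\<^sup>+x. ennreal (1/b) * g x \<partial>lborel)
        \<le> (\<integral>\<^sup>+x. ennreal (1/r) * h x \<partial>lborel)\<^sup>2"
    proof (rule prekopa_leindler_normalized)
      fix x y
      have "ennreal (1 / a) * f x * (ennreal (1 / b) * g y) = ennreal (1/a) * ennreal (1/b) * (f x * g y)"
        by (simp add: ac_simps)
      also have "\<dots> \<le> ennreal (1/a) * ennreal (1/b) * (h ((x + y) / 2))\<^sup>2"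
        by (intro mult_left_mono fg) auto
      also have "ennreal (1/a) * ennreal (1/b) = (ennreal (1/r))\<^sup>2"
        using ab r by (simp add: ennreal_power power_divide flip: ennreal_mult)
      finally show "ennreal (1 / a) * f x * (ennreal (1 / b) * g y) \<le> (ennreal (1 / r) * h ((x + y) / 2))\<^sup>2"
        by (simp add: power_mult_distrib)
      show "(SUP x. ennreal (1 / a) * f x) = 1" "(SUP x. ennreal (1 / b) * g x) = 1"
        using cancel[OF ab(1)] cancel[OF ab(2)]
        by (auto simp flip: SUP_mult_left_ennreal a b simp: mult.commute[of "ennreal (1 / _)" "ennreal _"])
    qed measurable
    have "(\<integral>\<^sup>+x. f x \<partial>lborel) * (\<integral>\<^sup>+x. g x \<partial>lborel) =
      ennreal a * ennreal b * ((\<integral>\<^sup>+x. ennreal (1/a) * f x \<partial>lborel) * (\<integral>\<^sup>+x. ennreal (1/b) * g x \<partial>lborel))"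
    proof -
      have "ennreal a * ennreal b * ((ennreal (1/a) * I) * (ennreal (1/b) * J)) = I * J" for I J
      proof -
        have "ennreal a * ennreal b * ((ennreal (1/a) * I) * (ennreal (1/b) * J))
          = (ennreal a * ennreal (1/a)) * (ennreal b * ennreal (1/b)) * (I * J)" by (simp only: ac_simps)
        then show ?thesis using cancel ab by simp
      qed
      then show ?thesis by (simp add: nn_integral_cmult)
    qed
    also have "\<dots> \<le> ennreal a * ennreal b * (\<integral>\<^sup>+x. ennreal (1/r) * h x \<partial>lborel)\<^sup>2"
      by (intro mult_left_mono main) auto
    also have "ennreal a * ennreal b = (ennreal r)\<^sup>2"
      using ab r by (simp add: ennreal_power flip: ennreal_mult)
    also have "(ennreal r)\<^sup>2 * (\<integral>\<^sup>+x. ennreal (1/r) * h x \<partial>lborel)\<^sup>2 = (ennreal r * ennreal (1/r) * (\<integral>\<^sup>+x. h x \<partial>lborel))\<^sup>2"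
      by (simp add: nn_integral_cmult power_mult_distrib mult.assoc)
    finally show ?thesis using cancel[OF r(1)] by simp
  qed
qed

lemma prekopa_leindler_real:
  fixes f g h :: "real \<Rightarrow> ennreal"
  assumes [measurable]: "f \<in> borel_measurable borel" "g \<in> borel_measurable borel" "h \<in> borel_measurable borel"
    and fg: "\<And>x y. f x * g y \<le> (h ((x + y) / 2))\<^sup>2"
  shows "(\<integral>\<^sup>+x. f x \<partial>lborel) * (\<integral>\<^sup>+x. g x \<partial>lborel) \<le> (\<integral>\<^sup>+x. h x \<partial>lborel)\<^sup>2"
proof -
  have sup: "(\<integral>\<^sup>+x. u x \<partial>lborel) = (SUP n::nat. \<integral>\<^sup>+x. min (u x) (of_nat n) \<partial>lborel)"
    if [measurable]: "u \<in> borel_measurable borel" for u :: "real \<Rightarrow> ennreal"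
  proof -
    have *: "(SUP n::nat. min (u x) (of_nat n)) = u x" for x
    proof -
      have "(SUP n::nat. min (u x) (of_nat n)) = min (u x) (SUP n::nat. of_nat n)"
        by (simp flip: inf_min add: inf_SUP)
      then show ?thesis by (simp add: ennreal_SUP_of_nat_eq_top)
    qed
    have "(\<integral>\<^sup>+x. u x \<partial>lborel) = (\<integral>\<^sup>+x. (SUP n::nat. min (u x) (of_nat n)) \<partial>lborel)"
      by (simp add: *)
    also have "\<dots> = (SUP n::nat. \<integral>\<^sup>+x. min (u x) (of_nat n) \<partial>lborel)"
      by (intro nn_integral_monotone_convergence_SUP) (auto simp: incseq_def le_fun_def min.coboundedI2 min.coboundedI1 intro!: min.mono)
    finally show ?thesis .
  qed
  have step: "(\<integral>\<^sup>+x. min (f x) (of_nat n) \<partial>lborel) * (\<integral>\<^sup>+x. min (g x) (of_nat n) \<partial>lborel) \<le> (\<integral>\<^sup>+x. h x \<partial>lborel)\<^sup>2"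
    for n :: nat
  proof (rule prekopa_leindler_bounded)
    show "min (f x) (of_nat n) * min (g y) (of_nat n) \<le> (h ((x + y) / 2))\<^sup>2" for x y
      using fg[of x y] by (rule order.trans[rotated]) (intro mult_mono; auto)
    show "min (f x) (of_nat n) \<le> ennreal (real n)" "min (g x) (of_nat n) \<le> ennreal (real n)" for x
      by (auto simp: ennreal_of_nat_eq_real_of_nat)
  qed measurable
  have step2: "(\<integral>\<^sup>+x. min (f x) (of_nat n) \<partial>lborel) * (\<integral>\<^sup>+x. min (g x) (of_nat k) \<partial>lborel) \<le> (\<integral>\<^sup>+x. h x \<partial>lborel)\<^sup>2"
    for n k :: nat
  proof -
    have "(\<integral>\<^sup>+x. min (f x) (of_nat n) \<partial>lborel) * (\<integral>\<^sup>+x. min (g x) (of_nat k) \<partial>lborel)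
      \<le> (\<integral>\<^sup>+x. min (f x) (of_nat (max n k)) \<partial>lborel) * (\<integral>\<^sup>+x. min (g x) (of_nat (max n k)) \<partial>lborel)"
      by (intro mult_mono nn_integral_mono min.mono) auto
    with step[of "max n k"] show ?thesis by (rule order.trans[rotated])
  qed
  show ?thesis
    unfolding sup[of f, OF assms(1)] sup[of g, OF assms(2)]
    by (subst SUP_mult_right_ennreal, rule SUP_least, subst SUP_mult_left_ennreal, rule SUP_least, rule step2)
qed

text \<open>Induction on the number of coordinates: the partial integrals over the old coordinates satisfy
the same inequality as functions of the new coordinate, by the induction hypothesis.\<close>

lemma prekopa_leindler_PiM:
  fixes f g h :: "('i \<Rightarrow> real) \<Rightarrow> ennreal"
  assumes "finite I"
    and "f \<in> borel_measurable (Pi\<^sub>M I (\<lambda>_. lborel))" "g \<in> borel_measurable (Pi\<^sub>M I (\<lambda>_. lborel))"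
      "h \<in> borel_measurable (Pi\<^sub>M I (\<lambda>_. lborel))"
    and "\<And>x y z. \<lbrakk>x \<in> space (Pi\<^sub>M I (\<lambda>_. lborel)); y \<in> space (Pi\<^sub>M I (\<lambda>_. lborel)); z \<in> space (Pi\<^sub>M I (\<lambda>_. lborel));
        \<And>i. i \<in> I \<Longrightarrow> z i = (x i + y i) / 2\<rbrakk> \<Longrightarrow> f x * g y \<le> (h z)\<^sup>2"
  shows "(\<integral>\<^sup>+x. f x \<partial>Pi\<^sub>M I (\<lambda>_. lborel)) * (\<integral>\<^sup>+x. g x \<partial>Pi\<^sub>M I (\<lambda>_. lborel))
      \<le> (\<integral>\<^sup>+x. h x \<partial>Pi\<^sub>M I (\<lambda>_. lborel))\<^sup>2"
  using assms
proof (induction I arbitrary: f g h rule: finite_induct)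
  case empty
  interpret product_sigma_finite "\<lambda>_::'i. lborel :: real measure" by standard
  show ?case by (simp add: nn_integral_empty) (rule empty.prems, auto simp: space_PiM)
next
  case (insert i I)
  interpret product_sigma_finite "\<lambda>_::'i. lborel :: real measure" by standard
  note [measurable] = insert.prems(1-3)
  have ins: "(\<integral>\<^sup>+x. u x \<partial>Pi\<^sub>M (insert i I) (\<lambda>_. lborel)) = (\<integral>\<^sup>+y. (\<integral>\<^sup>+x. u (x(i := y)) \<partial>Pi\<^sub>M I (\<lambda>_. lborel)) \<partial>lborel)"
    if "u \<in> borel_measurable (Pi\<^sub>M (insert i I) (\<lambda>_. lborel))" for u :: "('i \<Rightarrow> real) \<Rightarrow> ennreal"
    using insert.hyps that by (rule product_nn_integral_insert_rev)
  have sec: "(\<lambda>x. u (x(i := y))) \<in> borel_measurable (Pi\<^sub>M I (\<lambda>_. lborel))"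
    if [measurable]: "u \<in> borel_measurable (Pi\<^sub>M (insert i I) (\<lambda>_. lborel))"
    for u :: "('i \<Rightarrow> real) \<Rightarrow> ennreal" and y
  proof -
    have "(\<lambda>x. x(i := y)) \<in> measurable (Pi\<^sub>M I (\<lambda>_. lborel)) (Pi\<^sub>M (insert i I) (\<lambda>_. lborel :: real measure))"
      by (rule measurable_fun_upd[where J=I]) auto
    then show ?thesis by measurable
  qed
  have int: "(\<lambda>y. \<integral>\<^sup>+x. u (x(i := y)) \<partial>Pi\<^sub>M I (\<lambda>_. lborel)) \<in> borel_measurable borel"
    if [measurable]: "u \<in> borel_measurable (Pi\<^sub>M (insert i I) (\<lambda>_. lborel))"
    for u :: "('i \<Rightarrow> real) \<Rightarrow> ennreal"
  proof -
    interpret finite_product_sigma_finite "\<lambda>_::'i. lborel :: real measure" I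
      using insert.hyps by unfold_locales auto
    have "(\<lambda>(y, x). x(i := y)) \<in> measurable (lborel \<Otimes>\<^sub>M Pi\<^sub>M I (\<lambda>_. lborel)) (Pi\<^sub>M (insert i I) (\<lambda>_. lborel :: real measure))"
      unfolding split_beta by (rule measurable_fun_upd[where J=I]) auto
    then have "(\<lambda>(y, x). u (x(i := y))) \<in> borel_measurable (lborel \<Otimes>\<^sub>M Pi\<^sub>M I (\<lambda>_. lborel))"
      by (simp add: split_beta) measurable
    then have "(\<lambda>y. \<integral>\<^sup>+x. u (x(i := y)) \<partial>Pi\<^sub>M I (\<lambda>_. lborel)) \<in> borel_measurable lborel"
      by (rule sigma_finite_measure.borel_measurable_nn_integral[OF sigma_finite_measure_axioms])
    then show ?thesis by simp
  qed
  have upd: "x(i := a) \<in> space (Pi\<^sub>M (insert i I) (\<lambda>_. lborel))" if "x \<in> space (Pi\<^sub>M I (\<lambda>_. lborel))" for x and a :: real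
    using that by (auto simp: space_PiM PiE_def extensional_def)
  show ?case
    unfolding ins[OF insert.prems(1)] ins[OF insert.prems(2)] ins[OF insert.prems(3)]
  proof (rule prekopa_leindler_real)
    fix a b :: real
    show "(\<integral>\<^sup>+x. f (x(i := a)) \<partial>Pi\<^sub>M I (\<lambda>_. lborel)) * (\<integral>\<^sup>+x. g (x(i := b)) \<partial>Pi\<^sub>M I (\<lambda>_. lborel))
      \<le> (\<integral>\<^sup>+x. h (x(i := (a + b) / 2)) \<partial>Pi\<^sub>M I (\<lambda>_. lborel))\<^sup>2"
    proof (rule insert.IH)
      fix x y z :: "'i \<Rightarrow> real"
      assume *: "x \<in> space (Pi\<^sub>M I (\<lambda>_. lborel))" "y \<in> space (Pi\<^sub>M I (\<lambda>_. lborel))" "z \<in> space (Pi\<^sub>M I (\<lambda>_. lborel))"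
        "\<And>j. j \<in> I \<Longrightarrow> z j = (x j + y j) / 2"
      show "f (x(i := a)) * g (y(i := b)) \<le> (h (z(i := (a + b) / 2)))\<^sup>2"
      proof (rule insert.prems(4))
        show "x(i := a) \<in> space (Pi\<^sub>M (insert i I) (\<lambda>_. lborel))" "y(i := b) \<in> space (Pi\<^sub>M (insert i I) (\<lambda>_. lborel))"
          "z(i := (a + b) / 2) \<in> space (Pi\<^sub>M (insert i I) (\<lambda>_. lborel))"
          using upd[OF *(1)] upd[OF *(2)] upd[OF *(3)] by blast+
        show "(z(i := (a + b) / 2)) j = ((x(i := a)) j + (y(i := b)) j) / 2" if "j \<in> insert i I" for j
          using * that by auto
      qed
    qed (intro sec insert.prems)+
  qed (intro int insert.prems)+
qed

lemma nn_integral_lborel_PiM: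
  assumes "f \<in> borel_measurable borel"
  shows "(\<integral>\<^sup>+x. f (x::'a::euclidean_space) \<partial>lborel) = (\<integral>\<^sup>+x. f (\<Sum>b\<in>Basis. x b *\<^sub>R b) \<partial>Pi\<^sub>M Basis (\<lambda>_. lborel))"
  using assms by (subst lborel_eq) (rule nn_integral_distr, auto)

text \<open>Prekopa-Leindler for the indicators of \<open>A\<close> and \<open>-A\<close>, which have equal volume. This is the form in
which an isodiametric inequality is needed: the half difference body is symmetric, hence easy
to enclose, whereas \<open>A\<close> itself is not.\<close>

lemma emeasure_half_difference_body:
  fixes A :: "'a::euclidean_space set"
  assumes A: "compact A"
  shows "emeasure lborel A \<le> emeasure lborel {(x - y) /\<^sub>R 2 |x y. x \<in> A \<and> y \<in> A}"
proof -
  define D where "D = {(x - y) /\<^sub>R 2 |x y. x \<in> A \<and> y \<in> A}"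
  have D_eq: "D = (*\<^sub>R) (1/2) ` {x - y |x y. x \<in> A \<and> y \<in> A}"
    by (auto simp: D_def image_iff)
  have "compact D" unfolding D_eq using A by (simp add: compact_differences compact_scaling)
  then have D[measurable]: "D \<in> sets borel" by (rule borel_compact)
  have A[measurable]: "A \<in> sets borel" "uminus ` A \<in> sets borel"
    using A by (auto intro!: borel_compact compact_negations)
  have [measurable]: "(\<lambda>x. \<Sum>b\<in>Basis. x b *\<^sub>R b :: 'a) \<in> borel_measurable (Pi\<^sub>M Basis (\<lambda>_. lborel))"
    by measurable
  let ?s = "\<lambda>x. \<Sum>b\<in>Basis. x b *\<^sub>R b :: 'a"
  have "(\<integral>\<^sup>+x. indicator A (?s x) \<partial>Pi\<^sub>M Basis (\<lambda>_. lborel)) * (\<integral>\<^sup>+x. indicator (uminus ` A) (?s x) \<partial>Pi\<^sub>M Basis (\<lambda>_. lborel))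
      \<le> (\<integral>\<^sup>+x. indicator D (?s x) \<partial>Pi\<^sub>M Basis (\<lambda>_. lborel))\<^sup>2"
  proof (rule prekopa_leindler_PiM)
    fix x y z :: "'a \<Rightarrow> real"
    assume z: "\<And>i. i \<in> Basis \<Longrightarrow> z i = (x i + y i) / 2"
    have "?s z = (?s x + ?s y) /\<^sub>R 2"
      unfolding sum.distrib[symmetric] scaleR_sum_right
    proof (rule sum.cong[OF refl])
      fix b :: 'a assume "b \<in> Basis"
      then show "z b *\<^sub>R b = (x b *\<^sub>R b + y b *\<^sub>R b) /\<^sub>R 2"
        using z[of b] by (simp flip: scaleR_add_left)
    qed
    then have "?s z \<in> D" if "?s x \<in> A" "?s y \<in> uminus ` A"
      using that unfolding D_def by (force simp: image_iff)
    then show "indicator A (?s x) * indicator (uminus ` A) (?s y) \<le> (indicator D (?s z) :: ennreal)\<^sup>2"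
      by (auto simp: indicator_def split: if_splits)
  qed measurable
  then have "emeasure lborel A * emeasure lborel (uminus ` A) \<le> (emeasure lborel D)\<^sup>2"
    by (subst (asm) (1 2 3) nn_integral_lborel_PiM[symmetric]) auto
  moreover have "emeasure lborel (uminus ` A) = emeasure lborel A"
  proof -
    have "emeasure lborel (uminus ` A) = emeasure (distr lborel borel uminus) (uminus ` A)"
      by (subst lborel_distr_isometry) (auto intro: linearI)
    also have "\<dots> = emeasure lborel (uminus -` uminus ` A)" using A by (subst emeasure_distr) auto
    also have "uminus -` uminus ` A = A" by auto
    finally show ?thesis .
  qed
  ultimately have "(emeasure lborel A)\<^sup>2 \<le> (emeasure lborel D)\<^sup>2"
    by (simp add: power2_eq_square)
  have "emeasure lborel A \<le> emeasure lborel D"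
  proof (rule ccontr)
    assume "\<not> ?thesis"
    then have lt: "emeasure lborel D < emeasure lborel A" by simp
    have "(emeasure lborel D)\<^sup>2 < (emeasure lborel A)\<^sup>2"
    proof (cases "emeasure lborel D = 0")
      case True
      then show ?thesis using lt by (simp add: power2_eq_square zero_less_iff_neq_zero)
    next
      case False
      then have "emeasure lborel D * emeasure lborel D < emeasure lborel D * emeasure lborel A"
        using lt by (intro ennreal_mult_strict_left_mono) (auto simp: zero_less_iff_neq_zero order.strict_trans2)
      also have "\<dots> \<le> emeasure lborel A * emeasure lborel A"
        using lt by (intro mult_right_mono) auto
      finally show ?thesis by (simp add: power2_eq_square)
    qed
    with \<open>(emeasure lborel A)\<^sup>2 \<le> (emeasure lborel D)\<^sup>2\<close> show False by simp
  qed
  then show ?thesis unfolding D_def .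
qed

text \<open>By Fubini along the coordinate \<open>u\<close>; the sections are balls of radius \<open>b\<close> in one dimension less.\<close>

lemma emeasure_cylinder_Basis:
  fixes u :: "'a::euclidean_space"
  assumes u: "u \<in> Basis" and b: "b > 0" and cd: "c \<le> d"
  shows "emeasure lborel {z. c \<le> z \<bullet> u \<and> z \<bullet> u \<le> d \<and> norm (z - (z \<bullet> u) *\<^sub>R u) \<le> b}
    = ennreal (unit_ball_vol (real (DIM('a) - 1)) * b ^ (DIM('a) - 1) * (d - c))"
proof -
  let ?I = "Basis - {u}"
  interpret product_sigma_finite "\<lambda>_::'a. lborel :: real measure" by standard
  let ?C = "{z. c \<le> z \<bullet> u \<and> z \<bullet> u \<le> d \<and> norm (z - (z \<bullet> u) *\<^sub>R u) \<le> b}"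
  let ?s = "\<lambda>x. \<Sum>b\<in>Basis. x b *\<^sub>R b :: 'a"
  have C[measurable]: "?C \<in> sets borel" by measurable
  have ms: "?s \<in> borel_measurable (Pi\<^sub>M (insert u ?I) (\<lambda>_. lborel))"
    using u by (simp add: insert_absorb)
  have sn: "norm (z - (z \<bullet> u) *\<^sub>R u) = sqrt (\<Sum>i\<in>?I. (z \<bullet> i)\<^sup>2)" for z
  proof -
    have "norm (z - (z \<bullet> u) *\<^sub>R u) = sqrt (\<Sum>i\<in>Basis. ((z - (z \<bullet> u) *\<^sub>R u) \<bullet> i)\<^sup>2)"
      unfolding norm_eq_sqrt_inner by (subst euclidean_inner) (simp add: power2_eq_square)
    also have "(\<Sum>i\<in>Basis. ((z - (z \<bullet> u) *\<^sub>R u) \<bullet> i)\<^sup>2) = (\<Sum>i\<in>?I. (z \<bullet> i)\<^sup>2)"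
    proof -
      have "((z - (z \<bullet> u) *\<^sub>R u) \<bullet> u)\<^sup>2 = 0" using u by (simp add: inner_diff_left)
      moreover have "((z - (z \<bullet> u) *\<^sub>R u) \<bullet> i)\<^sup>2 = (z \<bullet> i)\<^sup>2" if "i \<in> ?I" for i
        using that u by (auto simp: inner_diff_left inner_Basis)
      ultimately show ?thesis using u by (subst sum.remove[of _ u]) (auto)
    qed
    finally show ?thesis .
  qed
  have si: "?s x \<bullet> i = x i" if "i \<in> Basis" for x i
    using that by simp
  have "emeasure lborel ?C = (\<integral>\<^sup>+x. indicator ?C x \<partial>lborel)" by simp
  also have "\<dots> = (\<integral>\<^sup>+x. indicator ?C (?s x) \<partial>Pi\<^sub>M (insert u ?I) (\<lambda>_. lborel))"
    using u by (subst nn_integral_lborel_PiM) (auto simp: insert_absorb)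
  also have "\<dots> = (\<integral>\<^sup>+y. (\<integral>\<^sup>+x. indicator ?C (?s (x(u := y))) \<partial>Pi\<^sub>M ?I (\<lambda>_. lborel)) \<partial>lborel)"
    using ms by (intro product_nn_integral_insert_rev) auto
  also have "\<dots> = (\<integral>\<^sup>+y. indicator {c..d} y * ennreal (unit_ball_vol (real (DIM('a) - 1)) * b ^ (DIM('a) - 1)) \<partial>lborel)"
  proof (rule nn_integral_cong)
    fix y :: real
    let ?B = "{f. sqrt (\<Sum>i\<in>?I. (f i)\<^sup>2) \<le> b} \<inter> space (Pi\<^sub>M ?I (\<lambda>_. lborel))"
    have mB: "?B \<in> sets (Pi\<^sub>M ?I (\<lambda>_. lborel))" by measurable
    have "(\<integral>\<^sup>+x. indicator ?C (?s (x(u := y))) \<partial>Pi\<^sub>M ?I (\<lambda>_. lborel))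
      = (\<integral>\<^sup>+x. indicator {c..d} y * indicator ?B x \<partial>Pi\<^sub>M ?I (\<lambda>_. lborel))"
    proof (rule nn_integral_cong)
      fix x :: "'a \<Rightarrow> real" assume x: "x \<in> space (Pi\<^sub>M ?I (\<lambda>_. lborel))"
      have "(\<Sum>i\<in>?I. (?s (x(u := y)) \<bullet> i)\<^sup>2) = (\<Sum>i\<in>?I. (x i)\<^sup>2)"
        by (intro sum.cong refl) (simp del: fun_upd_apply add: si, simp)
      moreover have "?s (x(u := y)) \<bullet> u = y"
        using u by (simp only: si) simp
      ultimately show "indicator ?C (?s (x(u := y))) = (indicator {c..d} y * indicator ?B x :: ennreal)"
        using x unfolding sn by (auto simp: indicator_def simp del: fun_upd_apply)
    qed
    also have "\<dots> = indicator {c..d} y * emeasure (Pi\<^sub>M ?I (\<lambda>_. lborel)) ?B"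
      using mB by (subst nn_integral_cmult) auto
    also have "emeasure (Pi\<^sub>M ?I (\<lambda>_. lborel)) ?B = ennreal (unit_ball_vol (real (DIM('a) - 1)) * b ^ (DIM('a) - 1))"
      using b u by (subst emeasure_cball_aux) (auto simp: card_Diff_singleton)
    finally show "(\<integral>\<^sup>+x. indicator ?C (?s (x(u := y))) \<partial>Pi\<^sub>M ?I (\<lambda>_. lborel)) =
        indicator {c..d} y * ennreal (unit_ball_vol (real (DIM('a) - 1)) * b ^ (DIM('a) - 1))" .
  qed
  also have "\<dots> = ennreal (d - c) * ennreal (unit_ball_vol (real (DIM('a) - 1)) * b ^ (DIM('a) - 1))"
    using cd by (subst nn_integral_multc) auto
  also have "\<dots> = ennreal ((d - c) * (unit_ball_vol (real (DIM('a) - 1)) * b ^ (DIM('a) - 1)))"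
    using cd b by (intro ennreal_mult[symmetric]) auto
  finally show ?thesis by (simp only: mult_ac)
qed

lemma emeasure_cylinder:
  fixes u :: "real^'m"
  assumes u: "norm u = 1" and b: "b > 0" and cd: "c \<le> d"
  shows "emeasure lborel {z. c \<le> z \<bullet> u \<and> z \<bullet> u \<le> d \<and> norm (z - (z \<bullet> u) *\<^sub>R u) \<le> b}
    = ennreal (unit_ball_vol (real (CARD('m) - 1)) * b ^ (CARD('m) - 1) * (d - c))"
proof -
  let ?v = "axis undefined 1 :: real^'m"
  have v: "?v \<in> Basis" by (simp add: axis_in_Basis_iff)
  obtain f where f: "orthogonal_transformation f" "f ?v = u"
    using u by (metis norm_axis_1 orthogonal_transformation_exists_1)
  then have lin: "linear f" and nf: "norm (f x) = norm x" and inn: "f x \<bullet> f y = x \<bullet> y" for x y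
    by (auto simp: orthogonal_transformation_linear orthogonal_transformation_norm orthogonal_transformation_def)
  interpret f: linear f by fact
  let ?C = "\<lambda>u. {z. c \<le> z \<bullet> u \<and> z \<bullet> u \<le> d \<and> norm (z - (z \<bullet> u) *\<^sub>R u) \<le> b}"
  have [measurable]: "f \<in> borel_measurable borel"
    using lin by (intro borel_measurable_continuous_onI) (simp add: linear_continuous_on linear_conv_bounded_linear)
  have "emeasure lborel (?C u) = emeasure (distr lborel borel f) (?C u)"
    using lin nf by (subst lborel_distr_isometry) auto
  also have "\<dots> = emeasure lborel (f -` ?C u)" by (subst emeasure_distr) auto
  also have "f -` ?C u = ?C ?v"
  proof -
    have "f z - (z \<bullet> ?v) *\<^sub>R u = f (z - (z \<bullet> ?v) *\<^sub>R ?v)" for z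
      by (simp only: f(2) f.diff f.scaleR)
    moreover have "f z \<bullet> u = z \<bullet> ?v" for z using inn[of z ?v] f(2) by simp
    ultimately show ?thesis by (simp only: vimage_Collect_eq nf)
  qed
  finally show ?thesis using emeasure_cylinder_Basis[OF v b cd] by simp
qed

section \<open>The area of the unit sphere\<close>

text \<open>The part over \<open>U\<close> of the spherical shell of thickness \<open>h\<close> inside the unit sphere. Its volume divided by \<open>h\<close>
stands for the area of \<open>U\<close> as \<open>h\<close> tends to 0.\<close>

definition cone_shell :: "real \<Rightarrow> 'a::real_normed_vector set \<Rightarrow> 'a set" where
  "cone_shell h U = (\<lambda>(r, u). r *\<^sub>R u) ` ({1 - h..1} \<times> U)"

lemma compact_cone_shell: "compact U \<Longrightarrow> compact (cone_shell h U)"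
  unfolding cone_shell_def split_beta
  by (intro compact_continuous_image compact_Times continuous_intros) auto

lemma cone_shell_sphere:
  assumes "0 < h" "h < 1"
  shows "cone_shell h (sphere (0::'a::euclidean_space) 1) = cball 0 1 - ball 0 (1 - h)"
proof (intro equalityI subsetI)
  fix z :: 'a assume "z \<in> cball 0 1 - ball 0 (1 - h)"
  then have z: "norm z \<le> 1" "1 - h \<le> norm z" by auto
  with assms have "norm z > 0" by linarith
  then have "z = norm z *\<^sub>R (z /\<^sub>R norm z)" "z /\<^sub>R norm z \<in> sphere 0 1" by auto
  with z show "z \<in> cone_shell h (sphere 0 1)"
    unfolding cone_shell_def by (intro image_eqI[of _ _ "(norm z, z /\<^sub>R norm z)"]) auto
qed (use assms in \<open>auto simp: cone_shell_def\<close>)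

lemma emeasure_cone_shell_sphere:
  assumes "0 < h" "h < 1"
  shows "emeasure lborel (cone_shell h (sphere (0::'a::euclidean_space) 1))
    = ennreal (unit_ball_vol (real DIM('a)) * (1 - (1 - h) ^ DIM('a)))"
proof -
  have "emeasure lborel (cone_shell h (sphere (0::'a) 1)) = emeasure lborel (cball (0::'a) 1) - emeasure lborel (ball (0::'a) (1 - h))"
    unfolding cone_shell_sphere[OF assms] using assms by (intro emeasure_Diff) (auto simp: emeasure_ball)
  also have "\<dots> = ennreal (unit_ball_vol (real DIM('a)) * (1 - (1 - h) ^ DIM('a)))"
    using assms by (simp add: emeasure_ball emeasure_cball ennreal_minus right_diff_distrib)
  finally show ?thesis .
qed

lemma norm_perp_le:
  fixes u x :: "'a::real_inner"
  assumes "norm u = 1"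
  shows "norm (x - (x \<bullet> u) *\<^sub>R u) \<le> norm x"
proof -
  have "(norm (x - (x \<bullet> u) *\<^sub>R u))\<^sup>2 = (norm x)\<^sup>2 - (x \<bullet> u)\<^sup>2"
    using assms unfolding power2_norm_eq_inner norm_eq_1
    by (simp add: inner_diff_left inner_diff_right power2_eq_square inner_commute)
  then have "(norm (x - (x \<bullet> u) *\<^sub>R u))\<^sup>2 \<le> (norm x)\<^sup>2" by simp
  then show ?thesis by (rule power2_le_imp_le) simp
qed

lemma inner_unit_vectors:
  fixes u v :: "'a::real_inner"
  assumes "norm u = 1" "norm v = 1"
  shows "u \<bullet> v = 1 - (dist u v)\<^sup>2 / 2"
  using assms unfolding dist_norm power2_norm_eq_inner norm_eq_1
  by (simp add: inner_diff_left inner_diff_right inner_commute field_simps)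

text \<open>A piece of the sphere of diameter at most \<open>D\<close> is nearly flat: half the difference body of its shell lies in a
cylinder of radius close to \<open>D / 2\<close> around the normal direction \<open>u0\<close> and of height
\<open>h + D\<^sup>2 / 2\<close>. Without passing to differences the radius would only be bounded by \<open>D\<close>.\<close>

lemma emeasure_cone_shell_le_pos:
  fixes U :: "(real^'m) set"
  assumes U: "compact U" "U \<subseteq> sphere 0 1" and D: "\<And>u v. u \<in> U \<Longrightarrow> v \<in> U \<Longrightarrow> dist u v \<le> D" "D > 0"
    and h: "0 < h" "h < 1"
  shows "emeasure lborel (cone_shell h U)
    \<le> ennreal (unit_ball_vol (real (CARD('m) - 1)) * (D * (1 + 2 * h) / 2) ^ (CARD('m) - 1) * (h + D\<^sup>2 / 2))"
proof (cases "U = {}")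
  case False
  then obtain u0 where u0: "u0 \<in> U" by auto
  then have n0: "norm u0 = 1" using U by auto
  let ?P = "\<lambda>z. z - (z \<bullet> u0) *\<^sub>R u0"
  let ?A = "cone_shell h U"
  let ?w = "h + D\<^sup>2 / 2"
  let ?C = "{z. - (?w / 2) \<le> z \<bullet> u0 \<and> z \<bullet> u0 \<le> ?w / 2 \<and> norm (?P z) \<le> D * (1 + 2 * h) / 2}"
  have halve: "- (w / 2) \<le> a / 2 \<and> a / 2 \<le> w / 2" if "\<bar>a\<bar> \<le> w" for a w :: real
    using that by auto
  have elt: "r *\<^sub>R u \<bullet> u0 \<le> 1 \<and> 1 - ?w \<le> r *\<^sub>R u \<bullet> u0" if u: "u \<in> U" and r: "1 - h \<le> r" "r \<le> 1" for r u
  proof -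
    have "norm u = 1" using u U by auto
    then have i: "u \<bullet> u0 = 1 - (dist u u0)\<^sup>2 / 2" using n0 by (rule inner_unit_vectors)
    have d: "(dist u u0)\<^sup>2 \<le> D\<^sup>2" using D(1)[OF u u0] by (intro power_mono) auto
    have le1: "u \<bullet> u0 \<le> 1" using i by simp
    have "r * (u \<bullet> u0) = u \<bullet> u0 - (1 - r) * (u \<bullet> u0)" by (simp add: algebra_simps)
    moreover have "(1 - r) * (u \<bullet> u0) \<le> h * 1"
    proof (cases "u \<bullet> u0 \<ge> 0")
      case True then show ?thesis using r le1 by (intro mult_mono) auto
    next
      case False
      then have "(1 - r) * (u \<bullet> u0) \<le> 0" using r by (intro mult_nonneg_nonpos) auto
      then show ?thesis using h by simp
    qed
    ultimately have "1 - ?w \<le> r * (u \<bullet> u0)" using i d by simp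
    moreover have "r * (u \<bullet> u0) \<le> 1" using r le1 h mult_left_mono[of "u \<bullet> u0" 1 r] by linarith
    ultimately show ?thesis by simp
  qed
  have sub: "{(x - y) /\<^sub>R 2 |x y. x \<in> ?A \<and> y \<in> ?A} \<subseteq> ?C"
  proof clarify
    fix x y assume "x \<in> ?A" "y \<in> ?A"
    then obtain r u r' u' where x: "x = r *\<^sub>R u" "1 - h \<le> r" "r \<le> 1" "u \<in> U"
      and y: "y = r' *\<^sub>R u'" "1 - h \<le> r'" "r' \<le> 1" "u' \<in> U" by (auto simp: cone_shell_def)
    have perp: "norm (?P v) \<le> D" if "v \<in> U" for v
    proof -
      have "?P v = ?P (v - u0)" using n0 by (simp add: inner_diff_left algebra_simps norm_eq_1)
      also have "norm \<dots> \<le> norm (v - u0)" using n0 by (rule norm_perp_le)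
      also have "\<dots> \<le> D" using D(1)[OF that u0] by (simp add: dist_norm)
      finally show ?thesis .
    qed
    have "?P (x - y) = ?P (u - u') - ((1 - r) *\<^sub>R ?P u - (1 - r') *\<^sub>R ?P u')"
      unfolding x y by (simp add: inner_diff_left algebra_simps)
    also have "norm \<dots> \<le> norm (?P (u - u')) + (norm ((1 - r) *\<^sub>R ?P u) + norm ((1 - r') *\<^sub>R ?P u'))"
      by (meson add_left_mono norm_triangle_ineq4 order_trans)
    also have "\<dots> \<le> D + (h * D + h * D)"
    proof (intro add_mono)
      show "norm (?P (u - u')) \<le> D"
        using norm_perp_le[OF n0, of "u - u'"] D(1)[OF x(4) y(4)] by (simp add: dist_norm)
      show "norm ((1 - r) *\<^sub>R ?P u) \<le> h * D" "norm ((1 - r') *\<^sub>R ?P u') \<le> h * D"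
        unfolding norm_scaleR using x y h perp by (intro mult_mono; simp)+
    qed
    finally have "norm (?P (x - y)) \<le> D * (1 + 2 * h)" by (simp add: algebra_simps)
    moreover have "?P ((x - y) /\<^sub>R 2) = ?P (x - y) /\<^sub>R 2" by (simp add: algebra_simps)
    ultimately have "norm (?P ((x - y) /\<^sub>R 2)) \<le> D * (1 + 2 * h) / 2" by simp
    moreover have "\<bar>(x - y) \<bullet> u0\<bar> \<le> ?w"
      using elt[OF x(4,2,3)] elt[OF y(4,2,3)] unfolding x y inner_diff_left by linarith
    then have "- (?w / 2) \<le> ((x - y) \<bullet> u0) / 2 \<and> ((x - y) \<bullet> u0) / 2 \<le> ?w / 2"
      by (rule halve)
    moreover have "((x - y) /\<^sub>R 2) \<bullet> u0 = ((x - y) \<bullet> u0) / 2" by (simp only: inner_scaleR_left) simp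
    ultimately show "- (?w / 2) \<le> ((x - y) /\<^sub>R 2) \<bullet> u0 \<and> ((x - y) /\<^sub>R 2) \<bullet> u0 \<le> ?w / 2
        \<and> norm (?P ((x - y) /\<^sub>R 2)) \<le> D * (1 + 2 * h) / 2" by simp
  qed
  have "emeasure lborel ?A \<le> emeasure lborel {(x - y) /\<^sub>R 2 |x y. x \<in> ?A \<and> y \<in> ?A}"
    by (rule emeasure_half_difference_body[OF compact_cone_shell[OF U(1)]])
  also have "\<dots> \<le> emeasure lborel ?C"
    using sub by (intro emeasure_mono) measurable
  also have "\<dots> = ennreal (unit_ball_vol (real (CARD('m) - 1)) * (D * (1 + 2 * h) / 2) ^ (CARD('m) - 1) * (?w / 2 - - (?w / 2)))"
  proof (rule emeasure_cylinder[OF n0])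
    show "0 < D * (1 + 2 * h) / 2" using D(2) h by (intro divide_pos_pos mult_pos_pos) auto
    have "0 \<le> ?w" using h by (intro add_nonneg_nonneg) auto
    have "- (w / 2) \<le> w / 2" if "0 \<le> w" for w :: real using that by simp
    then show "- (?w / 2) \<le> ?w / 2" using \<open>0 \<le> ?w\<close> by blast
  qed
  finally show ?thesis by simp
qed (simp add: cone_shell_def)

text \<open>A limit of the bounds for larger \<open>D\<close>; needed when \<open>U\<close> is a single point.\<close>

lemma emeasure_cone_shell_le:
  fixes U :: "(real^'m) set"
  assumes U: "compact U" "U \<subseteq> sphere 0 1" and D: "\<And>u v. u \<in> U \<Longrightarrow> v \<in> U \<Longrightarrow> dist u v \<le> D" "D \<ge> 0"
    and h: "0 < h" "h < 1"
  shows "emeasure lborel (cone_shell h U)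
    \<le> ennreal (unit_ball_vol (real (CARD('m) - 1)) * (D * (1 + 2 * h) / 2) ^ (CARD('m) - 1) * (h + D\<^sup>2 / 2))"
proof -
  let ?f = "\<lambda>D. ennreal (unit_ball_vol (real (CARD('m) - 1)) * (D * (1 + 2 * h) / 2) ^ (CARD('m) - 1) * (h + D\<^sup>2 / 2))"
  have "(?f \<longlongrightarrow> ?f D) (at_right D)"
    by (intro tendsto_ennrealI tendsto_intros) auto
  moreover have "\<forall>\<^sub>F D' in at_right D. emeasure lborel (cone_shell h U) \<le> ?f D'"
    using eventually_at_right_less[of D]
  proof eventually_elim
    case (elim D')
    then show ?case using D h U by (intro emeasure_cone_shell_le_pos) force+
  qed
  ultimately show ?thesis by (rule tendsto_lowerbound) simp
qed

lemma ennreal_divide_le_of_le_mult: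
  fixes S :: ennreal
  assumes "ennreal l \<le> ennreal c * S" "c > 0"
  shows "ennreal (l / c) \<le> S"
proof -
  have "ennreal (1 / c) * ennreal l \<le> ennreal (1 / c) * (ennreal c * S)"
    by (rule mult_left_mono[OF assms(1)]) simp
  moreover have "ennreal (1 / c) * ennreal c = ennreal 1"
    using assms(2) by (subst ennreal_mult[symmetric]) auto
  moreover have "ennreal (1 / c) * ennreal l = ennreal (l / c)"
    using assms(2) by (subst ennreal_mult'[symmetric]) auto
  ultimately show ?thesis by (simp add: mult.assoc[symmetric])
qed

text \<open>A covering of the sphere by sets of diameter at most \<open>h\<close> induces a covering of the shell of
thickness \<open>h\<close>; each piece of it has at most \<open>h\<close> times the weight of the covering set, up to
factors that tend to 1.\<close>

lemma hausdorff_measure_sphere_ge: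
  assumes h: "0 < h" "h < 1"
  shows "ennreal (unit_ball_vol (real CARD('m)) * (1 - (1 - h) ^ CARD('m))
      / ((1 + 2 * h) ^ (CARD('m) - 1) * (h + h\<^sup>2 / 2)))
    \<le> hausdorff_measure (CARD('m) - 1) (sphere (0::real^'m) 1)"
    (is "ennreal (?l / ?cc) \<le> ?H")
proof -
  let ?L = "ennreal ?l" and ?c = "ennreal ?cc"
  have cc: "?cc > 0" using h by (intro mult_pos_pos zero_less_power add_pos_nonneg) auto
  let ?k = "CARD('m) - 1"
  let ?S = "sphere (0::real^'m) 1"
  let ?w = "\<lambda>U::(real^'m) set. if U = {} then 0 else ennreal (unit_ball_vol (real ?k) * (diameter U / 2) ^ ?k)"
  have "ennreal (?l / ?cc) \<le> hausdorff_premeasure ?k h ?S"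
    unfolding hausdorff_premeasure_def
  proof (rule INF_greatest, clarify)
      fix U :: "nat \<Rightarrow> (real^'m) set"
      assume cov: "?S \<subseteq> (\<Union>i. U i)" and U: "\<forall>i. bounded (U i) \<and> diameter (U i) \<le> h"
      \<comment> \<open>Closures keep the diameter and make the pieces compact.\<close>
      define V where "V i = closure (U i) \<inter> ?S" for i
      have V: "compact (V i)" for i
        unfolding V_def using U by (intro closed_Int_compact) auto
      have mT: "(\<Union>i. cone_shell h (V i)) \<in> sets borel" "cone_shell h (V i) \<in> sets borel" for i
        using borel_compact[OF compact_cone_shell[OF V]] by auto
      have step: "emeasure lborel (cone_shell h (V i)) \<le> ?c * ?w (U i)" for i
      proof (cases "U i = {}")
        case True
        then show ?thesis by (simp add: V_def cone_shell_def)
      next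
        case False
        let ?D = "diameter (U i)"
        have D: "0 \<le> ?D" "?D \<le> h" using U by (auto intro: diameter_ge_0)
        have "emeasure lborel (cone_shell h (V i))
          \<le> ennreal (unit_ball_vol (real ?k) * (?D * (1 + 2 * h) / 2) ^ ?k * (h + ?D\<^sup>2 / 2))"
        proof (rule emeasure_cone_shell_le[OF V])
          fix u v assume "u \<in> V i" "v \<in> V i"
          then have "dist u v \<le> diameter (closure (U i))"
            using U by (intro diameter_bounded_bound) (auto simp: V_def)
          then show "dist u v \<le> ?D" using U by (simp add: diameter_closure)
        qed (use D h in \<open>auto simp: V_def\<close>)
        also have "\<dots> \<le> ennreal ((1 + 2 * h) ^ ?k * (h + h\<^sup>2 / 2) * (unit_ball_vol (real ?k) * (?D / 2) ^ ?k))"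
        proof (rule ennreal_leI)
          have "?D\<^sup>2 \<le> h\<^sup>2" using D by (intro power_mono) auto
          then have "(unit_ball_vol (real ?k) * (?D / 2) ^ ?k * (1 + 2 * h) ^ ?k) * (h + ?D\<^sup>2 / 2)
            \<le> (unit_ball_vol (real ?k) * (?D / 2) ^ ?k * (1 + 2 * h) ^ ?k) * (h + h\<^sup>2 / 2)"
            using D h by (intro mult_left_mono mult_nonneg_nonneg) auto
          then show "unit_ball_vol (real ?k) * (?D * (1 + 2 * h) / 2) ^ ?k * (h + ?D\<^sup>2 / 2)
            \<le> (1 + 2 * h) ^ ?k * (h + h\<^sup>2 / 2) * (unit_ball_vol (real ?k) * (?D / 2) ^ ?k)"
            by (simp add: power_mult_distrib power_divide mult_ac)
        qed
        also have "\<dots> = ?c * ?w (U i)"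
          using False h D by (simp add: ennreal_mult')
        finally show ?thesis .
      qed
      have "?L = emeasure lborel (cone_shell h ?S)"
        using emeasure_cone_shell_sphere[OF h, where 'a="real^'m"] by simp
      also have "\<dots> \<le> emeasure lborel (\<Union>i. cone_shell h (V i))"
      proof (rule emeasure_mono)
        show "cone_shell h ?S \<subseteq> (\<Union>i. cone_shell h (V i))"
        proof
          fix z assume "z \<in> cone_shell h ?S"
          then obtain r u where z: "z = r *\<^sub>R u" "r \<in> {1 - h..1}" "u \<in> ?S" by (auto simp: cone_shell_def)
          then obtain i where "u \<in> U i" using cov by auto
          then have "u \<in> V i" using z(3) closure_subset[of "U i"] unfolding V_def by auto
          then have "z \<in> cone_shell h (V i)" using z(1,2) unfolding cone_shell_def by (intro image_eqI[of _ _ "(r, u)"]) auto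
          then show "z \<in> (\<Union>i. cone_shell h (V i))" by auto
        qed
      qed (simp add: mT)
      also have "\<dots> \<le> (\<Sum>i. emeasure lborel (cone_shell h (V i)))"
        using mT by (intro emeasure_subadditive_countably) auto
      finally have le1: "?L \<le> (\<Sum>i. emeasure lborel (cone_shell h (V i)))" .
      have le2: "(\<Sum>i. emeasure lborel (cone_shell h (V i))) \<le> (\<Sum>i. ?c * ?w (U i))"
        by (rule suminf_le[OF step summableI summableI])
      have le: "?L \<le> ?c * (\<Sum>i. ?w (U i))"
        using order_trans[OF le1 le2] by (simp only: ennreal_suminf_cmult)
      show "ennreal (?l / ?cc) \<le> (\<Sum>i. ?w (U i))" by (rule ennreal_divide_le_of_le_mult[OF le cc])
    qed
  moreover have "hausdorff_premeasure ?k h ?S \<le> ?H"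
    using SUP_upper[of h "{0<..}" "\<lambda>\<delta>. hausdorff_premeasure ?k \<delta> ?S"] h
    unfolding hausdorff_measure_def by simp
  ultimately show ?thesis by (rule order_trans)
qed

text \<open>The shell over a cap of radius \<open>r\<close> contains a cylinder of radius \<open>(1 - h) * r\<close> around the axis of the cap.\<close>

lemma emeasure_cone_shell_cap_ge:
  fixes a :: "real^'m"
  assumes a: "norm a = 1" and h: "0 < h" "h < 1" and r: "0 < r" "r\<^sup>2 < h"
  shows "ennreal (unit_ball_vol (real (CARD('m) - 1)) * ((1 - h) * r) ^ (CARD('m) - 1) * (h - r\<^sup>2))
    \<le> emeasure lborel (cone_shell h (sphere 0 1 \<inter> cball a r))"
proof -
  let ?P = "\<lambda>z. z - (z \<bullet> a) *\<^sub>R a"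
  define b where "b = (1 - h) * r"
  have b: "b > 0" "b \<le> r" using h r by (auto simp: b_def)
  have r1: "r\<^sup>2 < 1" using r h by simp
  let ?C = "{z. 1 - h \<le> z \<bullet> a \<and> z \<bullet> a \<le> 1 - r\<^sup>2 \<and> norm (?P z) \<le> b}"
  have "?C \<subseteq> cone_shell h (sphere 0 1 \<inter> cball a r)"
  proof
    fix z assume "z \<in> ?C"
    then have z: "1 - h \<le> z \<bullet> a" "z \<bullet> a \<le> 1 - r\<^sup>2" "norm (?P z) \<le> b" by auto
    define t where "t = z \<bullet> a"
    define y where "y = norm (?P z)"
    have t: "0 < t" "1 - h \<le> t" "t \<le> 1 - r\<^sup>2" using z h by (auto simp: t_def)
    have y: "0 \<le> y" "y \<le> b" using z by (auto simp: y_def)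
    have nz: "(norm z)\<^sup>2 = t\<^sup>2 + y\<^sup>2"
      using a unfolding y_def t_def power2_norm_eq_inner norm_eq_1
      by (simp add: inner_diff_left inner_diff_right power2_eq_square inner_commute)
    have y2: "y\<^sup>2 \<le> r\<^sup>2" using y b by (intro power_mono) auto
    have t2: "t\<^sup>2 \<le> (1 - r\<^sup>2)\<^sup>2" using t by (intro power_mono) auto
    have "(1 - r\<^sup>2)\<^sup>2 = 1 - 2 * r\<^sup>2 + r\<^sup>2 * r\<^sup>2" by (simp add: power2_eq_square algebra_simps)
    moreover have "r\<^sup>2 * r\<^sup>2 \<le> r\<^sup>2 * 1" using r1 by (intro mult_left_mono) auto
    ultimately have "(norm z)\<^sup>2 \<le> 1\<^sup>2" using nz y2 t2 by simp
    then have n1: "norm z \<le> 1" by (rule power2_le_imp_le) simp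
    have "t\<^sup>2 \<le> (norm z)\<^sup>2" using nz by simp
    then have tn: "t \<le> norm z" by (rule power2_le_imp_le) simp
    then have n0: "norm z > 0" using t by linarith
    define u where "u = z /\<^sub>R norm z"
    have u: "norm u = 1" "z = norm z *\<^sub>R u" using n0 by (auto simp: u_def)
    have ua: "u \<bullet> a = t / norm z" by (simp add: u_def t_def field_simps)
    have "1 - r\<^sup>2 / 2 \<le> t / norm z"
    proof -
      have yt: "y \<le> r * t"
      proof -
        have "y \<le> (1 - h) * r" using y by (simp add: b_def)
        also have "\<dots> \<le> t * r" using t r by (intro mult_right_mono) auto
        finally show ?thesis by (simp add: mult.commute)
      qed
      have "y\<^sup>2 \<le> (r * t)\<^sup>2" using yt y by (intro power_mono) auto
      then have "(norm z)\<^sup>2 \<le> t\<^sup>2 * (1 + r\<^sup>2)" using nz by (simp add: power_mult_distrib algebra_simps)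
      \<comment> \<open>An angle with tangent at most \<open>r\<close> spans a chord of length at most \<open>r\<close>.\<close>
      moreover have "(1 - r\<^sup>2 / 2)\<^sup>2 * (1 + r\<^sup>2) \<le> 1"
      proof -
        have "(1 - r\<^sup>2 / 2)\<^sup>2 * (1 + r\<^sup>2) = 1 - (3 / 4 - r\<^sup>2 / 4) * (r\<^sup>2 * r\<^sup>2)"
          by (simp add: power2_eq_square algebra_simps)
        also have "\<dots> \<le> 1" using r1 by simp
        finally show ?thesis .
      qed
      ultimately have "((1 - r\<^sup>2 / 2) * norm z)\<^sup>2 \<le> t\<^sup>2"
      proof -
        assume A: "(norm z)\<^sup>2 \<le> t\<^sup>2 * (1 + r\<^sup>2)" and B: "(1 - r\<^sup>2 / 2)\<^sup>2 * (1 + r\<^sup>2) \<le> 1"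
        have "((1 - r\<^sup>2 / 2) * norm z)\<^sup>2 \<le> (1 - r\<^sup>2 / 2)\<^sup>2 * (t\<^sup>2 * (1 + r\<^sup>2))"
          unfolding power_mult_distrib by (intro mult_left_mono A) auto
        also have "\<dots> = t\<^sup>2 * ((1 - r\<^sup>2 / 2)\<^sup>2 * (1 + r\<^sup>2))" by (simp add: mult_ac)
        also have "\<dots> \<le> t\<^sup>2 * 1" using B by (intro mult_left_mono) auto
        finally show ?thesis by simp
      qed
      then have "(1 - r\<^sup>2 / 2) * norm z \<le> t" by (rule power2_le_imp_le) (use t in simp)
      then show ?thesis using n0 by (simp add: field_simps)
    qed
    then have "(dist u a)\<^sup>2 \<le> r\<^sup>2" using inner_unit_vectors[OF u(1) a] ua by simp
    then have "dist u a \<le> r" by (rule power2_le_imp_le) (use r in simp)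
    then have "u \<in> sphere 0 1 \<inter> cball a r" using u by (simp add: dist_commute)
    then show "z \<in> cone_shell h (sphere 0 1 \<inter> cball a r)"
      unfolding cone_shell_def using u tn t n1 by (intro image_eqI[of _ _ "(norm z, u)"]) auto
  qed
  then have "emeasure lborel ?C \<le> emeasure lborel (cone_shell h (sphere 0 1 \<inter> cball a r))"
    by (rule emeasure_mono) (simp add: borel_compact compact_cone_shell compact_Int)
  moreover have "emeasure lborel ?C = ennreal (unit_ball_vol (real (CARD('m) - 1)) * b ^ (CARD('m) - 1) * ((1 - r\<^sup>2) - (1 - h)))"
    using b r by (intro emeasure_cylinder a) auto
  ultimately show ?thesis by (simp add: b_def)
qed

lemma normalize_in_of_cone_shell:
  assumes "z \<in> cone_shell h (sphere 0 1 \<inter> A)" "h < 1"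
  shows "z /\<^sub>R norm z \<in> A"
proof -
  obtain s u where "z = s *\<^sub>R u" "1 - h \<le> s" "norm u = 1" "u \<in> A"
    using assms by (auto simp: cone_shell_def)
  moreover from this have "z /\<^sub>R norm z = u" using assms by simp
  ultimately show ?thesis by simp
qed

lemma hausdorff_premeasure_le_suminf:
  assumes "A \<subseteq> (\<Union>i. U i)" "\<And>i. bounded (U i)" "\<And>i. diameter (U i) \<le> \<delta>"
    and "\<And>i. U i \<noteq> {} \<Longrightarrow> unit_ball_vol (real k) * (diameter (U i) / 2) ^ k \<le> w i"
    and w: "\<And>i. 0 \<le> w i" "summable w"
  shows "hausdorff_premeasure k \<delta> A \<le> ennreal (suminf w)"
proof -
  have "hausdorff_premeasure k \<delta> A \<le>
      (\<Sum>i. if U i = {} then 0 else ennreal (unit_ball_vol (real k) * (diameter (U i) / 2) ^ k))"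
    unfolding hausdorff_premeasure_def using assms by (intro INF_lower) auto
  also have "\<dots> \<le> (\<Sum>i. ennreal (w i))"
    using assms by (intro suminf_le summableI) (auto intro: ennreal_leI)
  also have "\<dots> = ennreal (suminf w)"
    using w by (intro suminf_ennreal2) auto
  finally show ?thesis .
qed

text \<open>By Vitali's covering lemma there are disjoint caps whose fivefold enlargements cover the sphere.
Disjointness bounds the total weight of the caps by the volume of the shell. Finitely many caps leave a rest
covered by the enlargements of the other caps, because their union is closed and a small ball around an uncovered
point meets only later caps; the total weight of those is the tail of a convergent
series, so the factor \<open>5 ^ k\<close> does no harm.\<close>

lemma hausdorff_premeasure_sphere_le:
  assumes h: "0 < h" "h < 1" and r0: "0 < r0" "r0\<^sup>2 < h" "10 * r0 \<le> \<delta>"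
  shows "hausdorff_premeasure (CARD('m) - 1) \<delta> (sphere (0::real^'m) 1)
    \<le> ennreal (unit_ball_vol (real CARD('m)) * (1 - (1 - h) ^ CARD('m)) / ((1 - h) ^ (CARD('m) - 1) * (h - r0\<^sup>2)))"
proof -
  define k where "k = CARD('m) - 1"
  let ?S = "sphere (0::real^'m) 1"
  define K where "K = ?S \<times> {0<..r0}"
  define q where "q = (1 - h) ^ k * (h - r0\<^sup>2)"
  define V where "V = unit_ball_vol (real CARD('m)) * (1 - (1 - h) ^ CARD('m))"
  have q: "q > 0" unfolding q_def using h r0 by simp
  have V0: "V \<ge> 0" unfolding V_def using h by (simp add: power_le_one)
  have Kr: "0 < snd i \<and> snd i \<le> r0" if "i \<in> K" for i using that by (auto simp: K_def)
  obtain C where C: "countable C" "C \<subseteq> K"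
     "pairwise (\<lambda>i j. disjnt (cball (fst i) (snd i)) (cball (fst j) (snd j))) C"
     "\<And>i. i \<in> K \<Longrightarrow> \<exists>j. j \<in> C \<and> \<not> disjnt (cball (fst i) (snd i)) (cball (fst j) (snd j)) \<and>
                        cball (fst i) (snd i) \<subseteq> ball (fst j) (5 * snd j)"
    by (rule Vitali_covering_lemma_cballs_balls[of K snd r0 fst]) (rule Kr, assumption, rule that, assumption+)
  \<comment> \<open>The caps are enumerated by the set \<open>M\<close> of natural numbers, finite or not.\<close>
  define M where "M = to_nat_on C ` C"
  define e where "e = from_nat_into C"
  define a where "a n = fst (e n)" for n
  define r where "r n = snd (e n)" for n
  have injC: "inj_on (to_nat_on C) C" using C(1) by (rule inj_on_to_nat_on)
  have e: "e n \<in> C" if "n \<in> M" for n using that C(1) by (auto simp: M_def e_def)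
  have e_inj: "n = n'" if "n \<in> M" "n' \<in> M" "e n = e n'" for n n'
    using that C(1) by (auto simp: M_def e_def)
  have eM: "\<exists>n\<in>M. e n = j" if "j \<in> C" for j
    using that C(1) by (auto simp: M_def e_def)
  have ar: "norm (a n) = 1" "0 < r n" "r n \<le> r0" if "n \<in> M" for n
    using e[OF that] C(2) by (auto simp: K_def a_def r_def)
  define cap where "cap n = (if n \<in> M then cone_shell h (?S \<inter> cball (a n) (r n)) else {})" for n
  have capm: "cap n \<in> sets lborel" for n
    by (auto simp: cap_def intro!: borel_compact compact_cone_shell compact_Int)
  have disj: "disjoint_family cap"
    unfolding disjoint_family_on_def
  proof (intro ballI impI)
    fix i j :: nat assume ij: "i \<noteq> j"
    show "cap i \<inter> cap j = {}"
    proof (cases "i \<in> M \<and> j \<in> M")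
      case True
      then have "e i \<noteq> e j" using e_inj ij by blast
      then have dj: "cball (a i) (r i) \<inter> cball (a j) (r j) = {}"
        using C(3) e True unfolding pairwise_def disjnt_def a_def r_def by blast
      show ?thesis
      proof (rule equals0I)
        fix z assume "z \<in> cap i \<inter> cap j"
        then have "z /\<^sub>R norm z \<in> cball (a i) (r i)" "z /\<^sub>R norm z \<in> cball (a j) (r j)"
          using True h unfolding cap_def by (auto dest: normalize_in_of_cone_shell)
        then show False using dj by blast
      qed
    qed (auto simp: cap_def)
  qed
  define m where "m n = measure lborel (cap n)" for n
  have cap_sub: "cap n \<subseteq> cone_shell h ?S" for n
    unfolding cap_def cone_shell_def by auto
  have cone_shell_fin: "emeasure lborel (cone_shell h ?S) = ennreal V"
    using emeasure_cone_shell_sphere[OF h, where 'a="real^'m"] by (simp add: V_def)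
  have tm: "cone_shell h ?S \<in> sets lborel" by (auto intro!: borel_compact compact_cone_shell)
  have cap_fin: "emeasure lborel (cap n) \<le> ennreal V" for n
    using emeasure_mono[OF cap_sub tm] cone_shell_fin by simp
  have em: "emeasure lborel (cap n) = ennreal (m n)" for n
    unfolding m_def using cap_fin[of n] by (intro emeasure_eq_ennreal_measure) (auto simp: top_unique)
  have "(\<Sum>n. emeasure lborel (cap n)) = emeasure lborel (\<Union>n. cap n)"
    using capm disj by (intro suminf_emeasure) auto
  also have "\<dots> \<le> ennreal V"
    using cone_shell_fin cap_sub tm by (metis UN_least emeasure_mono)
  finally have sumle: "(\<Sum>n. ennreal (m n)) \<le> ennreal V" by (simp add: em)
  have m0: "m n \<ge> 0" for n by (simp add: m_def)
  have summ: "summable m"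
    using sumle m0 by (intro summable_suminf_not_top) (auto simp: top_unique)
  have sumV: "suminf m \<le> V"
    using sumle suminf_ennreal2[OF m0 summ] V0 by simp
  have capge: "unit_ball_vol (real k) * r n ^ k \<le> m n / q" if "n \<in> M" for n
  proof -
    have rr: "(r n)\<^sup>2 \<le> r0\<^sup>2" using ar[OF that] by (intro power_mono) auto
    have capn: "cap n = cone_shell h (?S \<inter> cball (a n) (r n))" using that by (simp add: cap_def)
    have "ennreal (unit_ball_vol (real k) * ((1 - h) * r n) ^ k * (h - (r n)\<^sup>2)) \<le> ennreal (m n)"
      unfolding em[symmetric] capn k_def
      by (rule emeasure_cone_shell_cap_ge) (use ar[OF that] order.strict_trans1[OF rr r0(2)] h in auto)
    then have 1: "unit_ball_vol (real k) * ((1 - h) * r n) ^ k * (h - (r n)\<^sup>2) \<le> m n"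
      using m0 by simp
    have "unit_ball_vol (real k) * ((1 - h) * r n) ^ k * (h - r0\<^sup>2)
      \<le> unit_ball_vol (real k) * ((1 - h) * r n) ^ k * (h - (r n)\<^sup>2)"
      using rr h ar[OF that] by (intro mult_left_mono mult_nonneg_nonneg) auto
    moreover have "(unit_ball_vol (real k) * r n ^ k) * q = unit_ball_vol (real k) * ((1 - h) * r n) ^ k * (h - r0\<^sup>2)"
      by (simp add: q_def power_mult_distrib mult_ac)
    ultimately have "(unit_ball_vol (real k) * r n ^ k) * q \<le> m n" using 1 by linarith
    then show ?thesis using q by (simp add: pos_le_divide_eq)
  qed
  have main: "hausdorff_premeasure k \<delta> ?S \<le> ennreal (V / q + x)" if x: "x > 0" for x
  proof -
    \<comment> \<open>Caps with index below \<open>n0\<close> are used as they are, the others fivefold enlarged.\<close>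
    obtain n0 where n0: "norm (\<Sum>i. m (i + n0)) < x * q / 5 ^ k"
      using suminf_exist_split[OF _ summ, of "x * q / 5 ^ k"] x q by auto
    define U where "U n = (if n \<notin> M then {} else if n < n0 then cball (a n) (r n) else ball (a n) (5 * r n))" for n
    define w where "w n = m n / q + (if n < n0 then 0 else 5 ^ k * m n / q)" for n
    have sumw2: "(\<lambda>n. if n < n0 then 0 else 5 ^ k * m n / q) sums (5 ^ k / q * (\<Sum>i. m (i + n0)))"
    proof -
      let ?g = "\<lambda>n. if n < n0 then 0 else 5 ^ k * m n / q"
      have "(\<lambda>i. 5 ^ k / q * m (i + n0)) sums (5 ^ k / q * (\<Sum>i. m (i + n0)))"
        using summ by (intro sums_mult summable_sums summable_ignore_initial_segment)
      then have "(\<lambda>i. ?g (i + n0)) sums (5 ^ k / q * (\<Sum>i. m (i + n0)))" by simp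
      then have "?g sums (5 ^ k / q * (\<Sum>i. m (i + n0)) + (\<Sum>i<n0. ?g i))"
        by (rule sums_iff_shift[THEN iffD1, rotated -1])
      then show ?thesis by simp
    qed
    have sumw: "w sums (suminf m / q + 5 ^ k / q * (\<Sum>i. m (i + n0)))"
      unfolding w_def by (intro sums_add sums_divide summable_sums summ sumw2)
    have w0: "w n \<ge> 0" for n using m0 q by (simp add: w_def)
    have "hausdorff_premeasure k \<delta> ?S \<le> ennreal (suminf w)"
    proof (rule hausdorff_premeasure_le_suminf)
      show "bounded (U i)" for i by (auto simp: U_def)
      show "summable w" using sumw by (rule sums_summable)
      show "0 \<le> w i" for i by (rule w0)
      have diam: "diameter (U i) \<le> (if i < n0 then 2 * r i else 10 * r i)" if "i \<in> M" for i
        using that ar[OF that] by (auto simp: U_def diameter_cball diameter_ball)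
      show "diameter (U i) \<le> \<delta>" for i
      proof (cases "i \<in> M")
        case True
        have "(if i < n0 then 2 * r i else 10 * r i) \<le> 10 * r0" using ar[OF True] by auto
        with diam[OF True] r0 show ?thesis by linarith
      qed (use r0 in \<open>auto simp: U_def\<close>)
      show "unit_ball_vol (real k) * (diameter (U i) / 2) ^ k \<le> w i" if "U i \<noteq> {}" for i
      proof -
        have iM: "i \<in> M" using that by (auto simp: U_def split: if_splits)
        have d0: "diameter (U i) \<ge> 0" by (intro diameter_ge_0) (auto simp: U_def)
        let ?c = "if i < n0 then 1 else 5 :: real"
        have "(diameter (U i) / 2) ^ k \<le> (?c * r i) ^ k"
          using diam[OF iM] d0 by (intro power_mono) (auto split: if_splits)
        then have "unit_ball_vol (real k) * (diameter (U i) / 2) ^ k \<le> ?c ^ k * (unit_ball_vol (real k) * r i ^ k)"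
          by (simp add: power_mult_distrib mult.left_commute mult_left_mono)
        also have "\<dots> \<le> ?c ^ k * (m i / q)"
          using capge[OF iM] by (intro mult_left_mono) auto
        also have "\<dots> \<le> w i" using m0[of i] q by (auto simp: w_def)
        finally show ?thesis .
      qed
      show "?S \<subseteq> (\<Union>i. U i)"
      proof
        fix x assume x: "x \<in> ?S"
        let ?F = "\<Union>i\<in>M \<inter> {..<n0}. cball (a i) (r i)"
        show "x \<in> (\<Union>i. U i)"
        proof (cases "x \<in> ?F")
          case True
          then show ?thesis by (auto simp: U_def)
        next
          case False
          have "closed ?F" by (intro closed_UN) auto
          then have "open (- ?F)" by auto
          then obtain d where d: "d > 0" "cball x d \<subseteq> - ?F"
            using False by (meson ComplI open_contains_cball)
          let ?d = "min d r0"
          have "(x, ?d) \<in> K" using x d r0 by (auto simp: K_def)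
          then obtain j where j: "j \<in> C" "\<not> disjnt (cball x ?d) (cball (fst j) (snd j))"
            "cball x ?d \<subseteq> ball (fst j) (5 * snd j)" using C(4) by force
          obtain n where n: "n \<in> M" "e n = j" using eM j by blast
          have "\<not> n < n0"
          proof
            assume "n < n0"
            then have "cball (a n) (r n) \<subseteq> ?F" using n by auto
            moreover have "cball x ?d \<subseteq> cball x d" by auto
            ultimately have "disjnt (cball x ?d) (cball (a n) (r n))" using d unfolding disjnt_def by blast
            then show False using j n by (simp add: a_def r_def)
          qed
          moreover have "x \<in> ball (a n) (5 * r n)"
            using j(3) n d r0 by (auto simp: a_def r_def subset_iff)
          ultimately show ?thesis using n by (auto simp: U_def)
        qed
      qed
    qed
    also have "suminf w \<le> V / q + x"
    proof -
      have "5 ^ k / q * (\<Sum>i. m (i + n0)) \<le> 5 ^ k / q * (x * q / 5 ^ k)"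
        using n0 q by (intro mult_left_mono) auto
      also have "\<dots> = x" using q by simp
      finally show ?thesis using sumw sumV q by (simp add: sums_iff add_mono divide_right_mono)
    qed
    finally show ?thesis by (simp add: ennreal_leI)
  qed
  have "((\<lambda>x. ennreal (V / q + x)) \<longlongrightarrow> ennreal (V / q + 0)) (at_right 0)"
    by (intro tendsto_ennrealI tendsto_intros)
  then have "hausdorff_premeasure k \<delta> ?S \<le> ennreal (V / q + 0)"
    by (rule tendsto_lowerbound) (rule eventually_mono[OF eventually_at_right_less main], assumption, simp)
  then show ?thesis by (simp add: V_def q_def k_def)
qed

lemma power_deficit_quotient_tendsto:
  "((\<lambda>h. (1 - (1 - h) ^ n) / h) \<longlongrightarrow> real n) (at_right (0::real))"
proof -
  have "((\<lambda>h. 1 - (1 - h) ^ n) has_real_derivative real n) (at 0 within {0<..})"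
    by (auto intro!: derivative_eq_intros)
  then show ?thesis
    by (simp add: has_field_derivative_iff)
qed

theorem hausdorff_measure_unit_sphere:
  "hausdorff_measure (CARD('m) - 1) (sphere (0::real^'m) 1) = ennreal (real CARD('m) * unit_ball_vol (real CARD('m)))"
proof (rule antisym)
  let ?k = "CARD('m) - 1" and ?m = "CARD('m)"
  let ?S = "sphere (0::real^'m) 1"
  let ?om = "unit_ball_vol (real ?m)"
  have ev: "\<forall>\<^sub>F h in at_right 0. 0 < h \<and> h < (c::real)" if "c > 0" for c
    using eventually_at_right_real[OF that] by simp
  show "hausdorff_measure ?k ?S \<le> ennreal (real ?m * ?om)"
    unfolding hausdorff_measure_def
  proof (rule SUP_least)
    fix \<delta> :: real assume "\<delta> \<in> {0<..}"
    then have \<delta>: "\<delta> > 0" by simp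
    have "((\<lambda>h. ennreal (?om * ((1 - (1 - h) ^ ?m) / h) / ((1 - h) ^ ?k * (1 - h)))) \<longlongrightarrow> ennreal (?om * real ?m / ((1 - 0) ^ ?k * (1 - 0)))) (at_right 0)"
      by (intro tendsto_ennrealI tendsto_intros power_deficit_quotient_tendsto) auto
    moreover have "\<forall>\<^sub>F h in at_right 0. 0 < h \<and> h < min 1 (\<delta> / 10)" using \<delta> by (intro ev) simp
    then have "\<forall>\<^sub>F h in at_right 0. hausdorff_premeasure ?k \<delta> ?S
       \<le> ennreal (?om * ((1 - (1 - h) ^ ?m) / h) / ((1 - h) ^ ?k * (1 - h)))"
    proof eventually_elim
      case (elim h)
      then have "h\<^sup>2 < h" by (simp add: power2_eq_square)
      then have "hausdorff_premeasure ?k \<delta> ?S \<le> ennreal (?om * (1 - (1 - h) ^ ?m) / ((1 - h) ^ ?k * (h - h\<^sup>2)))"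
        using elim by (intro hausdorff_premeasure_sphere_le) auto
      also have "h - h\<^sup>2 = h * (1 - h)" by (simp add: power2_eq_square algebra_simps)
      finally show ?case by (simp add: mult_ac)
    qed
    ultimately have "hausdorff_premeasure ?k \<delta> ?S \<le> ennreal (?om * real ?m / ((1 - 0) ^ ?k * (1 - 0)))"
      by (rule tendsto_lowerbound) simp
    then show "hausdorff_premeasure ?k \<delta> ?S \<le> ennreal (real ?m * ?om)" by (simp add: mult.commute)
  qed
  have "((\<lambda>h. ennreal (?om * ((1 - (1 - h) ^ ?m) / h) / ((1 + 2 * h) ^ ?k * (1 + h / 2)))) \<longlongrightarrow> ennreal (?om * real ?m / ((1 + 2 * 0) ^ ?k * (1 + 0 / 2)))) (at_right 0)"
    by (intro tendsto_ennrealI tendsto_intros power_deficit_quotient_tendsto) auto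
  moreover have "\<forall>\<^sub>F h in at_right 0. ennreal (?om * ((1 - (1 - h) ^ ?m) / h) / ((1 + 2 * h) ^ ?k * (1 + h / 2)))
      \<le> hausdorff_measure ?k ?S"
    using ev[OF zero_less_one]
  proof eventually_elim
    case (elim h)
    have "ennreal (?om * (1 - (1 - h) ^ ?m) / ((1 + 2 * h) ^ ?k * (h + h\<^sup>2 / 2))) \<le> hausdorff_measure ?k ?S"
      using elim by (intro hausdorff_measure_sphere_ge) auto
    also have "h + h\<^sup>2 / 2 = h * (1 + h / 2)" by (simp add: power2_eq_square algebra_simps)
    finally show ?case by (simp add: mult_ac)
  qed
  ultimately have "ennreal (?om * real ?m / ((1 + 2 * 0) ^ ?k * (1 + 0 / 2))) \<le> hausdorff_measure ?k ?S"
    by (rule tendsto_upperbound) simp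
  then show "ennreal (real ?m * ?om) \<le> hausdorff_measure ?k ?S" by (simp add: mult.commute)
qed

corollary unit_sphere_area_eq:
  "unit_sphere_area TYPE('m::finite) = real CARD('m) * unit_ball_vol (real CARD('m))"
  unfolding unit_sphere_area_def hausdorff_measure_unit_sphere by simp

section \<open>Functions with unit gradient\<close>

text \<open>The gradient of the definitions is a definite description; it denotes the gradient because a
linear functional on a Euclidean space is represented by a unique vector.\<close>

lemma has_derivative_grad:
  fixes f :: "real^'n \<Rightarrow> real"
  assumes "f differentiable (at x)"
  shows "(f has_derivative (\<lambda>h. grad f x \<bullet> h)) (at x)"
proof -
  obtain f' where f': "(f has_derivative f') (at x)" using assms by (auto simp: differentiable_def)
  then have lin: "linear f'" by (rule has_derivative_linear)
  define D where "D = (\<Sum>b\<in>Basis. f' b *\<^sub>R b)"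
  have f'D: "f' h = h \<bullet> D" for h
  proof -
    have "f' h = f' (\<Sum>b\<in>Basis. (h \<bullet> b) *\<^sub>R b)" by (simp add: euclidean_representation)
    also have "\<dots> = (\<Sum>b\<in>Basis. (h \<bullet> b) * f' b)"
      by (simp add: linear_sum[OF lin] linear_scale[OF lin])
    also have "\<dots> = h \<bullet> D" by (simp add: D_def inner_sum_right mult.commute)
    finally show ?thesis .
  qed
  have f'D_eq: "f' = (\<lambda>h. h \<bullet> D)" by (rule ext) (rule f'D)
  have G: "GDERIV f x :> D" unfolding gderiv_def using f' f'D_eq by simp
  have "grad f x = D" unfolding grad_def
  proof (rule the_equality[where P="\<lambda>D. GDERIV f x :> D", OF G])
    fix D' assume "GDERIV f x :> D'"
    then have "(\<lambda>h. h \<bullet> D') = (\<lambda>h. h \<bullet> D)"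
      using G unfolding gderiv_def by (rule has_derivative_unique)
    then show "D' = D" by (metis vector_eq_ldot)
  qed
  then show ?thesis using G unfolding gderiv_def by (simp add: inner_commute)
qed

lemma DERIV_along_line:
  fixes f :: "real^'n \<Rightarrow> real"
  assumes "f differentiable (at (x + t *\<^sub>R v))"
  shows "((\<lambda>t. f (x + t *\<^sub>R v)) has_real_derivative grad f (x + t *\<^sub>R v) \<bullet> v) (at t)"
proof -
  have "((\<lambda>t. f (x + t *\<^sub>R v)) has_derivative (\<lambda>s. grad f (x + t *\<^sub>R v) \<bullet> (s *\<^sub>R v))) (at t)"
    by (rule has_derivative_compose[where g=f and f="\<lambda>t. x + t *\<^sub>R v"])
      (auto intro!: derivative_eq_intros has_derivative_grad assms)
  moreover have "(\<lambda>s. grad f (x + t *\<^sub>R v) \<bullet> (s *\<^sub>R v)) = (*) (grad f (x + t *\<^sub>R v) \<bullet> v)"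
    by (simp add: fun_eq_iff mult.commute)
  ultimately show ?thesis by (simp only: has_field_derivative_def)
qed

lemma grad_uminus:
  fixes f :: "real^'n \<Rightarrow> real"
  assumes "f differentiable (at x)"
  shows "grad (\<lambda>x. - f x) x = - grad f x"
proof -
  have d: "((\<lambda>x. - f x) has_derivative (\<lambda>h. - (grad f x \<bullet> h))) (at x)"
    using has_derivative_grad[OF assms] by (rule has_derivative_minus)
  then have "(\<lambda>x. - f x) differentiable (at x)" by (auto simp: differentiable_def)
  then have "(\<lambda>h. grad (\<lambda>x. - f x) x \<bullet> h) = (\<lambda>h. - (grad f x \<bullet> h))"
    using has_derivative_grad d has_derivative_unique by blast
  then have "grad (\<lambda>x. - f x) x \<bullet> h = (- grad f x) \<bullet> h" for h by (simp add: fun_eq_iff)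
  then show ?thesis by (metis vector_eq_rdot)
qed

text \<open>If a 1-Lipschitz function grows at the maximal rate from \<open>x\<close> to \<open>x + v\<close>, then it is affine
along the whole segment.\<close>

lemma grad_along_extremal_segment:
  fixes d :: "real^'n \<Rightarrow> real"
  assumes lip: "\<And>x y. \<bar>d x - d y\<bar> \<le> dist x y" and diff: "d differentiable (at x)"
    and v: "\<bar>d (x + v) - d x\<bar> = norm v"
  shows "grad d x \<bullet> v = d (x + v) - d x"
proof -
  let ?c = "d (x + v) - d x"
  have lin: "d (x + t *\<^sub>R v) = d x + t * ?c" if t: "0 \<le> t" "t \<le> 1" for t
  proof -
    have "\<bar>d (x + t *\<^sub>R v) - d x\<bar> \<le> t * norm v"
      using lip[of "x + t *\<^sub>R v" x] t by (simp add: dist_norm)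
    moreover have "\<bar>d (x + v) - d (x + t *\<^sub>R v)\<bar> \<le> (1 - t) * norm v"
    proof -
      have "(x + v) - (x + t *\<^sub>R v) = (1 - t) *\<^sub>R v" by (simp add: algebra_simps)
      then show ?thesis using lip[of "x + v" "x + t *\<^sub>R v"] t by (simp add: dist_norm)
    qed
    ultimately show ?thesis
      using v by (cases "?c \<ge> 0") (simp_all add: algebra_simps abs_le_iff, linarith+)
  qed
  have "((\<lambda>t. d (x + t *\<^sub>R v)) has_real_derivative grad d x \<bullet> v) (at 0)"
    using DERIV_along_line[of d x 0 v] diff by simp
  then have "((\<lambda>t. d (x + t *\<^sub>R v)) has_real_derivative grad d x \<bullet> v) (at 0 within {0..1})"
    by (rule has_field_derivative_at_within)
  moreover have "((\<lambda>t. d (x + t *\<^sub>R v)) has_real_derivative ?c) (at 0 within {0..1})"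
  proof (rule has_field_derivative_transform_within[where d=1])
    show "((\<lambda>t. d x + t * ?c) has_real_derivative ?c) (at 0 within {0..1})"
      by (auto intro!: derivative_eq_intros)
  qed (use lin in auto)
  ultimately show ?thesis
    unfolding has_field_derivative_iff
    by (rule tendsto_unique[rotated]) (simp add: at_within_Icc_at_right trivial_limit_at_right_real)
qed

text \<open>The geometric properties of a signed distance that the argument uses. The Lipschitz bound is global, the
other two hold in the tube \<open>\<bar>d x\<bar> < R\<close>.\<close>

locale eikonal =
  fixes d :: "real^'n \<Rightarrow> real" and R :: real
  assumes lip: "\<bar>d x - d y\<bar> \<le> dist x y"
    and diff: "\<bar>d x\<bar> < R \<Longrightarrow> d differentiable (at x)"
    and unit: "\<bar>d x\<bar> < R \<Longrightarrow> norm (grad d x) = 1"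
begin

lemma continuous_d: "continuous_on UNIV d"
proof -
  have "1-lipschitz_on UNIV d" using lip by (intro lipschitz_onI) (auto simp: dist_real_def)
  then show ?thesis by (rule lipschitz_on_continuous_on)
qed

text \<open>For a slope \<open>l < 1\<close> the set of pairs \<open>(\<tau>, q)\<close> with \<open>dist x q \<le> \<tau>\<close> and
\<open>d x + l * \<tau> \<le> d q\<close> is compact, and where \<open>\<tau>\<close> is maximal it equals \<open>t\<close>: otherwise a step along
the gradient, which has length 1, would increase \<open>\<tau>\<close>. The maximum of \<open>d\<close> over the ball of radius \<open>t\<close> is thus at
least \<open>d x + l * t\<close> for every \<open>l < 1\<close>.\<close>

lemma steepest_ascent:
  assumes t: "0 \<le> t" "\<bar>d x\<bar> + t < R"
  obtains q where "dist x q \<le> t" "d q = d x + t"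
proof -
  have c1: "continuous_on A (\<lambda>p. d (snd p))" for A :: "(real \<times> (real^'n)) set"
    by (rule continuous_on_compose2[OF continuous_d]) (auto intro!: continuous_on_snd continuous_on_id)
  have approx: "\<exists>q. dist x q \<le> t \<and> d x + l * t \<le> d q" if l: "0 < l" "l < 1" for l
  proof -
    define C where "C = {p \<in> {0..t} \<times> cball x t. dist x (snd p) \<le> fst p \<and> d x + l * fst p \<le> d (snd p)}"
    have "compact C"
    proof -
      have "closed {p. dist x (snd p) \<le> fst p \<and> d x + l * fst p \<le> d (snd p)}"
        by (intro closed_Collect_conj closed_Collect_le continuous_intros c1)
      then have "compact (({0..t} \<times> cball x t) \<inter> {p. dist x (snd p) \<le> fst p \<and> d x + l * fst p \<le> d (snd p)})"
        by (intro compact_Int_closed compact_Times) auto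
      moreover have "C = ({0..t} \<times> cball x t) \<inter> {p. dist x (snd p) \<le> fst p \<and> d x + l * fst p \<le> d (snd p)}"
        unfolding C_def by blast
      ultimately show ?thesis by simp
    qed
    moreover have "(0, x) \<in> C" using t by (simp add: C_def)
    ultimately obtain p where p: "p \<in> C" "\<And>p'. p' \<in> C \<Longrightarrow> fst p' \<le> fst p"
      using continuous_attains_sup[of C fst] by (force intro: continuous_intros)
    define \<tau> q where "\<tau> = fst p" and "q = snd p"
    have q: "0 \<le> \<tau>" "\<tau> \<le> t" "dist x q \<le> \<tau>" "d x + l * \<tau> \<le> d q"
      using p(1) by (auto simp: C_def \<tau>_def q_def)
    have "\<tau> = t"
    proof (rule ccontr)
      assume "\<tau> \<noteq> t"
      then have lt: "\<tau> < t" using q by simp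
      have dq: "\<bar>d q\<bar> < R" using lip[of q x] q t by (simp add: dist_commute)
      let ?g = "grad d q"
      have "((\<lambda>h. d (q + h *\<^sub>R ?g) - l * h) has_real_derivative (?g \<bullet> ?g - l)) (at 0)"
        using DERIV_along_line[of d q 0 ?g] diff[OF dq] by (auto intro!: derivative_eq_intros)
      moreover have "?g \<bullet> ?g - l > 0" using unit[OF dq] l by (simp add: norm_eq_1)
      ultimately obtain e where e: "e > 0" "\<And>h. h > 0 \<Longrightarrow> h < e \<Longrightarrow> d q < d (q + h *\<^sub>R ?g) - l * h"
        using DERIV_pos_inc_right[of "\<lambda>h. d (q + h *\<^sub>R ?g) - l * h" "?g \<bullet> ?g - l" 0] by force
      define h where "h = min (e / 2) (t - \<tau>)"
      have h: "h > 0" "h < e" "h \<le> t - \<tau>" using e lt by (auto simp: h_def)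
      have "dist x (q + h *\<^sub>R ?g) \<le> \<tau> + h"
      proof -
        have "dist x (q + h *\<^sub>R ?g) \<le> dist x q + dist q (q + h *\<^sub>R ?g)" by (rule dist_triangle)
        also have "dist q (q + h *\<^sub>R ?g) = h" using h unit[OF dq] by (simp add: dist_norm)
        finally show ?thesis using q by simp
      qed
      moreover have "d x + l * (\<tau> + h) \<le> d (q + h *\<^sub>R ?g)"
        using e(2)[of h] h q by (simp add: distrib_left)
      ultimately have "(\<tau> + h, q + h *\<^sub>R ?g) \<in> C" using h q by (simp add: C_def)
      then have "\<tau> + h \<le> \<tau>" using p(2) by (force simp: \<tau>_def)
      then show False using h by simp
    qed
    then show ?thesis using q by blast
  qed
  obtain q where q: "q \<in> cball x t" "\<And>y. y \<in> cball x t \<Longrightarrow> d y \<le> d q"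
    using continuous_attains_sup[of "cball x t" d] continuous_on_subset[OF continuous_d] t by auto
  have "\<forall>\<^sub>F l in at_left 1. d x + l * t \<le> d q"
  proof -
    have "\<forall>\<^sub>F l in at_left 1. l \<in> {0<..<1::real}" by (rule eventually_at_left_real) simp
    then show ?thesis
    proof eventually_elim
      case (elim l)
      then obtain y where "dist x y \<le> t" "d x + l * t \<le> d y" using approx by auto
      then show ?case using q(2)[of y] by simp
    qed
  qed
  moreover have "((\<lambda>l. d x + l * t) \<longlongrightarrow> d x + 1 * t) (at_left 1)" by (intro tendsto_intros)
  ultimately have "d x + 1 * t \<le> d q" by (intro tendsto_upperbound) auto
  moreover have "d q \<le> d x + t" using lip[of q x] q(1) by (simp add: dist_commute)
  ultimately show ?thesis using that[of q] q(1) by simp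
qed

text \<open>The point reached by steepest ascent lies at the extremal distance, so the gradient at \<open>x\<close> points to it.\<close>

lemma ascent_along_grad:
  assumes t: "0 < t" "\<bar>d x\<bar> + t < R"
  shows "d (x + t *\<^sub>R grad d x) = d x + t"
proof -
  obtain q where q: "dist x q \<le> t" "d q = d x + t" using steepest_ascent t by (metis less_imp_le)
  have "t \<le> dist x q" using lip[of q x] q by (simp add: dist_commute)
  then have n: "norm (q - x) = t" using q by (simp add: dist_norm norm_minus_commute)
  have dx: "\<bar>d x\<bar> < R" using t by simp
  have "grad d x \<bullet> (q - x) = t"
    using grad_along_extremal_segment[OF lip diff[OF dx], of "q - x"] q n t by simp
  then have "(norm ((q - x) - t *\<^sub>R grad d x))\<^sup>2 = 0"
    using n unit[OF dx] by (simp add: power2_norm_eq_inner inner_diff_left inner_diff_right inner_commute norm_eq_1 power2_eq_square norm_eq_square)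
  then have "q = x + t *\<^sub>R grad d x" by (simp add: algebra_simps)
  then show ?thesis using q by simp
qed

text \<open>The point \<open>x + t * grad d x\<close> has value \<open>d x + t\<close>, and \<open>x + y\<close> is at distance
\<open>norm (t * grad d x - y)\<close> from it, which is at most \<open>t - grad d x \<bullet> y + (norm y)\<^sup>2 / (2 t)\<close>.\<close>

lemma lower_quadratic:
  assumes t: "0 < t" "\<bar>d x\<bar> + t < R"
  shows "d x + grad d x \<bullet> y - (norm y)\<^sup>2 / (2 * t) \<le> d (x + y)"
proof -
  let ?e = "grad d x"
  have e: "norm ?e = 1" using unit[of x] t by simp
  have cs: "?e \<bullet> y \<le> norm y" using norm_cauchy_schwarz[of ?e y] e by simp
  let ?w = "t - ?e \<bullet> y + (norm y)\<^sup>2 / (2 * t)"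
  have "0 \<le> ((t - norm y)\<^sup>2 + t\<^sup>2) / (2 * t)" using t by simp
  also have "\<dots> = t - norm y + (norm y)\<^sup>2 / (2 * t)"
    using t by (simp add: power2_eq_square field_simps)
  also have "\<dots> \<le> ?w" using cs by simp
  finally have w0: "0 \<le> ?w" .
  have "(norm (t *\<^sub>R ?e - y))\<^sup>2 = t\<^sup>2 - 2 * t * (?e \<bullet> y) + (norm y)\<^sup>2"
    using e unfolding power2_norm_eq_inner norm_eq_1
    by (simp add: inner_diff_left inner_diff_right inner_commute power2_eq_square algebra_simps)
  also have "\<dots> \<le> ?w\<^sup>2"
  proof -
    have "?w\<^sup>2 = t\<^sup>2 + 2 * t * (?w - t) + (?w - t)\<^sup>2" by (simp add: power2_eq_square algebra_simps)
    moreover have "2 * t * (?w - t) = - 2 * t * (?e \<bullet> y) + (norm y)\<^sup>2"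
      using t by (simp add: field_simps)
    ultimately show ?thesis by simp
  qed
  finally have "norm (t *\<^sub>R ?e - y) \<le> ?w" using w0 by (rule power2_le_imp_le)
  moreover have "\<bar>d (x + t *\<^sub>R ?e) - d (x + y)\<bar> \<le> norm (t *\<^sub>R ?e - y)"
    using lip[of "x + t *\<^sub>R ?e" "x + y"] by (simp add: dist_norm)
  ultimately show ?thesis using ascent_along_grad[OF t] by linarith
qed

lemma eikonal_uminus: "eikonal (\<lambda>x. - d x) R"
  by unfold_locales (use lip diff unit in \<open>auto simp: grad_uminus abs_minus_commute\<close>)

lemma quadratic_bound:
  assumes t: "0 < t" "\<bar>d x\<bar> + t < R"
  shows "\<bar>d (x + y) - d x - grad d x \<bullet> y\<bar> \<le> (norm y)\<^sup>2 / (2 * t)"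
  using lower_quadratic[OF t, of y] eikonal.lower_quadratic[OF eikonal_uminus, of t x y] t
    grad_uminus[OF diff, of x] by simp

lemma affine_along_grad:
  assumes "\<bar>d x\<bar> + \<bar>t\<bar> < R"
  shows "d (x + t *\<^sub>R grad d x) = d x + t"
proof -
  have "grad (\<lambda>x. - d x) x = - grad d x" using assms by (intro grad_uminus diff) simp
  then show ?thesis
    using ascent_along_grad[of t x] eikonal.ascent_along_grad[OF eikonal_uminus, of "- t" x] assms
    by (cases t "0::real" rule: linorder_cases) auto
qed

text \<open>The quadratic bounds at \<open>x\<close> and at \<open>x'\<close> compare the two affine approximations at one point
\<open>x' + k\<close>. The step \<open>k\<close> is taken along the difference of the gradients and of the length of
\<open>x' - x\<close>, which makes the difference of the two approximations largest relative to their errors.\<close>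

lemma grad_lipschitz:
  assumes t: "0 < t" "\<bar>d x\<bar> + t < R" "\<bar>d x'\<bar> + t < R"
  shows "norm (grad d x' - grad d x) \<le> 3 / t * norm (x' - x)"
proof (cases "grad d x' = grad d x \<or> x' = x")
  case False
  let ?e = "grad d x" and ?e' = "grad d x'"
  let ?h = "x' - x"
  let ?n = "norm (?e' - ?e)"
  have n: "?n > 0" and h0: "norm ?h > 0" using False by auto
  define k where "k = (norm ?h / ?n) *\<^sub>R (?e' - ?e)"
  have nk: "norm k = norm ?h" using n h0 by (simp add: k_def)
  have hk: "norm (?h + k) \<le> 2 * norm ?h" using norm_triangle_ineq[of ?h k] nk by simp
  have 1: "\<bar>d (x' + k) - d x - ?e \<bullet> (?h + k)\<bar> \<le> (norm (?h + k))\<^sup>2 / (2 * t)"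
    using quadratic_bound[OF t(1,2), of "?h + k"] by simp
  have 2: "\<bar>d (x' + k) - d x' - ?e' \<bullet> k\<bar> \<le> (norm k)\<^sup>2 / (2 * t)"
    by (rule quadratic_bound[OF t(1,3)])
  have 3: "\<bar>d x' - d x - ?e \<bullet> ?h\<bar> \<le> (norm ?h)\<^sup>2 / (2 * t)"
    using quadratic_bound[OF t(1,2), of ?h] by simp
  have "(norm (?h + k))\<^sup>2 / (2 * t) \<le> (2 * norm ?h)\<^sup>2 / (2 * t)"
    using hk t by (intro divide_right_mono power_mono) auto
  then have "(?e' - ?e) \<bullet> k \<le> (2 * norm ?h)\<^sup>2 / (2 * t) + (norm ?h)\<^sup>2 / (2 * t) + (norm ?h)\<^sup>2 / (2 * t)"
    using 1 2 3 nk unfolding inner_diff_left inner_add_right abs_le_iff by simp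
  also have "\<dots> = 3 / t * norm ?h * norm ?h" using t by (simp add: power2_eq_square field_simps)
  also have "(?e' - ?e) \<bullet> k = ?n * norm ?h"
    using n by (simp add: k_def power2_norm_eq_inner[symmetric] power2_eq_square)
  finally show ?thesis using h0 by (rule mult_right_le_imp_le)
qed (use t in auto)

text \<open>Along the direction \<open>grad d q0\<close> the function \<open>d\<close> increases at rate at least \<open>1/2\<close> throughout a small ball. So the translates
of the slice \<open>\<bar>d q - c\<bar> \<le> \<delta>\<close> by multiples of \<open>5 * \<delta>\<close> in this direction are disjoint; \<open>J\<close> of them fit into
a ball of radius \<open>t\<close>.\<close>

lemma thin_level_set_local:
  assumes R: "0 < t" "\<bar>c\<bar> + 2 * t < R" and \<delta>: "0 < \<delta>" "\<delta> \<le> t" and J: "0 < J" "5 * \<delta> * real J \<le> t / 2"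
  shows "emeasure lborel {q \<in> ball p (t / 24). \<bar>d q - c\<bar> \<le> \<delta>}
    \<le> emeasure lborel (ball (0::real^'n) t) / of_nat J"
proof (cases "{q \<in> ball p (t / 24). \<bar>d q - c\<bar> \<le> \<delta>} = {}")
  case True
  then show ?thesis by (simp only: emeasure_empty zero_le)
next
  case False
  let ?S = "{q \<in> ball p (t / 24). \<bar>d q - c\<bar> \<le> \<delta>}"
  have [measurable]: "d \<in> borel_measurable borel"
    using continuous_d by (rule borel_measurable_continuous_onI)
  have S[measurable]: "?S \<in> sets borel" by measurable
  obtain q0 where q0: "q0 \<in> ?S" using False by auto
  have near: "\<bar>d q\<bar> + t < R" if "q \<in> ?S" for q using that \<delta> R by auto
  let ?e = "grad d q0"
  have e1: "norm ?e = 1" using near[OF q0] R unit[of q0] by simp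
  have inc: "d q + h / 2 \<le> d (q + h *\<^sub>R ?e)" if q: "q \<in> ?S" and h: "0 \<le> h" "h \<le> t / 2" for q h
  proof -
    have "norm (q0 - q) \<le> t / 12" using q q0 dist_triangle2[of q0 q p] by (simp add: dist_norm[symmetric] dist_commute)
    then have "3 / t * norm (q0 - q) \<le> 3 / t * (t / 12)" using R by (intro mult_left_mono) auto
    moreover have "3 / t * (t / 12) = 1 / 4" using R by simp
    ultimately have "norm (?e - grad d q) \<le> 1 / 4"
      using grad_lipschitz[OF R(1) near[OF q] near[OF q0]] by linarith
    then have "(?e - grad d q) \<bullet> ?e \<le> 1 / 4"
      using norm_cauchy_schwarz[of "?e - grad d q" ?e] e1 by simp
    then have "3 / 4 \<le> grad d q \<bullet> ?e" using e1 by (simp add: inner_diff_left norm_eq_1)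
    then have "h * (3 / 4) \<le> h * (grad d q \<bullet> ?e)" using h by (intro mult_left_mono) auto
    moreover have "\<bar>d (q + h *\<^sub>R ?e) - d q - grad d q \<bullet> (h *\<^sub>R ?e)\<bar> \<le> (norm (h *\<^sub>R ?e))\<^sup>2 / (2 * t)"
      by (rule quadratic_bound[OF R(1) near[OF q]])
    moreover have "(norm (h *\<^sub>R ?e))\<^sup>2 / (2 * t) \<le> h / 4"
    proof -
      have "h * h \<le> h * (t / 2)" using h by (intro mult_left_mono) auto
      then show ?thesis using e1 R h by (simp add: power2_eq_square field_simps)
    qed
    ultimately show ?thesis by (simp add: abs_le_iff)
  qed
  define S where "S j = (+) ((5 * \<delta> * real j) *\<^sub>R ?e) ` ?S" for j
  have Sm: "emeasure lborel (S j) = emeasure lborel ?S" for j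
    unfolding S_def using S by (rule emeasure_lborel_translate)
  have Sb: "S j \<in> sets borel" for j
  proof -
    have "S j = (\<lambda>z. z - (5 * \<delta> * real j) *\<^sub>R ?e) -` ?S \<inter> space borel"
      by (auto simp: S_def image_iff) (metis add.commute diff_add_cancel)
    also have "\<dots> \<in> sets borel" by measurable
    finally show ?thesis .
  qed
  have disj: "disjoint_family_on S {..<J}"
    unfolding disjoint_family_on_def
  proof (intro ballI impI)
    have *: "S i \<inter> S j = {}" if ij: "i < j" "j < J" for i j
    proof (rule equals0I)
      fix z assume "z \<in> S i \<inter> S j"
      then obtain p q where pq: "p \<in> ?S" "q \<in> ?S"
        "z = (5 * \<delta> * real i) *\<^sub>R ?e + p" "z = (5 * \<delta> * real j) *\<^sub>R ?e + q" by (auto simp: S_def)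
      let ?h = "5 * \<delta> * (real j - real i)"
      have "p = q + ?h *\<^sub>R ?e" using pq by (simp add: algebra_simps)
      moreover have h: "5 * \<delta> * 1 \<le> ?h" using ij \<delta> by (intro mult_left_mono) auto
      moreover have "?h \<le> t / 2"
      proof -
        have "?h \<le> 5 * \<delta> * real J" using ij \<delta> by (intro mult_left_mono) auto
        then show ?thesis using J by simp
      qed
      ultimately have "d q + ?h / 2 \<le> d p" using inc[OF pq(2), of ?h] \<delta> by simp
      then show False using pq(1,2) h \<delta> by (auto simp: abs_le_iff)
    qed
    fix i j assume "i \<in> {..<J}" "j \<in> {..<J}" "i \<noteq> j"
    then show "S i \<inter> S j = {}" using *[of i j] *[of j i] by (cases i j rule: linorder_cases) auto
  qed
  have sub: "S j \<subseteq> ball p t" if "j < J" for j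
  proof
    fix z assume "z \<in> S j"
    then obtain q where q: "q \<in> ?S" "z = (5 * \<delta> * real j) *\<^sub>R ?e + q" by (auto simp: S_def)
    have "5 * \<delta> * real j \<le> 5 * \<delta> * real J" using that \<delta> by (intro mult_left_mono) auto
    moreover have "norm ((5 * \<delta> * real j) *\<^sub>R ?e) = 5 * \<delta> * real j" using \<delta> e1 by simp
    ultimately have "norm ((5 * \<delta> * real j) *\<^sub>R ?e) \<le> t / 2" using J by linarith
    then have "dist q z \<le> t / 2" using q by (simp add: dist_norm)
    moreover have "dist p q < t / 24" using q by simp
    ultimately have "dist p z < t / 24 + t / 2" using dist_triangle[of p z q] by simp
    then show "z \<in> ball p t" using R by simp
  qed
  have "of_nat J * emeasure lborel ?S = (\<Sum>j<J. emeasure lborel (S j))" by (simp add: Sm)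
  also have "\<dots> = emeasure lborel (\<Union>j<J. S j)"
    using Sb disj by (intro sum_emeasure) auto
  also have "\<dots> \<le> emeasure lborel (ball p t)" using sub by (intro emeasure_mono) auto
  also have "\<dots> = emeasure lborel (ball (0::real^'n) t)" using R by (simp add: emeasure_ball)
  finally have "of_nat J * emeasure lborel ?S / of_nat J \<le> emeasure lborel (ball (0::real^'n) t) / of_nat J"
    by (rule divide_right_mono_ennreal)
  moreover have "of_nat J * emeasure lborel ?S / of_nat J = emeasure lborel ?S"
    by (subst mult.commute) (rule mult_divide_eq_ennreal, use J in auto)
  ultimately show ?thesis by (simp only:)
qed

text \<open>The number of balls of radius \<open>t / 24\<close> that cover a ball of radius \<open>A\<close> does not depend on its centre.\<close>

lemma thin_level_set:
  assumes \<rho>: "0 < \<rho>" "\<rho> < R" and e: "0 < e"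
  shows "\<exists>\<delta>>0. \<forall>x c. \<bar>c\<bar> \<le> \<rho> \<longrightarrow> emeasure lborel {q \<in> cball x A. \<bar>d q - c\<bar> \<le> \<delta>} \<le> ennreal e"
proof -
  define t where "t = (R - \<rho>) / 3"
  have t: "t > 0" "\<rho> + 2 * t < R" using \<rho> by (auto simp: t_def field_simps)
  have cov: "cball (0::real^'n) A \<subseteq> (\<Union>p\<in>UNIV. ball p (t / 24))"
  proof
    fix p :: "real^'n"
    have "p \<in> ball p (t / 24)" using t by simp
    then show "p \<in> (\<Union>p\<in>UNIV. ball p (t / 24))" by blast
  qed
  obtain F where F: "finite F" "cball (0::real^'n) A \<subseteq> (\<Union>p\<in>F. ball p (t / 24))"
    by (rule compactE_image[OF _ _ cov]) auto
  define V where "V = unit_ball_vol (real DIM(real^'n)) * t ^ DIM(real^'n)"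
  have V: "emeasure lborel (ball (0::real^'n) t) = ennreal V" "V \<ge> 0" using t by (auto simp: V_def emeasure_ball)
  obtain J :: nat where J: "real (card F) * V / e < real J" using reals_Archimedean2 by blast
  have "0 \<le> real (card F) * V / e" using V e by simp
  then have "0 < real J" using J by (rule order.strict_trans1)
  then have J0: "J > 0" by simp
  define \<delta> where "\<delta> = min t (t / (10 * real J))"
  have "0 < t / (10 * real J)" using t J0 by (intro divide_pos_pos) auto
  then have \<delta>: "0 < \<delta>" "\<delta> \<le> t" using t unfolding \<delta>_def min_less_iff_conj by simp_all
  have \<delta>J: "5 * \<delta> * real J \<le> t / 2"
  proof -
    have "\<delta> \<le> t / (10 * real J)" by (simp add: \<delta>_def)
    then have "\<delta> * (10 * real J) \<le> t" using J0 by (subst (asm) pos_le_divide_eq) auto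
    then show ?thesis by simp
  qed
  have [measurable]: "d \<in> borel_measurable borel"
    using continuous_d by (rule borel_measurable_continuous_onI)
  show ?thesis
  proof (intro exI[of _ \<delta>] conjI allI impI \<delta>(1))
    fix x c assume c: "\<bar>c\<bar> \<le> \<rho>"
    have "{q \<in> cball x A. \<bar>d q - c\<bar> \<le> \<delta>} \<subseteq> (\<Union>p\<in>F. {q \<in> ball (x + p) (t / 24). \<bar>d q - c\<bar> \<le> \<delta>})"
    proof clarify
      fix q assume q: "q \<in> cball x A" "\<bar>d q - c\<bar> \<le> \<delta>"
      then have "q - x \<in> cball 0 A" by (simp add: dist_norm norm_minus_commute)
      then obtain p where p: "p \<in> F" "q - x \<in> ball p (t / 24)" using F by blast
      then have "q \<in> ball (x + p) (t / 24)" by (simp add: dist_norm algebra_simps)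
      with p q show "q \<in> (\<Union>p\<in>F. {q \<in> ball (x + p) (t / 24). \<bar>d q - c\<bar> \<le> \<delta>})" by blast
    qed
    then have "emeasure lborel {q \<in> cball x A. \<bar>d q - c\<bar> \<le> \<delta>}
      \<le> emeasure lborel (\<Union>p\<in>F. {q \<in> ball (x + p) (t / 24). \<bar>d q - c\<bar> \<le> \<delta>})"
    proof (rule emeasure_mono)
      have "{q \<in> ball (x + p) (t / 24). \<bar>d q - c\<bar> \<le> \<delta>} \<in> sets lborel" for p by measurable
      then show "(\<Union>p\<in>F. {q \<in> ball (x + p) (t / 24). \<bar>d q - c\<bar> \<le> \<delta>}) \<in> sets lborel"
        using F(1) by (intro sets.finite_UN) auto
    qed
    also have "\<dots> \<le> (\<Sum>p\<in>F. emeasure lborel {q \<in> ball (x + p) (t / 24). \<bar>d q - c\<bar> \<le> \<delta>})"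
      using F(1) by (intro emeasure_subadditive_finite) auto
    also have "\<dots> \<le> (\<Sum>p\<in>F. ennreal (V / real J))"
    proof (rule sum_mono)
      fix p
      have "emeasure lborel {q \<in> ball (x + p) (t / 24). \<bar>d q - c\<bar> \<le> \<delta>} \<le> ennreal V / of_nat J"
        using thin_level_set_local[of t c \<delta> J "x + p"] t c \<delta> \<delta>J J0 V by simp
      also have "\<dots> = ennreal (V / real J)"
        using J0 V by (simp add: divide_ennreal ennreal_of_nat_eq_real_of_nat)
      finally show "emeasure lborel {q \<in> ball (x + p) (t / 24). \<bar>d q - c\<bar> \<le> \<delta>} \<le> ennreal (V / real J)" .
    qed
    also have "\<dots> = ennreal (real (card F) * (V / real J))"
      by (subst ennreal_mult') (auto simp: ennreal_of_nat_eq_real_of_nat)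
    also have "\<dots> \<le> ennreal e"
    proof (rule ennreal_leI)
      have "real (card F) * V < real J * e" using J e by (simp add: pos_divide_less_eq)
      then show "real (card F) * (V / real J) \<le> e" using J0 by (simp add: field_simps)
    qed
    finally show "emeasure lborel {q \<in> cball x A. \<bar>d q - c\<bar> \<le> \<delta>} \<le> ennreal e" .
  qed
qed

end

section \<open>The signed distance\<close>

text \<open>A segment from a point of \<open>\<Omega>\<close> to a point outside meets the boundary, so there the two distances
add up to at most the length of the segment.\<close>

lemma signed_dist_lipschitz:
  assumes ne: "frontier \<Omega> \<noteq> {}"
  shows "\<bar>signed_dist \<Omega> x - signed_dist \<Omega> y\<bar> \<le> dist x y"
proof -
  have mixed: "infdist a (frontier \<Omega>) + infdist b (frontier \<Omega>) \<le> dist a b"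
    if a: "a \<in> \<Omega>" and b: "b \<notin> \<Omega>" for a b
  proof -
    have "closed_segment a b \<inter> frontier \<Omega> \<noteq> {}"
      by (rule connected_Int_frontier) (use a b in auto)
    then obtain p where p: "p \<in> closed_segment a b" "p \<in> frontier \<Omega>" by auto
    have "infdist a (frontier \<Omega>) \<le> dist a p" "infdist b (frontier \<Omega>) \<le> dist b p"
      using p by (auto intro: infdist_le)
    moreover have "dist a b = dist a p + dist p b"
      using p(1) between between_mem_segment by blast
    ultimately show ?thesis by (simp add: dist_commute)
  qed
  have same: "\<bar>infdist x (frontier \<Omega>) - infdist y (frontier \<Omega>)\<bar> \<le> dist x y"
    by (rule infdist_triangle_abs)
  have nn: "0 \<le> infdist x (frontier \<Omega>)" "0 \<le> infdist y (frontier \<Omega>)" by (auto simp: infdist_nonneg)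
  show ?thesis
    unfolding signed_dist_def
    using mixed[of x y] mixed[of y x] same nn by (auto simp: dist_commute abs_le_iff)
qed

lemma abs_signed_dist: "\<bar>signed_dist \<Omega> x\<bar> = infdist x (frontier \<Omega>)"
  by (auto simp: signed_dist_def infdist_nonneg)

lemma smooth_on_iter_partial:
  assumes "smooth_on S f" "x \<in> S"
  shows "iter_partial is f differentiable (at x)"
  using assms by (auto simp: smooth_on_def)

lemma isCont_grad:
  assumes "smooth_on S f" "x \<in> S"
  shows "isCont (grad f) x"
proof -
  have "isCont (\<lambda>y. grad f y $ i) x" for i
  proof -
    have "iter_partial [i] f differentiable (at x)" using assms by (rule smooth_on_iter_partial)
    then have "isCont (iter_partial [i] f) x" by (rule differentiable_imp_continuous_within)
    then show ?thesis by (simp add: partial_def[abs_def])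
  qed
  then show ?thesis unfolding isCont_def by (intro vec_tendstoI)
qed

lemma norm_grad_le_1_of_lipschitz:
  fixes d :: "real^'n \<Rightarrow> real"
  assumes lip: "\<And>x y. \<bar>d x - d y\<bar> \<le> dist x y" and diff: "d differentiable (at x)"
  shows "norm (grad d x) \<le> 1"
proof -
  let ?g = "grad d x"
  have der: "((\<lambda>t. d (x + t *\<^sub>R ?g)) has_real_derivative ?g \<bullet> ?g) (at 0)"
    using DERIV_along_line[of d x 0 ?g] diff by simp
  have lim: "((\<lambda>h. (d (x + h *\<^sub>R ?g) - d x) / h) \<longlongrightarrow> ?g \<bullet> ?g) (at_right 0)"
    using has_field_derivative_at_within[OF der, of "{0<..}"] by (simp add: has_field_derivative_iff)
  have "\<forall>\<^sub>F h in at_right 0. (d (x + h *\<^sub>R ?g) - d x) / h \<le> norm ?g"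
    using eventually_at_right_less[of 0]
  proof eventually_elim
    case (elim h)
    have "d (x + h *\<^sub>R ?g) - d x \<le> h * norm ?g"
      using lip[of "x + h *\<^sub>R ?g" x] elim by (simp add: dist_norm abs_le_iff)
    then show ?case using elim by (simp add: pos_divide_le_eq mult.commute)
  qed
  with lim have "?g \<bullet> ?g \<le> norm ?g" by (intro tendsto_upperbound) auto
  then have "norm ?g * norm ?g \<le> norm ?g * 1" by (simp add: power2_norm_eq_inner[symmetric] power2_eq_square)
  then have "norm ?g * norm ?g \<le> 1 * norm ?g" by simp
  then show ?thesis by (cases "norm ?g = 0") (simp, rule mult_right_le_imp_le[of _ "norm ?g"], simp_all)
qed

text \<open>Off the boundary, the signed distance changes at rate 1 along the segment to a nearest boundary
point. A boundary point is a limit of such points, because the boundary is locally a regular level set, and the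
gradient is continuous.\<close>

lemma eikonal_signed_dist:
  assumes ne: "frontier \<Omega> \<noteq> {}" and sb: "smooth_boundary \<Omega>"
    and sm: "smooth_on (tube \<Omega> R) (signed_dist \<Omega>)"
  shows "eikonal (signed_dist \<Omega>) R"
proof
  let ?d = "signed_dist \<Omega>"
  note lip = signed_dist_lipschitz[OF ne]
  show "\<bar>?d x - ?d y\<bar> \<le> dist x y" for x y by (rule lip)
  have diff: "?d differentiable (at x)" if "\<bar>?d x\<bar> < R" for x
    using smooth_on_iter_partial[OF sm, of x "[]"] that by (simp add: tube_def)
  show "?d differentiable (at x)" if "\<bar>?d x\<bar> < R" for x by (rule diff[OF that])
  have off: "norm (grad ?d x) = 1" if x: "\<bar>?d x\<bar> < R" "x \<notin> frontier \<Omega>" for x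
  proof -
    obtain y where y: "y \<in> frontier \<Omega>" "infdist x (frontier \<Omega>) = dist x y"
      using infdist_attains_inf[OF frontier_closed ne] by blast
    have dy: "?d y = 0" using y(1) abs_signed_dist[of \<Omega> y] by simp
    have v: "\<bar>?d (x + (y - x)) - ?d x\<bar> = norm (y - x)"
      using dy y(2) abs_signed_dist[of \<Omega> x] by (simp add: dist_norm norm_minus_commute)
    have "grad ?d x \<bullet> (y - x) = ?d (x + (y - x)) - ?d x"
      by (rule grad_along_extremal_segment[OF lip diff[OF x(1)] v])
    then have "norm (y - x) = \<bar>grad ?d x \<bullet> (y - x)\<bar>" using v by simp
    also have "\<dots> \<le> norm (grad ?d x) * norm (y - x)" by (rule Cauchy_Schwarz_ineq2)
    finally have "1 * norm (y - x) \<le> norm (grad ?d x) * norm (y - x)" by simp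
    moreover have "norm (y - x) > 0" using x y by auto
    ultimately have "1 \<le> norm (grad ?d x)" by (rule mult_right_le_imp_le)
    with norm_grad_le_1_of_lipschitz[OF lip diff[OF x(1)]] show ?thesis by simp
  qed
  show "norm (grad ?d x) = 1" if x: "\<bar>?d x\<bar> < R" for x
  proof (cases "x \<in> frontier \<Omega>")
    case True
    obtain U g where Ug: "open U \<and> x \<in> U \<and> smooth_on U g \<and> (\<forall>x\<in>U. grad g x \<noteq> 0) \<and>
       {x\<in>U. g x > 0} \<subseteq> \<Omega> \<and> {x\<in>U. g x < 0} \<subseteq> - \<Omega> \<and> {x\<in>U. g x = 0} = U \<inter> frontier \<Omega>"
      using bspec[OF sb[unfolded smooth_boundary_def] True] by (elim exE) (rule that)
    then have U: "open U" "x \<in> U" "smooth_on U g" "\<And>x. x \<in> U \<Longrightarrow> grad g x \<noteq> 0"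
      "{x\<in>U. g x = 0} = U \<inter> frontier \<Omega>"
      by simp_all
    let ?v = "grad g x"
    have g0: "g x = 0" using U True by blast
    have "g differentiable (at x)" using smooth_on_iter_partial[OF U(3,2), of "[]"] by simp
    then have "((\<lambda>t. g (x + t *\<^sub>R ?v)) has_real_derivative ?v \<bullet> ?v) (at 0)"
      using DERIV_along_line[of g x 0 ?v] by simp
    moreover have "?v \<bullet> ?v > 0" using U by simp
    ultimately obtain e where e: "e > 0" "\<And>h. h > 0 \<Longrightarrow> h < e \<Longrightarrow> 0 < g (x + h *\<^sub>R ?v)"
      using DERIV_pos_inc_right[of "\<lambda>t. g (x + t *\<^sub>R ?v)" "?v \<bullet> ?v" 0] g0 by force
    have path: "((\<lambda>t. x + t *\<^sub>R ?v) \<longlongrightarrow> x + 0 *\<^sub>R ?v) (at_right 0)" by (intro tendsto_intros)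
    have xt: "x \<in> tube \<Omega> R" using x by (simp add: tube_def)
    have "((\<lambda>t. norm (grad ?d (x + t *\<^sub>R ?v))) \<longlongrightarrow> norm (grad ?d x)) (at_right 0)"
      using path isCont_grad[OF sm xt] by (intro tendsto_norm isCont_tendsto_compose[of x "grad ?d"]) auto
    moreover have "\<forall>\<^sub>F t in at_right 0. norm (grad ?d (x + t *\<^sub>R ?v)) = 1"
    proof -
      have "\<forall>\<^sub>F t in at_right 0. x + t *\<^sub>R ?v \<in> U" using topological_tendstoD[OF path U(1)] U by simp
      moreover have "\<forall>\<^sub>F t in at_right 0. \<bar>?d (x + t *\<^sub>R ?v)\<bar> < R"
      proof -
        have "isCont ?d x" using diff[OF x] by (rule differentiable_imp_continuous_within)
        then have "((\<lambda>t. \<bar>?d (x + t *\<^sub>R ?v)\<bar>) \<longlongrightarrow> \<bar>?d x\<bar>) (at_right 0)"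
          using path by (intro tendsto_rabs isCont_tendsto_compose[of x ?d]) auto
        then show ?thesis using x by (rule order_tendstoD)
      qed
      moreover have "\<forall>\<^sub>F t in at_right 0. t \<in> {0<..<e}" using e by (intro eventually_at_right_real)
      ultimately show ?thesis
      proof eventually_elim
        case (elim t)
        then have "g (x + t *\<^sub>R ?v) > 0" using e by simp
        moreover have "x + t *\<^sub>R ?v \<in> U" using elim by blast
        moreover have "g z = 0" if "z \<in> U" "z \<in> frontier \<Omega>" for z
        proof -
          have "z \<in> {x\<in>U. g x = 0}" unfolding U(5) using that by simp
          then show ?thesis by simp
        qed
        ultimately have "x + t *\<^sub>R ?v \<notin> frontier \<Omega>" by force
        then show ?case using off elim by blast
      qed
    qed
    ultimately have "((\<lambda>t. 1::real) \<longlongrightarrow> norm (grad ?d x)) (at_right (0::real))"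
      using Lim_transform_eventually by fastforce
    then show ?thesis using tendsto_unique[OF _ _ tendsto_const] by (metis trivial_limit_at_right_real)
  qed (use off x in blast)
qed

definition hess :: "(real^'n \<Rightarrow> real) \<Rightarrow> real^'n \<Rightarrow> real^'n \<Rightarrow> real^'n \<Rightarrow> real" where
  "hess f x y z = (\<Sum>j\<in>UNIV. \<Sum>i\<in>UNIV. y $ j * z $ i * iter_partial [i, j] f x)"

lemma DERIV_iter_partial_line:
  assumes "smooth_on S f" "x + t *\<^sub>R y \<in> S"
  shows "((\<lambda>t. iter_partial is f (x + t *\<^sub>R y)) has_real_derivative
    (\<Sum>k\<in>UNIV. y $ k * iter_partial (k # is) f (x + t *\<^sub>R y))) (at t)"
  using DERIV_along_line[of "iter_partial is f" x t y] smooth_on_iter_partial[OF assms]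
  by (simp add: inner_vec_def partial_def mult.commute)

text \<open>Maclaurin's formula along the segment from \<open>x\<close> to \<open>x + y\<close>.\<close>

lemma taylor_third_order:
  fixes f :: "real^'n \<Rightarrow> real"
  assumes sm: "smooth_on S f" and seg: "\<And>t. 0 \<le> t \<Longrightarrow> t \<le> 1 \<Longrightarrow> x + t *\<^sub>R y \<in> S"
    and M: "\<And>t i j k. 0 \<le> t \<Longrightarrow> t \<le> 1 \<Longrightarrow> \<bar>iter_partial [k, i, j] f (x + t *\<^sub>R y)\<bar> \<le> M"
  shows "\<bar>f (x + y) - f x - grad f x \<bullet> y - hess f x y y / 2\<bar> \<le> real CARD('n) ^ 3 * M * norm y ^ 3 / 6"
proof -
  define D where "D m t = (if m = 0 then f (x + t *\<^sub>R y)
     else if m = 1 then (\<Sum>j\<in>UNIV. y $ j * iter_partial [j] f (x + t *\<^sub>R y))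
     else if m = 2 then (\<Sum>j\<in>UNIV. \<Sum>i\<in>UNIV. y $ j * y $ i * iter_partial [i, j] f (x + t *\<^sub>R y))
     else (\<Sum>j\<in>UNIV. \<Sum>i\<in>UNIV. \<Sum>k\<in>UNIV. y $ j * y $ i * y $ k * iter_partial [k, i, j] f (x + t *\<^sub>R y)))"
    for m :: nat and t
  have "(D m has_real_derivative D (Suc m) t) (at t)" if t: "m < 3" "0 \<le> t" "t \<le> 1" for m t
  proof -
    note st = seg[OF t(2,3)]
    consider "m = 0" | "m = 1" | "m = 2" using t by linarith
    then show ?thesis
    proof cases
      case 1
      then show ?thesis using DERIV_iter_partial_line[OF sm st, of "[]"] by (simp add: D_def[abs_def])
    next
      case 2
      have "((\<lambda>t. \<Sum>j\<in>UNIV. y $ j * iter_partial [j] f (x + t *\<^sub>R y)) has_real_derivative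
        (\<Sum>j\<in>UNIV. y $ j * (\<Sum>i\<in>UNIV. y $ i * iter_partial [i, j] f (x + t *\<^sub>R y)))) (at t)"
        by (intro DERIV_sum DERIV_cmult DERIV_iter_partial_line[OF sm st])
      then show ?thesis using 2 by (simp add: D_def[abs_def] sum_distrib_left mult.assoc)
    next
      case 3
      have "((\<lambda>t. \<Sum>j\<in>UNIV. \<Sum>i\<in>UNIV. (y $ j * y $ i) * iter_partial [i, j] f (x + t *\<^sub>R y)) has_real_derivative
        (\<Sum>j\<in>UNIV. \<Sum>i\<in>UNIV. (y $ j * y $ i) * (\<Sum>k\<in>UNIV. y $ k * iter_partial [k, i, j] f (x + t *\<^sub>R y)))) (at t)"
        by (intro DERIV_sum DERIV_cmult DERIV_iter_partial_line[OF sm st])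
      then show ?thesis using 3 by (simp add: D_def[abs_def] sum_distrib_left mult.assoc)
    qed
  qed
  then obtain t where t: "0 < t" "t < 1" "D 0 1 = (\<Sum>m<3. D m 0 / fact m * 1 ^ m) + D 3 t / fact 3 * 1 ^ 3"
    using Maclaurin[of 1 3 D "D 0"] by auto
  have "D 0 1 - D 0 0 - D 1 0 - D 2 0 / 2 = D 3 t / 6"
    using t(3) by (simp add: numeral_3_eq_3 numeral_2_eq_2 lessThan_Suc fact_numeral)
  moreover have "D 1 0 = grad f x \<bullet> y"
    by (simp add: D_def inner_vec_def partial_def mult.commute)
  moreover have "D 2 0 = hess f x y y" by (simp add: D_def hess_def)
  ultimately have eq: "f (x + y) - f x - grad f x \<bullet> y - hess f x y y / 2 = D 3 t / 6"
    by (simp add: D_def)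
  have "\<bar>D 3 t\<bar> \<le> (\<Sum>j\<in>(UNIV::'n set). \<Sum>i\<in>(UNIV::'n set). \<Sum>k\<in>(UNIV::'n set). norm y * norm y * norm y * M)"
  proof -
    have "norm (\<Sum>j\<in>UNIV. \<Sum>i\<in>UNIV. \<Sum>k\<in>UNIV. y $ j * y $ i * y $ k * iter_partial [k, i, j] f (x + t *\<^sub>R y))
      \<le> (\<Sum>j\<in>(UNIV::'n set). \<Sum>i\<in>(UNIV::'n set). \<Sum>k\<in>(UNIV::'n set). norm y * norm y * norm y * M)"
    proof (intro sum_norm_le)
      fix i j k
      show "norm (y $ j * y $ i * y $ k * iter_partial [k, i, j] f (x + t *\<^sub>R y)) \<le> norm y * norm y * norm y * M"
        unfolding real_norm_def abs_mult using t by (intro mult_mono component_le_norm_cart M mult_nonneg_nonneg) auto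
    qed
    then show ?thesis by (simp add: D_def)
  qed
  also have "\<dots> = real CARD('n) ^ 3 * M * norm y ^ 3" by (simp add: power3_eq_cube mult_ac)
  finally show ?thesis unfolding eq by simp
qed

lemma bilinear_hess: "bilinear (hess f x)"
  unfolding bilinear_def hess_def
  by (auto intro!: linearI simp: sum.distrib[symmetric] sum_distrib_left algebra_simps)

lemma hess_bound:
  fixes f :: "real^'n \<Rightarrow> real"
  assumes M: "\<And>i j. \<bar>iter_partial [i, j] f x\<bar> \<le> M"
  shows "\<bar>hess f x y z\<bar> \<le> real CARD('n) ^ 2 * M * norm y * norm z"
proof -
  have "norm (hess f x y z) \<le> (\<Sum>j\<in>(UNIV::'n set). \<Sum>i\<in>(UNIV::'n set). norm y * norm z * M)"
    unfolding hess_def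
  proof (intro sum_norm_le)
    fix i j
    show "norm (y $ j * z $ i * iter_partial [i, j] f x) \<le> norm y * norm z * M"
      unfolding real_norm_def abs_mult by (intro mult_mono component_le_norm_cart M mult_nonneg_nonneg) auto
  qed
  also have "\<dots> = real CARD('n) ^ 2 * M * norm y * norm z" by (simp add: power2_eq_square mult_ac)
  finally show ?thesis by simp
qed

lemma laplacian_eq_sum_hess:
  fixes f :: "real^'n \<Rightarrow> real"
  shows "laplacian f x = (\<Sum>b\<in>Basis. hess f x b b)"
proof -
  have "hess f x (axis k 1) (axis k 1) = iter_partial [k, k] f x" for k
    unfolding hess_def axis_def by (simp add: if_distrib[of "\<lambda>c. c * _"] if_distrib[of "\<lambda>c. _ * c"] cong: if_cong del: iter_partial.simps)
  moreover have "(Basis :: (real^'n) set) = (\<lambda>k. axis k 1) ` UNIV" by (auto simp: Basis_vec_def)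
  moreover have "inj (\<lambda>k. axis k (1::real) :: real^'n)" by (auto simp: inj_on_def axis_eq_axis)
  ultimately have "(\<Sum>b\<in>Basis. hess f x b b) = (\<Sum>k\<in>UNIV. iter_partial [k, k] f x)"
    using sum.reindex[of "\<lambda>k. axis k (1::real) :: real^'n" UNIV "\<lambda>b. hess f x b b"] by (simp only: o_def)
  then show ?thesis by (simp add: laplacian_def)
qed

text \<open>The function is affine along the line through \<open>x\<close> in the direction of its gradient at \<open>x\<close>.\<close>

lemma (in eikonal) hess_grad_zero:
  assumes sm: "smooth_on S d" and x: "x \<in> S" "open S" "\<bar>d x\<bar> < R"
  shows "hess d x (grad d x) (grad d x) = 0"
proof -
  let ?e = "grad d x"
  define r where "r = R - \<bar>d x\<bar>"
  have r: "r > 0" using x by (simp add: r_def)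
  have path: "((\<lambda>t. x + t *\<^sub>R ?e) \<longlongrightarrow> x + 0 *\<^sub>R ?e) (nhds 0)" by (intro tendsto_intros filterlim_ident)
  have near: "\<forall>\<^sub>F t in nhds 0. x + t *\<^sub>R ?e \<in> S \<and> \<bar>t\<bar> < r"
  proof (rule eventually_conj)
    show "\<forall>\<^sub>F t in nhds 0. x + t *\<^sub>R ?e \<in> S" using topological_tendstoD[OF path x(2)] x(1) by simp
    have "\<forall>\<^sub>F t in nhds 0. t \<in> {-r<..<r}" using r by (intro eventually_nhds_in_open) auto
    then show "\<forall>\<^sub>F t in nhds 0. \<bar>t\<bar> < r" by eventually_elim auto
  qed
  define D1 where "D1 t = (\<Sum>j\<in>UNIV. ?e $ j * iter_partial [j] d (x + t *\<^sub>R ?e))" for t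
  have "\<forall>\<^sub>F t in nhds 0. D1 t = 1"
    using near
  proof eventually_elim
    case (elim t)
    have 1: "((\<lambda>t. d (x + t *\<^sub>R ?e)) has_real_derivative D1 t) (at t)"
      using DERIV_iter_partial_line[OF sm, of x t ?e "[]"] elim by (simp add: D1_def)
    have "((\<lambda>t. d x + t) has_real_derivative 1) (at t)" by (auto intro!: derivative_eq_intros)
    moreover have "\<forall>\<^sub>F t in nhds t. d (x + t *\<^sub>R ?e) = d x + t"
    proof -
      have "\<forall>\<^sub>F u in nhds t. u \<in> {-r<..<r}" using elim by (intro eventually_nhds_in_open) auto
      then show ?thesis
        by eventually_elim (rule affine_along_grad, auto simp: r_def)
    qed
    ultimately have "((\<lambda>t. d (x + t *\<^sub>R ?e)) has_real_derivative 1) (at t)"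
      by (subst DERIV_cong_ev[OF refl _ refl])
    with 1 show ?case by (rule DERIV_unique)
  qed
  then have "(D1 has_real_derivative 0) (at 0)"
    by (subst DERIV_cong_ev[OF refl _ refl, where g="\<lambda>_. 1"]) auto
  moreover have "(D1 has_real_derivative (\<Sum>j\<in>UNIV. ?e $ j * (\<Sum>i\<in>UNIV. ?e $ i * iter_partial [i, j] d (x + 0 *\<^sub>R ?e)))) (at 0)"
    unfolding D1_def by (intro DERIV_sum DERIV_cmult DERIV_iter_partial_line[OF sm]) (use x in simp)
  ultimately have "0 = (\<Sum>j\<in>UNIV. ?e $ j * (\<Sum>i\<in>UNIV. ?e $ i * iter_partial [i, j] d (x + 0 *\<^sub>R ?e)))"
    by (rule DERIV_unique)
  then show ?thesis unfolding hess_def by (simp add: sum_distrib_left mult.assoc del: iter_partial.simps)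
qed

lemma tube_eq: "tube \<Omega> r = {x. infdist x (frontier \<Omega>) < r}"
  by (simp add: tube_def abs_signed_dist)

lemma bounded_tube:
  assumes "bounded (frontier \<Omega>)" "frontier \<Omega> \<noteq> {}"
  shows "bounded (tube \<Omega> r)"
proof -
  obtain B where B: "\<And>y. y \<in> frontier \<Omega> \<Longrightarrow> norm y \<le> B" using assms(1) by (auto simp: bounded_iff)
  have "norm x \<le> B + r" if "x \<in> tube \<Omega> r" for x
  proof -
    obtain y where y: "y \<in> frontier \<Omega>" "infdist x (frontier \<Omega>) = dist x y"
      using infdist_attains_inf[OF frontier_closed assms(2)] by blast
    then have "norm (x - y) < r" using that by (simp add: tube_eq dist_norm)
    then show ?thesis using B[OF y(1)] norm_triangle_sub[of x y] by simp
  qed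
  then show ?thesis by (auto simp: bounded_iff)
qed

text \<open>If \<open>K\<close> is bounded, the points within \<open>\<rho> / 4\<close> of \<open>K\<close> lie in a compact subset of the larger tube, where the
derivatives are continuous.\<close>

lemma derivatives_bounded_near:
  fixes \<Omega> :: "(real^'n) set"
  assumes ne: "frontier \<Omega> \<noteq> {}" and \<rho>: "\<rho> > 0"
    and sm: "smooth_on (tube \<Omega> (2 * \<rho>)) (signed_dist \<Omega>)"
    and K: "K \<subseteq> tube \<Omega> \<rho>" "bounded K \<or> (\<forall>r < 2 * \<rho>. bounded_derivs_on (tube \<Omega> r) (signed_dist \<Omega>))"
  obtains M where "M \<ge> 0" "\<And>x z i j. x \<in> K \<Longrightarrow> dist x z \<le> \<rho> / 4 \<Longrightarrow> \<bar>iter_partial [i, j] (signed_dist \<Omega>) z\<bar> \<le> M"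
    "\<And>x z i j k. x \<in> K \<Longrightarrow> dist x z \<le> \<rho> / 4 \<Longrightarrow> \<bar>iter_partial [k, i, j] (signed_dist \<Omega>) z\<bar> \<le> M"
proof -
  let ?d = "signed_dist \<Omega>"
  define L where "L = {z. \<exists>x\<in>K. dist x z \<le> \<rho> / 4}"
  have L: "L \<subseteq> tube \<Omega> (3 / 2 * \<rho>)"
  proof
    fix z assume "z \<in> L"
    then obtain x where x: "x \<in> K" "dist x z \<le> \<rho> / 4" by (auto simp: L_def)
    then have "\<bar>?d x\<bar> < \<rho>" using K by (auto simp: tube_def)
    then show "z \<in> tube \<Omega> (3 / 2 * \<rho>)"
      using signed_dist_lipschitz[OF ne, of x z] x \<rho> by (auto simp: tube_def)
  qed
  have bdd: "bounded (iter_partial is ?d ` L)" for "is"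
    using K(2)
  proof
    assume "bounded K"
    then obtain B where B: "\<And>x. x \<in> K \<Longrightarrow> norm x \<le> B" by (auto simp: bounded_iff)
    let ?C = "cball (0::real^'n) (B + \<rho> / 4) \<inter> {z. \<bar>?d z\<bar> \<le> 3 / 2 * \<rho>}"
    have cd: "continuous_on UNIV ?d"
      using signed_dist_lipschitz[OF ne] by (intro lipschitz_on_continuous_on[of 1] lipschitz_onI) (auto simp: dist_real_def)
    have "compact ?C"
      by (intro compact_Int_closed closed_Collect_le continuous_intros cd) auto
    moreover have "continuous_on ?C (iter_partial is ?d)"
    proof (rule continuous_at_imp_continuous_on, rule ballI)
      fix z assume "z \<in> ?C"
      then have "z \<in> tube \<Omega> (2 * \<rho>)" using \<rho> by (auto simp: tube_def)
      then show "isCont (iter_partial is ?d) z"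
        using smooth_on_iter_partial[OF sm] differentiable_imp_continuous_within by blast
    qed
    ultimately have "bounded (iter_partial is ?d ` ?C)"
      using compact_continuous_image compact_imp_bounded by blast
    moreover have "L \<subseteq> ?C"
    proof
      fix z assume z: "z \<in> L"
      then obtain x where x: "x \<in> K" "dist x z \<le> \<rho> / 4" by (auto simp: L_def)
      then have "norm z \<le> B + \<rho> / 4"
        using B[OF x(1)] norm_triangle_sub[of z x] by (simp add: dist_norm norm_minus_commute)
      then show "z \<in> ?C" using L z by (auto simp: tube_def)
    qed
    ultimately show ?thesis by (meson bounded_subset image_mono)
  next
    assume "\<forall>r < 2 * \<rho>. bounded_derivs_on (tube \<Omega> r) ?d"
    then have "bounded (iter_partial is ?d ` tube \<Omega> (3 / 2 * \<rho>))"
      using \<rho> by (auto simp: bounded_derivs_on_def)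
    then show ?thesis using L by (meson bounded_subset image_mono)
  qed
  have "\<exists>b. \<forall>z\<in>L. \<bar>iter_partial is ?d z\<bar> \<le> b" for "is"
    using bdd[of "is"] by (auto simp: bounded_iff)
  then obtain b where b: "\<And>is z. z \<in> L \<Longrightarrow> \<bar>iter_partial is ?d z\<bar> \<le> b is" by metis
  define M where "M = (\<Sum>i\<in>UNIV. \<Sum>j\<in>UNIV. \<bar>b [i, j]\<bar>) + (\<Sum>k\<in>UNIV. \<Sum>i\<in>UNIV. \<Sum>j\<in>UNIV. \<bar>b [k, i, j]\<bar>)"
  have nn: "0 \<le> (\<Sum>i\<in>UNIV. \<Sum>j\<in>UNIV. \<bar>b [i, j]\<bar>)" "0 \<le> (\<Sum>k\<in>UNIV. \<Sum>i\<in>UNIV. \<Sum>j\<in>UNIV. \<bar>b [k, i, j]\<bar>)"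
    by (intro sum_nonneg; simp)+
  have M2: "b [i, j] \<le> M" for i j
  proof -
    have "b [i, j] \<le> \<bar>b [i, j]\<bar>" by simp
    also have "\<dots> \<le> (\<Sum>j\<in>UNIV. \<bar>b [i, j]\<bar>)" by (rule member_le_sum) auto
    also have "\<dots> \<le> (\<Sum>i\<in>UNIV. \<Sum>j\<in>UNIV. \<bar>b [i, j]\<bar>)" by (rule member_le_sum) (auto intro: sum_nonneg)
    finally show ?thesis using nn by (simp add: M_def)
  qed
  have M3: "b [k, i, j] \<le> M" for k i j
  proof -
    have "b [k, i, j] \<le> \<bar>b [k, i, j]\<bar>" by simp
    also have "\<dots> \<le> (\<Sum>j\<in>UNIV. \<bar>b [k, i, j]\<bar>)" by (rule member_le_sum) auto
    also have "\<dots> \<le> (\<Sum>i\<in>UNIV. \<Sum>j\<in>UNIV. \<bar>b [k, i, j]\<bar>)" by (rule member_le_sum) (auto intro: sum_nonneg)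
    also have "\<dots> \<le> (\<Sum>k\<in>UNIV. \<Sum>i\<in>UNIV. \<Sum>j\<in>UNIV. \<bar>b [k, i, j]\<bar>)" by (rule member_le_sum) (auto intro: sum_nonneg)
    finally show ?thesis using nn by (simp add: M_def)
  qed
  show ?thesis
  proof (rule that[of M])
    show "M \<ge> 0" using nn by (simp add: M_def)
    fix x z assume "x \<in> K" "dist x z \<le> \<rho> / 4"
    then have "z \<in> L" by (auto simp: L_def)
    then show "\<bar>iter_partial [i, j] ?d z\<bar> \<le> M" "\<bar>iter_partial [k, i, j] ?d z\<bar> \<le> M" for i j k
      using b[of z "[i, j]"] b[of z "[k, i, j]"] M2[of i j] M3[of k i j] by linarith+
  qed
qed

section \<open>Level sets and hyperplanes near the origin\<close>

lemma nn_integral_powr_near_0: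
  assumes a: "a < real DIM('a)" and r: "0 < r"
  shows "(\<integral>\<^sup>+y. ennreal (indicator {..<r} (norm y) * norm (y::'a::euclidean_space) powr - a) \<partial>lborel)
    = ennreal (real DIM('a) * unit_ball_vol (real DIM('a)) * r powr (real DIM('a) - a) / (real DIM('a) - a))"
proof -
  let ?n = "real DIM('a)"
  let ?c = "?n * unit_ball_vol ?n"
  have n1: "DIM('a) \<ge> 1" using DIM_positive[where 'a='a] by linarith
  have "(\<integral>\<^sup>+y. ennreal (indicator {..<r} (norm y) * norm (y::'a) powr - a) \<partial>lborel)
    = (\<integral>\<^sup>+t. ennreal (indicator {0<..} t * (?c * t ^ (DIM('a) - 1))) * ennreal (indicator {..<r} t * t powr - a) \<partial>lborel)"
    by (rule nn_integral_radial[where 'a='a, of "\<lambda>t. ennreal (indicator {..<r} t * t powr - a)"]) measurable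
  also have "\<dots> = (\<integral>\<^sup>+t. ennreal (?c * t powr (?n - a - 1)) * indicator {0..r} t \<partial>lborel)"
  proof (intro nn_integral_cong_AE)
    have "AE t in lborel. t \<noteq> 0 \<and> t \<noteq> r" by (auto intro: AE_lborel_singleton)
    then show "AE t in lborel. ennreal (indicator {0<..} t * (?c * t ^ (DIM('a) - 1))) * ennreal (indicator {..<r} t * t powr - a)
      = ennreal (?c * t powr (?n - a - 1)) * indicator {0..r} t"
    proof eventually_elim
      case (elim t)
      show ?case
      proof (cases "0 < t \<and> t < r")
        case True
        have "t ^ (DIM('a) - 1) * t powr - a = t powr (?n - a - 1)"
          using True n1 by (simp add: powr_realpow[symmetric] powr_add[symmetric] of_nat_diff algebra_simps)
        then show ?thesis using True by (simp add: ennreal_mult'[symmetric] mult.assoc)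
      next
        case False
        then show ?thesis using elim by (auto simp: indicator_def)
      qed
    qed
  qed
  also have "\<dots> = ennreal (?c * r powr (?n - a) / (?n - a))"
  proof -
    have "((\<lambda>t. ?c * t powr (?n - a - 1)) has_integral (?c * (r powr (?n - a) / (?n - a)))) {0..r}"
      using has_integral_powr_from_0[of "?n - a - 1" r] a r by (intro has_integral_mult_right) (simp add: algebra_simps)
    from nn_integral_has_integral_lebesgue[OF _ this]
    show ?thesis by (simp add: ennreal_mult'' ennreal_indicator mult.commute)
  qed
  finally show ?thesis .
qed

lemma nn_integral_powr_at_infinity:
  assumes a: "real DIM('a) < a" and r: "0 < r"
  shows "(\<integral>\<^sup>+y. ennreal (indicator {r..} (norm y) * norm (y::'a::euclidean_space) powr - a) \<partial>lborel)
    = ennreal (real DIM('a) * unit_ball_vol (real DIM('a)) * r powr (real DIM('a) - a) / (a - real DIM('a)))"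
proof -
  let ?n = "real DIM('a)"
  let ?c = "?n * unit_ball_vol ?n"
  have n1: "DIM('a) \<ge> 1" using DIM_positive[where 'a='a] by linarith
  have "(\<integral>\<^sup>+y. ennreal (indicator {r..} (norm y) * norm (y::'a) powr - a) \<partial>lborel)
    = (\<integral>\<^sup>+t. ennreal (indicator {0<..} t * (?c * t ^ (DIM('a) - 1))) * ennreal (indicator {r..} t * t powr - a) \<partial>lborel)"
    by (rule nn_integral_radial[where 'a='a, of "\<lambda>t. ennreal (indicator {r..} t * t powr - a)"]) measurable
  also have "\<dots> = (\<integral>\<^sup>+t. ennreal (?c * t powr (?n - a - 1)) * indicator {r..} t \<partial>lborel)"
  proof (intro nn_integral_cong)
    fix t
    show "ennreal (indicator {0<..} t * (?c * t ^ (DIM('a) - 1))) * ennreal (indicator {r..} t * t powr - a)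
      = ennreal (?c * t powr (?n - a - 1)) * indicator {r..} t"
    proof (cases "r \<le> t")
      case True
      then have "t > 0" using r by simp
      then have "t ^ (DIM('a) - 1) * t powr - a = t powr (?n - a - 1)"
        using n1 by (simp add: powr_realpow[symmetric] powr_add[symmetric] of_nat_diff algebra_simps)
      then show ?thesis using True \<open>t > 0\<close> by (simp add: ennreal_mult'[symmetric] mult.assoc)
    qed (auto simp: indicator_def)
  qed
  also have "\<dots> = ennreal (?c * r powr (?n - a) / (a - ?n))"
  proof -
    have "((\<lambda>t. ?c * t powr (?n - a - 1)) has_integral (?c * (- (r powr (?n - a - 1 + 1)) / (?n - a - 1 + 1)))) {r..}"
      using a r by (intro has_integral_mult_right has_integral_powr_to_inf) auto
    moreover have "- (r powr (?n - a - 1 + 1)) / (?n - a - 1 + 1) = r powr (?n - a) / (a - ?n)"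
      using a by (simp add: field_simps)
    ultimately have "((\<lambda>t. ?c * t powr (?n - a - 1)) has_integral (?c * (r powr (?n - a) / (a - ?n)))) {r..}"
      by (simp only:)
    from nn_integral_has_integral_lebesgue[OF _ this]
    show ?thesis by (simp add: ennreal_mult'' ennreal_indicator mult.commute)
  qed
  finally show ?thesis .
qed

lemma nn_integral_lborel_Pair:
  fixes f :: "real \<times> 'b::euclidean_space \<Rightarrow> ennreal"
  assumes [measurable]: "f \<in> borel_measurable borel"
  shows "(\<integral>\<^sup>+p. f p \<partial>lborel) = (\<integral>\<^sup>+y. (\<integral>\<^sup>+t. f (t, y) \<partial>lborel) \<partial>lborel)"
proof -
  have f: "f \<in> borel_measurable (lborel \<Otimes>\<^sub>M lborel)" by (simp add: lborel_prod)
  have "(\<integral>\<^sup>+p. f p \<partial>lborel) = (\<integral>\<^sup>+p. f p \<partial>(lborel \<Otimes>\<^sub>M lborel))" by (simp add: lborel_prod)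
  also have "\<dots> = (\<integral>\<^sup>+y. (\<integral>\<^sup>+t. f (t, y) \<partial>lborel) \<partial>lborel)"
    using f by (rule lborel_pair.nn_integral_snd[symmetric])
  finally show ?thesis .
qed

text \<open>In a product \<open>\<real> \<times> 'b\<close>, where the first coordinate is the direction of the gradient, suppose that the sets
\<open>\<tau> < D p\<close> and \<open>\<tau> < fst p\<close> disagree at \<open>p = (t, y)\<close> and \<open>D p\<close> differs from \<open>t\<close> quadratically. Then \<open>t\<close> is so close to
\<open>\<tau>\<close> that the norms of \<open>(t, y)\<close> and \<open>(\<tau>, y)\<close> are comparable. This allows the kernel
to be evaluated at \<open>(\<tau>, y)\<close> instead.\<close>

lemma disagreement_window:
  fixes t :: real and y :: "'b::euclidean_space"
  assumes K: "0 \<le> K" "K * \<sigma> \<le> 1 / 8" and p: "norm (t, y) \<le> \<sigma>"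
    and dis: "\<bar>t - \<tau>\<bar> \<le> K * (norm (t, y))\<^sup>2"
  shows "\<bar>t - \<tau>\<bar> \<le> norm (\<tau>, y) / 7" "norm (t, y) \<le> 8 / 7 * norm (\<tau>, y)" "6 / 7 * norm (\<tau>, y) \<le> norm (t, y)"
    "\<bar>t - \<tau>\<bar> \<le> 2 * K * (norm (\<tau>, y))\<^sup>2"
proof -
  let ?w = "norm (\<tau>, y)" and ?n = "norm (t, y)"
  have diff: "norm ((t, y) - (\<tau>, y)) = \<bar>t - \<tau>\<bar>" by (simp add: norm_Pair)
  have n: "?n \<le> ?w + \<bar>t - \<tau>\<bar>" "?w \<le> ?n + \<bar>t - \<tau>\<bar>"
    using norm_triangle_sub[of "(t, y)" "(\<tau>, y)"] norm_triangle_sub[of "(\<tau>, y)" "(t, y)"] diff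
    by (simp_all add: norm_minus_commute)
  have "K * ?n\<^sup>2 = (K * ?n) * ?n" by (simp add: power2_eq_square)
  also have "\<dots> \<le> 1 / 8 * ?n"
  proof (rule mult_right_mono)
    have "K * ?n \<le> K * \<sigma>" using K p by (intro mult_left_mono) auto
    then show "K * ?n \<le> 1 / 8" using K by simp
  qed simp
  finally have 1: "\<bar>t - \<tau>\<bar> \<le> 1 / 8 * ?n" using dis by simp
  show w: "\<bar>t - \<tau>\<bar> \<le> ?w / 7" using 1 n by simp
  show nw: "?n \<le> 8 / 7 * ?w" using w n by simp
  show "6 / 7 * ?w \<le> ?n" using w n by simp
  have "K * ?n\<^sup>2 \<le> K * (8 / 7 * ?w)\<^sup>2" using K nw by (intro mult_left_mono power_mono) auto
  also have "\<dots> = 64 / 49 * (K * ?w\<^sup>2)" by (simp add: power2_eq_square)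
  also have "\<dots> \<le> 2 * (K * ?w\<^sup>2)" using K by (intro mult_right_mono) auto
  finally show "\<bar>t - \<tau>\<bar> \<le> 2 * K * ?w\<^sup>2" using dis by simp
qed

text \<open>On the line over \<open>y\<close> the two sets disagree in an interval of length of order \<open>w\<^sup>2\<close>, \<open>w = norm (\<tau>, y)\<close>, on which the
kernel is of order \<open>w powr - P\<close>. As \<open>norm y \<le> w\<close>, the mass is at most of the order of the
integral of \<open>norm y powr - (P - 2)\<close> over a ball of the hyperplane.\<close>

lemma symdiff_mass_near_0:
  fixes D :: "real \<times> 'b::euclidean_space \<Rightarrow> real"
  assumes [measurable]: "D \<in> borel_measurable borel"
    and K: "0 \<le> K" "K * r \<le> 1 / 8" and D: "\<And>p. \<bar>D p - fst p\<bar> \<le> K * (norm p)\<^sup>2"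
    and P: "2 \<le> P" "P - 2 < real DIM('b)" and r: "0 < r"
  shows "(\<integral>\<^sup>+p. ennreal (indicator {p. norm p < r \<and> (\<tau> < D p) \<noteq> (\<tau> < fst p)} p * norm p powr - P) \<partial>lborel)
    \<le> ennreal (4 * K * (6 / 7) powr - P * (real DIM('b) * unit_ball_vol (real DIM('b))
        * r powr (real DIM('b) - (P - 2)) / (real DIM('b) - (P - 2))))"
proof -
  let ?S = "{p. norm p < r \<and> (\<tau> < D p) \<noteq> (\<tau> < fst p)}"
  let ?c = "4 * K * (6 / 7) powr - P"
  have slice: "(\<integral>\<^sup>+t. ennreal (indicator ?S (t, y) * norm (t, y) powr - P) \<partial>lborel)
      \<le> ennreal ?c * ennreal (indicator {..<r} (norm y) * norm y powr - (P - 2))" if y: "y \<noteq> 0" for y :: 'b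
  proof (cases "norm y < r")
    case False
    then have "(t, y) \<notin> ?S" for t
      using norm_snd_le[of y t] by simp
    then show ?thesis by simp
  next
    case True
    let ?w = "norm (\<tau>, y)"
    have w: "norm y \<le> ?w" by (rule norm_snd_le)
    then have w0: "0 < ?w" using y by (meson zero_less_norm_iff less_le_trans)
    have pt: "ennreal (indicator ?S (t, y) * norm (t, y) powr - P)
      \<le> ennreal ((6 / 7 * ?w) powr - P) * indicator {\<tau> - 2 * K * ?w\<^sup>2..\<tau> + 2 * K * ?w\<^sup>2} t" for t
    proof (cases "(t, y) \<in> ?S")
      case True
      then have n: "norm (t, y) < r" and ne: "(\<tau> < D (t, y)) \<noteq> (\<tau> < t)" by auto
      have "\<bar>t - \<tau>\<bar> \<le> K * (norm (t, y))\<^sup>2" using D[of "(t, y)"] ne by auto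
      note W = disagreement_window[OF K less_imp_le[OF n] this]
      have "norm (t, y) powr - P \<le> (6 / 7 * ?w) powr - P"
        using W(3) w0 P by (intro powr_mono2') auto
      moreover have "t \<in> {\<tau> - 2 * K * ?w\<^sup>2..\<tau> + 2 * K * ?w\<^sup>2}" using W(4) by (auto simp: abs_le_iff)
      ultimately show ?thesis using True by (simp add: ennreal_leI)
    qed simp
    have "(\<integral>\<^sup>+t. ennreal (indicator ?S (t, y) * norm (t, y) powr - P) \<partial>lborel)
      \<le> (\<integral>\<^sup>+t. ennreal ((6 / 7 * ?w) powr - P) * indicator {\<tau> - 2 * K * ?w\<^sup>2..\<tau> + 2 * K * ?w\<^sup>2} t \<partial>lborel)"
      by (intro nn_integral_mono pt)
    also have "\<dots> = ennreal ((6 / 7 * ?w) powr - P) * ennreal (4 * K * ?w\<^sup>2)"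
      using K by (subst nn_integral_cmult_indicator) (auto simp: mult.assoc)
    also have "\<dots> = ennreal ((6 / 7 * ?w) powr - P * (4 * K * ?w\<^sup>2))" by (simp add: ennreal_mult')
    also have "(6 / 7 * ?w) powr - P * (4 * K * ?w\<^sup>2) = ?c * ?w powr - (P - 2)"
    proof -
      have "(6 / 7 * ?w) powr - P = (6 / 7) powr - P * ?w powr - P"
        by (rule powr_mult)
      moreover have "?w powr - P * ?w\<^sup>2 = ?w powr - (P - 2)"
      proof -
        have "?w\<^sup>2 = ?w powr 2" using w0 by simp
        then have "?w powr - P * ?w\<^sup>2 = ?w powr (- P + 2)" by (simp only: powr_add)
        then show ?thesis by simp
      qed
      ultimately show ?thesis by (simp add: mult_ac)
    qed
    also have "ennreal (?c * ?w powr - (P - 2)) \<le> ennreal (?c * norm y powr - (P - 2))"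
      using w y P K by (intro ennreal_leI mult_left_mono powr_mono2') auto
    also have "\<dots> = ennreal ?c * ennreal (indicator {..<r} (norm y) * norm y powr - (P - 2))"
      using True K by (simp add: ennreal_mult')
    finally show ?thesis .
  qed
  have n: "(norm :: real \<times> 'b \<Rightarrow> real) \<in> borel_measurable borel" "(fst :: real \<times> 'b \<Rightarrow> real) \<in> borel_measurable borel"
    by (intro borel_measurable_continuous_onI continuous_intros)+
  have [measurable]: "(\<lambda>p::real \<times> 'b. norm p powr - P) \<in> borel_measurable borel"
    by (rule measurable_compose[OF n(1)]) measurable
  have [measurable]: "?S \<in> sets borel"
  proof -
    note n[measurable]
    show ?thesis by measurable
  qed
  have kS: "(\<lambda>p. indicator ?S p * norm p powr - P :: real) \<in> borel_measurable borel" by measurable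
  have "(\<integral>\<^sup>+p. ennreal (indicator ?S p * norm p powr - P) \<partial>lborel)
    = (\<integral>\<^sup>+y. (\<integral>\<^sup>+t. ennreal (indicator ?S (t, y) * norm (t, y) powr - P) \<partial>lborel) \<partial>lborel)"
    by (rule nn_integral_lborel_Pair) (rule measurable_compose[OF kS measurable_ennreal])
  also have "\<dots> \<le> (\<integral>\<^sup>+y. ennreal ?c * ennreal (indicator {..<r} (norm (y::'b)) * norm y powr - (P - 2)) \<partial>lborel)"
    by (intro nn_integral_mono_AE eventually_mono[OF AE_lborel_singleton[of 0]]) (rule slice)
  also have "\<dots> = ennreal ?c * (\<integral>\<^sup>+y. ennreal (indicator {..<r} (norm (y::'b)) * norm y powr - (P - 2)) \<partial>lborel)"
    by (rule nn_integral_cmult) measurable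
  also have "\<dots> = ennreal ?c * ennreal (real DIM('b) * unit_ball_vol (real DIM('b))
        * r powr (real DIM('b) - (P - 2)) / (real DIM('b) - (P - 2)))"
    using P r by (subst nn_integral_powr_near_0) auto
  also have "\<dots> = ennreal (?c * (real DIM('b) * unit_ball_vol (real DIM('b))
        * r powr (real DIM('b) - (P - 2)) / (real DIM('b) - (P - 2))))"
    using K by (intro ennreal_mult'[symmetric]) auto
  finally show ?thesis .
qed

lemma measurable_prod_norm_fst_snd:
  "(norm :: real \<times> 'b::euclidean_space \<Rightarrow> real) \<in> borel_measurable borel"
  "(fst :: real \<times> 'b::euclidean_space \<Rightarrow> real) \<in> borel_measurable borel"
  "(snd :: real \<times> 'b::euclidean_space \<Rightarrow> 'b) \<in> borel_measurable borel"
  "(\<lambda>p :: real \<times> 'b::euclidean_space. norm p powr a) \<in> borel_measurable borel"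
proof -
  show n: "(norm :: real \<times> 'b::euclidean_space \<Rightarrow> real) \<in> borel_measurable borel"
    "(fst :: real \<times> 'b::euclidean_space \<Rightarrow> real) \<in> borel_measurable borel"
    "(snd :: real \<times> 'b::euclidean_space \<Rightarrow> 'b) \<in> borel_measurable borel"
    by (intro borel_measurable_continuous_onI continuous_intros)+
  show "(\<lambda>p :: real \<times> 'b::euclidean_space. norm p powr a) \<in> borel_measurable borel"
    by (rule measurable_compose[OF n(1)]) measurable
qed

lemma powr_minus_lipschitz:
  fixes u v c P :: real
  assumes "0 < c" "c \<le> u" "c \<le> v" "0 \<le> P"
  shows "\<bar>u powr - P - v powr - P\<bar> \<le> P * c powr (- P - 1) * \<bar>u - v\<bar>"
proof -
  have main: "\<bar>u powr - P - v powr - P\<bar> \<le> P * c powr (- P - 1) * \<bar>u - v\<bar>" if uv: "c \<le> u" "u < v" for u v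
  proof -
    have "\<exists>z>u. z < v \<and> v powr - P - u powr - P = (v - u) * (- P * z powr (- P - 1))"
      using uv assms(1) by (intro MVT2) (auto intro!: derivative_eq_intros)
    then obtain z where z: "u < z" "z < v" "v powr - P - u powr - P = (v - u) * (- P * z powr (- P - 1))" by auto
    have "z powr (- P - 1) \<le> c powr (- P - 1)" using z uv assms by (intro powr_mono2') auto
    then have "(v - u) * (P * z powr (- P - 1)) \<le> (v - u) * (P * c powr (- P - 1))"
      using uv assms by (intro mult_left_mono) auto
    moreover have "0 \<le> (v - u) * (P * z powr (- P - 1))" using uv assms by simp
    moreover have "u powr - P - v powr - P = (v - u) * (P * z powr (- P - 1))" using z(3) by simp
    ultimately show ?thesis using uv by (simp add: mult_ac)
  qed
  show ?thesis
  proof (cases u v rule: linorder_cases)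
    case less then show ?thesis using main[of u v] assms by simp
  next
    case greater then show ?thesis using main[of v u] assms by (simp add: abs_minus_commute)
  qed simp
qed

lemma integral_shifted_halfline:
  fixes q \<tau> :: real
  shows "integrable lborel (\<lambda>t. indicator {t. \<tau> < t + q} t - indicator {\<tau><..} t :: real)"
    and "(LINT t|lborel. indicator {t. \<tau> < t + q} t - indicator {\<tau><..} t) = q"
proof -
  have "has_bochner_integral lborel (\<lambda>t. indicator {t. \<tau> < t + q} t - indicator {\<tau><..} t) q"
  proof (cases "q \<ge> 0")
    case True
    have "has_bochner_integral lborel (indicator {\<tau> - q<..\<tau>}) (measure lborel {\<tau> - q<..\<tau>})"
      using True by (intro has_bochner_integral_real_indicator) auto
    moreover have "(\<lambda>t. indicator {t. \<tau> < t + q} t - indicator {\<tau><..} t) = (indicator {\<tau> - q<..\<tau>} :: real \<Rightarrow> real)"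
      using True by (auto simp: indicator_def fun_eq_iff)
    ultimately show ?thesis using True by simp
  next
    case False
    have "has_bochner_integral lborel (indicator {\<tau><..\<tau> - q}) (measure lborel {\<tau><..\<tau> - q})"
      using False by (intro has_bochner_integral_real_indicator) auto
    then have "has_bochner_integral lborel (\<lambda>t. - indicator {\<tau><..\<tau> - q} t) (- measure lborel {\<tau><..\<tau> - q})"
      by (rule has_bochner_integral_minus)
    moreover have "(\<lambda>t. indicator {t. \<tau> < t + q} t - indicator {\<tau><..} t) = (\<lambda>t. - indicator {\<tau><..\<tau> - q} t :: real)"
      using False by (auto simp: indicator_def fun_eq_iff)
    ultimately show ?thesis using False by simp
  qed
  then show "integrable lborel (\<lambda>t. indicator {t. \<tau> < t + q} t - indicator {\<tau><..} t :: real)"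
    and "(LINT t|lborel. indicator {t. \<tau> < t + q} t - indicator {\<tau><..} t) = q"
    by (auto simp: has_bochner_integral_iff)
qed

lemma nn_integral_shifted_halfline:
  fixes q \<tau> :: real
  shows "(\<integral>\<^sup>+t. ennreal \<bar>indicator {t. \<tau> < t + q} t - indicator {\<tau><..} t\<bar> \<partial>lborel) = ennreal \<bar>q\<bar>"
proof -
  have "(\<integral>\<^sup>+t. ennreal \<bar>indicator {t. \<tau> < t + q} t - indicator {\<tau><..} t\<bar> \<partial>lborel)
    = (\<integral>\<^sup>+t. indicator (if q \<ge> 0 then {\<tau> - q<..\<tau>} else {\<tau><..\<tau> - q}) t \<partial>lborel)"
    by (intro nn_integral_cong) (auto simp: indicator_def)
  then show ?thesis by (auto simp: abs_if)
qed

text \<open>On the line over \<open>y\<close>, the superlevel set of \<open>D\<close> is compared with the half-line that begins at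
\<open>\<tau> - q\<close>, where \<open>q\<close> is half the quadratic form at \<open>(\<tau>, y)\<close>. There are two errors: the set \<open>D > \<tau>\<close> differs from that half-line
only where \<open>t + q\<close> is within a cubic distance of \<open>\<tau>\<close>, and replacing the kernel at \<open>(t, y)\<close> by the kernel at \<open>(\<tau>, y)\<close> costs
its Lipschitz constant times the length of the window that contains all disagreements.\<close>

lemma second_order_pointwise:
  fixes D :: "real \<times> 'b::euclidean_space \<Rightarrow> real" and y :: 'b
  assumes K: "0 \<le> K" "K * r \<le> 1 / 64" and M: "0 \<le> M" and r: "0 < r"
    and D1: "\<And>p. \<bar>D p - fst p\<bar> \<le> K * (norm p)\<^sup>2"
    and D2: "\<And>p. norm p \<le> 2 * r \<Longrightarrow> \<bar>D p - fst p - B p p / 2\<bar> \<le> M * norm p ^ 3"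
    and B: "bilinear B" "\<And>p q. \<bar>B p q\<bar> \<le> 2 * K * norm p * norm q"
    and \<tau>: "\<tau> \<noteq> 0" "\<bar>\<tau>\<bar> \<le> r / 4" and P: "0 \<le> P" and y: "norm y < r"
  defines "w \<equiv> norm (\<tau>, y)" and "q \<equiv> B (\<tau>, y) (\<tau>, y) / 2"
  shows "\<bar>indicator {t. \<bar>t\<bar> < r} t * (indicator {t. \<tau> < D (t, y)} t - indicator {\<tau><..} t) * norm (t, y) powr - P
       - (indicator {t. \<tau> < t + q} t - indicator {\<tau><..} t) * w powr - P\<bar>
    \<le> indicator {t. \<bar>t + q - \<tau>\<bar> \<le> (2 * M + 5 * K\<^sup>2) * w ^ 3} t * (6 / 7 * w) powr - P
      + indicator {t. \<bar>t - \<tau>\<bar> \<le> 2 * K * w\<^sup>2} t * (P * (6 / 7 * w) powr (- P - 1) * (2 * K * w\<^sup>2))"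
    (is "\<bar>?F - ?G\<bar> \<le> ?H1 + ?H2")
proof -
  have w0: "w > 0" using \<tau> by (auto simp: w_def zero_prod_def)
  have wr: "w \<le> 5 / 4 * r"
    using norm_Pair_le[of \<tau> y] \<tau> y by (simp add: w_def)
  have Kw: "2 * K * w\<^sup>2 \<le> w / 7" "2 * K * w\<^sup>2 \<le> r / 4"
  proof -
    have "K * w \<le> K * (5 / 4 * r)" using wr K by (intro mult_left_mono) auto
    also have "\<dots> \<le> 5 / 256" using K by simp
    finally have "2 * (K * w) * w \<le> 2 * (5 / 256) * w" using w0 by (intro mult_right_mono mult_left_mono) auto
    then show "2 * K * w\<^sup>2 \<le> w / 7" using w0 by (simp add: power2_eq_square mult.assoc)
    then show "2 * K * w\<^sup>2 \<le> r / 4" using wr r by simp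
  qed
  have Kw0: "0 \<le> K * w\<^sup>2" using K by simp
  have q: "\<bar>q\<bar> \<le> K * w\<^sup>2"
    using B(2)[of "(\<tau>, y)" "(\<tau>, y)"] by (simp add: q_def w_def power2_eq_square mult.assoc)
  have H0: "0 \<le> ?H1" "0 \<le> ?H2" using P K by (auto simp: indicator_def)
  show ?thesis
  proof (cases "\<bar>t - \<tau>\<bar> \<le> 2 * K * w\<^sup>2")
    case True
    have diff: "(t, y) - (\<tau>, y) = (t - \<tau>, 0)" by simp
    have nd: "norm (t - \<tau>, 0::'b) = \<bar>t - \<tau>\<bar>" by (simp add: norm_Pair)
    have nw: "\<bar>norm (t, y) - w\<bar> \<le> \<bar>t - \<tau>\<bar>"
      using norm_triangle_ineq3[of "(t, y)" "(\<tau>, y)"] diff nd by (simp add: w_def)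
    have n: "norm (t, y) \<le> 8 / 7 * w" "6 / 7 * w \<le> norm (t, y)" using nw True Kw by linarith+
    have t: "\<bar>t\<bar> < r" using True Kw \<tau> r by linarith
    have n2: "norm (t, y) \<le> 2 * r" using n wr r by linarith
    have Dq: "\<bar>D (t, y) - (t + q)\<bar> \<le> (2 * M + 5 * K\<^sup>2) * w ^ 3"
    proof -
      have "\<bar>D (t, y) - t - B (t, y) (t, y) / 2\<bar> \<le> M * norm (t, y) ^ 3" using D2[OF n2] by simp
      also have "\<dots> \<le> M * (8 / 7 * w) ^ 3" using n M by (intro mult_left_mono power_mono) auto
      also have "\<dots> \<le> 2 * M * w ^ 3"
      proof -
        have "(8 / 7 * w) ^ 3 \<le> 2 * w ^ 3" using w0 by (simp add: power_mult_distrib power3_eq_cube)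
        then show ?thesis using M by (metis mult.assoc mult.commute mult_left_mono)
      qed
      finally have 1: "\<bar>D (t, y) - t - B (t, y) (t, y) / 2\<bar> \<le> 2 * M * w ^ 3" .
      have "B (t, y) (t, y) - B (\<tau>, y) (\<tau>, y) = B (t - \<tau>, 0) (t, y) + B (\<tau>, y) (t - \<tau>, 0)"
      proof -
        have "B (t - \<tau>, 0) (t, y) = B (t, y) (t, y) - B (\<tau>, y) (t, y)"
          using bilinear_lsub[OF B(1), of "(t, y)" "(\<tau>, y)" "(t, y)"] by simp
        moreover have "B (\<tau>, y) (t - \<tau>, 0) = B (\<tau>, y) (t, y) - B (\<tau>, y) (\<tau>, y)"
          using bilinear_rsub[OF B(1), of "(\<tau>, y)" "(t, y)" "(\<tau>, y)"] by simp
        ultimately show ?thesis by simp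
      qed
      also have "\<bar>\<dots>\<bar> \<le> 2 * K * \<bar>t - \<tau>\<bar> * norm (t, y) + 2 * K * w * \<bar>t - \<tau>\<bar>"
        using B(2)[of "(t - \<tau>, 0)" "(t, y)"] B(2)[of "(\<tau>, y)" "(t - \<tau>, 0)"] nd
        by (simp add: w_def)
      also have "\<dots> \<le> 2 * K * (2 * K * w\<^sup>2) * (8 / 7 * w) + 2 * K * w * (2 * K * w\<^sup>2)"
        using True n K w0 by (intro add_mono mult_mono) auto
      also have "\<dots> = (60 / 7) * (K\<^sup>2 * w ^ 3)" by (simp add: power2_eq_square power3_eq_cube algebra_simps)
      also have "\<dots> \<le> 10 * (K\<^sup>2 * w ^ 3)" using w0 by (intro mult_right_mono) auto
      finally have "\<bar>B (t, y) (t, y) / 2 - q\<bar> \<le> 5 * K\<^sup>2 * w ^ 3" by (simp add: q_def)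
      with 1 show ?thesis by (simp add: distrib_right abs_le_iff)
    qed
    have kp: "norm (t, y) powr - P \<le> (6 / 7 * w) powr - P"
      using n w0 P by (intro powr_mono2') auto
    have kd: "\<bar>norm (t, y) powr - P - w powr - P\<bar> \<le> P * (6 / 7 * w) powr (- P - 1) * (2 * K * w\<^sup>2)"
    proof -
      have "\<bar>norm (t, y) powr - P - w powr - P\<bar> \<le> P * (6 / 7 * w) powr (- P - 1) * \<bar>norm (t, y) - w\<bar>"
        using n w0 P by (intro powr_minus_lipschitz) auto
      also have "\<dots> \<le> P * (6 / 7 * w) powr (- P - 1) * (2 * K * w\<^sup>2)"
        using nw True P by (intro mult_left_mono) auto
      finally show ?thesis .
    qed
    let ?a = "indicator {t. \<tau> < D (t, y)} t :: real"
    let ?b = "indicator {t. \<tau> < t + q} t :: real"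
    let ?c = "indicator {\<tau><..} t :: real"
    have "?F - ?G = (?a - ?b) * norm (t, y) powr - P + (?b - ?c) * (norm (t, y) powr - P - w powr - P)"
      using t by (simp add: algebra_simps)
    moreover have "\<bar>(?a - ?b) * norm (t, y) powr - P\<bar> \<le> ?H1"
    proof (cases "\<tau> < D (t, y) \<longleftrightarrow> \<tau> < t + q")
      case False
      then have "\<bar>t + q - \<tau>\<bar> \<le> (2 * M + 5 * K\<^sup>2) * w ^ 3" using Dq by (auto simp: abs_le_iff)
      then show ?thesis using kp False by (auto simp: indicator_def)
    qed (use H0 in \<open>auto simp: indicator_def\<close>)
    moreover have "\<bar>(?b - ?c) * (norm (t, y) powr - P - w powr - P)\<bar> \<le> ?H2"
    proof -
      have "\<bar>?b - ?c\<bar> \<le> 1" by (auto simp: indicator_def)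
      then have "\<bar>?b - ?c\<bar> * \<bar>norm (t, y) powr - P - w powr - P\<bar> \<le> 1 * (P * (6 / 7 * w) powr (- P - 1) * (2 * K * w\<^sup>2))"
        using kd by (intro mult_mono) auto
      then show ?thesis using True by (simp add: abs_mult)
    qed
    ultimately show ?thesis by linarith
  next
    case False
    have F0: "?F = 0"
    proof (cases "\<bar>t\<bar> < r \<and> (\<tau> < D (t, y)) \<noteq> (\<tau> < t)")
      case True
      then have "\<bar>t - \<tau>\<bar> \<le> \<bar>D (t, y) - fst (t, y)\<bar>" by auto
      then have 1: "\<bar>t - \<tau>\<bar> \<le> K * (norm (t, y))\<^sup>2" using D1[of "(t, y)"] by linarith
      have "norm (t, y) \<le> 2 * r" using norm_Pair_le[of t y] True y by simp
      then have "\<bar>t - \<tau>\<bar> \<le> 2 * K * w\<^sup>2"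
        unfolding w_def using K by (intro disagreement_window(4)[OF _ _ _ 1, of "2 * r"]) auto
      with False show ?thesis by simp
    qed (auto simp: indicator_def)
    have G0: "?G = 0" using q False Kw0 by (auto simp: indicator_def abs_le_iff)
    show ?thesis unfolding F0 G0 using H0 by simp
  qed
qed

lemma nn_integral_two_windows:
  fixes a1 a2 c1 c2 u v :: real
  assumes "0 \<le> a1" "0 \<le> a2" "0 \<le> c1" "0 \<le> c2"
  shows "(\<integral>\<^sup>+t. ennreal a1 * indicator {u - c1..u + c1} t + ennreal a2 * indicator {v - c2..v + c2} t \<partial>lborel)
    = ennreal (a1 * (2 * c1) + a2 * (2 * c2))"
  using assms
  by (subst nn_integral_add) (auto simp: nn_integral_cmult_indicator ennreal_mult ennreal_plus)

text \<open>Integrating the pointwise estimate over \<open>t\<close> leaves errors of order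
\<open>norm y powr (3 - P)\<close>, which is integrable near the origin of \<open>'b\<close>. The bound is uniform in \<open>\<tau>\<close> because the
norm of \<open>(\<tau>, y)\<close> is at least that of \<open>y\<close>.\<close>

lemma level_set_second_order:
  fixes K M r P :: real
  assumes K: "0 \<le> K" "K * r \<le> 1 / 64" and M: "0 \<le> M" and r: "0 < r"
    and P: "3 \<le> P" "P - 3 < real DIM('b::euclidean_space)" "1 + real DIM('b) < P"
  shows "\<exists>C. \<forall>(D :: real \<times> 'b \<Rightarrow> real) B \<tau>.
    D \<in> borel_measurable borel \<longrightarrow> (\<forall>p. \<bar>D p - fst p\<bar> \<le> K * (norm p)\<^sup>2) \<longrightarrow>
    (\<forall>p. norm p \<le> 2 * r \<longrightarrow> \<bar>D p - fst p - B p p / 2\<bar> \<le> M * norm p ^ 3) \<longrightarrow>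
    bilinear B \<longrightarrow> (\<forall>p q. \<bar>B p q\<bar> \<le> 2 * K * norm p * norm q) \<longrightarrow> \<tau> \<noteq> 0 \<longrightarrow> \<bar>\<tau>\<bar> \<le> r / 4 \<longrightarrow>
    integrable lborel (\<lambda>p. (indicator {p. \<tau> < D p} p - indicator {p. \<tau> < fst p} p) * norm p powr - P) \<and>
    \<bar>(LINT p|lborel. (indicator {p. \<tau> < D p} p - indicator {p. \<tau> < fst p} p) * norm p powr - P)
     - (LINT y|lborel. indicator {..<r} (norm (y::'b)) * (B (\<tau>, y) (\<tau>, y) / 2 * norm (\<tau>, y) powr - P))\<bar> \<le> C"
proof -
  define C2 where "C2 = 2 * (2 * M + 5 * K\<^sup>2) * (6 / 7) powr - P + 8 * K\<^sup>2 * P * (6 / 7) powr (- P - 1)"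
  define V where "V = real DIM('b) * unit_ball_vol (real DIM('b)) * r powr (real DIM('b) - (P - 3)) / (real DIM('b) - (P - 3))"
  define T where "T = real DIM(real \<times> 'b) * unit_ball_vol (real DIM(real \<times> 'b)) * r powr (real DIM(real \<times> 'b) - P) / (P - real DIM(real \<times> 'b))"
  have C20: "C2 \<ge> 0" using M P by (simp add: C2_def)
  have V0: "V \<ge> 0" using P by (simp add: V_def)
  have T0: "T \<ge> 0" using P by (simp add: T_def)
  note [measurable] = measurable_prod_norm_fst_snd[where 'b='b]
  show ?thesis
  proof (rule exI[of _ "C2 * V + T"], intro allI impI)
    fix D :: "real \<times> 'b \<Rightarrow> real" and B :: "real \<times> 'b \<Rightarrow> real \<times> 'b \<Rightarrow> real" and \<tau> :: real
    assume D[measurable]: "D \<in> borel_measurable borel"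
      and D1: "\<forall>p. \<bar>D p - fst p\<bar> \<le> K * (norm p)\<^sup>2"
      and D2: "\<forall>p. norm p \<le> 2 * r \<longrightarrow> \<bar>D p - fst p - B p p / 2\<bar> \<le> M * norm p ^ 3"
      and B: "bilinear B" "\<forall>p q. \<bar>B p q\<bar> \<le> 2 * K * norm p * norm q"
      and \<tau>: "\<tau> \<noteq> 0" "\<bar>\<tau>\<bar> \<le> r / 4"
    define w where "w y = norm (\<tau>, y)" for y :: 'b
    define q where "q y = B (\<tau>, y) (\<tau>, y) / 2" for y
    have w0: "w y > 0" for y using \<tau> by (auto simp: w_def zero_prod_def)
    have wy: "norm y \<le> w y" "\<bar>\<tau>\<bar> \<le> w y" for y
      using norm_snd_le[of y \<tau>] norm_fst_le[of \<tau> y] by (auto simp: w_def)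
    have cw: "continuous_on UNIV w" unfolding w_def by (intro continuous_intros)
    have cq: "continuous_on UNIV q" unfolding q_def
      by (intro continuous_intros bilinear_continuous_on_compose[OF _ _ B(1)]) auto
    have [measurable]: "w \<in> borel_measurable borel" "q \<in> borel_measurable borel"
      using cw cq by (auto intro: borel_measurable_continuous_onI)
    have [measurable]: "(\<lambda>p::real \<times> 'b. w (snd p)) \<in> borel_measurable borel" "(\<lambda>p::real \<times> 'b. q (snd p)) \<in> borel_measurable borel"
      by (rule measurable_compose[OF measurable_prod_norm_fst_snd(3)], measurable)+
    have [measurable]: "(\<lambda>p::real \<times> 'b. norm (snd p)) \<in> borel_measurable borel"
      by (rule measurable_compose[OF measurable_prod_norm_fst_snd(3)], measurable)
    have qK: "\<bar>q y\<bar> \<le> K * (w y)\<^sup>2" for y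
      using B(2)[rule_format, of "(\<tau>, y)" "(\<tau>, y)"] by (simp add: q_def w_def power2_eq_square mult.assoc)
    \<comment> \<open>\<open>f\<close> is the integrand, \<open>F\<close> its restriction to the cylinder over the ball of radius \<open>r\<close>, \<open>G\<close> the integrand with the
half-line shifted by \<open>q\<close> and the kernel frozen, \<open>H\<close> the bound for their difference.\<close>
    define f where "f p = (indicator {p. \<tau> < D p} p - indicator {p. \<tau> < fst p} p) * norm p powr - P" for p
    define F where "F p = indicator {p. norm (snd p) < r \<and> \<bar>fst p\<bar> < r} p * f p" for p
    define G where "G p = indicator {p. norm (snd p) < r} p
      * ((indicator {p. \<tau> < fst p + q (snd p)} p - indicator {p. \<tau> < fst p} p) * w (snd p) powr - P)" for p
    define H where "H p = indicator {p. norm (snd p) < r} p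
      * (indicator {p. \<bar>fst p + q (snd p) - \<tau>\<bar> \<le> (2 * M + 5 * K\<^sup>2) * w (snd p) ^ 3} p * (6 / 7 * w (snd p)) powr - P
        + indicator {p. \<bar>fst p - \<tau>\<bar> \<le> 2 * K * (w (snd p))\<^sup>2} p * (P * (6 / 7 * w (snd p)) powr (- P - 1) * (2 * K * (w (snd p))\<^sup>2)))" for p
    have fm: "f \<in> borel_measurable borel" and Fm: "F \<in> borel_measurable borel"
      and Gm: "G \<in> borel_measurable borel" and Hm: "H \<in> borel_measurable borel"
      unfolding f_def F_def G_def H_def by measurable
    have H0: "0 \<le> H p" for p unfolding H_def using P K by (auto simp: indicator_def)
    have FGH: "\<bar>F p - G p\<bar> \<le> H p" for p
    proof (cases "norm (snd p) < r")
      case True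
      obtain t y where p: "p = (t, y)" by (cases p)
      have y: "norm y < r" using True p by simp
      have "\<bar>indicator {t. \<bar>t\<bar> < r} t * (indicator {t. \<tau> < D (t, y)} t - indicator {\<tau><..} t) * norm (t, y) powr - P
           - (indicator {t. \<tau> < t + B (\<tau>, y) (\<tau>, y) / 2} t - indicator {\<tau><..} t) * norm (\<tau>, y) powr - P\<bar>
        \<le> indicator {t. \<bar>t + B (\<tau>, y) (\<tau>, y) / 2 - \<tau>\<bar> \<le> (2 * M + 5 * K\<^sup>2) * norm (\<tau>, y) ^ 3} t * (6 / 7 * norm (\<tau>, y)) powr - P
          + indicator {t. \<bar>t - \<tau>\<bar> \<le> 2 * K * (norm (\<tau>, y))\<^sup>2} t * (P * (6 / 7 * norm (\<tau>, y)) powr (- P - 1) * (2 * K * (norm (\<tau>, y))\<^sup>2))"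
        using K M r D1 D2 B \<tau> P y by (intro second_order_pointwise[where B=B]) auto
      then show ?thesis
        using y unfolding p F_def f_def G_def H_def w_def q_def by (simp add: indicator_def)
    next
      case False
      then show ?thesis by (simp add: F_def G_def H_def)
    qed
    have Hint: "(\<integral>\<^sup>+p. ennreal (H p) \<partial>lborel) \<le> ennreal (C2 * V)"
    proof -
      have slice: "(\<integral>\<^sup>+t. ennreal (H (t, y)) \<partial>lborel) \<le> ennreal C2 * ennreal (indicator {..<r} (norm y) * norm y powr - (P - 3))"
        if y: "y \<noteq> 0" for y
      proof (cases "norm y < r")
        case True
        let ?w = "w y"
        let ?c1 = "(2 * M + 5 * K\<^sup>2) * ?w ^ 3" and ?a1 = "(6 / 7 * ?w) powr - P"
        let ?c2 = "2 * K * ?w\<^sup>2" and ?a2 = "P * (6 / 7 * ?w) powr (- P - 1) * (2 * K * ?w\<^sup>2)"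
        have c: "?c1 \<ge> 0" "?c2 \<ge> 0" "?a1 \<ge> 0" "?a2 \<ge> 0" using K M P w0[of y] by auto
        have "(\<integral>\<^sup>+t. ennreal (H (t, y)) \<partial>lborel)
          = (\<integral>\<^sup>+t. ennreal ?a1 * indicator {\<tau> - q y - ?c1..\<tau> - q y + ?c1} t + ennreal ?a2 * indicator {\<tau> - ?c2..\<tau> + ?c2} t \<partial>lborel)"
        proof (rule nn_integral_cong)
          fix t
          have "H (t, y) = ?a1 * indicator {\<tau> - q y - ?c1..\<tau> - q y + ?c1} t + ?a2 * indicator {\<tau> - ?c2..\<tau> + ?c2} t"
            unfolding H_def using True by (auto simp: indicator_def abs_le_iff)
          then show "ennreal (H (t, y)) = ennreal ?a1 * indicator {\<tau> - q y - ?c1..\<tau> - q y + ?c1} t + ennreal ?a2 * indicator {\<tau> - ?c2..\<tau> + ?c2} t"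
            using c by (auto simp: indicator_def ennreal_plus)
        qed
        also have "\<dots> = ennreal (?a1 * (2 * ?c1) + ?a2 * (2 * ?c2))"
          by (rule nn_integral_two_windows) (use c in auto)
        also have "?a1 * (2 * ?c1) + ?a2 * (2 * ?c2) = C2 * ?w powr - (P - 3)"
        proof -
          have 1: "(6 / 7 * ?w) powr - P = (6 / 7) powr - P * ?w powr - P"
            "(6 / 7 * ?w) powr (- P - 1) = (6 / 7) powr (- P - 1) * ?w powr (- P - 1)" by (rule powr_mult)+
          have "?w ^ 3 = ?w powr 3" "?w\<^sup>2 = ?w powr 2" using w0[of y] by simp_all
          then have 2: "?w powr - P * ?w ^ 3 = ?w powr (- P + 3)" "?w powr (- P - 1) * (?w\<^sup>2 * ?w\<^sup>2) = ?w powr (- P - 1 + (2 + 2))"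
            by (simp_all only: powr_add)
          have "?a1 * (2 * ?c1) + ?a2 * (2 * ?c2) = 2 * (2 * M + 5 * K\<^sup>2) * (6 / 7) powr - P * (?w powr - P * ?w ^ 3)
             + 8 * K\<^sup>2 * P * (6 / 7) powr (- P - 1) * (?w powr (- P - 1) * (?w\<^sup>2 * ?w\<^sup>2))"
            unfolding 1 by (simp add: power2_eq_square)
          then show ?thesis unfolding 2 C2_def by (simp add: distrib_right)
        qed
        also have "ennreal (C2 * ?w powr - (P - 3)) \<le> ennreal (C2 * norm y powr - (P - 3))"
          using wy y P C20 by (intro ennreal_leI mult_left_mono powr_mono2') auto
        also have "\<dots> = ennreal C2 * ennreal (indicator {..<r} (norm y) * norm y powr - (P - 3))"
          using True C20 by (simp add: ennreal_mult')
        finally show ?thesis .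
      qed (simp add: H_def)
      have "(\<integral>\<^sup>+p. ennreal (H p) \<partial>lborel) = (\<integral>\<^sup>+y. (\<integral>\<^sup>+t. ennreal (H (t, y)) \<partial>lborel) \<partial>lborel)"
        by (rule nn_integral_lborel_Pair) (rule measurable_compose[OF Hm measurable_ennreal])
      also have "\<dots> \<le> (\<integral>\<^sup>+y. ennreal C2 * ennreal (indicator {..<r} (norm (y::'b)) * norm y powr - (P - 3)) \<partial>lborel)"
        by (intro nn_integral_mono_AE eventually_mono[OF AE_lborel_singleton[of 0]]) (rule slice)
      also have "\<dots> = ennreal C2 * (\<integral>\<^sup>+y. ennreal (indicator {..<r} (norm (y::'b)) * norm y powr - (P - 3)) \<partial>lborel)"
        by (rule nn_integral_cmult) measurable
      also have "\<dots> = ennreal C2 * ennreal V"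
        using P r by (subst nn_integral_powr_near_0) (auto simp: V_def)
      also have "\<dots> = ennreal (C2 * V)" using C20 by (simp add: ennreal_mult')
      finally show ?thesis .
    qed
    have Hi: "integrable lborel H"
      using Hint H0 Hm by (intro integrableI_nonneg) (auto simp: top_unique le_less_trans)
    have Hle: "integral\<^sup>L lborel H \<le> C2 * V"
      using Hint H0 Hi C20 V0 by (subst (asm) nn_integral_eq_integral) auto
    have Gslice: "(\<integral>\<^sup>+t. ennreal \<bar>G (t, y)\<bar> \<partial>lborel) = ennreal (indicator {..<r} (norm y) * (\<bar>q y\<bar> * w y powr - P))" for y
    proof -
      have "(\<integral>\<^sup>+t. ennreal \<bar>G (t, y)\<bar> \<partial>lborel)
        = (\<integral>\<^sup>+t. ennreal (indicator {..<r} (norm y) * w y powr - P) * ennreal \<bar>indicator {t. \<tau> < t + q y} t - indicator {\<tau><..} t\<bar> \<partial>lborel)"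
        by (intro nn_integral_cong) (auto simp: G_def indicator_def ennreal_mult'[symmetric])
      also have "\<dots> = ennreal (indicator {..<r} (norm y) * w y powr - P) * ennreal \<bar>q y\<bar>"
        by (subst nn_integral_cmult) (auto simp: nn_integral_shifted_halfline)
      finally show ?thesis by (simp add: ennreal_mult'[symmetric] mult_ac)
    qed
    have Gi: "integrable lborel G"
    proof (rule integrableI_bounded)
      show "G \<in> borel_measurable lborel" using Gm by simp
      have "(\<integral>\<^sup>+p. ennreal (norm (G p)) \<partial>lborel) = (\<integral>\<^sup>+y. (\<integral>\<^sup>+t. ennreal \<bar>G (t, y)\<bar> \<partial>lborel) \<partial>lborel)"
        using Gm by (subst nn_integral_lborel_Pair) auto
      also have "\<dots> \<le> (\<integral>\<^sup>+y. ennreal (K * \<bar>\<tau>\<bar> powr (2 - P)) * indicator (ball 0 r) (y::'b) \<partial>lborel)"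
      proof (rule nn_integral_mono)
        fix y :: 'b
        have "\<bar>q y\<bar> * w y powr - P \<le> K * (w y)\<^sup>2 * w y powr - P" by (intro mult_right_mono qK) auto
        also have "\<dots> = K * w y powr (2 - P)"
        proof -
          have "(w y)\<^sup>2 = w y powr 2" using w0[of y] by simp
          then have "(w y)\<^sup>2 * w y powr - P = w y powr (2 + - P)" by (simp only: powr_add)
          then show ?thesis by (simp add: mult.assoc)
        qed
        also have "\<dots> \<le> K * \<bar>\<tau>\<bar> powr (2 - P)"
          using wy[of y] \<tau> P K by (intro mult_left_mono powr_mono2') auto
        finally show "(\<integral>\<^sup>+t. ennreal \<bar>G (t, y)\<bar> \<partial>lborel) \<le> ennreal (K * \<bar>\<tau>\<bar> powr (2 - P)) * indicator (ball 0 r) y"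
          unfolding Gslice by (auto simp: indicator_def ennreal_leI)
      qed
      also have "\<dots> = ennreal (K * \<bar>\<tau>\<bar> powr (2 - P)) * emeasure lborel (ball (0::'b) r)"
        by (rule nn_integral_cmult_indicator) simp
      also have "\<dots> < \<infinity>" using r by (simp add: emeasure_ball ennreal_mult_less_top)
      finally show "(\<integral>\<^sup>+p. ennreal (norm (G p)) \<partial>lborel) < \<infinity>" .
    qed
    have Gint: "integral\<^sup>L lborel G = (LINT y|lborel. indicator {..<r} (norm (y::'b)) * (B (\<tau>, y) (\<tau>, y) / 2 * norm (\<tau>, y) powr - P))"
    proof -
      have Gi2: "integrable (lborel \<Otimes>\<^sub>M lborel) (\<lambda>(t, y). G (t, y))" using Gi by (simp add: lborel_prod)
      have "integral\<^sup>L lborel G = integral\<^sup>L (lborel \<Otimes>\<^sub>M lborel) (\<lambda>(t, y). G (t, y))" by (simp add: lborel_prod)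
      also have "\<dots> = (LINT y|lborel. LINT t|lborel. G (t, y))"
        by (rule lborel_pair.integral_snd[symmetric, OF Gi2])
      also have "\<dots> = (LINT y|lborel. indicator {..<r} (norm (y::'b)) * (q y * w y powr - P))"
      proof (rule Bochner_Integration.integral_cong[OF refl])
        fix y :: 'b
        have "(LINT t|lborel. G (t, y)) = (LINT t|lborel. (indicator {t. \<tau> < t + q y} t - indicator {\<tau><..} t) * (indicator {..<r} (norm y) * w y powr - P))"
          by (intro Bochner_Integration.integral_cong refl) (auto simp: G_def indicator_def)
        also have "\<dots> = q y * (indicator {..<r} (norm y) * w y powr - P)"
          by (simp add: integral_shifted_halfline)
        finally show "(LINT t|lborel. G (t, y)) = indicator {..<r} (norm y) * (q y * w y powr - P)" by (simp add: mult_ac)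
      qed
      finally show ?thesis by (simp add: q_def w_def)
    qed
    have Fi: "integrable lborel F"
    proof (rule Bochner_Integration.integrable_bound)
      show "integrable lborel (\<lambda>p. \<bar>G p\<bar> + H p)" using Gi Hi by auto
      show "F \<in> borel_measurable lborel" using Fm by simp
      show "AE p in lborel. norm (F p) \<le> norm (\<bar>G p\<bar> + H p)"
      proof (rule AE_I2)
        fix p
        have "\<bar>F p\<bar> \<le> \<bar>G p\<bar> + H p" using FGH[of p] by linarith
        then show "norm (F p) \<le> norm (\<bar>G p\<bar> + H p)" using H0[of p] by simp
      qed
    qed
    \<comment> \<open>Outside the cylinder the norm is at least \<open>r\<close>, where the kernel is integrable.\<close>
    define L where "L p = indicator {r..} (norm p) * norm p powr - P" for p :: "real \<times> 'b"
    have Lm: "L \<in> borel_measurable borel" unfolding L_def by measurable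
    have L0: "0 \<le> L p" for p by (simp add: L_def)
    have "(\<integral>\<^sup>+p. ennreal (L p) \<partial>lborel) = ennreal T"
      unfolding L_def T_def using P r by (intro nn_integral_powr_at_infinity) auto
    then have Li: "integrable lborel L" and Lint: "integral\<^sup>L lborel L = T"
      using L0 Lm T0 by (auto intro!: integrableI_nonneg simp: integral_eq_nn_integral)
    have fFL: "\<bar>f p - F p\<bar> \<le> L p" for p
    proof (cases "norm (snd p) < r \<and> \<bar>fst p\<bar> < r")
      case False
      then have "r \<le> norm p" using norm_snd_le[of "snd p" "fst p"] norm_fst_le[of "fst p" "snd p"] by auto
      then show ?thesis using False by (auto simp: F_def f_def L_def indicator_def)
    qed (simp add: F_def L0)
    have dfi: "integrable lborel (\<lambda>p. f p - F p)"
    proof (rule Bochner_Integration.integrable_bound[OF Li])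
      show "(\<lambda>p. f p - F p) \<in> borel_measurable lborel" using fm Fm by simp
    qed (use fFL L0 in auto)
    have fi: "integrable lborel f"
      using Bochner_Integration.integrable_add[OF dfi Fi] by simp
    have "\<bar>integral\<^sup>L lborel f - integral\<^sup>L lborel F\<bar> \<le> T"
    proof -
      have "\<bar>integral\<^sup>L lborel (\<lambda>p. f p - F p)\<bar> \<le> integral\<^sup>L lborel L"
        using fFL Li dfi by (intro order_trans[OF integral_abs_bound] integral_mono) auto
      then show ?thesis using fi Fi Lint by simp
    qed
    moreover have "\<bar>integral\<^sup>L lborel F - integral\<^sup>L lborel G\<bar> \<le> C2 * V"
    proof -
      have "\<bar>integral\<^sup>L lborel (\<lambda>p. F p - G p)\<bar> \<le> integral\<^sup>L lborel H"
        using FGH Fi Gi Hi by (intro order_trans[OF integral_abs_bound] integral_mono) auto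
      then show ?thesis using Fi Gi Hle by simp
    qed
    ultimately have "\<bar>integral\<^sup>L lborel f - integral\<^sup>L lborel G\<bar> \<le> C2 * V + T" by linarith
    then show "integrable lborel (\<lambda>p. (indicator {p. \<tau> < D p} p - indicator {p. \<tau> < fst p} p) * norm p powr - P) \<and>
      \<bar>(LINT p|lborel. (indicator {p. \<tau> < D p} p - indicator {p. \<tau> < fst p} p) * norm p powr - P)
       - (LINT y|lborel. indicator {..<r} (norm (y::'b)) * (B (\<tau>, y) (\<tau>, y) / 2 * norm (\<tau>, y) powr - P))\<bar> \<le> C2 * V + T"
      using fi unfolding Gint f_def[abs_def] by simp
  qed
qed

section \<open>Quadratic forms averaged over a hyperplane\<close>

lemma integral_isometry:
  fixes T :: "'b::euclidean_space \<Rightarrow> 'b" and f :: "'b \<Rightarrow> real"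
  assumes T: "linear T" "\<And>x. norm (T x) = norm x" and f: "f \<in> borel_measurable borel"
  shows "(LINT y|lborel. f (T y)) = (LINT y|lborel. f y)"
proof -
  have [measurable]: "T \<in> borel_measurable borel"
    using T(1) by (intro borel_measurable_continuous_onI) (simp add: linear_continuous_on linear_conv_bounded_linear)
  have "(LINT y|lborel. f y) = (LINT y|distr lborel borel T. f y)"
    using lborel_distr_isometry[OF T refl] by simp
  also have "\<dots> = (LINT y|lborel. f (T y))" using f by (intro integral_distr) auto
  finally show ?thesis by simp
qed

definition reflect :: "'b::real_inner \<Rightarrow> 'b \<Rightarrow> 'b" where
  "reflect u y = y - (2 * (y \<bullet> u) / (u \<bullet> u)) *\<^sub>R u"

lemma linear_reflect: "linear (reflect u)"
  by (intro linearI) (simp_all add: reflect_def inner_add_left algebra_simps add_divide_distrib)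

lemma norm_reflect: "norm (reflect u y) = norm y"
proof (cases "u = 0")
  case False
  have "(norm (reflect u y))\<^sup>2 = (norm y)\<^sup>2"
    unfolding power2_norm_eq_inner reflect_def using False
    by (simp add: inner_diff_left inner_diff_right inner_commute field_simps)
  then show ?thesis by (simp add: power2_eq_iff_nonneg)
qed (simp add: reflect_def)

lemma radial_linear_average:
  fixes L :: "'b::euclidean_space \<Rightarrow> real" and g :: "real \<Rightarrow> real"
  assumes L: "linear L" and [measurable]: "g \<in> borel_measurable borel"
  shows "(LINT y|lborel. L y * g (norm y)) = 0"
proof -
  have [measurable]: "L \<in> borel_measurable borel"
    using L by (intro borel_measurable_continuous_onI) (simp add: linear_continuous_on linear_conv_bounded_linear)
  have "(LINT y|lborel. L (- y) * g (norm (- y))) = (LINT y|lborel. L y * g (norm y))"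
    by (rule integral_isometry[of uminus "\<lambda>y. L y * g (norm y)"]) (auto intro: linearI)
  then show ?thesis by (simp add: linear_neg[OF L])
qed

text \<open>Reflections in coordinate hyperplanes make the mixed second moments of a radial weight vanish, and the
reflection that exchanges two basis vectors makes the diagonal moments equal.\<close>

lemma radial_quadratic_average:
  fixes B :: "'b::euclidean_space \<Rightarrow> 'b \<Rightarrow> real" and g :: "real \<Rightarrow> real"
  assumes B: "bilinear B" and [measurable]: "g \<in> borel_measurable borel"
    and int: "integrable lborel (\<lambda>y::'b. (norm y)\<^sup>2 * g (norm y))"
  shows "integrable lborel (\<lambda>y. B y y * g (norm y))"
    and "(LINT y|lborel. B y y * g (norm y)) = (\<Sum>b\<in>Basis. B b b) / real DIM('b) * (LINT y|lborel. (norm (y::'b))\<^sup>2 * g (norm y))"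
proof -
  define J where "J b c = (LINT y|lborel. (y \<bullet> b) * (y \<bullet> c) * g (norm y))" for b c :: 'b
  have Ji: "integrable lborel (\<lambda>y. (y \<bullet> b) * (y \<bullet> c) * g (norm y))" if "b \<in> Basis" "c \<in> Basis" for b c :: 'b
  proof (rule Bochner_Integration.integrable_bound[OF int])
    show "AE y in lborel. norm ((y \<bullet> b) * (y \<bullet> c) * g (norm y)) \<le> norm ((norm y)\<^sup>2 * g (norm y))"
    proof (rule AE_I2)
      fix y :: 'b
      have "\<bar>y \<bullet> b\<bar> * \<bar>y \<bullet> c\<bar> * \<bar>g (norm y)\<bar> \<le> norm y * norm y * \<bar>g (norm y)\<bar>"
        using that by (intro mult_right_mono mult_mono Basis_le_norm) auto
      then show "norm ((y \<bullet> b) * (y \<bullet> c) * g (norm y)) \<le> norm ((norm y)\<^sup>2 * g (norm y))"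
        by (simp add: abs_mult power2_eq_square)
    qed
  qed measurable
  have J0: "J b c = 0" if bc: "b \<in> Basis" "c \<in> Basis" "b \<noteq> c" for b c
  proof -
    have "(LINT y|lborel. (reflect b y \<bullet> b) * (reflect b y \<bullet> c) * g (norm (reflect b y))) = J b c"
      unfolding J_def by (rule integral_isometry[OF linear_reflect norm_reflect]) measurable
    moreover have "reflect b y \<bullet> b = - (y \<bullet> b)" "reflect b y \<bullet> c = y \<bullet> c" for y
      using bc by (auto simp: reflect_def inner_diff_left inner_Basis)
    ultimately show ?thesis by (simp add: norm_reflect J_def)
  qed
  have Jeq: "J b b = J c c" if bc: "b \<in> Basis" "c \<in> Basis" for b c
  proof (cases "b = c")
    case False
    have "(LINT y|lborel. (reflect (b - c) y \<bullet> b) * (reflect (b - c) y \<bullet> b) * g (norm (reflect (b - c) y))) = J b b"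
      unfolding J_def by (rule integral_isometry[OF linear_reflect norm_reflect]) measurable
    moreover have "reflect (b - c) y \<bullet> b = y \<bullet> c" for y
      using bc False by (auto simp: reflect_def inner_diff_left inner_diff_right inner_Basis diff_divide_distrib)
    ultimately show ?thesis by (simp add: norm_reflect J_def)
  qed simp
  have n2: "(norm y)\<^sup>2 = (\<Sum>b\<in>Basis. (y \<bullet> b) * (y \<bullet> b))" for y :: 'b
    unfolding power2_norm_eq_inner by (rule euclidean_inner)
  have Jsum: "(LINT y|lborel. (norm (y::'b))\<^sup>2 * g (norm y)) = (\<Sum>b\<in>Basis. J b b)"
    unfolding n2 J_def sum_distrib_right by (rule Bochner_Integration.integral_sum) (rule Ji)
  have Jb: "J b b = (LINT y|lborel. (norm (y::'b))\<^sup>2 * g (norm y)) / real DIM('b)" if "b \<in> Basis" for b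
  proof -
    have "(\<Sum>c\<in>Basis. J c c) = (\<Sum>c\<in>(Basis::'b set). J b b)" by (rule sum.cong[OF refl]) (rule Jeq[OF _ that])
    then show ?thesis unfolding Jsum by simp
  qed
  have By: "B y y * g (norm y) = (\<Sum>b\<in>Basis. \<Sum>c\<in>Basis. B b c * ((y \<bullet> b) * (y \<bullet> c) * g (norm y)))" for y
  proof -
    have "B y y = B (\<Sum>b\<in>Basis. (y \<bullet> b) *\<^sub>R b) (\<Sum>c\<in>Basis. (y \<bullet> c) *\<^sub>R c)" by (simp add: euclidean_representation)
    also have "\<dots> = (\<Sum>b\<in>Basis. \<Sum>c\<in>Basis. B ((y \<bullet> b) *\<^sub>R b) ((y \<bullet> c) *\<^sub>R c))"
      by (subst bilinear_sum[OF B]) (simp add: sum.cartesian_product)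
    also have "\<dots> = (\<Sum>b\<in>Basis. \<Sum>c\<in>Basis. (y \<bullet> b) * ((y \<bullet> c) * B b c))"
      by (intro sum.cong refl) (simp add: bilinear_lmul[OF B] bilinear_rmul[OF B] mult_ac)
    finally have e: "B y y = (\<Sum>b\<in>Basis. \<Sum>c\<in>Basis. (y \<bullet> b) * ((y \<bullet> c) * B b c))" .
    show ?thesis unfolding e sum_distrib_right by (intro sum.cong refl) (simp add: mult_ac)
  qed
  show "integrable lborel (\<lambda>y. B y y * g (norm y))"
    unfolding By by (intro Bochner_Integration.integrable_sum integrable_mult_right Ji)
  have "(LINT y|lborel. B y y * g (norm y)) = (\<Sum>b\<in>Basis. \<Sum>c\<in>Basis. B b c * J b c)"
  proof -
    have Ji': "integrable lborel (\<lambda>y. B b c * ((y \<bullet> b) * (y \<bullet> c) * g (norm y)))" if "b \<in> Basis" "c \<in> Basis" for b c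
      using Ji[OF that] by (rule integrable_mult_right)
    have "(LINT y|lborel. (\<Sum>c\<in>Basis. B b c * ((y \<bullet> b) * (y \<bullet> c) * g (norm y)))) = (\<Sum>c\<in>Basis. B b c * J b c)"
      if b: "b \<in> Basis" for b
      using Ji'[OF b] by (subst Bochner_Integration.integral_sum) (auto simp: J_def)
    moreover have "integrable lborel (\<lambda>y. (\<Sum>c\<in>Basis. B b c * ((y \<bullet> b) * (y \<bullet> c) * g (norm y))))"
      if b: "b \<in> Basis" for b
      using Ji'[OF b] by (rule Bochner_Integration.integrable_sum)
    ultimately show ?thesis unfolding By by (subst Bochner_Integration.integral_sum) auto
  qed
  also have "\<dots> = (\<Sum>b\<in>Basis. B b b * J b b)"
  proof (rule sum.cong[OF refl])
    fix b :: 'b assume b: "b \<in> Basis"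
    have "(\<Sum>c\<in>Basis. B b c * J b c) = (\<Sum>c\<in>Basis. if c = b then B b b * J b b else 0)"
      using b J0 by (intro sum.cong) auto
    then show "(\<Sum>c\<in>Basis. B b c * J b c) = B b b * J b b" using b by simp
  qed
  also have "\<dots> = (\<Sum>b\<in>Basis. B b b) / real DIM('b) * (LINT y|lborel. (norm (y::'b))\<^sup>2 * g (norm y))"
    using Jb by (simp add: sum_divide_distrib sum_distrib_right)
  finally show "(LINT y|lborel. B y y * g (norm y)) = (\<Sum>b\<in>Basis. B b b) / real DIM('b) * (LINT y|lborel. (norm (y::'b))\<^sup>2 * g (norm y))" .
qed

lemma integral_radial_nonneg:
  fixes h :: "real \<Rightarrow> real"
  assumes [measurable]: "h \<in> borel_measurable borel" and h: "\<And>r. 0 \<le> h r"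
  shows "(LINT y|lborel. h (norm (y::'a::euclidean_space))) =
    real DIM('a) * unit_ball_vol (real DIM('a)) * (LINT r|lborel. indicator {0<..} r * (r ^ (DIM('a) - 1) * h r))"
proof -
  let ?c = "real DIM('a) * unit_ball_vol (real DIM('a))"
  have nn: "0 \<le> indicator {0<..} r * (r ^ (DIM('a) - 1) * h r)" for r :: real
    using h by (auto simp: indicator_def)
  have "(LINT y|lborel. h (norm (y::'a))) = enn2real (\<integral>\<^sup>+y. ennreal (h (norm (y::'a))) \<partial>lborel)"
    using h by (intro integral_eq_nn_integral) auto
  also have "(\<integral>\<^sup>+y. ennreal (h (norm (y::'a))) \<partial>lborel)
    = (\<integral>\<^sup>+r. ennreal (indicator {0<..} r * (?c * r ^ (DIM('a) - 1))) * ennreal (h r) \<partial>lborel)"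
    by (rule nn_integral_radial) measurable
  also have "\<dots> = (\<integral>\<^sup>+r. ennreal (?c * (indicator {0<..} r * (r ^ (DIM('a) - 1) * h r))) \<partial>lborel)"
    using h by (intro nn_integral_cong) (auto simp: indicator_def ennreal_mult'[symmetric] mult_ac)
  also have "enn2real \<dots> = (LINT r|lborel. ?c * (indicator {0<..} r * (r ^ (DIM('a) - 1) * h r)))"
    using nn by (intro integral_eq_nn_integral[symmetric]) auto
  finally show ?thesis by simp
qed

lemma norm_Pair_powr:
  assumes "\<tau> \<noteq> 0"
  shows "norm (\<tau>::real, y::'b::euclidean_space) powr - P = (\<tau>\<^sup>2 + (norm y)\<^sup>2) powr (- P / 2)"
proof -
  have "0 < \<tau>\<^sup>2 + (norm y)\<^sup>2" using assms by (simp add: add_pos_nonneg)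
  then show ?thesis unfolding norm_Pair by (simp add: powr_half_sqrt[symmetric] powr_powr)
qed

text \<open>Of the quadratic form at \<open>(\<tau>, y)\<close> the part in the direction \<open>(1, 0)\<close> vanishes by assumption, the
mixed parts are linear in \<open>y\<close> and integrate to 0, and the part in \<open>y\<close> averages to its trace. The trace over the
product basis is the same, again by the assumption. Polar coordinates then give \<open>q ^ (m + 1)\<close>, two powers
coming from the quadratic form and \<open>m - 1\<close> from the area of spheres, \<open>m = DIM('b)\<close>.\<close>

lemma quadratic_slab_integral:
  fixes B :: "real \<times> 'b::euclidean_space \<Rightarrow> real \<times> 'b \<Rightarrow> real"
  assumes B: "bilinear B" "B (1, 0) (1, 0) = 0" and \<tau>: "\<tau> \<noteq> 0" and r: "0 < r" and P: "0 \<le> P"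
  shows "(LINT y|lborel. indicator {..<r} (norm (y::'b)) * (B (\<tau>, y) (\<tau>, y) / 2 * norm (\<tau>, y) powr - P))
    = (\<Sum>b\<in>Basis. B b b) / 2 * unit_ball_vol (real DIM('b))
      * (LINT q|lborel. indicator {0<..<r} q * (q ^ (DIM('b) + 1) * (\<tau>\<^sup>2 + q\<^sup>2) powr (- P / 2)))"
proof -
  define g where "g q = indicator {..<r} q * (\<tau>\<^sup>2 + q\<^sup>2) powr (- P / 2)" for q :: real
  have [measurable]: "g \<in> borel_measurable borel" unfolding g_def by measurable
  have g0: "0 \<le> g q" for q by (simp add: g_def)
  have t2: "\<tau>\<^sup>2 > 0" using \<tau> by simp
  have gb: "g q \<le> (\<tau>\<^sup>2) powr (- P / 2)" for q
    unfolding g_def using t2 P by (auto simp: indicator_def intro!: powr_mono2')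
  have bint: "integrable lborel (\<lambda>y::'b. h y * g (norm y))"
    if [measurable]: "h \<in> borel_measurable borel" and h: "\<And>y. norm y < r \<Longrightarrow> \<bar>h y\<bar> \<le> c" for h c
  proof (rule Bochner_Integration.integrable_bound)
    show "integrable lborel (\<lambda>y. c * (\<tau>\<^sup>2) powr (- P / 2) * indicator (ball (0::'b) r) y)"
      by (intro integrable_mult_right integrable_real_indicator) (use r in \<open>auto simp: emeasure_ball\<close>)
    show "AE y in lborel. norm (h y * g (norm y)) \<le> norm (c * (\<tau>\<^sup>2) powr (- P / 2) * indicator (ball (0::'b) r) y)"
    proof (rule AE_I2)
      fix y :: 'b
      show "norm (h y * g (norm y)) \<le> norm (c * (\<tau>\<^sup>2) powr (- P / 2) * indicator (ball (0::'b) r) y)"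
      proof (cases "norm y < r")
        case True
        have "\<bar>h y\<bar> * g (norm y) \<le> c * (\<tau>\<^sup>2) powr (- P / 2)"
          using h[OF True] gb g0 by (intro mult_mono) auto
        moreover have "0 \<le> c" using h[OF True] by linarith
        ultimately show ?thesis using True g0 by (simp add: abs_mult)
      qed (simp add: g_def)
    qed
  qed measurable
  have int2: "integrable lborel (\<lambda>y::'b. (norm y)\<^sup>2 * g (norm y))"
    using r by (intro bint[of _ "r\<^sup>2"]) (auto intro: power_mono)
  define L1 L2 B' where "L1 y = B (1, 0) (0, y)" and "L2 y = B (0, y) (1, 0)" and "B' y z = B (0, y) (0, z)" for y z :: 'b
  have lin: "linear (\<lambda>y::'b. (0::real, y))" by (intro linearI) auto
  have BL: "linear (B x)" "linear (\<lambda>y. B y x)" for x using B(1) unfolding bilinear_def by blast+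
  have L: "linear L1" "linear L2"
    unfolding L1_def L2_def using linear_compose[OF lin BL(1)] linear_compose[OF lin BL(2)] by (auto simp: o_def)
  have B': "bilinear B'"
    unfolding bilinear_def B'_def using linear_compose[OF lin BL(1)] linear_compose[OF lin BL(2)] by (auto simp: o_def)
  have Lint: "integrable lborel (\<lambda>y. l y * g (norm y))" if lin_l: "linear l" for l :: "'b \<Rightarrow> real"
  proof -
    obtain c where c: "c > 0" "\<And>y. norm (l y) \<le> c * norm y"
      using linear_bounded_pos[OF lin_l] by blast
    show ?thesis
    proof (rule bint[of _ "c * r"])
      show "l \<in> borel_measurable borel"
        using lin_l by (intro borel_measurable_continuous_onI) (simp add: linear_continuous_on linear_conv_bounded_linear)
      show "\<bar>l y\<bar> \<le> c * r" if "norm y < r" for y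
      proof -
        have "c * norm y \<le> c * r" using that c(1) by (intro mult_left_mono) auto
        then show ?thesis using c(2)[of y] by simp
      qed
    qed
  qed
  have split: "B (\<tau>, y) (\<tau>, y) = \<tau> * L1 y + \<tau> * L2 y + B' y y" for y
  proof -
    have e: "(\<tau>, y) = \<tau> *\<^sub>R (1, 0) + (0, y)" by simp
    show ?thesis unfolding e
      by (simp only: bilinear_ladd[OF B(1)] bilinear_radd[OF B(1)] bilinear_lmul[OF B(1)] bilinear_rmul[OF B(1)] B(2))
        (simp add: L1_def L2_def B'_def)
  qed
  have pt: "indicator {..<r} (norm y) * (B (\<tau>, y) (\<tau>, y) / 2 * norm (\<tau>, y) powr - P)
    = \<tau> / 2 * (L1 y * g (norm y)) + \<tau> / 2 * (L2 y * g (norm y)) + 1 / 2 * (B' y y * g (norm y))" for y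
    unfolding split norm_Pair_powr[OF \<tau>] g_def by (simp add: algebra_simps)
  note avg = radial_quadratic_average[OF B' \<open>g \<in> borel_measurable borel\<close> int2]
  have "(LINT y|lborel. indicator {..<r} (norm (y::'b)) * (B (\<tau>, y) (\<tau>, y) / 2 * norm (\<tau>, y) powr - P))
    = 1 / 2 * (LINT y|lborel. B' y y * g (norm y))"
    unfolding pt using Lint[OF L(1)] Lint[OF L(2)] avg(1)
    by (simp add: radial_linear_average[OF L(1)] radial_linear_average[OF L(2)])
  also have "\<dots> = 1 / 2 * ((\<Sum>b\<in>Basis. B' b b) / real DIM('b) * (LINT y|lborel. (norm (y::'b))\<^sup>2 * g (norm y)))"
    by (simp only: avg(2))
  also have "(LINT y|lborel. (norm (y::'b))\<^sup>2 * g (norm y))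
    = real DIM('b) * unit_ball_vol (real DIM('b)) * (LINT q|lborel. indicator {0<..} q * (q ^ (DIM('b) - 1) * (q\<^sup>2 * g q)))"
    using g0 by (intro integral_radial_nonneg[of "\<lambda>q. q\<^sup>2 * g q"]) auto
  also have "(LINT q|lborel. indicator {0<..} q * (q ^ (DIM('b) - 1) * (q\<^sup>2 * g q)))
    = (LINT q|lborel. indicator {0<..<r} q * (q ^ (DIM('b) + 1) * (\<tau>\<^sup>2 + q\<^sup>2) powr (- P / 2)))"
  proof (rule Bochner_Integration.integral_cong[OF refl])
    fix q :: real
    have "q ^ (DIM('b) - 1) * q\<^sup>2 = q ^ (DIM('b) + 1)"
      using DIM_positive[where 'a='b] by (subst power_add[symmetric]) (auto intro!: arg_cong[of _ _ "\<lambda>n. q ^ n"])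
    then show "indicator {0<..} q * (q ^ (DIM('b) - 1) * (q\<^sup>2 * g q))
      = indicator {0<..<r} q * (q ^ (DIM('b) + 1) * (\<tau>\<^sup>2 + q\<^sup>2) powr (- P / 2))"
      by (auto simp: g_def indicator_def mult.assoc[symmetric])
  qed
  also have "(\<Sum>b\<in>Basis. B' b b) = (\<Sum>b\<in>Basis. B b b)"
  proof -
    have "(\<Sum>b\<in>(Basis :: (real \<times> 'b) set). B b b) = B (1, 0) (1, 0) + (\<Sum>b\<in>Basis. B (0, b) (0, b))"
      unfolding Basis_prod_def
      by (subst sum.union_disjoint) (auto simp: sum.reindex inj_on_def)
    then show ?thesis by (simp add: B(2) B'_def)
  qed
  finally show ?thesis by simp
qed

section \<open>The radial integrals\<close>

lemma powr_tail_integral: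
  assumes "a < - 1" "0 < (r::real)"
  shows "integrable lborel (\<lambda>q. indicator {r..} q * q powr a)"
    and "(LINT q|lborel. indicator {r..} q * q powr a) = r powr (a + 1) / (- a - 1)"
proof -
  have "((\<lambda>q. q powr a) has_integral (- (r powr (a + 1)) / (a + 1))) {r..}"
    using assms by (intro has_integral_powr_to_inf) auto
  from nn_integral_has_integral_lebesgue[OF _ this]
  have nn: "(\<integral>\<^sup>+q. ennreal (indicator {r..} q * q powr a) \<partial>lborel) = ennreal (- (r powr (a + 1)) / (a + 1))"
    by simp
  then show "integrable lborel (\<lambda>q. indicator {r..} q * q powr a)"
    by (intro integrableI_nonneg) auto
  have "(LINT q|lborel. indicator {r..} q * q powr a) = enn2real (ennreal (- (r powr (a + 1)) / (a + 1)))"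
    unfolding nn[symmetric] by (intro integral_eq_nn_integral) auto
  also have "\<dots> = - (r powr (a + 1)) / (a + 1)"
    using assms by (intro enn2real_ennreal divide_nonpos_neg) auto
  finally show "(LINT q|lborel. indicator {r..} q * q powr a) = r powr (a + 1) / (- a - 1)"
    using assms by (simp add: field_simps)
qed

lemma profile_le_powr:
  fixes q \<tau> P :: real
  assumes "0 < q" "0 \<le> P"
  shows "q ^ k * (\<tau>\<^sup>2 + q\<^sup>2) powr (- P / 2) \<le> q powr (real k - P)"
proof -
  have "(\<tau>\<^sup>2 + q\<^sup>2) powr (- P / 2) \<le> (q\<^sup>2) powr (- P / 2)"
    using assms by (intro powr_mono2') auto
  also have "(q\<^sup>2) powr (- P / 2) = q powr (- P)"
    using assms by (simp add: powr_powr powr_numeral[symmetric] del: powr_numeral)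
  finally have "q ^ k * (\<tau>\<^sup>2 + q\<^sup>2) powr (- P / 2) \<le> q ^ k * q powr (- P)"
    using assms by (intro mult_left_mono) auto
  also have "\<dots> = q powr (real k - P)"
    using assms by (simp add: powr_realpow[symmetric] powr_add[symmetric])
  finally show ?thesis .
qed

lemma profile_integrable:
  fixes \<tau> P :: real
  assumes \<tau>: "\<tau> \<noteq> 0" and P: "real k + 1 < P"
  shows "integrable lborel (\<lambda>q. indicator {0<..} q * (q ^ k * (\<tau>\<^sup>2 + q\<^sup>2) powr (- P / 2)))"
proof (rule Bochner_Integration.integrable_bound)
  let ?c = "(\<tau>\<^sup>2) powr (- P / 2)"
  show "integrable lborel (\<lambda>q. ?c * indicator {0..1} q + indicator {1..} q * q powr (real k - P))"
    using P by (intro Bochner_Integration.integrable_add integrable_mult_right integrable_real_indicator powr_tail_integral) auto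
  show "AE q in lborel. norm (indicator {0<..} q * (q ^ k * (\<tau>\<^sup>2 + q\<^sup>2) powr (- P / 2)))
    \<le> norm (?c * indicator {0..1} q + indicator {1..} q * q powr (real k - P))"
  proof (rule AE_I2)
    fix q :: real
    consider "q \<le> 0" | "0 < q" "q < 1" | "1 \<le> q" by linarith
    then show "norm (indicator {0<..} q * (q ^ k * (\<tau>\<^sup>2 + q\<^sup>2) powr (- P / 2)))
      \<le> norm (?c * indicator {0..1} q + indicator {1..} q * q powr (real k - P))"
    proof cases
      case 2
      have "q ^ k * (\<tau>\<^sup>2 + q\<^sup>2) powr (- P / 2) \<le> 1 * ?c"
        using 2 \<tau> P by (intro mult_mono power_le_one powr_mono2') auto
      then show ?thesis using 2 by simp
    next
      case 3
      have "q ^ k * (\<tau>\<^sup>2 + q\<^sup>2) powr (- P / 2) \<le> q powr (real k - P)"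
        using 3 P by (intro profile_le_powr) auto
      moreover have "0 \<le> ?c * indicator {0..1} q" by simp
      ultimately have "q ^ k * (\<tau>\<^sup>2 + q\<^sup>2) powr (- P / 2) \<le> ?c * indicator {0..1} q + q powr (real k - P)" by linarith
      then show ?thesis using 3 by (simp add: add_nonneg_nonneg)
    qed simp
  qed
qed measurable

lemma profile_scaling:
  fixes \<tau> P :: real
  assumes \<tau>: "\<tau> \<noteq> 0"
  shows "(LINT q|lborel. indicator {0<..} q * (q ^ k * (\<tau>\<^sup>2 + q\<^sup>2) powr (- P / 2)))
    = \<bar>\<tau>\<bar> powr (real k + 1 - P) * (LINT q|lborel. indicator {0<..} q * (q ^ k * (1 + q\<^sup>2) powr (- P / 2)))"
proof -
  have t: "0 < \<bar>\<tau>\<bar>" using \<tau> by simp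
  have "(LINT q|lborel. indicator {0<..} q * (q ^ k * (\<tau>\<^sup>2 + q\<^sup>2) powr (- P / 2)))
    = \<bar>\<tau>\<bar> * (LINT q|lborel. indicator {0<..} (\<bar>\<tau>\<bar> * q) * ((\<bar>\<tau>\<bar> * q) ^ k * (\<tau>\<^sup>2 + (\<bar>\<tau>\<bar> * q)\<^sup>2) powr (- P / 2)))"
    using lborel_integral_real_affine[of "\<bar>\<tau>\<bar>" "\<lambda>q. indicator {0<..} q * (q ^ k * (\<tau>\<^sup>2 + q\<^sup>2) powr (- P / 2))" 0] \<tau> by simp
  also have "(LINT q|lborel. indicator {0<..} (\<bar>\<tau>\<bar> * q) * ((\<bar>\<tau>\<bar> * q) ^ k * (\<tau>\<^sup>2 + (\<bar>\<tau>\<bar> * q)\<^sup>2) powr (- P / 2)))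
    = (LINT q|lborel. \<bar>\<tau>\<bar> powr (real k - P) * (indicator {0<..} q * (q ^ k * (1 + q\<^sup>2) powr (- P / 2))))"
  proof (rule Bochner_Integration.integral_cong[OF refl])
    fix q :: real
    have "\<tau>\<^sup>2 + (\<bar>\<tau>\<bar> * q)\<^sup>2 = \<tau>\<^sup>2 * (1 + q\<^sup>2)" by (simp add: power_mult_distrib distrib_left)
    then have 1: "(\<tau>\<^sup>2 + (\<bar>\<tau>\<bar> * q)\<^sup>2) powr (- P / 2) = (\<tau>\<^sup>2) powr (- P / 2) * (1 + q\<^sup>2) powr (- P / 2)"
      by (simp add: powr_mult)
    have "\<tau>\<^sup>2 = \<bar>\<tau>\<bar> powr 2" using t by simp
    then have "(\<tau>\<^sup>2) powr (- P / 2) = \<bar>\<tau>\<bar> powr - P" by (simp only: powr_powr) simp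
    moreover have "\<bar>\<tau>\<bar> ^ k = \<bar>\<tau>\<bar> powr real k" using t by (simp add: powr_realpow)
    ultimately have 2: "\<bar>\<tau>\<bar> ^ k * (\<tau>\<^sup>2) powr (- P / 2) = \<bar>\<tau>\<bar> powr (real k - P)"
      by (simp add: powr_add[symmetric])
    have 3: "indicator {0<..} (\<bar>\<tau>\<bar> * q) = (indicator {0<..} q :: real)" using t by (auto simp: indicator_def zero_less_mult_iff)
    show "indicator {0<..} (\<bar>\<tau>\<bar> * q) * ((\<bar>\<tau>\<bar> * q) ^ k * (\<tau>\<^sup>2 + (\<bar>\<tau>\<bar> * q)\<^sup>2) powr (- P / 2))
      = \<bar>\<tau>\<bar> powr (real k - P) * (indicator {0<..} q * (q ^ k * (1 + q\<^sup>2) powr (- P / 2)))"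
      unfolding 1 3 2[symmetric] by (simp add: power_mult_distrib mult_ac)
  qed
  also have "\<bar>\<tau>\<bar> * \<dots> = \<bar>\<tau>\<bar> powr (real k + 1 - P) * (LINT q|lborel. indicator {0<..} q * (q ^ k * (1 + q\<^sup>2) powr (- P / 2)))"
  proof -
    have e: "real k + 1 - P = 1 + (real k - P)" by simp
    show ?thesis unfolding e powr_add using t by simp
  qed
  finally show ?thesis .
qed

text \<open>Substituting \<open>\<bar>\<tau>\<bar> * q\<close> for \<open>q\<close> in the integral over the whole half-line, and bounding the part beyond \<open>r\<close>
by a power.\<close>

lemma profile_truncated_powr:
  fixes \<tau> P r :: real
  assumes \<tau>: "\<tau> \<noteq> 0" and P: "real k + 1 < P" and r: "0 < r"
  shows "\<bar>(LINT q|lborel. indicator {0<..<r} q * (q ^ k * (\<tau>\<^sup>2 + q\<^sup>2) powr (- P / 2)))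
    - (LINT q|lborel. indicator {0<..} q * (q ^ k * (1 + q\<^sup>2) powr (- P / 2))) * \<bar>\<tau>\<bar> powr (real k + 1 - P)\<bar>
    \<le> r powr (real k + 1 - P) / (P - real k - 1)"
proof -
  define f where "f q = q ^ k * (\<tau>\<^sup>2 + q\<^sup>2) powr (- P / 2)" for q :: real
  have [measurable]: "f \<in> borel_measurable borel" unfolding f_def by measurable
  have full: "integrable lborel (\<lambda>q. indicator {0<..} q * f q)"
    unfolding f_def by (rule profile_integrable[OF \<tau> P])
  have i1: "integrable lborel (\<lambda>q. indicator {0<..<r} q * f q)"
    by (rule Bochner_Integration.integrable_bound[OF full]) (auto simp: indicator_def)
  have i2: "integrable lborel (\<lambda>q. indicator {r..} q * f q)"
    by (rule Bochner_Integration.integrable_bound[OF full]) (use r in \<open>auto simp: indicator_def\<close>)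
  have "(LINT q|lborel. indicator {0<..} q * f q) = (LINT q|lborel. indicator {0<..<r} q * f q + indicator {r..} q * f q)"
    using r by (intro Bochner_Integration.integral_cong refl) (auto simp: indicator_def)
  also have "\<dots> = (LINT q|lborel. indicator {0<..<r} q * f q) + (LINT q|lborel. indicator {r..} q * f q)"
    by (rule Bochner_Integration.integral_add[OF i1 i2])
  finally have sum: "(LINT q|lborel. indicator {0<..} q * f q) = (LINT q|lborel. indicator {0<..<r} q * f q) + (LINT q|lborel. indicator {r..} q * f q)" .
  have "(LINT q|lborel. indicator {r..} q * f q) \<le> (LINT q|lborel. indicator {r..} q * q powr (real k - P))"
  proof (rule integral_mono[OF i2])
    show "integrable lborel (\<lambda>q. indicator {r..} q * q powr (real k - P))" using P r by (intro powr_tail_integral) auto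
    show "indicator {r..} q * f q \<le> indicator {r..} q * q powr (real k - P)" for q
      using profile_le_powr[of q P k \<tau>] P r by (auto simp: indicator_def f_def)
  qed
  also have "\<dots> = r powr (real k - P + 1) / (- (real k - P) - 1)" using P r by (intro powr_tail_integral) auto
  finally have up: "(LINT q|lborel. indicator {r..} q * f q) \<le> r powr (real k + 1 - P) / (P - real k - 1)" by (simp add: algebra_simps)
  have lo: "0 \<le> (LINT q|lborel. indicator {r..} q * f q)"
    using r by (intro Bochner_Integration.integral_nonneg) (auto simp: f_def indicator_def)
  have "(LINT q|lborel. indicator {0<..} q * f q)
     = (LINT q|lborel. indicator {0<..} q * (q ^ k * (1 + q\<^sup>2) powr (- P / 2))) * \<bar>\<tau>\<bar> powr (real k + 1 - P)"
    unfolding f_def using profile_scaling[OF \<tau>, of k P] by (simp add: mult.commute)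
  with sum up lo show ?thesis unfolding f_def by simp
qed

text \<open>The critical exponent. The integrand lies between \<open>g1 - m * g2\<close> and \<open>g1\<close>, where \<open>g1 = q / (\<tau>\<^sup>2 + q\<^sup>2)\<close> has the
logarithm as primitive and the integral of \<open>g2\<close> is at most \<open>1/2\<close>; the lower bound is Bernoulli's inequality.\<close>

lemma profile_truncated_log:
  fixes \<tau> r :: real
  assumes \<tau>: "\<tau> \<noteq> 0" "\<bar>\<tau>\<bar> \<le> r" and r: "0 < r"
  shows "\<bar>(LINT q|lborel. indicator {0<..<r} q * (q ^ (m + 1) * (\<tau>\<^sup>2 + q\<^sup>2) powr (- real (m + 2) / 2))) - ln (1 / \<bar>\<tau>\<bar>)\<bar>
    \<le> real m / 2 + \<bar>ln r\<bar> + ln 2"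
proof -
  define g1 where "g1 q = q / (\<tau>\<^sup>2 + q\<^sup>2)" for q
  define g2 where "g2 q = q * \<tau>\<^sup>2 / (\<tau>\<^sup>2 + q\<^sup>2)\<^sup>2" for q
  define f where "f q = q ^ (m + 1) * (\<tau>\<^sup>2 + q\<^sup>2) powr (- real (m + 2) / 2)" for q :: real
  have t2: "0 < \<tau>\<^sup>2" using \<tau> by simp
  then have tq: "0 < \<tau>\<^sup>2 + q\<^sup>2" for q by (simp add: add_pos_nonneg)
  have [measurable]: "f \<in> borel_measurable borel" "g1 \<in> borel_measurable borel" "g2 \<in> borel_measurable borel"
    unfolding f_def g1_def g2_def by measurable
  have fg: "f q \<le> g1 q" "g1 q - real m * g2 q \<le> f q" if q: "0 < q" for q
  proof -
    define x where "x = q\<^sup>2 / (\<tau>\<^sup>2 + q\<^sup>2)"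
    have x: "0 < x" "x < 1" using q t2 tq[of q] by (auto simp: x_def)
    have eq: "f q = g1 q * x powr (real m / 2)"
    proof -
      have "x powr (real m / 2) = (q\<^sup>2) powr (real m / 2) * (\<tau>\<^sup>2 + q\<^sup>2) powr - (real m / 2)"
        using q tq[of q] unfolding x_def by (subst powr_divide) (auto simp: powr_minus_divide)
      also have "(q\<^sup>2) powr (real m / 2) = q ^ m"
      proof -
        have "q\<^sup>2 = q powr 2" using q by simp
        then have "(q\<^sup>2) powr (real m / 2) = q powr real m" by (simp only: powr_powr) simp
        then show ?thesis using q by (simp add: powr_realpow)
      qed
      finally have 1: "x powr (real m / 2) = q ^ m * (\<tau>\<^sup>2 + q\<^sup>2) powr - (real m / 2)" .
      have "- real (m + 2) / 2 = - 1 + - (real m / 2)" by (simp add: field_simps)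
      then have "(\<tau>\<^sup>2 + q\<^sup>2) powr (- real (m + 2) / 2) = (\<tau>\<^sup>2 + q\<^sup>2) powr - 1 * (\<tau>\<^sup>2 + q\<^sup>2) powr - (real m / 2)"
        by (simp only: powr_add)
      also have "(\<tau>\<^sup>2 + q\<^sup>2) powr - 1 = 1 / (\<tau>\<^sup>2 + q\<^sup>2)" using tq[of q] by (simp add: powr_minus_divide)
      finally show ?thesis unfolding f_def g1_def 1 by (simp add: mult_ac)
    qed
    have g1q: "0 \<le> g1 q" using q tq[of q] by (simp add: g1_def)
    have "x powr (real m / 2) \<le> 1" using x by (simp add: powr_le1)
    then show "f q \<le> g1 q" using eq g1q mult_left_mono[of "x powr (real m / 2)" 1 "g1 q"] by simp
    have "1 + real m * (x - 1) \<le> (1 + (x - 1)) ^ m" using x by (intro Bernoulli_inequality) simp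
    also have "\<dots> = x powr real m" using x by (simp add: powr_realpow)
    also have "\<dots> \<le> x powr (real m / 2)" using x by (intro powr_mono') auto
    finally have "g1 q * (1 + real m * (x - 1)) \<le> f q" unfolding eq using g1q by (intro mult_left_mono) auto
    moreover have "g1 q * (x - 1) = - g2 q"
    proof -
      have "x - 1 = (q\<^sup>2 - (\<tau>\<^sup>2 + q\<^sup>2)) / (\<tau>\<^sup>2 + q\<^sup>2)"
        unfolding x_def diff_divide_distrib using divide_self[of "\<tau>\<^sup>2 + q\<^sup>2"] tq[of q] by linarith
      then have "x - 1 = - \<tau>\<^sup>2 / (\<tau>\<^sup>2 + q\<^sup>2)" by simp
      then show ?thesis by (simp add: g1_def g2_def power2_eq_square)
    qed
    moreover have "g1 q * (1 + real m * (x - 1)) = g1 q + real m * (g1 q * (x - 1))" by (simp add: algebra_simps)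
    ultimately show "g1 q - real m * g2 q \<le> f q" by simp
  qed
  have G1: "has_bochner_integral lborel (\<lambda>q. g1 q * indicator {0..r} q) (ln (\<tau>\<^sup>2 + r\<^sup>2) / 2 - ln (\<tau>\<^sup>2 + 0\<^sup>2) / 2)"
  proof (rule has_bochner_integral_FTC_Icc_nonneg[where F="\<lambda>q. ln (\<tau>\<^sup>2 + q\<^sup>2) / 2"])
    fix q :: real assume "q \<in> {0..r}"
    then have q: "0 \<le> q" "q \<le> r" by auto
    have "((\<lambda>q. ln (\<tau>\<^sup>2 + q\<^sup>2)) has_real_derivative (1 / (\<tau>\<^sup>2 + q\<^sup>2) * (2 * q))) (at q)"
      by (auto intro!: derivative_eq_intros tq)
    then have "((\<lambda>q. ln (\<tau>\<^sup>2 + q\<^sup>2) / 2) has_real_derivative (1 / (\<tau>\<^sup>2 + q\<^sup>2) * (2 * q)) / 2) (at q)"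
      by (rule DERIV_cdivide)
    moreover have "1 / S * (2 * q) / 2 = q / S" for S by simp
    ultimately show "((\<lambda>q. ln (\<tau>\<^sup>2 + q\<^sup>2) / 2) has_real_derivative g1 q) (at q)" by (simp only: g1_def)
    show "0 \<le> g1 q" using q tq[of q] by (simp add: g1_def)
  qed (use r in auto)
  have G2: "has_bochner_integral lborel (\<lambda>q. g2 q * indicator {0..r} q)
    ((- \<tau>\<^sup>2 / 2) * inverse (\<tau>\<^sup>2 + r\<^sup>2) - (- \<tau>\<^sup>2 / 2) * inverse (\<tau>\<^sup>2 + 0\<^sup>2))"
  proof (rule has_bochner_integral_FTC_Icc_nonneg[where F="\<lambda>q. (- \<tau>\<^sup>2 / 2) * inverse (\<tau>\<^sup>2 + q\<^sup>2)"])
    fix q :: real assume "q \<in> {0..r}"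
    then have q: "0 \<le> q" "q \<le> r" by auto
    have "\<tau>\<^sup>2 + q\<^sup>2 \<noteq> 0" using tq[of q] by linarith
    then have "((\<lambda>q. inverse (\<tau>\<^sup>2 + q\<^sup>2)) has_real_derivative - (2 * q * inverse ((\<tau>\<^sup>2 + q\<^sup>2) ^ Suc (Suc 0)))) (at q)"
      by (intro DERIV_inverse_fun) (auto intro!: derivative_eq_intros)
    then have "((\<lambda>q. (- \<tau>\<^sup>2 / 2) * inverse (\<tau>\<^sup>2 + q\<^sup>2)) has_real_derivative
      (- \<tau>\<^sup>2 / 2) * - (2 * q * inverse ((\<tau>\<^sup>2 + q\<^sup>2) ^ Suc (Suc 0)))) (at q)"
      by (rule DERIV_cmult)
    moreover have "(- \<tau>\<^sup>2 / 2) * - (2 * q * inverse ((\<tau>\<^sup>2 + q\<^sup>2) ^ Suc (Suc 0))) = g2 q"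
    proof -
      have A: "(- t / 2) * - (2 * q * i) = q * t * i" for t i :: real by simp
      have B: "q * t / S\<^sup>2 = q * t * inverse (S ^ Suc (Suc 0))" for t S :: real
        by (simp only: divide_inverse numeral_2_eq_2)
      show ?thesis unfolding g2_def by (rule trans[OF A B[symmetric]])
    qed
    ultimately show "((\<lambda>q. (- \<tau>\<^sup>2 / 2) * inverse (\<tau>\<^sup>2 + q\<^sup>2)) has_real_derivative g2 q) (at q)" by simp
    show "0 \<le> g2 q" using q by (simp add: g2_def)
  qed (use r in auto)
  have F1: "integrable lborel (\<lambda>q. indicator {0<..<r} q * f q)"
  proof (rule Bochner_Integration.integrable_bound)
    show "integrable lborel (\<lambda>q. g1 q * indicator {0..r} q)" using G1 by (simp add: has_bochner_integral_iff)
    show "AE q in lborel. norm (indicator {0<..<r} q * f q) \<le> norm (g1 q * indicator {0..r} q)"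
    proof (rule AE_I2)
      fix q :: real
      show "norm (indicator {0<..<r} q * f q) \<le> norm (g1 q * indicator {0..r} q)"
      proof (cases "0 < q \<and> q < r")
        case True
        have "0 \<le> f q" using True by (simp add: f_def)
        then show ?thesis using True fg(1)[of q] by simp
      qed simp
    qed
  qed measurable
  have "(LINT q|lborel. indicator {0<..<r} q * f q) \<le> (LINT q|lborel. g1 q * indicator {0..r} q)"
  proof (rule integral_mono[OF F1])
    show "integrable lborel (\<lambda>q. g1 q * indicator {0..r} q)" using G1 by (simp add: has_bochner_integral_iff)
    show "indicator {0<..<r} q * f q \<le> g1 q * indicator {0..r} q" for q
      using fg(1)[of q] tq[of q] by (auto simp: indicator_def g1_def)
  qed
  moreover have "(LINT q|lborel. g1 q * indicator {0..r} q - real m * (g2 q * indicator {0..r} q)) \<le> (LINT q|lborel. indicator {0<..<r} q * f q)"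
  proof (rule integral_mono_AE[OF _ F1])
    show "integrable lborel (\<lambda>q. g1 q * indicator {0..r} q - real m * (g2 q * indicator {0..r} q))"
      using G1 G2 by (auto simp: has_bochner_integral_iff)
    have "AE q in lborel. q \<noteq> 0 \<and> q \<noteq> r" by (auto intro: AE_lborel_singleton)
    then show "AE q in lborel. g1 q * indicator {0..r} q - real m * (g2 q * indicator {0..r} q) \<le> indicator {0<..<r} q * f q"
      by eventually_elim (use fg(2) in \<open>auto simp: indicator_def\<close>)
  qed
  ultimately have bounds: "(LINT q|lborel. indicator {0<..<r} q * f q) \<le> ln (\<tau>\<^sup>2 + r\<^sup>2) / 2 - ln (\<tau>\<^sup>2) / 2"
    "ln (\<tau>\<^sup>2 + r\<^sup>2) / 2 - ln (\<tau>\<^sup>2) / 2 - real m * (1 / 2 - \<tau>\<^sup>2 / 2 * inverse (\<tau>\<^sup>2 + r\<^sup>2)) \<le> (LINT q|lborel. indicator {0<..<r} q * f q)"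
    using G1 G2 t2 by (auto simp: has_bochner_integral_iff)
  have "real m * (1 / 2 - \<tau>\<^sup>2 / 2 * inverse (\<tau>\<^sup>2 + r\<^sup>2)) \<le> real m * (1 / 2)"
    using tq[of r] by (intro mult_left_mono) auto
  moreover have "ln (\<tau>\<^sup>2) / 2 = - ln (1 / \<bar>\<tau>\<bar>)"
  proof -
    have "ln (\<bar>\<tau>\<bar>\<^sup>2) = 2 * ln \<bar>\<tau>\<bar>" using \<tau> by (subst ln_realpow) auto
    then show ?thesis using \<tau> by (simp add: ln_div)
  qed
  moreover have "ln r \<le> ln (\<tau>\<^sup>2 + r\<^sup>2) / 2" "ln (\<tau>\<^sup>2 + r\<^sup>2) / 2 \<le> ln r + ln 2"
  proof -
    have r2: "ln (r\<^sup>2) = 2 * ln r" using r by (subst ln_realpow) auto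
    have "ln (r\<^sup>2) \<le> ln (\<tau>\<^sup>2 + r\<^sup>2)" using r t2 by (subst ln_le_cancel_iff) (auto simp: add_pos_pos)
    then show "ln r \<le> ln (\<tau>\<^sup>2 + r\<^sup>2) / 2" using r2 by simp
    have "\<tau>\<^sup>2 \<le> r\<^sup>2" using \<tau> r by (metis abs_le_square_iff abs_of_pos)
    then have "\<tau>\<^sup>2 + r\<^sup>2 \<le> 4 * r\<^sup>2" using zero_le_power2[of r] by linarith
    then have "\<tau>\<^sup>2 + r\<^sup>2 \<le> (r * 2)\<^sup>2" by (simp add: power_mult_distrib)
    then have "ln (\<tau>\<^sup>2 + r\<^sup>2) \<le> ln ((r * 2)\<^sup>2)" using r t2 by (subst ln_le_cancel_iff) (auto simp: add_pos_pos)
    also have "\<dots> = real 2 * ln (r * 2)" by (rule ln_realpow)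
    also have "ln (r * 2) = ln r + ln 2" using r by (simp add: ln_mult)
    finally show "ln (\<tau>\<^sup>2 + r\<^sup>2) / 2 \<le> ln r + ln 2" by simp
  qed
  moreover have "0 \<le> ln (2::real)" by simp
  ultimately show ?thesis using bounds unfolding f_def by linarith
qed

lemma halfline_derivative_integral_zero:
  fixes F f :: "real \<Rightarrow> real"
  assumes "\<And>q. 0 < q \<Longrightarrow> (F has_real_derivative f q) (at q)" "\<And>q. 0 < q \<Longrightarrow> isCont f q"
    and int: "integrable lborel (\<lambda>q. indicator {0<..} q * f q)"
    and "(F \<longlongrightarrow> 0) (at_right 0)" "(F \<longlongrightarrow> 0) at_top"
  shows "(LINT q|lborel. indicator {0<..} q * f q) = 0"
proof -
  have e: "einterval 0 \<infinity> = {0<..}" by (auto simp: einterval_def zero_ereal_def)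
  have "(LBINT q=ereal 0..\<infinity>. f q) = 0 - 0"
  proof (rule interval_integral_FTC_integrable)
    show "set_integrable lborel (einterval (ereal 0) \<infinity>) f"
      using int by (simp add: set_integrable_def e flip: zero_ereal_def)
  qed (use assms in \<open>auto simp: has_real_derivative_iff_has_vector_derivative[symmetric] ereal_tendsto_simps1\<close>)
  then show ?thesis
    by (simp add: interval_lebesgue_integral_def set_lebesgue_integral_def e flip: zero_ereal_def)
qed

lemma profile_DERIV:
  fixes P q :: real
  assumes "0 < q"
  shows "((\<lambda>q. q ^ Suc k * (1 + q\<^sup>2) powr (- P / 2)) has_real_derivative
    real (Suc k) * q ^ k * (1 + q\<^sup>2) powr (- P / 2) - P * q ^ (k + 2) * (1 + q\<^sup>2) powr (- (P + 2) / 2)) (at q)"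
proof -
  have pos: "0 < 1 + q\<^sup>2" by (simp add: add_pos_nonneg)
  have "((\<lambda>q. 1 + q\<^sup>2) has_real_derivative 2 * q) (at q)" by (auto intro!: derivative_eq_intros)
  then have "((\<lambda>q. (1 + q\<^sup>2) powr (- P / 2)) has_real_derivative (- P / 2) * (1 + q\<^sup>2) powr (- P / 2 - 1) * (2 * q)) (at q)"
    using has_real_derivative_powr[OF pos, of "- P / 2"] by (rule DERIV_chain2[rotated])
  moreover have "((\<lambda>q. q ^ Suc k) has_real_derivative real (Suc k) * q ^ k) (at q)"
    using DERIV_pow[of "Suc k" q UNIV] by simp
  ultimately have D: "((\<lambda>q. q ^ Suc k * (1 + q\<^sup>2) powr (- P / 2)) has_real_derivative
    real (Suc k) * q ^ k * (1 + q\<^sup>2) powr (- P / 2) + (- P / 2) * (1 + q\<^sup>2) powr (- P / 2 - 1) * (2 * q) * q ^ Suc k) (at q)"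
    by (rule DERIV_mult[rotated])
  have e: "- P / 2 - 1 = - (P + 2) / 2" by simp
  have gen: "a + (- P / 2) * X * (2 * q) * q ^ Suc k = a - P * q ^ (k + 2) * X" for a X
    by (simp add: power_add power2_eq_square)
  show ?thesis by (rule DERIV_cong[OF D]) (unfold e, rule gen)
qed

lemma profile_tendsto_at_top:
  fixes P :: real
  assumes "real k < P"
  shows "((\<lambda>q. q ^ k * (1 + q\<^sup>2) powr (- P / 2)) \<longlongrightarrow> 0) at_top"
proof (rule tendsto_sandwich[OF _ _ tendsto_const])
  show "\<forall>\<^sub>F q in at_top. 0 \<le> q ^ k * (1 + q\<^sup>2) powr (- P / 2)"
    using eventually_ge_at_top[of 0] by eventually_elim simp
  show "\<forall>\<^sub>F q in at_top. q ^ k * (1 + q\<^sup>2) powr (- P / 2) \<le> q powr (real k - P)"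
    using eventually_gt_at_top[of 0]
  proof eventually_elim
    case (elim q)
    then show ?case using profile_le_powr[of q P k 1] assms by simp
  qed
  show "((\<lambda>q. q powr (real k - P)) \<longlongrightarrow> 0) at_top"
    using assms by (intro tendsto_neg_powr filterlim_ident) auto
qed

lemma profile_tendsto_at_0:
  fixes P :: real
  shows "((\<lambda>q. q ^ Suc k * (1 + q\<^sup>2) powr (- P / 2)) \<longlongrightarrow> 0) (at_right 0)"
proof -
  have "((\<lambda>q. q ^ Suc k * (1 + q\<^sup>2) powr (- P / 2)) \<longlongrightarrow> 0 ^ Suc k * (1 + 0\<^sup>2) powr (- P / 2)) (at_right (0::real))"
    by (intro tendsto_intros) auto
  then show ?thesis by simp
qed

definition profile_mass :: "nat \<Rightarrow> real \<Rightarrow> real" where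
  "profile_mass k P = (LINT q|lborel. indicator {0<..} q * (q ^ k * (1 + q\<^sup>2) powr (- P / 2)))"

lemma profile_integrable_1:
  "real k + 1 < P \<Longrightarrow> integrable lborel (\<lambda>q. indicator {0<..} q * (q ^ k * (1 + q\<^sup>2) powr (- P / 2)))"
  using profile_integrable[of 1 k P] by simp

text \<open>The integral of the derivative of \<open>q ^ (k + 1) * (1 + q\<^sup>2) powr (- P / 2)\<close> over the half-line is 0.\<close>

lemma profile_mass_recursion:
  fixes P :: real
  assumes P: "real k + 1 < P"
  shows "real (Suc k) * profile_mass k P = P * profile_mass (k + 2) (P + 2)"
proof -
  let ?f = "\<lambda>q. real (Suc k) * q ^ k * (1 + q\<^sup>2) powr (- P / 2) - P * q ^ (k + 2) * (1 + q\<^sup>2) powr (- (P + 2) / 2)"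
  have i: "integrable lborel (\<lambda>q. indicator {0<..} q * (q ^ k * (1 + q\<^sup>2) powr (- P / 2)))"
    "integrable lborel (\<lambda>q. indicator {0<..} q * (q ^ (k + 2) * (1 + q\<^sup>2) powr (- (P + 2) / 2)))"
    using P by (intro profile_integrable_1; simp)+
  have split: "indicator {0<..} q * ?f q = real (Suc k) * (indicator {0<..} q * (q ^ k * (1 + q\<^sup>2) powr (- P / 2)))
     - P * (indicator {0<..} q * (q ^ (k + 2) * (1 + q\<^sup>2) powr (- (P + 2) / 2)))" for q :: real
    by (simp only: right_diff_distrib mult_ac)
  have "(LINT q|lborel. indicator {0<..} q * ?f q) = 0"
  proof (rule halfline_derivative_integral_zero)
    show "((\<lambda>q. q ^ Suc k * (1 + q\<^sup>2) powr (- P / 2)) has_real_derivative ?f q) (at q)" if "0 < q" for q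
      by (rule profile_DERIV[OF that])
    show "isCont ?f q" if "0 < q" for q
    proof -
      have "1 + q\<^sup>2 \<noteq> 0" using zero_le_power2[of q] by linarith
      then show ?thesis by (intro continuous_intros) auto
    qed
    show "integrable lborel (\<lambda>q. indicator {0<..} q * ?f q)"
      unfolding split using i by (intro Bochner_Integration.integrable_diff integrable_mult_right)
    show "((\<lambda>q. q ^ Suc k * (1 + q\<^sup>2) powr (- P / 2)) \<longlongrightarrow> 0) at_top"
      using P by (intro profile_tendsto_at_top) simp
  qed (rule profile_tendsto_at_0)
  also have "(LINT q|lborel. indicator {0<..} q * ?f q) = real (Suc k) * profile_mass k P - P * profile_mass (k + 2) (P + 2)"
    unfolding split profile_mass_def using i by (subst Bochner_Integration.integral_diff) (auto intro!: integrable_mult_right)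
  finally show ?thesis by simp
qed

lemma profile_mass_split:
  fixes P :: real
  assumes P: "real k + 1 < P"
  shows "profile_mass k P = profile_mass k (P + 2) + profile_mass (k + 2) (P + 2)"
proof -
  have i: "integrable lborel (\<lambda>q. indicator {0<..} q * (q ^ k * (1 + q\<^sup>2) powr (- (P + 2) / 2)))"
    "integrable lborel (\<lambda>q. indicator {0<..} q * (q ^ (k + 2) * (1 + q\<^sup>2) powr (- (P + 2) / 2)))"
    using P by (intro profile_integrable_1; simp)+
  have "profile_mass k P = (LINT q|lborel. indicator {0<..} q * (q ^ k * (1 + q\<^sup>2) powr (- (P + 2) / 2))
     + indicator {0<..} q * (q ^ (k + 2) * (1 + q\<^sup>2) powr (- (P + 2) / 2)))"
    unfolding profile_mass_def
  proof (rule Bochner_Integration.integral_cong[OF refl])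
    fix q :: real
    have pos: "0 < 1 + q\<^sup>2" by (simp add: add_pos_nonneg)
    have e: "- P / 2 = 1 + - (P + 2) / 2" by (simp add: field_simps)
    have "(1 + q\<^sup>2) powr (- P / 2) = (1 + q\<^sup>2) * (1 + q\<^sup>2) powr (- (P + 2) / 2)"
      unfolding e powr_add using pos by simp
    then show "indicator {0<..} q * (q ^ k * (1 + q\<^sup>2) powr (- P / 2)) =
      indicator {0<..} q * (q ^ k * (1 + q\<^sup>2) powr (- (P + 2) / 2))
     + indicator {0<..} q * (q ^ (k + 2) * (1 + q\<^sup>2) powr (- (P + 2) / 2))"
    proof -
      assume eq: "(1 + q\<^sup>2) powr (- P / 2) = (1 + q\<^sup>2) * (1 + q\<^sup>2) powr (- (P + 2) / 2)"
      have gen: "i * (a * ((1 + b) * X)) = i * (a * X) + i * (a * b * X)" for i a b X :: real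
        by (simp add: algebra_simps)
      show ?thesis unfolding eq power_add by (rule gen)
    qed
  qed
  also have "\<dots> = profile_mass k (P + 2) + profile_mass (k + 2) (P + 2)"
    unfolding profile_mass_def using i by (rule Bochner_Integration.integral_add)
  finally show ?thesis .
qed

lemma profile_mass_pos:
  fixes P :: real
  assumes P: "real k + 1 < P"
  shows "0 < profile_mass k P"
proof -
  let ?f = "\<lambda>q. indicator {0<..} q * (q ^ k * (1 + q\<^sup>2) powr (- P / 2))"
  have pos: "0 < 1 + q\<^sup>2" for q :: real by (simp add: add_pos_nonneg)
  have "profile_mass k P \<noteq> 0"
  proof
    assume "profile_mass k P = 0"
    moreover have "AE q in lborel. 0 \<le> ?f q" by (auto simp: indicator_def)
    ultimately have "AE q in lborel. ?f q = 0"
      using integral_nonneg_eq_0_iff_AE[OF profile_integrable_1[OF P]] unfolding profile_mass_def by blast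
    then have "AE q in lborel. q \<notin> {0<..<1::real}"
    proof eventually_elim
      case (elim q)
      then show ?case using pos[of q] by (auto simp: indicator_def)
    qed
    then have "emeasure lborel {0<..<1::real} = 0"
      by (subst (asm) AE_iff_measurable[of "{0<..<1}"]) auto
    then show False by simp
  qed
  moreover have "0 \<le> profile_mass k P"
    unfolding profile_mass_def by (intro Bochner_Integration.integral_nonneg) (auto simp: indicator_def)
  ultimately show ?thesis by simp
qed

text \<open>The recursion and the splitting of \<open>profile_mass\<close> express the integral in \<open>c_star\<close>, with its sign-changing
numerator, by one integral with positive integrand.\<close>

lemma c_star_profile_factor:
  assumes n: "2 \<le> n" and s: "1 / 2 < s"
  shows "(real n + 2 * s) / 2 * (LINT q:{0<..}|lborel. q ^ (n - 2) * ((real n - 1) - q\<^sup>2) / (1 + q\<^sup>2) powr ((real n + 2 * s + 2) / 2))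
    = s * (2 * s - 1) * profile_mass n (real n + 2 * s)"
proof -
  define P where "P = real n + 2 * s"
  obtain k where k: "n = Suc (Suc k)" using n by (metis add_2_eq_Suc le_Suc_ex)
  have i: "integrable lborel (\<lambda>q. indicator {0<..} q * (q ^ k * (1 + q\<^sup>2) powr (- (P + 2) / 2)))"
    "integrable lborel (\<lambda>q. indicator {0<..} q * (q ^ (k + 2) * (1 + q\<^sup>2) powr (- (P + 2) / 2)))"
    using s by (intro profile_integrable_1; simp add: P_def k)+
  let ?A = "profile_mass k (P + 2)" and ?B = "profile_mass (k + 2) (P + 2)" and ?I = "profile_mass n P"
  have "(LINT q:{0<..}|lborel. q ^ (n - 2) * ((real n - 1) - q\<^sup>2) / (1 + q\<^sup>2) powr ((real n + 2 * s + 2) / 2))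
    = (LINT q|lborel. (real n - 1) * (indicator {0<..} q * (q ^ k * (1 + q\<^sup>2) powr (- (P + 2) / 2)))
     - indicator {0<..} q * (q ^ (k + 2) * (1 + q\<^sup>2) powr (- (P + 2) / 2)))"
    unfolding set_lebesgue_integral_def
  proof (rule Bochner_Integration.integral_cong[OF refl])
    fix q :: real
    have e: "- (P + 2) / 2 = - ((real n + 2 * s + 2) / 2)" by (simp add: P_def field_simps)
    have nk: "n - 2 = k" by (simp add: k)
    have "(1 + q\<^sup>2) powr (- (P + 2) / 2) = 1 / (1 + q\<^sup>2) powr ((real n + 2 * s + 2) / 2)"
      unfolding e by (rule powr_minus_divide)
    then show "indicator {0<..} q *\<^sub>R (q ^ (n - 2) * ((real n - 1) - q\<^sup>2) / (1 + q\<^sup>2) powr ((real n + 2 * s + 2) / 2))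
      = (real n - 1) * (indicator {0<..} q * (q ^ k * (1 + q\<^sup>2) powr (- (P + 2) / 2)))
     - indicator {0<..} q * (q ^ (k + 2) * (1 + q\<^sup>2) powr (- (P + 2) / 2))"
    proof -
      assume X: "(1 + q\<^sup>2) powr (- (P + 2) / 2) = 1 / (1 + q\<^sup>2) powr ((real n + 2 * s + 2) / 2)"
      have gen: "i *\<^sub>R (a * (c - b) / D) = c * (i * (a * (1 / D))) - i * (a * b * (1 / D))" for i a b c D :: real
        by (simp add: algebra_simps diff_divide_distrib)
      show ?thesis unfolding X nk power_add by (rule gen)
    qed
  qed
  also have "\<dots> = (real n - 1) * ?A - ?B"
    unfolding profile_mass_def using i by (subst Bochner_Integration.integral_diff) (auto intro!: integrable_mult_right)
  also have "(real n - 1) * ?A = (2 * s + 1) * ?B"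
  proof -
    have kP: "real k + 1 < P" using s by (simp add: P_def k)
    have "(real n - 1) * (?A + ?B) = P * ?B"
      using profile_mass_recursion[OF kP] profile_mass_split[OF kP] by (simp add: k)
    then show ?thesis by (simp add: P_def algebra_simps)
  qed
  finally have J: "(LINT q:{0<..}|lborel. q ^ (n - 2) * ((real n - 1) - q\<^sup>2) / (1 + q\<^sup>2) powr ((real n + 2 * s + 2) / 2)) = 2 * s * ?B"
    by (simp add: algebra_simps)
  have nP: "real n + 1 < P" using s by (simp add: P_def)
  have "(real n + 1) * ?I = P * profile_mass (n + 2) (P + 2)"
    using profile_mass_recursion[OF nP] by (simp add: add.commute)
  moreover have "profile_mass (n + 2) (P + 2) = ?I - ?B"
    using profile_mass_split[OF nP] by (simp add: k)
  ultimately have "(real n + 1) * ?I = P * (?I - ?B)" by (simp only:)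
  then have PB: "P * ?B = (2 * s - 1) * ?I" by (simp add: P_def algebra_simps)
  have "(real n + 2 * s) / 2 * (2 * s * ?B) = s * (P * ?B)" by (simp add: P_def)
  then show ?thesis unfolding J PB by (simp add: P_def)
qed

section \<open>The transition as a distribution function\<close>

text \<open>A distribution function on the line with a continuous, positive and bounded density.\<close>

locale transition =
  fixes \<phi> f :: "real \<Rightarrow> real" and Bd :: real
  assumes der: "(\<phi> has_real_derivative f x) (at x)"
    and cont: "isCont f x"
    and f_pos: "0 < f x" and f_le: "f x \<le> Bd"
    and lim_bot: "(\<phi> \<longlongrightarrow> 0) at_bot" and lim_top: "(\<phi> \<longlongrightarrow> 1) at_top"
begin

definition mu :: "real measure" where "mu = density lborel (\<lambda>x. ennreal (f x))"

lemma f_borel[measurable]: "f \<in> borel_measurable borel"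
  using cont by (intro borel_measurable_continuous_onI continuous_at_imp_continuous_on) auto

lemma phi_borel[measurable]: "\<phi> \<in> borel_measurable borel"
  using der by (intro borel_measurable_continuous_onI continuous_at_imp_continuous_on) (auto intro: DERIV_isCont)

lemma sets_mu[measurable_cong, simp]: "sets mu = sets borel"
  by (simp add: mu_def)

lemma space_mu[simp]: "space mu = UNIV" by (simp add: mu_def)

lemma emeasure_mu_atLeast: "emeasure mu {a..} = ennreal (1 - \<phi> a)"
proof -
  have "emeasure mu {a..} = (\<integral>\<^sup>+x. ennreal (f x) * indicator {a..} x \<partial>lborel)"
    by (simp add: mu_def emeasure_density)
  also have "\<dots> = ennreal (1 - \<phi> a)"
    using der f_pos lim_top by (intro nn_integral_FTC_atLeast) (auto intro: less_imp_le)
  finally show ?thesis .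
qed

lemma emeasure_mu_UNIV: "emeasure mu UNIV = 1"
proof -
  have "(\<lambda>n. emeasure mu {- real n..}) \<longlonglongrightarrow> emeasure mu (\<Union>n. {- real n..})"
    by (intro Lim_emeasure_incseq) (auto simp: incseq_def)
  moreover have "(\<Union>n. {- real n..}) = (UNIV :: real set)"
    by (auto) (metis minus_le_iff real_arch_simple)
  moreover have "(\<lambda>n. ennreal (1 - \<phi> (- real n))) \<longlonglongrightarrow> ennreal (1 - 0)"
  proof (intro tendsto_ennrealI tendsto_diff tendsto_const)
    show "(\<lambda>n. \<phi> (- real n)) \<longlonglongrightarrow> 0"
      by (rule filterlim_compose[OF lim_bot]) (simp add: filterlim_uminus_at_bot filterlim_real_sequentially)
  qed
  ultimately show ?thesis using LIMSEQ_unique by (auto simp: emeasure_mu_atLeast)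
qed

sublocale mu: prob_space mu
  by (rule prob_spaceI) (simp add: emeasure_mu_UNIV)

lemma measure_mu_lessThan: "measure mu {..<u} = \<phi> u"
proof -
  have "\<phi> u \<le> 1"
  proof (rule tendsto_lowerbound[OF lim_top])
    show "\<forall>\<^sub>F x in at_top. \<phi> u \<le> \<phi> x"
      using eventually_ge_at_top[of u]
    proof eventually_elim
      case (elim x)
      show ?case by (rule DERIV_nonneg_imp_nondecreasing[OF elim]) (use der f_pos less_imp_le in blast)
    qed
  qed simp
  then have 1: "measure mu {u..} = 1 - \<phi> u" by (simp add: measure_def emeasure_mu_atLeast)
  have "{..<u} = space mu - {u..}" by auto
  then show ?thesis using 1 mu.prob_compl[of "{u..}"] by simp
qed

lemma integral_mu:
  fixes g :: "real \<Rightarrow> real"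
  assumes "g \<in> borel_measurable borel"
  shows "(LINT x|lborel. g x * f x) = (LINT x|mu. g x)"
  unfolding mu_def using assms f_pos
  by (subst integral_density) (auto simp: mult.commute intro: less_imp_le)

text \<open>The law of \<open>Y - X\<close> for independent \<open>X\<close>, \<open>Y\<close> with distribution function \<open>\<phi>\<close>.\<close>

definition gap :: "real measure" where
  "gap = distr (mu \<Otimes>\<^sub>M mu) borel (\<lambda>p. snd p - fst p)"

sublocale mumu: pair_prob_space mu mu by unfold_locales

lemma sets_gap[measurable_cong, simp]: "sets gap = sets borel" by (simp add: gap_def)
lemma space_gap[simp]: "space gap = UNIV" by (simp add: gap_def)

sublocale gap: prob_space gap
  unfolding gap_def by (rule mumu.prob_space_distr) simp

lemma nn_integral_gap:
  assumes [measurable]: "h \<in> borel_measurable borel"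
  shows "(\<integral>\<^sup>+t. h t \<partial>gap) = (\<integral>\<^sup>+x. (\<integral>\<^sup>+a. h (a - x) \<partial>mu) \<partial>mu)"
proof -
  have "(\<integral>\<^sup>+t. h t \<partial>gap) = (\<integral>\<^sup>+p. h (snd p - fst p) \<partial>(mu \<Otimes>\<^sub>M mu))"
    unfolding gap_def by (subst nn_integral_distr) auto
  also have "\<dots> = (\<integral>\<^sup>+x. (\<integral>\<^sup>+a. h (a - x) \<partial>mu) \<partial>mu)"
    by (subst mu.nn_integral_fst[symmetric]) auto
  finally show ?thesis .
qed

text \<open>The law of the difference has a density bounded by \<open>Bd\<close>.\<close>

lemma nn_integral_gap_le:
  assumes [measurable]: "h \<in> borel_measurable borel"
  shows "(\<integral>\<^sup>+t. h t \<partial>gap) \<le> ennreal Bd * (\<integral>\<^sup>+t. h t \<partial>lborel)"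
proof -
  have inner: "(\<integral>\<^sup>+a. h (a - x) \<partial>mu) \<le> ennreal Bd * (\<integral>\<^sup>+t. h t \<partial>lborel)" for x
  proof -
    have "(\<integral>\<^sup>+a. h (a - x) \<partial>mu) = (\<integral>\<^sup>+a. ennreal (f a) * h (a - x) \<partial>lborel)"
      unfolding mu_def by (subst nn_integral_density) auto
    also have "\<dots> \<le> (\<integral>\<^sup>+a. ennreal Bd * h (a - x) \<partial>lborel)"
      using f_le by (intro nn_integral_mono mult_right_mono ennreal_leI) auto
    also have "\<dots> = ennreal Bd * (\<integral>\<^sup>+a. h (a - x) \<partial>lborel)" by (rule nn_integral_cmult) measurable
    also have "(\<integral>\<^sup>+a. h (a - x) \<partial>lborel) = (\<integral>\<^sup>+t. h t \<partial>lborel)"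
      using nn_integral_real_affine[of "\<lambda>a. h (a - x)" 1 x] by simp
    finally show ?thesis .
  qed
  have "(\<integral>\<^sup>+t. h t \<partial>gap) \<le> (\<integral>\<^sup>+x. ennreal Bd * (\<integral>\<^sup>+t. h t \<partial>lborel) \<partial>mu)"
    unfolding nn_integral_gap[OF assms] by (intro nn_integral_mono inner)
  then show ?thesis by (simp add: emeasure_mu_UNIV)
qed

lemma phi_bounds: "0 \<le> \<phi> u" "\<phi> u \<le> 1"
  using measure_mu_lessThan[of u] by (metis measure_nonneg, metis mu.prob_le_1)

lemma phi_average: "(LINT x|mu. \<phi> (x + u)) = measure gap {..<u}"
proof -
  have "measure gap {..<u} = enn2real (\<integral>\<^sup>+t. indicator {..<u} t \<partial>gap)" by (simp add: measure_def)
  also have "(\<integral>\<^sup>+t. indicator {..<u} t \<partial>gap) = (\<integral>\<^sup>+x. (\<integral>\<^sup>+a. indicator {..<u} (a - x) \<partial>mu) \<partial>mu)"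
    by (rule nn_integral_gap) measurable
  also have "\<dots> = (\<integral>\<^sup>+x. ennreal (\<phi> (x + u)) \<partial>mu)"
  proof (rule nn_integral_cong)
    fix x
    have "(\<integral>\<^sup>+a. indicator {..<u} (a - x) \<partial>mu) = (\<integral>\<^sup>+a. indicator {..<x + u} a \<partial>mu)"
      by (intro nn_integral_cong) (auto simp: indicator_def)
    also have "\<dots> = emeasure mu {..<x + u}" by simp
    also have "\<dots> = ennreal (\<phi> (x + u))" by (simp add: mu.emeasure_eq_measure measure_mu_lessThan)
    finally show "(\<integral>\<^sup>+a. indicator {..<u} (a - x) \<partial>mu) = ennreal (\<phi> (x + u))" .
  qed
  also have "enn2real \<dots> = (LINT x|mu. \<phi> (x + u))"
    using phi_bounds by (intro integral_eq_nn_integral[symmetric]) auto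
  finally show ?thesis by simp
qed

lemma phi_lipschitz: "\<bar>\<phi> u - \<phi> v\<bar> \<le> Bd * \<bar>u - v\<bar>"
proof -
  have main: "\<bar>\<phi> v - \<phi> u\<bar> \<le> Bd * (v - u)" if uv: "u < v" for u v
  proof -
    obtain z where z: "u < z" "z < v" "\<phi> v - \<phi> u = (v - u) * f z"
      using MVT2[OF uv, of \<phi> f] der by auto
    have "(v - u) * f z \<le> (v - u) * Bd" using uv f_le by (intro mult_left_mono) auto
    moreover have "0 \<le> (v - u) * f z" using uv f_pos[of z] by (intro mult_nonneg_nonneg) auto
    ultimately show ?thesis using z by (simp add: mult.commute)
  qed
  show ?thesis
  proof (cases u v rule: linorder_cases)
    case less then show ?thesis using main[of u v] by (simp add: abs_minus_commute)
  next
    case greater then show ?thesis using main[of v u] by simp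
  qed simp
qed

text \<open>For fixed \<open>z\<close>, the average over \<open>X\<close> of \<open>\<phi> (X + u)\<close> is the probability of \<open>Y < X + u\<close>, that is, the mass that \<open>gap\<close>
gives to \<open>{..<u}\<close>. So both sides are the integral over \<open>z\<close> of the difference of two such masses. The
exchange of the integrals is justified by the bound \<open>min 1 (Bd * \<bar>F z - l z\<bar>)\<close> for the difference.\<close>

lemma averaged_transition_integral:
  fixes F l :: "'a::euclidean_space \<Rightarrow> real" and k :: "'a \<Rightarrow> real"
  assumes [measurable]: "F \<in> borel_measurable borel" "l \<in> borel_measurable borel" "k \<in> borel_measurable borel"
    and k: "\<And>z. 0 \<le> k z"
    and int: "integrable lborel (\<lambda>z. min 1 (Bd * \<bar>F z - l z\<bar>) * k z)"
  shows "(LINT x|mu. LINT z|lborel. (\<phi> (x + F z) - \<phi> (x + l z)) * k z)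
      = (LINT t|gap. LINT z|lborel. (indicator {z. t < F z} z - indicator {z. t < l z} z) * k z)"
    and "integrable gap (\<lambda>t. LINT z|lborel. (indicator {z. t < F z} z - indicator {z. t < l z} z) * k z)"
    and "(\<lambda>x. LINT z|lborel. (\<phi> (x + F z) - \<phi> (x + l z)) * k z) \<in> borel_measurable borel"
proof -
  define m where "m z = min 1 (Bd * \<bar>F z - l z\<bar>)" for z
  have [measurable]: "m \<in> borel_measurable borel" unfolding m_def by measurable
  have Bd0: "0 \<le> Bd" using f_pos[of 0] f_le[of 0] by linarith
  have m0: "0 \<le> m z" for z using Bd0 by (simp add: m_def)
  have mk: "integrable lborel (\<lambda>z. m z * k z)" using int by (simp add: m_def)
  have dphi: "\<bar>\<phi> (x + F z) - \<phi> (x + l z)\<bar> \<le> m z" for x z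
    using phi_lipschitz[of "x + F z" "x + l z"] phi_bounds[of "x + F z"] phi_bounds[of "x + l z"]
    by (auto simp: m_def abs_le_iff)
  interpret A: pair_sigma_finite mu "lborel :: 'a measure" by unfold_locales
  interpret G: pair_sigma_finite gap "lborel :: 'a measure" by unfold_locales
  show "(\<lambda>x. LINT z|lborel. (\<phi> (x + F z) - \<phi> (x + l z)) * k z) \<in> borel_measurable borel"
    by measurable
  have phi_int: "integrable mu (\<lambda>x. \<phi> (x + u))" for u
    using phi_bounds by (intro mu.integrable_const_bound[of _ 1]) auto
  have I1: "integrable (mu \<Otimes>\<^sub>M lborel) (\<lambda>(x, z). (\<phi> (x + F z) - \<phi> (x + l z)) * k z)"
  proof (rule Bochner_Integration.integrable_bound)
    show "integrable (mu \<Otimes>\<^sub>M lborel) (\<lambda>(x, z). m z * k z)"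
    proof (rule integrableI_bounded)
      have "(\<integral>\<^sup>+p. ennreal (norm (case p of (x, z) \<Rightarrow> m z * k z)) \<partial>(mu \<Otimes>\<^sub>M lborel))
        = (\<integral>\<^sup>+x. (\<integral>\<^sup>+z. ennreal (norm (m z * k z)) \<partial>lborel) \<partial>mu)"
        by (subst lborel.nn_integral_fst[symmetric]) auto
      also have "\<dots> < \<infinity>" using mk by (simp add: integrable_iff_bounded emeasure_mu_UNIV)
      finally show "(\<integral>\<^sup>+p. ennreal (norm (case p of (x, z) \<Rightarrow> m z * k z)) \<partial>(mu \<Otimes>\<^sub>M lborel)) < \<infinity>" .
    qed measurable
    show "AE p in mu \<Otimes>\<^sub>M lborel. norm (case p of (x, z) \<Rightarrow> (\<phi> (x + F z) - \<phi> (x + l z)) * k z)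
      \<le> norm (case p of (x, z) \<Rightarrow> m z * k z)"
      using dphi k m0 by (intro AE_I2) (auto simp: abs_mult intro!: mult_right_mono)
  qed measurable
  have "(LINT x|mu. LINT z|lborel. (\<phi> (x + F z) - \<phi> (x + l z)) * k z)
      = (LINT z|lborel. LINT x|mu. (\<phi> (x + F z) - \<phi> (x + l z)) * k z)"
    by (rule A.Fubini_integral[OF I1, symmetric])
  also have "\<dots> = (LINT z|lborel. (measure gap {..<F z} - measure gap {..<l z}) * k z)"
    using phi_int by (simp add: phi_average)
  finally have 1: "(LINT x|mu. LINT z|lborel. (\<phi> (x + F z) - \<phi> (x + l z)) * k z)
      = (LINT z|lborel. (measure gap {..<F z} - measure gap {..<l z}) * k z)" .
  have gi: "integrable gap (\<lambda>t. indicator {..<u} t :: real)" for u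
    by (intro gap.integrable_const_bound[of _ 1]) auto
  have gapdiff: "(LINT t|gap. indicator {z. t < F z} z - indicator {z. t < l z} z) = measure gap {..<F z} - measure gap {..<l z}" for z
  proof -
    have "(LINT t|gap. indicator {z. t < F z} z - indicator {z. t < l z} z) = (LINT t|gap. indicator {..<F z} t - indicator {..<l z} t)"
      by (intro Bochner_Integration.integral_cong) (auto simp: indicator_def)
    also have "\<dots> = measure gap {..<F z} - measure gap {..<l z}"
      using gi by (subst Bochner_Integration.integral_diff) auto
    finally show ?thesis .
  qed
  have gapabs: "(\<integral>\<^sup>+t. ennreal \<bar>indicator {z. t < F z} z - indicator {z. t < l z} z\<bar> \<partial>gap) \<le> ennreal (m z)" for z
  proof -
    have "(\<integral>\<^sup>+t. ennreal \<bar>indicator {z. t < F z} z - indicator {z. t < l z} z\<bar> \<partial>gap)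
      = (\<integral>\<^sup>+t. ennreal \<bar>indicator {..<F z} t - indicator {..<l z} t\<bar> \<partial>gap)"
      by (intro nn_integral_cong) (auto simp: indicator_def)
    also have "\<dots> = ennreal (LINT t|gap. \<bar>indicator {..<F z} t - indicator {..<l z} t\<bar>)"
      using gi by (intro nn_integral_eq_integral integrable_abs Bochner_Integration.integrable_diff) auto
    also have "(LINT t|gap. \<bar>indicator {..<F z} t - indicator {..<l z} t\<bar>) = \<bar>measure gap {..<F z} - measure gap {..<l z}\<bar>"
    proof (cases "l z \<le> F z")
      case True
      then have "(LINT t|gap. \<bar>indicator {..<F z} t - indicator {..<l z} t :: real\<bar>) = (LINT t|gap. indicator {..<F z} t - indicator {..<l z} t)"
        by (intro Bochner_Integration.integral_cong) (auto simp: indicator_def)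
      moreover have "measure gap {..<l z} \<le> measure gap {..<F z}" using True by (intro gap.finite_measure_mono) auto
      ultimately show ?thesis using gi by (simp add: Bochner_Integration.integral_diff)
    next
      case False
      then have "(LINT t|gap. \<bar>indicator {..<F z} t - indicator {..<l z} t :: real\<bar>) = (LINT t|gap. indicator {..<l z} t - indicator {..<F z} t)"
        by (intro Bochner_Integration.integral_cong) (auto simp: indicator_def)
      moreover have "measure gap {..<F z} \<le> measure gap {..<l z}" using False by (intro gap.finite_measure_mono) auto
      ultimately show ?thesis using gi by (simp add: Bochner_Integration.integral_diff)
    qed
    also have "measure gap {..<F z} - measure gap {..<l z} = (LINT x|mu. \<phi> (x + F z) - \<phi> (x + l z))"
      using phi_int by (simp add: phi_average)
    also have "\<bar>LINT x|mu. \<phi> (x + F z) - \<phi> (x + l z)\<bar> \<le> (LINT x|mu. m z)"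
      using phi_int dphi by (intro order_trans[OF integral_abs_bound] integral_mono) auto
    finally show ?thesis by (simp add: emeasure_mu_UNIV measure_def mu.prob_space ennreal_leI)
  qed
  have I2: "integrable (gap \<Otimes>\<^sub>M lborel) (\<lambda>(t, z). (indicator {z. t < F z} z - indicator {z. t < l z} z) * k z)"
  proof (rule integrableI_bounded)
    have e: "(\<lambda>(t, z). (indicator {z. t < F z} z - indicator {z. t < l z} z) * k z)
      = (\<lambda>(t, z). (indicator {(t, z). t < F z} (t, z) - indicator {(t, z). t < l z} (t, z)) * k z)"
      by (auto simp: fun_eq_iff indicator_def)
    show meas: "(\<lambda>(t, z). (indicator {z. t < F z} z - indicator {z. t < l z} z) * k z) \<in> borel_measurable (gap \<Otimes>\<^sub>M lborel)"
      unfolding e by measurable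
    have "(\<integral>\<^sup>+p. ennreal (norm (case p of (t, z) \<Rightarrow> (indicator {z. t < F z} z - indicator {z. t < l z} z) * k z)) \<partial>(gap \<Otimes>\<^sub>M lborel))
      = (\<integral>\<^sup>+z. (\<integral>\<^sup>+t. ennreal (norm ((indicator {z. t < F z} z - indicator {z. t < l z} z) * k z)) \<partial>gap) \<partial>lborel)"
      using meas by (subst G.nn_integral_snd[symmetric]) auto
    also have "\<dots> \<le> (\<integral>\<^sup>+z. ennreal (m z * k z) \<partial>lborel)"
    proof (rule nn_integral_mono)
      fix z
      have "(\<integral>\<^sup>+t. ennreal (norm ((indicator {z. t < F z} z - indicator {z. t < l z} z) * k z)) \<partial>gap)
        = (\<integral>\<^sup>+t. ennreal \<bar>indicator {z. t < F z} z - indicator {z. t < l z} z\<bar> * ennreal (k z) \<partial>gap)"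
        using k by (intro nn_integral_cong) (simp add: abs_mult ennreal_mult')
      also have "\<dots> = (\<integral>\<^sup>+t. ennreal \<bar>indicator {z. t < F z} z - indicator {z. t < l z} z\<bar> \<partial>gap) * ennreal (k z)"
      proof (rule nn_integral_multc)
        have e: "(\<lambda>t. ennreal \<bar>indicator {z. t < F z} z - indicator {z. t < l z} z\<bar>) = (\<lambda>t. ennreal \<bar>indicator {..<F z} t - indicator {..<l z} t\<bar>)"
          by (auto simp: fun_eq_iff indicator_def)
        show "(\<lambda>t. ennreal \<bar>indicator {z. t < F z} z - indicator {z. t < l z} z\<bar>) \<in> borel_measurable gap"
          unfolding e by measurable
      qed
      also have "\<dots> \<le> ennreal (m z) * ennreal (k z)" by (intro mult_right_mono gapabs) auto
      also have "\<dots> = ennreal (m z * k z)" using m0 k by (simp add: ennreal_mult)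
      finally show "(\<integral>\<^sup>+t. ennreal (norm ((indicator {z. t < F z} z - indicator {z. t < l z} z) * k z)) \<partial>gap) \<le> ennreal (m z * k z)" .
    qed
    also have "\<dots> < \<infinity>"
      using mk m0 k by (simp add: integrable_iff_bounded abs_of_nonneg)
    finally show "(\<integral>\<^sup>+p. ennreal (norm (case p of (t, z) \<Rightarrow> (indicator {z. t < F z} z - indicator {z. t < l z} z) * k z)) \<partial>(gap \<Otimes>\<^sub>M lborel)) < \<infinity>" .
  qed
  show "integrable gap (\<lambda>t. LINT z|lborel. (indicator {z. t < F z} z - indicator {z. t < l z} z) * k z)"
    using G.integrable_fst[OF I2] by simp
  have "(LINT t|gap. LINT z|lborel. (indicator {z. t < F z} z - indicator {z. t < l z} z) * k z)
    = (LINT z|lborel. LINT t|gap. (indicator {z. t < F z} z - indicator {z. t < l z} z) * k z)"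
    by (rule G.Fubini_integral[OF I2, symmetric])
  also have "\<dots> = (LINT z|lborel. (measure gap {..<F z} - measure gap {..<l z}) * k z)"
    by (simp add: gapdiff)
  finally show "(LINT x|mu. LINT z|lborel. (\<phi> (x + F z) - \<phi> (x + l z)) * k z)
      = (LINT t|gap. LINT z|lborel. (indicator {z. t < F z} z - indicator {z. t < l z} z) * k z)"
    using 1 by simp
qed

end

section \<open>The energy of the transition\<close>

text \<open>The right-hand side is the second primitive of \<open>w powr - (1 + 2 * s)\<close> at \<open>c\<close>, taken twice for the two signs of \<open>w\<close>.\<close>

lemma hinge_kernel_integral:
  fixes s c :: real
  assumes s: "1 / 2 < s" and c: "0 < c"
  shows "(\<integral>\<^sup>+w. ennreal (\<bar>w\<bar> powr - (1 + 2 * s)) * ennreal (max 0 (\<bar>w\<bar> - c)) \<partial>lborel)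
    = ennreal (c powr (1 - 2 * s) / (s * (2 * s - 1)))"
proof -
  have i: "integrable lborel (\<lambda>q. indicator {c..} q * q powr (- 2 * s))"
    "integrable lborel (\<lambda>q. indicator {c..} q * q powr (- (1 + 2 * s)))"
    using s c by (intro powr_tail_integral; simp)+
  have pt: "ennreal (indicator {0<..} r * (real DIM(real) * unit_ball_vol (real DIM(real)) * r ^ (DIM(real) - 1)))
      * (ennreal (r powr - (1 + 2 * s)) * ennreal (max 0 (r - c)))
    = ennreal (2 * (indicator {c..} r * r powr (- 2 * s)) - 2 * c * (indicator {c..} r * r powr (- (1 + 2 * s))))" for r :: real
  proof (cases "c \<le> r")
    case True
    then have r: "0 < r" using c by simp
    have "- 2 * s = 1 + - (1 + 2 * s)" by simp
    then have "r powr (- 2 * s) = r * r powr - (1 + 2 * s)" using r by (simp only: powr_add) simp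
    then have "2 * (r powr - (1 + 2 * s) * (r - c)) = 2 * r powr (- 2 * s) - 2 * c * r powr (- (1 + 2 * s))"
      by (simp add: algebra_simps)
    moreover have "indicator {0<..} r * (real DIM(real) * unit_ball_vol (real DIM(real)) * r ^ (DIM(real) - 1)) = 2" using r by simp
    moreover have "max 0 (r - c) = r - c" using True by simp
    moreover have "ennreal 2 * (ennreal a * ennreal b) = ennreal (2 * (a * b))" if "0 \<le> a" "0 \<le> b" for a b
      using that by (simp only: ennreal_mult mult_nonneg_nonneg zero_le_numeral)
    ultimately show ?thesis using True by (simp only: powr_ge_zero diff_ge_0_iff_ge indicator_simps atLeast_iff mult_1)
  qed (use c in \<open>auto simp: indicator_def max_def\<close>)
  have "(\<integral>\<^sup>+w. ennreal (\<bar>w\<bar> powr - (1 + 2 * s)) * ennreal (max 0 (\<bar>w\<bar> - c)) \<partial>lborel)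
    = (\<integral>\<^sup>+r. ennreal (2 * (indicator {c..} r * r powr (- 2 * s)) - 2 * c * (indicator {c..} r * r powr (- (1 + 2 * s)))) \<partial>lborel)"
    using nn_integral_radial[where 'a=real, of "\<lambda>r. ennreal (r powr - (1 + 2 * s)) * ennreal (max 0 (r - c))"]
    unfolding pt by simp
  also have "\<dots> = ennreal (LINT r|lborel. 2 * (indicator {c..} r * r powr (- 2 * s)) - 2 * c * (indicator {c..} r * r powr (- (1 + 2 * s))))"
  proof (rule nn_integral_eq_integral)
    show "integrable lborel (\<lambda>r. 2 * (indicator {c..} r * r powr (- 2 * s)) - 2 * c * (indicator {c..} r * r powr (- (1 + 2 * s))))"
      using i by (intro Bochner_Integration.integrable_diff integrable_mult_right)
    show "AE r in lborel. 0 \<le> 2 * (indicator {c..} r * r powr (- 2 * s)) - 2 * c * (indicator {c..} r * r powr (- (1 + 2 * s)))"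
    proof (rule AE_I2)
      fix r :: real
      show "0 \<le> 2 * (indicator {c..} r * r powr (- 2 * s)) - 2 * c * (indicator {c..} r * r powr (- (1 + 2 * s)))"
      proof (cases "c \<le> r")
        case True
        then have r: "0 < r" using c by simp
        have "- 2 * s = 1 + - (1 + 2 * s)" by simp
        then have "r powr (- 2 * s) = r * r powr - (1 + 2 * s)" using r by (simp only: powr_add) simp
        moreover have "c * r powr - (1 + 2 * s) \<le> r * r powr - (1 + 2 * s)" using True by (intro mult_right_mono) auto
        ultimately show ?thesis using True by simp
      qed simp
    qed
  qed
  also have "(LINT r|lborel. 2 * (indicator {c..} r * r powr (- 2 * s)) - 2 * c * (indicator {c..} r * r powr (- (1 + 2 * s))))
    = 2 * (c powr (- 2 * s + 1) / (- (- 2 * s) - 1)) - 2 * c * (c powr (- (1 + 2 * s) + 1) / (- (- (1 + 2 * s)) - 1))"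
    using i powr_tail_integral(2)[of "- 2 * s" c] powr_tail_integral(2)[of "- (1 + 2 * s)" c] s c
    by (subst Bochner_Integration.integral_diff) (auto intro!: integrable_mult_right)
  also have "\<dots> = c powr (1 - 2 * s) / (s * (2 * s - 1))"
  proof -
    have "1 - 2 * s = 1 + (- (1 + 2 * s) + 1)" by simp
    then have cc: "c powr (1 - 2 * s) = c * c powr (- (1 + 2 * s) + 1)" using c by (simp only: powr_add) simp
    have "2 * (X / (2 * s - 1)) - 2 * (X / (2 * s)) = X / (s * (2 * s - 1))" for X
      using s by (simp add: field_simps)
    from this[of "c powr (1 - 2 * s)"] show ?thesis by (simp add: cc)
  qed
  finally show ?thesis .
qed

context transition
begin

lemma emeasure_gap_0: "emeasure gap {0} = 0"
proof -
  have "emeasure gap {0} = (\<integral>\<^sup>+t. indicator {0::real} t \<partial>gap)" by simp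
  also have "\<dots> \<le> ennreal Bd * (\<integral>\<^sup>+t. indicator {0::real} t \<partial>lborel)" by (rule nn_integral_gap_le) measurable
  also have "\<dots> = 0" by simp
  finally show ?thesis by simp
qed

lemma AE_gap_nonzero: "AE t in gap. t \<noteq> 0"
  using emeasure_gap_0 by (intro AE_I[of _ _ "{0}"]) auto

text \<open>The density of \<open>gap\<close> is bounded, and \<open>\<bar>t\<bar> powr - a\<close> is integrable near 0 for \<open>a < 1\<close>.\<close>

lemma integrable_gap_powr:
  assumes "0 < a" "a < 1"
  shows "integrable gap (\<lambda>t. \<bar>t\<bar> powr - a)"
proof (rule integrableI_nonneg)
  have "(\<integral>\<^sup>+t. ennreal (\<bar>t\<bar> powr - a) \<partial>gap) \<le> (\<integral>\<^sup>+t. ennreal (indicator {..<1} \<bar>t\<bar> * \<bar>t\<bar> powr - a) + 1 \<partial>gap)"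
  proof (rule nn_integral_mono)
    fix t :: real
    show "ennreal (\<bar>t\<bar> powr - a) \<le> ennreal (indicator {..<1} \<bar>t\<bar> * \<bar>t\<bar> powr - a) + 1"
    proof (cases "\<bar>t\<bar> < 1")
      case False
      then have "\<bar>t\<bar> powr - a \<le> 1 powr - a" using assms by (intro powr_mono2') auto
      then show ?thesis using False by simp
    qed simp
  qed
  also have "\<dots> = (\<integral>\<^sup>+t. ennreal (indicator {..<1} \<bar>t\<bar> * \<bar>t\<bar> powr - a) \<partial>gap) + 1"
    using gap.emeasure_space_1 by (subst nn_integral_add) auto
  also have "\<dots> < \<infinity>"
  proof -
    have near: "(\<integral>\<^sup>+t. ennreal (indicator {..<1} \<bar>t\<bar> * \<bar>t\<bar> powr - a) \<partial>lborel) < top"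
      using nn_integral_powr_near_0[where 'a=real, of a 1] assms by simp
    have "(\<integral>\<^sup>+t. ennreal (indicator {..<1} \<bar>t\<bar> * \<bar>t\<bar> powr - a) \<partial>gap)
      \<le> ennreal Bd * (\<integral>\<^sup>+t. ennreal (indicator {..<1} \<bar>t\<bar> * \<bar>t\<bar> powr - a) \<partial>lborel)"
      by (rule nn_integral_gap_le) measurable
    also have "\<dots> < top"
      using near by (simp add: ennreal_mult_less_top)
    finally show ?thesis by simp
  qed
  finally show "(\<integral>\<^sup>+t. ennreal (\<bar>t\<bar> powr - a) \<partial>gap) < \<infinity>" .
qed auto

text \<open>The square of \<open>\<phi> (\<xi> + w) - \<phi> \<xi>\<close> is the probability that two independent variables both lie
between \<open>\<xi>\<close> and \<open>\<xi> + w\<close>. Integrated over \<open>\<xi>\<close>, this gives the positive part of \<open>\<bar>w\<bar>\<close> minus the distance of the two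
variables, and integrating the kernel in \<open>w\<close> against it gives a power of that distance.\<close>

lemma energy_nn_integral:
  assumes s: "1 / 2 < s"
  shows "(\<integral>\<^sup>+\<xi>. (\<integral>\<^sup>+w. ennreal ((\<phi> (\<xi> + w) - \<phi> \<xi>)\<^sup>2 / \<bar>w\<bar> powr (1 + 2 * s)) \<partial>lborel) \<partial>lborel)
    = (\<integral>\<^sup>+t. ennreal (\<bar>t\<bar> powr (1 - 2 * s) / (s * (2 * s - 1))) \<partial>gap)"
proof -
  let ?Q = "mu \<Otimes>\<^sub>M mu"
  interpret Q: pair_sigma_finite "lborel :: real measure" ?Q by unfold_locales
  \<comment> \<open>The event that both entries of \<open>p\<close> lie between \<open>\<xi>\<close> and \<open>\<xi> + w\<close>, half-open so that its probability is exactly a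
difference of values of \<open>\<phi>\<close>.\<close>
  define S :: "(real \<times> real \<times> (real \<times> real)) set" where "S = {(\<xi>, w, p). min \<xi> (\<xi> + w) \<le> fst p \<and> fst p < max \<xi> (\<xi> + w)
     \<and> min \<xi> (\<xi> + w) \<le> snd p \<and> snd p < max \<xi> (\<xi> + w)}"
  define K where "K \<xi> w p = ennreal (\<bar>w\<bar> powr - (1 + 2 * s)) * indicator S (\<xi>, w, p)" for \<xi> w :: real and p :: "real \<times> real"
  have setsQ[measurable_cong]: "sets ?Q = sets (borel \<Otimes>\<^sub>M borel)" by (rule sets_pair_measure_cong) auto
  have S[measurable]: "S \<in> sets (lborel \<Otimes>\<^sub>M lborel \<Otimes>\<^sub>M ?Q)"
  proof -
    have "S = {x \<in> space (lborel \<Otimes>\<^sub>M lborel \<Otimes>\<^sub>M ?Q). min (fst x) (fst x + fst (snd x)) \<le> fst (snd (snd x)) \<and> fst (snd (snd x)) < max (fst x) (fst x + fst (snd x))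
     \<and> min (fst x) (fst x + fst (snd x)) \<le> snd (snd (snd x)) \<and> snd (snd (snd x)) < max (fst x) (fst x + fst (snd x))}"
      by (auto simp: S_def space_pair_measure)
    also have "\<dots> \<in> sets (lborel \<Otimes>\<^sub>M lborel \<Otimes>\<^sub>M ?Q)" by measurable
    finally show ?thesis .
  qed
  have KM[measurable]: "(\<lambda>(\<xi>, w, p). K \<xi> w p) \<in> borel_measurable (lborel \<Otimes>\<^sub>M lborel \<Otimes>\<^sub>M ?Q)"
    unfolding K_def by measurable
  have 1: "ennreal ((\<phi> (\<xi> + w) - \<phi> \<xi>)\<^sup>2 / \<bar>w\<bar> powr (1 + 2 * s)) = (\<integral>\<^sup>+p. K \<xi> w p \<partial>?Q)" for \<xi> w
  proof -
    define lo hi where "lo = min \<xi> (\<xi> + w)" and "hi = max \<xi> (\<xi> + w)"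
    have lh: "lo \<le> hi" by (simp add: lo_def hi_def)
    have "{lo..<hi} = {..<hi} - {..<lo}" by auto
    then have "measure mu {lo..<hi} = \<phi> hi - \<phi> lo"
      using lh mu.finite_measure_Diff[of "{..<hi}" "{..<lo}"] by (simp add: measure_mu_lessThan)
    then have m: "emeasure mu {lo..<hi} = ennreal (\<phi> hi - \<phi> lo)" by (simp add: mu.emeasure_eq_measure)
    have mono: "\<phi> lo \<le> \<phi> hi"
      using measure_mu_lessThan[of lo] measure_mu_lessThan[of hi] mu.finite_measure_mono[of "{..<lo}" "{..<hi}"] lh by auto
    have "(\<integral>\<^sup>+p. K \<xi> w p \<partial>?Q) = (\<integral>\<^sup>+p. ennreal (\<bar>w\<bar> powr - (1 + 2 * s)) * indicator ({lo..<hi} \<times> {lo..<hi}) p \<partial>?Q)"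
      by (intro nn_integral_cong) (auto simp: K_def S_def lo_def hi_def indicator_def)
    also have "\<dots> = ennreal (\<bar>w\<bar> powr - (1 + 2 * s)) * emeasure ?Q ({lo..<hi} \<times> {lo..<hi})"
      by (rule nn_integral_cmult_indicator) auto
    also have "emeasure ?Q ({lo..<hi} \<times> {lo..<hi}) = ennreal (\<phi> hi - \<phi> lo) * ennreal (\<phi> hi - \<phi> lo)"
      by (subst mu.emeasure_pair_measure_Times) (auto simp: m)
    also have "ennreal (\<bar>w\<bar> powr - (1 + 2 * s)) * \<dots> = ennreal (\<bar>w\<bar> powr - (1 + 2 * s) * ((\<phi> hi - \<phi> lo) * (\<phi> hi - \<phi> lo)))"
      using mono by (simp add: ennreal_mult')
    also have "(\<phi> hi - \<phi> lo) * (\<phi> hi - \<phi> lo) = (\<phi> (\<xi> + w) - \<phi> \<xi>)\<^sup>2"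
      by (cases "w \<ge> 0") (auto simp: lo_def hi_def power2_eq_square algebra_simps)
    finally have "(\<integral>\<^sup>+p. K \<xi> w p \<partial>?Q) = ennreal (\<bar>w\<bar> powr - (1 + 2 * s) * (\<phi> (\<xi> + w) - \<phi> \<xi>)\<^sup>2)" .
    moreover have "(\<phi> (\<xi> + w) - \<phi> \<xi>)\<^sup>2 / \<bar>w\<bar> powr (1 + 2 * s) = \<bar>w\<bar> powr - (1 + 2 * s) * (\<phi> (\<xi> + w) - \<phi> \<xi>)\<^sup>2"
      by (simp only: powr_minus divide_inverse mult.commute)
    ultimately show ?thesis by (simp only:)
  qed
  have 2: "(\<integral>\<^sup>+\<xi>. indicator S (\<xi>, w, p) \<partial>lborel) = ennreal (max 0 (\<bar>w\<bar> - \<bar>snd p - fst p\<bar>))" for w p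
  proof -
    let ?lo = "min (fst p) (snd p)" and ?hi = "max (fst p) (snd p)"
    have "(\<integral>\<^sup>+\<xi>. indicator S (\<xi>, w, p) \<partial>lborel)
      = (\<integral>\<^sup>+\<xi>. indicator (if w \<ge> 0 then {?hi - w<..?lo} else {?hi<..?lo - w}) \<xi> \<partial>lborel)"
      by (intro nn_integral_cong) (auto simp: S_def indicator_def min_def max_def split: if_splits)
    also have "\<dots> = emeasure lborel (if w \<ge> 0 then {?hi - w<..?lo} else {?hi<..?lo - w})" by simp
    also have "\<dots> = ennreal (max 0 (\<bar>w\<bar> - \<bar>snd p - fst p\<bar>))"
    proof -
      have Ioc: "emeasure lborel {a<..b} = ennreal (max 0 (b - a))" for a b :: real
        by (cases "a \<le> b") auto
      have "?lo - (?hi - w) = w - \<bar>snd p - fst p\<bar>" "(?lo - w) - ?hi = - w - \<bar>snd p - fst p\<bar>"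
        by (auto simp: min_def max_def)
      then show ?thesis by (simp only: Ioc split: if_split) auto
    qed
    finally show ?thesis .
  qed
  define H where "H c = (\<integral>\<^sup>+w. ennreal (\<bar>w\<bar> powr - (1 + 2 * s)) * ennreal (max 0 (\<bar>w\<bar> - \<bar>c\<bar>)) \<partial>lborel)" for c :: real
  have [measurable]: "H \<in> borel_measurable borel" unfolding H_def by measurable
  have "(\<integral>\<^sup>+\<xi>. (\<integral>\<^sup>+w. (\<integral>\<^sup>+p. K \<xi> w p \<partial>?Q) \<partial>lborel) \<partial>lborel)
      = (\<integral>\<^sup>+\<xi>. (\<integral>\<^sup>+p. (\<integral>\<^sup>+w. K \<xi> w p \<partial>lborel) \<partial>?Q) \<partial>lborel)"
    by (intro nn_integral_cong Q.Fubini'[symmetric]) measurable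
  also have "\<dots> = (\<integral>\<^sup>+p. (\<integral>\<^sup>+\<xi>. (\<integral>\<^sup>+w. K \<xi> w p \<partial>lborel) \<partial>lborel) \<partial>?Q)"
  proof (rule Q.Fubini'[symmetric])
    have "(\<lambda>x. (fst (fst x), snd x, snd (fst x))) \<in> ((lborel \<Otimes>\<^sub>M ?Q) \<Otimes>\<^sub>M lborel) \<rightarrow>\<^sub>M (lborel \<Otimes>\<^sub>M lborel \<Otimes>\<^sub>M ?Q)"
      by measurable
    from measurable_compose[OF this KM]
    have "(\<lambda>x. K (fst (fst x)) (snd x) (snd (fst x))) \<in> borel_measurable ((lborel \<Otimes>\<^sub>M ?Q) \<Otimes>\<^sub>M lborel)" by simp
    from lborel.borel_measurable_nn_integral_fst[OF this]
    show "(\<lambda>(\<xi>, p). \<integral>\<^sup>+w. K \<xi> w p \<partial>lborel) \<in> borel_measurable (lborel \<Otimes>\<^sub>M ?Q)" by (simp add: split_beta)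
  qed
  also have "\<dots> = (\<integral>\<^sup>+p. (\<integral>\<^sup>+w. (\<integral>\<^sup>+\<xi>. K \<xi> w p \<partial>lborel) \<partial>lborel) \<partial>?Q)"
  proof (rule nn_integral_cong)
    fix p assume p: "p \<in> space ?Q"
    have "(\<lambda>x. (snd x, fst x, p)) \<in> (lborel \<Otimes>\<^sub>M lborel) \<rightarrow>\<^sub>M (lborel \<Otimes>\<^sub>M lborel \<Otimes>\<^sub>M ?Q)"
      using p by measurable
    from measurable_compose[OF this KM]
    have "(\<lambda>(w, \<xi>). K \<xi> w p) \<in> borel_measurable (lborel \<Otimes>\<^sub>M lborel)" by (simp add: split_beta)
    then show "(\<integral>\<^sup>+\<xi>. (\<integral>\<^sup>+w. K \<xi> w p \<partial>lborel) \<partial>lborel) = (\<integral>\<^sup>+w. (\<integral>\<^sup>+\<xi>. K \<xi> w p \<partial>lborel) \<partial>lborel)"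
      by (rule lborel_pair.Fubini')
  qed
  also have "\<dots> = (\<integral>\<^sup>+p. H (snd p - fst p) \<partial>?Q)"
  proof (intro nn_integral_cong)
    fix p
    have "(\<integral>\<^sup>+\<xi>. K \<xi> w p \<partial>lborel) = ennreal (\<bar>w\<bar> powr - (1 + 2 * s)) * ennreal (max 0 (\<bar>w\<bar> - \<bar>snd p - fst p\<bar>))" for w
    proof -
      have "(\<lambda>\<xi>. indicator S (\<xi>, w, p) :: ennreal) \<in> borel_measurable lborel"
        unfolding S_def by (auto simp: indicator_def)
      then show ?thesis unfolding K_def by (subst nn_integral_cmult) (auto simp: 2)
    qed
    then show "(\<integral>\<^sup>+w. (\<integral>\<^sup>+\<xi>. K \<xi> w p \<partial>lborel) \<partial>lborel) = H (snd p - fst p)" by (simp add: H_def)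
  qed
  also have "\<dots> = (\<integral>\<^sup>+t. H t \<partial>gap)"
    unfolding gap_def by (rule nn_integral_distr[symmetric]) auto
  also have "\<dots> = (\<integral>\<^sup>+t. ennreal (\<bar>t\<bar> powr (1 - 2 * s) / (s * (2 * s - 1))) \<partial>gap)"
    using AE_gap_nonzero
  proof (intro nn_integral_cong_AE, eventually_elim)
    case (elim t)
    then show ?case unfolding H_def using s by (intro hinge_kernel_integral) auto
  qed
  finally show ?thesis by (simp add: 1)
qed

text \<open>The passage from nonnegative integrals: the inner integral is finite for almost every \<open>\<xi>\<close>, because the
outer one is finite.\<close>

lemma energy_eq:
  assumes s: "1 / 2 < s" "s < 1"
  shows "(LINT \<xi>|lborel. LINT w|lborel. (\<phi> (\<xi> + w) - \<phi> \<xi>)\<^sup>2 / \<bar>w\<bar> powr (1 + 2 * s))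
    = (LINT t|gap. \<bar>t\<bar> powr (1 - 2 * s)) / (s * (2 * s - 1))"
proof -
  have i: "integrable gap (\<lambda>t. \<bar>t\<bar> powr (1 - 2 * s) / (s * (2 * s - 1)))"
    using integrable_gap_powr[of "2 * s - 1"] s by (intro integrable_divide) simp
  define I where "I \<xi> = (\<integral>\<^sup>+w. ennreal ((\<phi> (\<xi> + w) - \<phi> \<xi>)\<^sup>2 / \<bar>w\<bar> powr (1 + 2 * s)) \<partial>lborel)" for \<xi>
  have [measurable]: "I \<in> borel_measurable borel" unfolding I_def by measurable
  have tot: "(\<integral>\<^sup>+\<xi>. I \<xi> \<partial>lborel) = ennreal (LINT t|gap. \<bar>t\<bar> powr (1 - 2 * s) / (s * (2 * s - 1)))"
    unfolding I_def energy_nn_integral[OF s(1)] using s i by (intro nn_integral_eq_integral) auto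
  have "AE \<xi> in lborel. I \<xi> \<noteq> \<infinity>"
    by (intro nn_integral_PInf_AE) (auto simp: tot)
  then have fin: "AE \<xi> in lborel. ennreal (enn2real (I \<xi>)) = I \<xi>"
    by eventually_elim (simp add: ennreal_enn2real_if)
  have "(LINT w|lborel. (\<phi> (\<xi> + w) - \<phi> \<xi>)\<^sup>2 / \<bar>w\<bar> powr (1 + 2 * s)) = enn2real (I \<xi>)" for \<xi>
    unfolding I_def by (intro integral_eq_nn_integral) auto
  then have "(LINT \<xi>|lborel. LINT w|lborel. (\<phi> (\<xi> + w) - \<phi> \<xi>)\<^sup>2 / \<bar>w\<bar> powr (1 + 2 * s))
    = (LINT \<xi>|lborel. enn2real (I \<xi>))" by simp
  also have "\<dots> = enn2real (\<integral>\<^sup>+\<xi>. ennreal (enn2real (I \<xi>)) \<partial>lborel)"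
    by (intro integral_eq_nn_integral) auto
  also have "(\<integral>\<^sup>+\<xi>. ennreal (enn2real (I \<xi>)) \<partial>lborel) = (\<integral>\<^sup>+\<xi>. I \<xi> \<partial>lborel)"
    using fin by (rule nn_integral_cong_AE)
  also have "enn2real \<dots> = (LINT t|gap. \<bar>t\<bar> powr (1 - 2 * s) / (s * (2 * s - 1)))"
    unfolding tot using s by (intro enn2real_ennreal Bochner_Integration.integral_nonneg) auto
  finally show ?thesis by simp
qed

lemma gap_powr_pos:
  assumes s: "1 / 2 < s" "s < 1"
  shows "0 < (LINT t|gap. \<bar>t\<bar> powr (1 - 2 * s))"
proof -
  have i: "integrable gap (\<lambda>t. \<bar>t\<bar> powr (1 - 2 * s))"
    using integrable_gap_powr[of "2 * s - 1"] s by simp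
  have "(LINT t|gap. \<bar>t\<bar> powr (1 - 2 * s)) \<noteq> 0"
  proof
    assume "(LINT t|gap. \<bar>t\<bar> powr (1 - 2 * s)) = 0"
    then have "AE t in gap. \<bar>t\<bar> powr (1 - 2 * s) = 0"
      using integral_nonneg_eq_0_iff_AE[OF i] by auto
    with AE_gap_nonzero have "AE t in gap. False" by eventually_elim auto
    then show False using gap.AE_False by auto
  qed
  moreover have "0 \<le> (LINT t|gap. \<bar>t\<bar> powr (1 - 2 * s))" by (intro Bochner_Integration.integral_nonneg) auto
  ultimately show ?thesis by linarith
qed

lemma c_star_eq:
  assumes n: "2 \<le> n" and s: "1 / 2 < s" "s < 1"
  shows "c_star n s \<phi> = profile_mass n (real n + 2 * s) * (LINT t|gap. \<bar>t\<bar> powr (1 - 2 * s))"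
  unfolding c_star_def c_star_profile_factor[OF n s(1)] energy_eq[OF s] using s by simp

lemma c_star_pos:
  assumes n: "2 \<le> n" and s: "1 / 2 < s" "s < 1"
  shows "0 < c_star n s \<phi>"
  unfolding c_star_eq[OF n s] using gap_powr_pos[OF s] profile_mass_pos[of n "real n + 2 * s"] s by simp

end

section \<open>The excess of a level set over a half-space\<close>

text \<open>For \<open>t = 0\<close>, \<open>D y = d (x + y) - d x\<close>, \<open>e = grad d x\<close> and \<open>P = n + 2 s\<close> this is the fractional mean curvature of the
level set of \<open>d\<close> through \<open>x\<close>.\<close>

definition level_excess :: "real \<Rightarrow> ('a::euclidean_space \<Rightarrow> real) \<Rightarrow> 'a \<Rightarrow> real \<Rightarrow> real" where
  "level_excess P D e t =
    (LINT y|lborel. (indicator {y. t < D y} y - indicator {y. t < e \<bullet> y} y) * norm y powr - P)"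

lemma integral_lborel_dilation:
  fixes g :: "'a::euclidean_space \<Rightarrow> real"
  assumes "g \<in> borel_measurable borel" "0 < c"
  shows "(LINT y|lborel. g y) = c ^ DIM('a) * (LINT z|lborel. g (c *\<^sub>R z))"
proof -
  have "(LINT y|lborel. g y) = (LINT y|density (distr lborel borel (\<lambda>x. 0 + c *\<^sub>R x)) (\<lambda>_. ennreal (\<bar>c\<bar> ^ DIM('a))). g y)"
    using assms by (subst lborel_affine[of c 0]) auto
  also have "\<dots> = (LINT y|distr lborel borel (\<lambda>x. 0 + c *\<^sub>R x). \<bar>c\<bar> ^ DIM('a) *\<^sub>R g y)"
    using assms by (intro integral_density) auto
  also have "\<dots> = (LINT z|lborel. \<bar>c\<bar> ^ DIM('a) *\<^sub>R g (0 + c *\<^sub>R z))"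
    using assms by (intro integral_distr) auto
  finally show ?thesis using assms by simp
qed

lemma level_excess_dilation:
  fixes D :: "'a::euclidean_space \<Rightarrow> real"
  assumes [measurable]: "D \<in> borel_measurable borel" and c: "0 < c"
  shows "(LINT z|lborel. (indicator {z. t < D (c *\<^sub>R z) / c} z - indicator {z. t < e \<bullet> z} z) * norm z powr - P)
    = c powr (P - real DIM('a)) * level_excess P D e (c * t)"
proof -
  have "level_excess P D e (c * t) = c ^ DIM('a) *
    (LINT z|lborel. (indicator {y. c * t < D y} (c *\<^sub>R z) - indicator {y. c * t < e \<bullet> y} (c *\<^sub>R z)) * norm (c *\<^sub>R z) powr - P)"
    unfolding level_excess_def using c by (intro integral_lborel_dilation) auto
  also have "(LINT z|lborel. (indicator {y. c * t < D y} (c *\<^sub>R z) - indicator {y. c * t < e \<bullet> y} (c *\<^sub>R z)) * norm (c *\<^sub>R z) powr - P)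
    = (LINT z|lborel. c powr - P * ((indicator {z. t < D (c *\<^sub>R z) / c} z - indicator {z. t < e \<bullet> z} z) * norm z powr - P))"
  proof (rule Bochner_Integration.integral_cong[OF refl])
    fix z :: 'a
    have "c * t < D (c *\<^sub>R z) \<longleftrightarrow> t < D (c *\<^sub>R z) / c" using c by (simp add: pos_less_divide_eq mult.commute)
    then have 1: "indicator {y. c * t < D y} (c *\<^sub>R z) = (indicator {z. t < D (c *\<^sub>R z) / c} z :: real)"
      by (simp add: indicator_def)
    have 2: "indicator {y. c * t < e \<bullet> y} (c *\<^sub>R z) = (indicator {z. t < e \<bullet> z} z :: real)"
      using c by (simp add: indicator_def)
    show "(indicator {y. c * t < D y} (c *\<^sub>R z) - indicator {y. c * t < e \<bullet> y} (c *\<^sub>R z)) * norm (c *\<^sub>R z) powr - P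
      = c powr - P * ((indicator {z. t < D (c *\<^sub>R z) / c} z - indicator {z. t < e \<bullet> z} z) * norm z powr - P)"
      unfolding 1 2 using c by (simp add: powr_mult mult_ac)
  qed
  finally have "level_excess P D e (c * t) = (c ^ DIM('a) * c powr - P) *
    (LINT z|lborel. (indicator {z. t < D (c *\<^sub>R z) / c} z - indicator {z. t < e \<bullet> z} z) * norm z powr - P)" by simp
  moreover have "c powr (P - real DIM('a)) * (c ^ DIM('a) * c powr - P) = 1"
    using c by (simp add: powr_realpow[symmetric] powr_add[symmetric])
  ultimately show ?thesis by (simp add: mult.assoc[symmetric])
qed

lemma integrable_kernel_tail:
  assumes "real DIM('a::euclidean_space) < P" "0 < r"
  shows "integrable lborel (\<lambda>y::'a. indicator {r..} (norm y) * norm y powr - P)"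
proof (rule integrableI_nonneg)
  show "(\<integral>\<^sup>+y. ennreal (indicator {r..} (norm y) * norm (y::'a) powr - P) \<partial>lborel) < \<infinity>"
    using assms by (subst nn_integral_powr_at_infinity) auto
qed auto

lemma integrable_truncated_kernel:
  assumes P: "real DIM('a::euclidean_space) < P" "P - 2 < real DIM('a)" and c: "0 \<le> c"
  shows "integrable lborel (\<lambda>z::'a. min 1 (c * (norm z)\<^sup>2) * norm z powr - P)"
proof (rule Bochner_Integration.integrable_bound)
  have "integrable lborel (\<lambda>z::'a. indicator {..<1} (norm z) * norm z powr - (P - 2))"
  proof (rule integrableI_nonneg)
    show "(\<integral>\<^sup>+z. ennreal (indicator {..<1} (norm z) * norm (z::'a) powr - (P - 2)) \<partial>lborel) < \<infinity>"
      using P by (subst nn_integral_powr_near_0) auto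
  qed auto
  then show "integrable lborel (\<lambda>z::'a. c * (indicator {..<1} (norm z) * norm z powr - (P - 2)) + indicator {1..} (norm z) * norm z powr - P)"
    using integrable_kernel_tail[OF P(1), of 1] by (intro Bochner_Integration.integrable_add integrable_mult_right) auto
  show "AE z in lborel. norm (min 1 (c * (norm z)\<^sup>2) * norm (z::'a) powr - P)
    \<le> norm (c * (indicator {..<1} (norm z) * norm z powr - (P - 2)) + indicator {1..} (norm z) * norm z powr - P)"
  proof (rule AE_I2)
    fix z :: 'a
    have m0: "0 \<le> min 1 (c * (norm z)\<^sup>2)" using c by simp
    show "norm (min 1 (c * (norm z)\<^sup>2) * norm z powr - P)
      \<le> norm (c * (indicator {..<1} (norm z) * norm z powr - (P - 2)) + indicator {1..} (norm z) * norm z powr - P)"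
    proof (cases "norm z < 1")
      case True
      have "(norm z)\<^sup>2 * norm z powr - P = norm z powr - (P - 2)"
      proof (cases "z = 0")
        case False
        then have "(norm z)\<^sup>2 = norm z powr 2" by simp
        then have "(norm z)\<^sup>2 * norm z powr - P = norm z powr (2 + - P)" by (simp only: powr_add)
        then show ?thesis by simp
      qed simp
      moreover have "min 1 (c * (norm z)\<^sup>2) * norm z powr - P \<le> c * (norm z)\<^sup>2 * norm z powr - P"
        by (intro mult_right_mono) auto
      ultimately show ?thesis using True m0 c by (simp add: mult.assoc abs_mult)
    next
      case False
      have "min 1 (c * (norm z)\<^sup>2) * norm z powr - P \<le> 1 * norm z powr - P" by (intro mult_right_mono) auto
      then show ?thesis using False m0 by (simp add: abs_mult)
    qed
  qed
qed measurable

text \<open>The average over \<open>\<xi>\<close> turns the integrand of \<open>a_eps\<close> into a difference of indicators, and the dilation by \<open>\<epsilon>\<close> produces the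
factor \<open>\<epsilon> powr (2 * s)\<close>.\<close>

lemma (in transition) a_bar_eq_gap_integral:
  fixes d :: "real^'n \<Rightarrow> real"
  assumes f: "f = deriv \<phi>" and s: "0 < s" "s < 1" and \<epsilon>: "0 < \<epsilon>"
    and [measurable]: "d \<in> borel_measurable borel" and K: "0 \<le> K"
    and quad: "\<And>y. \<bar>d (x + y) - d x - grad d x \<bullet> y\<bar> \<le> K * (norm y)\<^sup>2"
  shows "a_bar s \<phi> d \<epsilon> x = \<epsilon> powr (2 * s) / eta s \<epsilon>
      * (LINT t|gap. level_excess (real CARD('n) + 2 * s) (\<lambda>y. d (x + y) - d x) (grad d x) (\<epsilon> * t))"
    and "integrable gap (\<lambda>t. level_excess (real CARD('n) + 2 * s) (\<lambda>y. d (x + y) - d x) (grad d x) (\<epsilon> * t))"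
proof -
  let ?P = "real CARD('n) + 2 * s"
  let ?D = "\<lambda>y. d (x + y) - d x"
  let ?F = "\<lambda>z. ?D (\<epsilon> *\<^sub>R z) / \<epsilon>"
  let ?l = "\<lambda>z. grad d x \<bullet> z"
  let ?k = "\<lambda>z::real^'n. norm z powr - ?P"
  have Bd0: "0 \<le> Bd" using f_pos[of 0] f_le[of 0] by linarith
  have Fl: "\<bar>?F z - ?l z\<bar> \<le> (K * \<epsilon>) * (norm z)\<^sup>2" for z
  proof -
    have "?F z - ?l z = (?D (\<epsilon> *\<^sub>R z) - grad d x \<bullet> (\<epsilon> *\<^sub>R z)) / \<epsilon>" using \<epsilon> by (simp add: field_simps)
    also have "\<bar>\<dots>\<bar> = \<bar>?D (\<epsilon> *\<^sub>R z) - grad d x \<bullet> (\<epsilon> *\<^sub>R z)\<bar> / \<epsilon>" using \<epsilon> by simp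
    also have "\<dots> \<le> K * (norm (\<epsilon> *\<^sub>R z))\<^sup>2 / \<epsilon>" using quad[of "\<epsilon> *\<^sub>R z"] \<epsilon> by (intro divide_right_mono) auto
    also have "\<dots> = (K * \<epsilon>) * (norm z)\<^sup>2" using \<epsilon> by (simp add: power2_eq_square)
    finally show ?thesis .
  qed
  have Fm: "?F \<in> borel_measurable borel" "?l \<in> borel_measurable borel" "?k \<in> borel_measurable borel" by measurable
  have int: "integrable lborel (\<lambda>z. min 1 (Bd * \<bar>?F z - ?l z\<bar>) * ?k z)"
  proof (rule Bochner_Integration.integrable_bound)
    show "integrable lborel (\<lambda>z::real^'n. min 1 ((Bd * (K * \<epsilon>)) * (norm z)\<^sup>2) * norm z powr - ?P)"
      using s Bd0 K \<epsilon> by (intro integrable_truncated_kernel) auto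
    show "AE z in lborel. norm (min 1 (Bd * \<bar>?F z - ?l z\<bar>) * ?k z) \<le> norm (min 1 ((Bd * (K * \<epsilon>)) * (norm z)\<^sup>2) * norm z powr - ?P)"
    proof (rule AE_I2)
      fix z :: "real^'n"
      have "Bd * \<bar>?F z - ?l z\<bar> \<le> (Bd * (K * \<epsilon>)) * (norm z)\<^sup>2"
        using mult_left_mono[OF Fl[of z] Bd0] by (simp add: mult.assoc)
      then have "min 1 (Bd * \<bar>?F z - ?l z\<bar>) \<le> min 1 ((Bd * (K * \<epsilon>)) * (norm z)\<^sup>2)" by (intro min.mono) auto
      moreover have "0 \<le> min 1 (Bd * \<bar>?F z - ?l z\<bar>)" using Bd0 by simp
      ultimately show "norm (min 1 (Bd * \<bar>?F z - ?l z\<bar>) * ?k z) \<le> norm (min 1 ((Bd * (K * \<epsilon>)) * (norm z)\<^sup>2) * norm z powr - ?P)"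
        unfolding norm_mult by (intro mult_right_mono) auto
    qed
  qed measurable
  have k0: "0 \<le> ?k z" for z by simp
  note avg = averaged_transition_integral[OF Fm k0 int]
  have aeps: "a_eps s \<phi> d \<epsilon> \<xi> x = (LINT z|lborel. (\<phi> (\<xi> + ?F z) - \<phi> (\<xi> + ?l z)) * ?k z)" for \<xi>
    unfolding a_eps_def by (simp only: powr_minus divide_inverse)
  have dil: "(LINT z|lborel. (indicator {z. t < ?F z} z - indicator {z. t < ?l z} z) * ?k z)
     = \<epsilon> powr (2 * s) * level_excess ?P ?D (grad d x) (\<epsilon> * t)" for t
    using level_excess_dilation[of ?D \<epsilon> t "grad d x" ?P] \<epsilon> by simp
  show "integrable gap (\<lambda>t. level_excess ?P ?D (grad d x) (\<epsilon> * t))"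
    using avg(2) \<epsilon> unfolding dil by simp
  have "(LINT \<xi>|lborel. a_eps s \<phi> d \<epsilon> \<xi> x * deriv \<phi> \<xi>) = (LINT \<xi>|mu. a_eps s \<phi> d \<epsilon> \<xi> x)"
    unfolding f[symmetric] using avg(3) unfolding aeps by (intro integral_mu) simp
  also have "\<dots> = (LINT t|gap. \<epsilon> powr (2 * s) * level_excess ?P ?D (grad d x) (\<epsilon> * t))"
    unfolding aeps avg(1) dil ..
  finally show "a_bar s \<phi> d \<epsilon> x = \<epsilon> powr (2 * s) / eta s \<epsilon>
      * (LINT t|gap. level_excess ?P ?D (grad d x) (\<epsilon> * t))"
    unfolding a_bar_def by simp
qed

text \<open>The first coordinate is embedded as one coordinate of \<open>real^'n\<close>, the others are distributed over the rest, and a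
rotation takes the distinguished axis to \<open>e\<close>.\<close>

lemma adapted_isometry:
  fixes e :: "real^'n"
  assumes card: "CARD('n) = CARD('m::finite) + 1" and e: "norm e = 1"
  obtains T :: "real \<times> (real^'m) \<Rightarrow> real^'n" where "linear T" "\<And>p. norm (T p) = norm p" "T (1, 0) = e"
    "\<And>p q. T p \<bullet> T q = p \<bullet> q"
proof -
  obtain j0 :: 'n where True by simp
  have "card (UNIV :: 'm set) = card (UNIV - {j0})" using card by (simp add: card_Diff_singleton)
  then obtain h where h: "bij_betw h (UNIV :: 'm set) (UNIV - {j0})"
    using finite_same_card_bij[of "UNIV :: 'm set" "UNIV - {j0}"] by auto
  let ?g = "inv_into UNIV h"
  define Q :: "real \<times> (real^'m) \<Rightarrow> real^'n" where "Q p = (\<chi> j. if j = j0 then fst p else snd p $ ?g j)" for p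
  have Qlin: "linear Q" by (intro linearI) (auto simp: Q_def vec_eq_iff)
  have Qinner: "Q p \<bullet> Q q = p \<bullet> q" for p q
  proof -
    have "Q p \<bullet> Q q = (\<Sum>j\<in>UNIV. Q p $ j * Q q $ j)" by (simp add: inner_vec_def)
    also have "\<dots> = fst p * fst q + (\<Sum>j\<in>UNIV - {j0}. snd p $ ?g j * snd q $ ?g j)"
      by (subst sum.remove[of _ j0]) (auto simp: Q_def intro!: sum.cong)
    also have "(\<Sum>j\<in>UNIV - {j0}. snd p $ ?g j * snd q $ ?g j) = (\<Sum>i\<in>UNIV. snd p $ ?g (h i) * snd q $ ?g (h i))"
      by (rule sum.reindex_bij_betw[OF h, symmetric])
    also have "\<dots> = snd p \<bullet> snd q"
      using h by (simp add: inner_vec_def bij_betw_def inv_into_f_f)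
    finally show ?thesis by (simp add: inner_prod_def)
  qed
  have Q1: "norm (Q (1, 0)) = 1" using Qinner[of "(1, 0)" "(1, 0)"] by (simp add: norm_eq_1 inner_prod_def)
  obtain R where R: "orthogonal_transformation R" "R (Q (1, 0)) = e"
    using orthogonal_transformation_exists_1[OF Q1 e] by blast
  have Rlin: "linear R" and Rinner: "R u \<bullet> R v = u \<bullet> v" for u v
    using R(1) by (auto simp: orthogonal_transformation_def)
  show thesis
  proof (rule that[of "R \<circ> Q"])
    show "linear (R \<circ> Q)" using Qlin Rlin by (rule linear_compose)
    show inn: "(R \<circ> Q) p \<bullet> (R \<circ> Q) q = p \<bullet> q" for p q by (simp add: Rinner Qinner)
    show "norm ((R \<circ> Q) p) = norm p" for p using inn[of p p] by (simp add: norm_eq_sqrt_inner)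
    show "(R \<circ> Q) (1, 0) = e" using R by simp
  qed
qed

text \<open>The trace of a bilinear form is the same in every orthonormal basis.\<close>

lemma trace_isometry:
  fixes H :: "'b::euclidean_space \<Rightarrow> 'b \<Rightarrow> real" and T :: "'a::euclidean_space \<Rightarrow> 'b"
  assumes H: "bilinear H" and T: "linear T" "\<And>p q. T p \<bullet> T q = p \<bullet> q" and dim: "DIM('a) = DIM('b)"
  shows "(\<Sum>b\<in>Basis. H (T b) (T b)) = (\<Sum>c\<in>Basis. H c c)"
proof -
  have norm: "norm (T p) = norm p" for p by (simp add: norm_eq_sqrt_inner T(2))
  have surj: "surj T" by (rule isometry_surj[OF T(1) norm dim])
  have orth: "(\<Sum>b\<in>Basis. (T b \<bullet> c) * (T b \<bullet> c')) = c \<bullet> c'" for c c'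
  proof -
    obtain u v where uv: "c = T u" "c' = T v" using surj by (metis surjD)
    have "(\<Sum>b\<in>Basis. (T b \<bullet> c) * (T b \<bullet> c')) = (\<Sum>b\<in>Basis. (u \<bullet> b) * (v \<bullet> b))"
      unfolding uv T(2) by (simp add: inner_commute)
    also have "\<dots> = u \<bullet> v" by (rule euclidean_inner[symmetric])
    finally show ?thesis by (simp add: uv T(2))
  qed
  have exp: "H y y = (\<Sum>c\<in>Basis. \<Sum>c'\<in>Basis. (y \<bullet> c) * (y \<bullet> c') * H c c')" for y
  proof -
    have "H y y = H (\<Sum>c\<in>Basis. (y \<bullet> c) *\<^sub>R c) (\<Sum>c'\<in>Basis. (y \<bullet> c') *\<^sub>R c')" by (simp add: euclidean_representation)
    also have "\<dots> = (\<Sum>c\<in>Basis. \<Sum>c'\<in>Basis. H ((y \<bullet> c) *\<^sub>R c) ((y \<bullet> c') *\<^sub>R c'))"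
      by (subst bilinear_sum[OF H]) (simp add: sum.cartesian_product)
    also have "\<dots> = (\<Sum>c\<in>Basis. \<Sum>c'\<in>Basis. (y \<bullet> c) * (y \<bullet> c') * H c c')"
      by (intro sum.cong refl) (simp add: bilinear_lmul[OF H] bilinear_rmul[OF H] mult_ac)
    finally show ?thesis .
  qed
  have "(\<Sum>b\<in>Basis. H (T b) (T b)) = (\<Sum>b\<in>Basis. \<Sum>c\<in>Basis. \<Sum>c'\<in>Basis. (T b \<bullet> c) * (T b \<bullet> c') * H c c')"
    by (subst exp) (rule refl)
  also have "\<dots> = (\<Sum>c\<in>Basis. \<Sum>c'\<in>Basis. \<Sum>b\<in>Basis. (T b \<bullet> c) * (T b \<bullet> c') * H c c')"
    by (subst sum.swap, intro sum.cong refl, subst sum.swap, rule refl)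
  also have "\<dots> = (\<Sum>c\<in>Basis. \<Sum>c'\<in>Basis. (c \<bullet> c') * H c c')"
    by (simp only: sum_distrib_right[symmetric] orth)
  also have "\<dots> = (\<Sum>c\<in>Basis. H c c)"
  proof (rule sum.cong[OF refl])
    fix c :: 'b assume c: "c \<in> Basis"
    have "(\<Sum>c'\<in>Basis. (c \<bullet> c') * H c c') = (\<Sum>c'\<in>Basis. if c' = c then H c c else 0)"
      using c by (intro sum.cong) (auto simp: inner_Basis)
    then show "(\<Sum>c'\<in>Basis. (c \<bullet> c') * H c c') = H c c" using c by simp
  qed
  finally show ?thesis .
qed

lemma level_excess_adapted:
  fixes T :: "real \<times> (real^'m::finite) \<Rightarrow> real^'n::finite"
  assumes card: "CARD('n) = CARD('m) + 1"
    and T: "linear T" "\<And>p. norm (T p) = norm p" "\<And>p q. T p \<bullet> T q = p \<bullet> q"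
    and [measurable]: "D \<in> borel_measurable borel"
  shows "level_excess P D (T (1, 0)) t
    = (LINT p|lborel. (indicator {p. t < D (T p)} p - indicator {p. t < fst p} p) * norm p powr - P)"
proof -
  have dim: "DIM(real \<times> (real^'m)) = DIM(real^'n)" using card by simp
  have [measurable]: "T \<in> borel_measurable borel"
    using T(1) by (intro borel_measurable_continuous_onI) (simp add: linear_continuous_on linear_conv_bounded_linear)
  have "level_excess P D (T (1, 0)) t
    = (LINT y|distr lborel borel T. (indicator {y. t < D y} y - indicator {y. t < T (1, 0) \<bullet> y} y) * norm y powr - P)"
    unfolding level_excess_def lborel_distr_isometry[OF T(1,2) dim] ..
  also have "\<dots> = (LINT p|lborel. (indicator {y. t < D y} (T p) - indicator {y. t < T (1, 0) \<bullet> y} (T p)) * norm (T p) powr - P)"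
    by (rule integral_distr) auto
  also have "\<dots> = (LINT p|lborel. (indicator {p. t < D (T p)} p - indicator {p. t < fst p} p) * norm p powr - P)"
    by (intro Bochner_Integration.integral_cong refl) (auto simp: indicator_def T(2,3) inner_prod_def)
  finally show ?thesis .
qed

section \<open>The expansion for \<open>s \<ge> 1/2\<close>\<close>

text \<open>Two functions bounded by the norm cannot differ in their comparison with \<open>t\<close> at points of norm below \<open>\<bar>t\<bar>\<close>.\<close>

lemma level_excess_far:
  fixes D :: "'a::euclidean_space \<Rightarrow> real"
  assumes [measurable]: "D \<in> borel_measurable borel" and D: "\<And>y. \<bar>D y\<bar> \<le> norm y" and e: "norm e = 1"
    and c: "0 < c" "c \<le> \<bar>t\<bar>" and P: "real DIM('a) < P"
  shows "\<bar>level_excess P D e t\<bar> \<le> (LINT y|lborel. indicator {c..} (norm (y::'a)) * norm y powr - P)"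
proof -
  let ?f = "\<lambda>y. (indicator {y. t < D y} y - indicator {y. t < e \<bullet> y} y) * norm y powr - P"
  let ?g = "\<lambda>y::'a. indicator {c..} (norm y) * norm y powr - P"
  have ig: "integrable lborel ?g" using P c by (intro integrable_kernel_tail) auto
  have le: "norm (?f y) \<le> ?g y" for y
  proof (cases "c \<le> norm y")
    case True
    have "\<bar>indicator {y. t < D y} y - indicator {y. t < e \<bullet> y} y\<bar> \<le> (1::real)" by (auto simp: indicator_def)
    then show ?thesis using True by (simp add: abs_mult mult_left_le_one_le)
  next
    case False
    have "\<bar>e \<bullet> y\<bar> \<le> norm y" using Cauchy_Schwarz_ineq2[of e y] e by simp
    then have "t < D y \<longleftrightarrow> t < e \<bullet> y" using False c D[of y] by linarith
    then show ?thesis using False by (simp add: indicator_def)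
  qed
  have "integrable lborel ?f"
    by (rule Bochner_Integration.integrable_bound[OF ig]) (use le in \<open>auto intro: order_trans[OF _ abs_ge_self]\<close>)
  then have "(LINT y|lborel. \<bar>?f y\<bar>) \<le> (LINT y|lborel. ?g y)"
    using ig le by (intro integral_mono integrable_abs) auto
  then have "\<bar>LINT y|lborel. ?f y\<bar> \<le> (LINT y|lborel. ?g y)"
    by (rule order_trans[OF integral_abs_bound])
  then show ?thesis unfolding level_excess_def .
qed

text \<open>The growth of the excess at small \<open>t\<close>, up to bounded terms and a multiple of the Laplacian.\<close>

definition curvature_profile :: "nat \<Rightarrow> real \<Rightarrow> real \<Rightarrow> real" where
  "curvature_profile k s t = (if s = 1 / 2 then max 0 (ln (1 / \<bar>t\<bar>)) else profile_mass k (real k + 2 * s) * \<bar>t\<bar> powr (1 - 2 * s))"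

text \<open>The restriction \<open>r \<le> 1\<close> makes \<open>ln (1 / \<bar>t\<bar>)\<close> nonnegative for \<open>\<bar>t\<bar> \<le> r / 4\<close>, so that its positive part can be used.\<close>

lemma curvature_profile_truncation:
  fixes r s :: real
  assumes s: "1 / 2 \<le> s" and r: "0 < r" "r \<le> 1" and k: "1 \<le> k"
  obtains C where "0 \<le> C"
    "\<And>t. t \<noteq> 0 \<Longrightarrow> \<bar>t\<bar> \<le> r / 4 \<Longrightarrow>
      \<bar>(LINT q|lborel. indicator {0<..<r} q * (q ^ k * (t\<^sup>2 + q\<^sup>2) powr (- (real k + 2 * s) / 2))) - curvature_profile k s t\<bar> \<le> C"
    "\<And>t. r / 4 \<le> \<bar>t\<bar> \<Longrightarrow> \<bar>curvature_profile k s t\<bar> \<le> C"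
proof (cases "s = 1 / 2")
  case True
  obtain m where m: "k = m + 1" using k by (metis add.commute le_Suc_ex One_nat_def)
  have e: "- (real k + 2 * s) / 2 = - real (m + 2) / 2" using True m by simp
  show thesis
  proof (rule that[of "real m / 2 + \<bar>ln r\<bar> + ln 2 + ln 4"])
    fix t :: real assume t: "t \<noteq> 0" "\<bar>t\<bar> \<le> r / 4"
    have "0 \<le> ln (1 / \<bar>t\<bar>)" using t r by (intro ln_ge_zero) (auto simp: field_simps)
    then have cp: "curvature_profile k s t = ln (1 / \<bar>t\<bar>)" using True by (simp add: curvature_profile_def)
    have "\<bar>(LINT q|lborel. indicator {0<..<r} q * (q ^ k * (t\<^sup>2 + q\<^sup>2) powr (- (real k + 2 * s) / 2))) - curvature_profile k s t\<bar>
      \<le> real m / 2 + \<bar>ln r\<bar> + ln 2"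
      unfolding cp e unfolding m using t r by (intro profile_truncated_log) auto
    then show "\<bar>(LINT q|lborel. indicator {0<..<r} q * (q ^ k * (t\<^sup>2 + q\<^sup>2) powr (- (real k + 2 * s) / 2))) - curvature_profile k s t\<bar>
      \<le> real m / 2 + \<bar>ln r\<bar> + ln 2 + ln 4" by (smt (verit) ln_ge_zero)
  next
    fix t :: real assume t: "r / 4 \<le> \<bar>t\<bar>"
    have "ln (1 / \<bar>t\<bar>) \<le> ln (4 / r)" using t r by (subst ln_le_cancel_iff) (auto simp: field_simps)
    also have "\<dots> = ln 4 - ln r" using r by (simp add: ln_div)
    finally have "ln (1 / \<bar>t\<bar>) \<le> ln 4 + \<bar>ln r\<bar>" by linarith
    moreover have "0 \<le> ln (4::real)" "0 \<le> ln (2::real)" by auto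
    ultimately have "max 0 (ln (1 / \<bar>t\<bar>)) \<le> real m / 2 + \<bar>ln r\<bar> + ln 2 + ln 4"
      by (smt (verit) of_nat_0_le_iff divide_nonneg_pos)
    then show "\<bar>curvature_profile k s t\<bar> \<le> real m / 2 + \<bar>ln r\<bar> + ln 2 + ln 4"
      using True by (simp add: curvature_profile_def)
  qed simp
next
  case False
  then have s: "1 / 2 < s" using s by simp
  let ?P = "real k + 2 * s"
  have P: "real k + 1 < ?P" using s by simp
  let ?C1 = "r powr (real k + 1 - ?P) / (?P - real k - 1)" and ?C2 = "profile_mass k ?P * (r / 4) powr (1 - 2 * s)"
  have C1: "0 \<le> ?C1" using s by simp
  have C2: "0 \<le> ?C2" using profile_mass_pos[OF P] by simp
  show thesis
  proof (rule that[of "?C1 + ?C2"])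
    fix t :: real assume t: "t \<noteq> 0" "\<bar>t\<bar> \<le> r / 4"
    have "\<bar>(LINT q|lborel. indicator {0<..<r} q * (q ^ k * (t\<^sup>2 + q\<^sup>2) powr (- ?P / 2))) - profile_mass k ?P * \<bar>t\<bar> powr (real k + 1 - ?P)\<bar> \<le> ?C1"
      unfolding profile_mass_def by (rule profile_truncated_powr[OF t(1) P r(1)])
    moreover have "real k + 1 - ?P = 1 - 2 * s" by simp
    ultimately show "\<bar>(LINT q|lborel. indicator {0<..<r} q * (q ^ k * (t\<^sup>2 + q\<^sup>2) powr (- ?P / 2))) - curvature_profile k s t\<bar> \<le> ?C1 + ?C2"
      using False C2 by (simp add: curvature_profile_def)
  next
    fix t :: real assume t: "r / 4 \<le> \<bar>t\<bar>"
    have "\<bar>t\<bar> powr (1 - 2 * s) \<le> (r / 4) powr (1 - 2 * s)" using t r s by (intro powr_mono2') auto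
    then have "profile_mass k ?P * \<bar>t\<bar> powr (1 - 2 * s) \<le> ?C2" using profile_mass_pos[OF P] by (intro mult_left_mono) auto
    moreover have "0 \<le> profile_mass k ?P * \<bar>t\<bar> powr (1 - 2 * s)" using profile_mass_pos[OF P] by simp
    ultimately have "\<bar>profile_mass k ?P * \<bar>t\<bar> powr (1 - 2 * s)\<bar> \<le> ?C1 + ?C2" using C1 by linarith
    then show "\<bar>curvature_profile k s t\<bar> \<le> ?C1 + ?C2"
      using False by (simp add: curvature_profile_def)
  qed (use C1 C2 in linarith)
qed

lemma laplacian_bound:
  fixes f :: "real^'n \<Rightarrow> real"
  assumes "\<And>i j. \<bar>iter_partial [i, j] f x\<bar> \<le> M"
  shows "\<bar>laplacian f x\<bar> \<le> real CARD('n) * M"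
proof -
  have "\<bar>laplacian f x\<bar> \<le> (\<Sum>i\<in>(UNIV::'n set). M)"
    unfolding laplacian_def
  proof (rule order_trans[OF sum_abs], rule sum_mono)
    fix i :: 'n
    show "\<bar>partial i (partial i f) x\<bar> \<le> M" using assms[of i i] by simp
  qed
  then show ?thesis by simp
qed

text \<open>For small \<open>\<bar>t\<bar>\<close> the second order comparison applies in coordinates adapted to the gradient, with \<open>hess d x\<close> as
quadratic form; for the other \<open>t\<close> both terms are bounded.\<close>

lemma (in eikonal) level_excess_expansion:
  fixes X :: "(real^'n) set"
  assumes card: "CARD('n) = CARD('m::finite) + 1" and s: "1 / 2 \<le> s" "s < 1"
    and l: "0 < l" "\<And>x. x \<in> X \<Longrightarrow> \<bar>d x\<bar> + l < R"
    and sm: "open S" "smooth_on S d" "\<And>x. x \<in> X \<Longrightarrow> cball x \<delta> \<subseteq> S" and \<delta>: "0 < \<delta>"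
    and M: "0 \<le> M" "\<And>x z i j. x \<in> X \<Longrightarrow> dist x z \<le> \<delta> \<Longrightarrow> \<bar>iter_partial [i, j] d z\<bar> \<le> M"
      "\<And>x z i j k. x \<in> X \<Longrightarrow> dist x z \<le> \<delta> \<Longrightarrow> \<bar>iter_partial [k, i, j] d z\<bar> \<le> M"
  shows "\<exists>C\<ge>0. \<forall>x\<in>X. \<forall>t. t \<noteq> 0 \<longrightarrow>
    \<bar>level_excess (real CARD('n) + 2 * s) (\<lambda>y. d (x + y) - d x) (grad d x) t
      - laplacian d x / 2 * unit_ball_vol (real CARD('m)) * curvature_profile CARD('n) s t\<bar> \<le> C"
proof -
  let ?N = "real CARD('n)"
  let ?P = "?N + 2 * s"
  \<comment> \<open>\<open>K\<close> bounds the deviation from the tangent half-space and \<open>2 * K\<close> the second derivative;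
\<open>2 * r \<le> \<delta>\<close> keeps the Taylor expansion inside the region where the derivatives are bounded.\<close>
  define K where "K = max (1 / (2 * l)) (?N ^ 2 * M / 2)"
  define r where "r = min (\<delta> / 2) (min (1 / (64 * K)) 1)"
  have "0 < 1 / (2 * l)" using l by simp
  then have K0: "0 < K" unfolding K_def by linarith
  have r: "0 < r" "r \<le> 1" "2 * r \<le> \<delta>" using \<delta> K0 by (auto simp: r_def)
  have "r \<le> 1 / (64 * K)" by (simp add: r_def)
  then have Kr: "K * r \<le> 1 / 64" using K0 by (simp add: field_simps)
  have m: "DIM(real^'m) = CARD('m)" by simp
  have N1: "1 \<le> CARD('n)" using card by simp
  have N2: "2 \<le> CARD('n)" using card zero_less_card_finite[where 'a='m] by linarith
  have "2 \<le> ?N" using N2 by simp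
  then have P: "3 \<le> ?P" using s by linarith
  have P': "?P - 3 < real DIM(real^'m)" "1 + real DIM(real^'m) < ?P"
    using s card by simp_all
  define M3 where "M3 = ?N ^ 3 * M / 6"
  have M3: "0 \<le> M3" using M by (simp add: M3_def)
  obtain C1 where C1: "\<And>(D :: real \<times> (real^'m) \<Rightarrow> real) B \<tau>.
    D \<in> borel_measurable borel \<Longrightarrow> (\<forall>p. \<bar>D p - fst p\<bar> \<le> K * (norm p)\<^sup>2) \<Longrightarrow>
    (\<forall>p. norm p \<le> 2 * r \<longrightarrow> \<bar>D p - fst p - B p p / 2\<bar> \<le> M3 * norm p ^ 3) \<Longrightarrow>
    bilinear B \<Longrightarrow> (\<forall>p q. \<bar>B p q\<bar> \<le> 2 * K * norm p * norm q) \<Longrightarrow> \<tau> \<noteq> 0 \<Longrightarrow> \<bar>\<tau>\<bar> \<le> r / 4 \<Longrightarrow>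
    \<bar>(LINT p|lborel. (indicator {p. \<tau> < D p} p - indicator {p. \<tau> < fst p} p) * norm p powr - ?P)
     - (LINT y|lborel. indicator {..<r} (norm (y::real^'m)) * (B (\<tau>, y) (\<tau>, y) / 2 * norm (\<tau>, y) powr - ?P))\<bar> \<le> C1"
    using level_set_second_order[where 'b="real^'m", OF less_imp_le[OF K0] Kr M3 r(1) P P'] by blast
  obtain C2 where C2: "0 \<le> C2"
    "\<And>t. t \<noteq> 0 \<Longrightarrow> \<bar>t\<bar> \<le> r / 4 \<Longrightarrow>
      \<bar>(LINT q|lborel. indicator {0<..<r} q * (q ^ CARD('n) * (t\<^sup>2 + q\<^sup>2) powr (- ?P / 2))) - curvature_profile CARD('n) s t\<bar> \<le> C2"
    "\<And>t. r / 4 \<le> \<bar>t\<bar> \<Longrightarrow> \<bar>curvature_profile CARD('n) s t\<bar> \<le> C2"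
    using curvature_profile_truncation[OF s(1) r(1,2) N1] by blast
  define C3 where "C3 = (LINT y|lborel. indicator {r / 4..} (norm (y::real^'n)) * norm y powr - ?P)"
  define L where "L = ?N * M / 2 * unit_ball_vol (real CARD('m))"
  have L0: "0 \<le> L" using M by (simp add: L_def)
  have C30: "0 \<le> C3" unfolding C3_def by (intro Bochner_Integration.integral_nonneg) auto
  have dm: "d \<in> borel_measurable borel" using continuous_d by (rule borel_measurable_continuous_onI)
  show ?thesis
  proof (intro exI[of _ "\<bar>C1\<bar> + L * C2 + C3"] conjI ballI allI impI)
    show "0 \<le> \<bar>C1\<bar> + L * C2 + C3" using L0 C2 C30 by simp
  next
    fix x t assume x: "x \<in> X" and t: "t \<noteq> (0::real)"
    let ?D = "\<lambda>y. d (x + y) - d x" and ?e = "grad d x"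
    let ?c = "laplacian d x / 2 * unit_ball_vol (real CARD('m))"
    have dx: "\<bar>d x\<bar> < R" using l(1) l(2)[OF x] by linarith
    have e1: "norm ?e = 1" by (rule unit[OF dx])
    have Dm[measurable]: "?D \<in> borel_measurable borel"
      using dm by measurable
    have xS: "x \<in> S" using sm(3)[OF x] \<delta> by auto
    have "\<bar>laplacian d x\<bar> \<le> ?N * M" using M(2)[OF x, of x] \<delta> by (intro laplacian_bound) auto
    then have "\<bar>laplacian d x\<bar> / 2 * unit_ball_vol (real CARD('m)) \<le> ?N * M / 2 * unit_ball_vol (real CARD('m))"
      by (intro mult_right_mono divide_right_mono) auto
    then have lap: "\<bar>?c\<bar> \<le> L" unfolding L_def abs_mult by simp
    show "\<bar>level_excess ?P ?D ?e t - ?c * curvature_profile CARD('n) s t\<bar> \<le> \<bar>C1\<bar> + L * C2 + C3"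
    proof (cases "\<bar>t\<bar> \<le> r / 4")
      case True
      obtain T :: "real \<times> (real^'m) \<Rightarrow> real^'n" where T: "linear T" "\<And>p. norm (T p) = norm p" "T (1, 0) = ?e"
        "\<And>p q. T p \<bullet> T q = p \<bullet> q"
        using adapted_isometry[OF card e1] by blast
      have fstT: "fst p = ?e \<bullet> T p" for p
        unfolding T(3)[symmetric] T(4) by (simp add: inner_prod_def)
      define B where "B p q = hess d x (T p) (T q)" for p q
      have Bbil: "bilinear B"
        using bilinear_hess[of d x] T(1) unfolding bilinear_def B_def
        by (auto intro: linear_compose[unfolded o_def])
      have Bbd: "\<bar>B p q\<bar> \<le> 2 * K * norm p * norm q" for p q
      proof -
        have "\<bar>B p q\<bar> \<le> ?N ^ 2 * M * norm (T p) * norm (T q)"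
          unfolding B_def using M(2)[OF x, of x] \<delta> by (intro hess_bound) auto
        also have "\<dots> \<le> 2 * K * norm (T p) * norm (T q)"
          unfolding K_def by (intro mult_right_mono) auto
        finally show ?thesis by (simp add: T(2))
      qed
      have D1: "\<bar>?D (T p) - fst p\<bar> \<le> K * (norm p)\<^sup>2" for p
      proof -
        have "\<bar>d (x + T p) - d x - ?e \<bullet> T p\<bar> \<le> (norm (T p))\<^sup>2 / (2 * l)"
          using l x by (intro quadratic_bound) auto
        also have "\<dots> = 1 / (2 * l) * (norm (T p))\<^sup>2" by simp
        also have "\<dots> \<le> K * (norm (T p))\<^sup>2" unfolding K_def by (intro mult_right_mono) auto
        finally show ?thesis by (simp add: T(2) fstT)
      qed
      have D2: "\<bar>?D (T p) - fst p - B p p / 2\<bar> \<le> M3 * norm p ^ 3" if p: "norm p \<le> 2 * r" for p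
      proof -
        have near: "dist x (x + u *\<^sub>R T p) \<le> \<delta>" if u: "0 \<le> u" "u \<le> 1" for u
        proof -
          have "dist x (x + u *\<^sub>R T p) = u * norm p" using u by (simp add: dist_norm T(2))
          also have "\<dots> \<le> 1 * norm p" using u by (intro mult_right_mono) auto
          finally show ?thesis using p r by simp
        qed
        have "\<bar>d (x + T p) - d x - ?e \<bullet> T p - hess d x (T p) (T p) / 2\<bar> \<le> ?N ^ 3 * M * norm (T p) ^ 3 / 6"
        proof (rule taylor_third_order[OF sm(2)])
          show "x + u *\<^sub>R T p \<in> S" if "0 \<le> u" "u \<le> 1" for u using near[OF that] sm(3)[OF x] by auto
          show "\<bar>iter_partial [k, i, j] d (x + u *\<^sub>R T p)\<bar> \<le> M" if "0 \<le> u" "u \<le> 1" for u i j k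
            using near[OF that] by (intro M(3)[OF x]) 
        qed
        then show ?thesis by (simp add: T(2) fstT B_def M3_def mult.assoc)
      qed
      have Tc: "T \<in> borel_measurable borel"
        using T(1) by (intro borel_measurable_continuous_onI) (simp add: linear_continuous_on linear_conv_bounded_linear)
      have DTm: "(\<lambda>p. ?D (T p)) \<in> borel_measurable borel"
        by (rule measurable_compose[OF Tc Dm])
      have dim: "DIM(real \<times> (real^'m)) = DIM(real^'n)" using card by simp
      have B0: "B (1, 0) (1, 0) = 0" unfolding B_def T(3) by (rule hess_grad_zero[OF sm(2) xS sm(1) dx])
      have tr: "(\<Sum>b\<in>Basis. B b b) = laplacian d x"
        unfolding B_def laplacian_eq_sum_hess by (rule trace_isometry[OF bilinear_hess T(1,4) dim])
      have q: "(LINT y|lborel. indicator {..<r} (norm (y::real^'m)) * (B (t, y) (t, y) / 2 * norm (t, y) powr - ?P))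
        = ?c * (LINT q|lborel. indicator {0<..<r} q * (q ^ CARD('n) * (t\<^sup>2 + q\<^sup>2) powr (- ?P / 2)))"
        using quadratic_slab_integral[OF Bbil B0 t r(1), of ?P] P card unfolding tr by simp
      have 1: "\<bar>level_excess ?P ?D ?e t - ?c * (LINT q|lborel. indicator {0<..<r} q * (q ^ CARD('n) * (t\<^sup>2 + q\<^sup>2) powr (- ?P / 2)))\<bar> \<le> C1"
        unfolding q[symmetric] T(3)[symmetric] level_excess_adapted[OF card T(1,2,4) Dm]
        using DTm D1 D2 Bbil Bbd t True by (intro C1) blast+
      have "\<bar>?c * (LINT q|lborel. indicator {0<..<r} q * (q ^ CARD('n) * (t\<^sup>2 + q\<^sup>2) powr (- ?P / 2))) - ?c * curvature_profile CARD('n) s t\<bar>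
        \<le> L * C2"
        unfolding right_diff_distrib[symmetric] abs_mult[of ?c] using lap C2(2)[OF t True] L0 by (intro mult_mono) auto
      with 1 C30 show ?thesis by linarith
    next
      case False
      have "\<bar>?D y\<bar> \<le> norm y" for y using lip[of "x + y" x] by (simp add: dist_norm)
      then have "\<bar>level_excess ?P ?D ?e t\<bar> \<le> C3"
        unfolding C3_def using r False s e1 by (intro level_excess_far Dm) auto
      moreover have "\<bar>?c * curvature_profile CARD('n) s t\<bar> \<le> L * C2"
        unfolding abs_mult[of ?c] using lap C2(3)[of t] L0 False by (intro mult_mono) auto
      ultimately show ?thesis by linarith
    qed
  qed
qed

text \<open>The exponent \<open>1 / 2\<close> lies strictly between 0 and 1, where powers are integrable with respect to \<open>gap\<close>.\<close>

lemma ln_inverse_le_powr: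
  fixes t :: real
  shows "max 0 (ln (1 / \<bar>t\<bar>)) \<le> 2 * \<bar>t\<bar> powr - (1 / 2)"
proof (cases "t = 0")
  case False
  then have t: "0 < \<bar>t\<bar>" by simp
  have "ln (\<bar>t\<bar> powr - (1 / 2)) \<le> \<bar>t\<bar> powr - (1 / 2)" using t by (intro ln_bound) auto
  moreover have "ln (\<bar>t\<bar> powr - (1 / 2)) = - (1 / 2) * ln \<bar>t\<bar>" using t by (simp add: ln_powr)
  moreover have "ln (1 / \<bar>t\<bar>) = - ln \<bar>t\<bar>" using t by (simp add: ln_div)
  moreover have "0 \<le> \<bar>t\<bar> powr - (1 / 2)" by simp
  ultimately show ?thesis by linarith
qed simp

lemma eventually_at_right_less_1: "\<forall>\<^sub>F \<epsilon> in at_right 0. \<epsilon> < (1::real)"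
  by (auto simp: eventually_at_right_field intro: exI[of _ 1])

lemma powr_div_eta_tendsto_0:
  assumes s: "1 / 2 \<le> s"
  shows "((\<lambda>\<epsilon>. \<epsilon> powr (2 * s) / eta s \<epsilon>) \<longlongrightarrow> 0) (at_right 0)"
proof (cases "s = 1 / 2")
  case True
  have l: "filterlim (\<lambda>\<epsilon>::real. - ln \<epsilon>) at_top (at_right 0)"
    by (rule filterlim_compose[OF filterlim_uminus_at_top_at_bot ln_at_0])
  have "((\<lambda>\<epsilon>::real. inverse (- ln \<epsilon>)) \<longlongrightarrow> 0) (at_right 0)"
    by (rule tendsto_inverse_0_at_top[OF l])
  moreover have "\<forall>\<^sub>F \<epsilon> in at_right 0. inverse (- ln \<epsilon>) = \<epsilon> powr (2 * s) / eta s \<epsilon>"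
    using eventually_at_right_less[of 0] eventually_at_right_less_1
  proof eventually_elim
    case (elim \<epsilon>)
    have "\<bar>ln \<epsilon>\<bar> = - ln \<epsilon>" using elim by simp
    have pw: "\<epsilon> powr (2 * s) = \<epsilon>"
    proof -
      have "2 * s = 1" using True by simp
      then show ?thesis using elim by (simp only: powr_one less_imp_le)
    qed
    show ?case using True elim \<open>\<bar>ln \<epsilon>\<bar> = - ln \<epsilon>\<close> unfolding pw by (simp add: eta_def inverse_eq_divide)
  qed
  ultimately show ?thesis by (rule Lim_transform_eventually)
next
  case False
  then have s: "1 / 2 < s" using s by simp
  have "((\<lambda>\<epsilon>::real. \<epsilon> powr (2 * s - 1)) \<longlongrightarrow> 0) (at_right 0)"
    using s by (intro tendsto_zero_powrI[where b="2 * s - 1"] tendsto_const tendsto_ident_at) (auto simp: eventually_at_right_less[of 0] intro: eventually_mono[OF eventually_at_right_less[of 0]])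
  moreover have "\<forall>\<^sub>F \<epsilon> in at_right 0. \<epsilon> powr (2 * s - 1) = \<epsilon> powr (2 * s) / eta s \<epsilon>"
    using eventually_at_right_less[of 0]
    by eventually_elim (use s in \<open>simp add: eta_def powr_diff\<close>)
  ultimately show ?thesis by (rule Lim_transform_eventually)
qed

context transition
begin

lemma integrable_curvature_profile:
  assumes s: "1 / 2 \<le> s" "s < 1" and \<epsilon>: "0 < \<epsilon>"
  shows "integrable gap (\<lambda>t. curvature_profile k s (\<epsilon> * t))"
proof (cases "s = 1 / 2")
  case True
  have i: "integrable gap (\<lambda>t. 2 * \<epsilon> powr - (1 / 2) * \<bar>t\<bar> powr - (1 / 2))"
    using integrable_gap_powr[of "1 / 2"] by (intro integrable_mult_right) auto
  show ?thesis
  proof (rule Bochner_Integration.integrable_bound[OF i])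
    show "(\<lambda>t. curvature_profile k s (\<epsilon> * t)) \<in> borel_measurable gap"
      unfolding curvature_profile_def using True by simp
    have "norm (curvature_profile k s (\<epsilon> * t)) \<le> norm (2 * \<epsilon> powr - (1 / 2) * \<bar>t\<bar> powr - (1 / 2))" for t
      using ln_inverse_le_powr[of "\<epsilon> * t"] True \<epsilon> by (simp add: curvature_profile_def powr_mult abs_mult)
    then show "AE t in gap. norm (curvature_profile k s (\<epsilon> * t)) \<le> norm (2 * \<epsilon> powr - (1 / 2) * \<bar>t\<bar> powr - (1 / 2))"
      by (rule AE_I2)
  qed
next
  case False
  have "(\<lambda>t. curvature_profile k s (\<epsilon> * t))
    = (\<lambda>t. (profile_mass k (real k + 2 * s) * \<epsilon> powr (1 - 2 * s)) * \<bar>t\<bar> powr - (2 * s - 1))"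
    using False \<epsilon> by (simp add: curvature_profile_def abs_mult powr_mult fun_eq_iff)
  then show ?thesis using integrable_gap_powr[of "2 * s - 1"] s False by (simp only:) (intro integrable_mult_right, auto)
qed

text \<open>With \<open>L\<close> in the role of \<open>- ln \<epsilon>\<close>, the integrand tends to 1 and is dominated by \<open>1 + 2 * \<bar>t\<bar> powr - (1 / 2)\<close>.\<close>

lemma log_profile_average_tendsto:
  "((\<lambda>L. LINT t|gap. max 0 (L - ln \<bar>t\<bar>) / L) \<longlongrightarrow> 1) at_top"
proof -
  have "((\<lambda>L. LINT t|gap. max 0 (L - ln \<bar>t\<bar>) / L) \<longlongrightarrow> (LINT t|gap. 1)) at_top"
  proof (rule integral_dominated_convergence_at_top)
    show "integrable gap (\<lambda>t. 1 + 2 * \<bar>t\<bar> powr - (1 / 2))"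
      using integrable_gap_powr[of "1 / 2"] by (intro Bochner_Integration.integrable_add integrable_mult_right) auto
    show "\<forall>\<^sub>F L in at_top. AE t in gap. norm (max 0 (L - ln \<bar>t\<bar>) / L) \<le> 1 + 2 * \<bar>t\<bar> powr - (1 / 2)"
      using eventually_ge_at_top[of "1::real"]
    proof eventually_elim
      case (elim L)
      show ?case
        using AE_gap_nonzero
      proof eventually_elim
        case (elim t)
        have "ln (1 / \<bar>t\<bar>) = - ln \<bar>t\<bar>" using elim by (simp add: ln_div)
        then have b: "max 0 (- ln \<bar>t\<bar>) \<le> 2 * \<bar>t\<bar> powr - (1 / 2)" using ln_inverse_le_powr[of t] by simp
        have "max 0 (L - ln \<bar>t\<bar>) \<le> L + max 0 (- ln \<bar>t\<bar>)" using \<open>1 \<le> L\<close> by auto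
        also have "\<dots> \<le> L + L * max 0 (- ln \<bar>t\<bar>)" using \<open>1 \<le> L\<close> by (auto simp: mult_le_cancel_right1)
        finally have "max 0 (L - ln \<bar>t\<bar>) \<le> L * (1 + max 0 (- ln \<bar>t\<bar>))" by (simp add: algebra_simps)
        then have "max 0 (L - ln \<bar>t\<bar>) / L \<le> 1 + max 0 (- ln \<bar>t\<bar>)" using \<open>1 \<le> L\<close> by (simp add: divide_le_eq mult.commute)
        also have "\<dots> \<le> 1 + 2 * \<bar>t\<bar> powr - (1 / 2)" using b by simp
        finally show ?case using \<open>1 \<le> L\<close> by simp
      qed
    qed
    show "AE t in gap. ((\<lambda>L. max 0 (L - ln \<bar>t\<bar>) / L) \<longlongrightarrow> 1) at_top"
    proof (rule AE_I2)
      fix t :: real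
      have "((\<lambda>L. 1 - ln \<bar>t\<bar> / L) \<longlongrightarrow> 1 - 0) at_top"
        by (intro tendsto_intros tendsto_divide_0[OF tendsto_const] filterlim_at_top_imp_at_infinity filterlim_ident)
      then have "((\<lambda>L. 1 - ln \<bar>t\<bar> / L) \<longlongrightarrow> 1) at_top" by simp
      moreover have "\<forall>\<^sub>F L in at_top. 1 - ln \<bar>t\<bar> / L = max 0 (L - ln \<bar>t\<bar>) / L"
        using eventually_ge_at_top[of "max 1 (ln \<bar>t\<bar>)"] by eventually_elim (auto simp: field_simps)
      ultimately show "((\<lambda>L. max 0 (L - ln \<bar>t\<bar>) / L) \<longlongrightarrow> 1) at_top"
        by (rule Lim_transform_eventually)
    qed
  qed auto
  then show ?thesis using gap.prob_space by simp
qed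

text \<open>For \<open>s > 1/2\<close> there is nothing to pass to the limit: the profile is homogeneous and the expression does not depend on
\<open>\<epsilon>\<close>.\<close>

lemma curvature_profile_average_tendsto:
  assumes s: "1 / 2 \<le> s" "s < 1" and k: "2 \<le> k"
  shows "((\<lambda>\<epsilon>. \<epsilon> powr (2 * s) / eta s \<epsilon> * (LINT t|gap. curvature_profile k s (\<epsilon> * t)))
    \<longlongrightarrow> (if s = 1 / 2 then 1 else c_star k s \<phi>)) (at_right 0)"
proof (cases "s = 1 / 2")
  case True
  have l: "filterlim (\<lambda>\<epsilon>::real. - ln \<epsilon>) at_top (at_right 0)"
    by (rule filterlim_compose[OF filterlim_uminus_at_top_at_bot ln_at_0])
  have "((\<lambda>\<epsilon>. LINT t|gap. max 0 (- ln \<epsilon> - ln \<bar>t\<bar>) / (- ln \<epsilon>)) \<longlongrightarrow> 1) (at_right 0)"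
    by (rule filterlim_compose[OF log_profile_average_tendsto l])
  moreover have "\<forall>\<^sub>F \<epsilon> in at_right 0. (LINT t|gap. max 0 (- ln \<epsilon> - ln \<bar>t\<bar>) / (- ln \<epsilon>))
      = \<epsilon> powr (2 * s) / eta s \<epsilon> * (LINT t|gap. curvature_profile k s (\<epsilon> * t))"
    using eventually_at_right_less[of 0] eventually_at_right_less_1
  proof eventually_elim
    case (elim \<epsilon>)
    have "\<bar>ln \<epsilon>\<bar> = - ln \<epsilon>" using elim by simp
    have pw: "\<epsilon> powr (2 * s) = \<epsilon>"
    proof -
      have "2 * s = 1" using True by simp
      then show ?thesis using elim by (simp only: powr_one less_imp_le)
    qed
    have e: "\<epsilon> powr (2 * s) / eta s \<epsilon> = 1 / (- ln \<epsilon>)"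
      using True elim \<open>\<bar>ln \<epsilon>\<bar> = - ln \<epsilon>\<close> unfolding pw by (simp add: eta_def)
    have "(LINT t|gap. max 0 (- ln \<epsilon> - ln \<bar>t\<bar>) / (- ln \<epsilon>)) = (LINT t|gap. 1 / (- ln \<epsilon>) * curvature_profile k s (\<epsilon> * t))"
      using AE_gap_nonzero
    proof (intro integral_cong_AE, goal_cases)
      case 3
      then show ?case
      proof eventually_elim
        case (elim t)
        have "ln (1 / \<bar>\<epsilon> * t\<bar>) = - ln \<epsilon> - ln \<bar>t\<bar>" using elim \<open>0 < \<epsilon>\<close> by (simp add: ln_div ln_mult abs_mult)
        then show ?case using True by (simp add: curvature_profile_def)
      qed
    qed (use True in \<open>simp_all add: curvature_profile_def\<close>)
    then show ?case unfolding e by simp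
  qed
  ultimately show ?thesis unfolding if_P[OF True] by (rule Lim_transform_eventually)
next
  case False
  then have s1: "1 / 2 < s" using s by simp
  have "\<forall>\<^sub>F \<epsilon> in at_right 0. c_star k s \<phi> = \<epsilon> powr (2 * s) / eta s \<epsilon> * (LINT t|gap. curvature_profile k s (\<epsilon> * t))"
    using eventually_at_right_less[of 0]
  proof eventually_elim
    case (elim \<epsilon>)
    have "(LINT t|gap. curvature_profile k s (\<epsilon> * t))
      = (LINT t|gap. (profile_mass k (real k + 2 * s) * \<epsilon> powr (1 - 2 * s)) * \<bar>t\<bar> powr (1 - 2 * s))"
      using False elim by (simp add: curvature_profile_def abs_mult powr_mult mult.assoc)
    also have "\<dots> = \<epsilon> powr (1 - 2 * s) * c_star k s \<phi>"
      unfolding c_star_eq[OF k s1 s(2)] by simp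
    finally have i: "(LINT t|gap. curvature_profile k s (\<epsilon> * t)) = \<epsilon> powr (1 - 2 * s) * c_star k s \<phi>" .
    have "\<epsilon> powr (2 * s) * \<epsilon> powr (1 - 2 * s) = \<epsilon>" using elim by (simp add: powr_add[symmetric])
    then have "\<epsilon> powr (2 * s) / eta s \<epsilon> * (\<epsilon> powr (1 - 2 * s) * c) = c" for c
      using s1 elim by (simp add: eta_def field_simps)
    then show ?case unfolding i by simp
  qed
  then show ?thesis using False by (simp add: Lim_transform_eventually[OF tendsto_const])
qed

text \<open>The bounded error of the expansion is multiplied by \<open>\<epsilon> powr (2 * s) / eta s \<epsilon>\<close>, which tends to 0, and the Laplacian is
bounded on \<open>X\<close>, so convergence of the averaged profile carries over uniformly.\<close>

lemma a_bar_uniform_limit_laplacian: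
  fixes X :: "(real^'n) set"
  assumes f: "f = deriv \<phi>" and eik: "eikonal d R"
    and card: "CARD('n) = CARD('m::finite) + 1" and s: "1 / 2 \<le> s" "s < 1"
    and l: "0 < l" "\<And>x. x \<in> X \<Longrightarrow> \<bar>d x\<bar> + l < R"
    and sm: "open S" "smooth_on S d" "\<And>x. x \<in> X \<Longrightarrow> cball x \<delta> \<subseteq> S" and \<delta>: "0 < \<delta>"
    and M: "0 \<le> M" "\<And>x z i j. x \<in> X \<Longrightarrow> dist x z \<le> \<delta> \<Longrightarrow> \<bar>iter_partial [i, j] d z\<bar> \<le> M"
      "\<And>x z i j k. x \<in> X \<Longrightarrow> dist x z \<le> \<delta> \<Longrightarrow> \<bar>iter_partial [k, i, j] d z\<bar> \<le> M"
  shows "uniform_limit X (a_bar s \<phi> d) (limit_curvature (unit_sphere_area TYPE('m)) s \<phi> d) (at_right 0)"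
proof -
  let ?N = "CARD('n)"
  let ?V = "unit_ball_vol (real CARD('m))"
  let ?P = "real ?N + 2 * s"
  define J where "J \<epsilon> = \<epsilon> powr (2 * s) / eta s \<epsilon> * (LINT t|gap. curvature_profile ?N s (\<epsilon> * t))" for \<epsilon>
  define J0 where "J0 = (if s = 1 / 2 then 1 else c_star ?N s \<phi>)"
  define L where "L = real ?N * M / 2 * ?V"
  have L0: "0 \<le> L" using M by (simp add: L_def)
  have N2: "2 \<le> ?N" using card zero_less_card_finite[where 'a='m] by linarith
  have dm: "d \<in> borel_measurable borel" using eikonal.continuous_d[OF eik] by (rule borel_measurable_continuous_onI)
  have "\<exists>C\<ge>0. \<forall>x\<in>X. \<forall>t. t \<noteq> 0 \<longrightarrow>
    \<bar>level_excess ?P (\<lambda>y. d (x + y) - d x) (grad d x) t - laplacian d x / 2 * ?V * curvature_profile ?N s t\<bar> \<le> C"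
    by (rule eikonal.level_excess_expansion[OF eik card s l(1) _ sm(1,2) _ \<delta> M(1)]) (fact l sm M)+
  then obtain C where C: "0 \<le> C" "\<forall>x\<in>X. \<forall>t. t \<noteq> 0 \<longrightarrow>
    \<bar>level_excess ?P (\<lambda>y. d (x + y) - d x) (grad d x) t - laplacian d x / 2 * ?V * curvature_profile ?N s t\<bar> \<le> C"
    by (elim exE conjE)
  have m: "real ?N - 1 = real CARD('m)" "real CARD('m) \<noteq> 0" using card zero_less_card_finite[where 'a='m] by simp_all
  have "unit_sphere_area TYPE('m) / (real ?N - 1) = ?V"
    unfolding m(1) unit_sphere_area_eq using m(2) by (rule nonzero_mult_div_cancel_left)
  then have limc: "limit_curvature (unit_sphere_area TYPE('m)) s \<phi> d x = laplacian d x / 2 * ?V * J0" for x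
    unfolding limit_curvature_def J0_def using s by (simp only: if_not_P not_less mult_ac) simp
  have err: "\<bar>a_bar s \<phi> d \<epsilon> x - limit_curvature (unit_sphere_area TYPE('m)) s \<phi> d x\<bar>
      \<le> \<bar>\<epsilon> powr (2 * s) / eta s \<epsilon>\<bar> * C + L * \<bar>J \<epsilon> - J0\<bar>" if x: "x \<in> X" and \<epsilon>: "0 < \<epsilon>" for x \<epsilon>
  proof -
    let ?c = "laplacian d x / 2 * ?V"
    let ?E = "\<lambda>t. level_excess ?P (\<lambda>y. d (x + y) - d x) (grad d x) (\<epsilon> * t)"
    have quad: "\<bar>d (x + y) - d x - grad d x \<bullet> y\<bar> \<le> 1 / (2 * l) * (norm y)\<^sup>2" for y
      using eikonal.quadratic_bound[OF eik l(1) l(2)[OF x]] by simp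
    have K: "0 \<le> 1 / (2 * l)" using l by simp
    have s0: "0 < s" using s by simp
    note ab = a_bar_eq_gap_integral[OF f s0 s(2) \<epsilon> dm K quad]
    note ig = integrable_curvature_profile[OF s \<epsilon>, of ?N]
    have gen: "\<bar>a\<bar> \<le> \<bar>q\<bar> * B" if "a = q * I" "\<bar>I\<bar> \<le> B" for a q I B :: real
      using that by (simp add: abs_mult mult_left_mono)
    have "a_bar s \<phi> d \<epsilon> x - ?c * J \<epsilon> = \<epsilon> powr (2 * s) / eta s \<epsilon> * (LINT t|gap. ?E t - ?c * curvature_profile ?N s (\<epsilon> * t))"
      unfolding ab(1) J_def Bochner_Integration.integral_diff[OF ab(2) integrable_mult_right[OF ig]] by (simp add: algebra_simps)
    moreover have "\<bar>LINT t|gap. ?E t - ?c * curvature_profile ?N s (\<epsilon> * t)\<bar> \<le> C"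
    proof -
      have i: "integrable gap (\<lambda>t. ?E t - ?c * curvature_profile ?N s (\<epsilon> * t))"
        using ab(2) ig by (intro Bochner_Integration.integrable_diff integrable_mult_right)
      have "(LINT t|gap. \<bar>?E t - ?c * curvature_profile ?N s (\<epsilon> * t)\<bar>) \<le> (LINT t|gap. C)"
      proof (rule integral_mono_AE)
        show "AE t in gap. \<bar>?E t - ?c * curvature_profile ?N s (\<epsilon> * t)\<bar> \<le> C"
          using AE_gap_nonzero by eventually_elim (use C(2) x \<epsilon> in simp)
      qed (use i in auto)
      also have "(LINT t|gap. C) = C" using gap.prob_space by simp
      finally show ?thesis by (rule order_trans[OF integral_abs_bound])
    qed
    ultimately have 1: "\<bar>a_bar s \<phi> d \<epsilon> x - ?c * J \<epsilon>\<bar> \<le> \<bar>\<epsilon> powr (2 * s) / eta s \<epsilon>\<bar> * C"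
      by (rule gen)
    have "\<bar>laplacian d x\<bar> \<le> real ?N * M" using M(2)[OF x, of x] \<delta> by (intro laplacian_bound) auto
    then have "\<bar>laplacian d x\<bar> / 2 * ?V \<le> L"
      unfolding L_def by (intro mult_right_mono divide_right_mono) auto
    then have "\<bar>?c\<bar> \<le> L" unfolding abs_mult by simp
    then have "\<bar>?c * J \<epsilon> - ?c * J0\<bar> \<le> L * \<bar>J \<epsilon> - J0\<bar>"
      unfolding right_diff_distrib[symmetric] abs_mult[of ?c] by (intro mult_right_mono) auto
    with 1 show ?thesis unfolding limc by linarith
  qed
  have "(J \<longlongrightarrow> J0) (at_right 0)"
    unfolding J_def[abs_def] J0_def by (rule curvature_profile_average_tendsto[OF s N2])
  then have "((\<lambda>\<epsilon>. \<bar>\<epsilon> powr (2 * s) / eta s \<epsilon>\<bar> * C + L * \<bar>J \<epsilon> - J0\<bar>) \<longlongrightarrow> \<bar>0\<bar> * C + L * \<bar>J0 - J0\<bar>) (at_right 0)"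
    by (intro tendsto_intros powr_div_eta_tendsto_0 s)
  then have z: "((\<lambda>\<epsilon>. \<bar>\<epsilon> powr (2 * s) / eta s \<epsilon>\<bar> * C + L * \<bar>J \<epsilon> - J0\<bar>) \<longlongrightarrow> 0) (at_right 0)" by simp
  show ?thesis
  proof (rule uniform_limitI)
    fix e :: real assume "0 < e"
    then have "\<forall>\<^sub>F \<epsilon> in at_right 0. \<bar>\<epsilon> powr (2 * s) / eta s \<epsilon>\<bar> * C + L * \<bar>J \<epsilon> - J0\<bar> < e"
      using z by (auto dest: order_tendstoD(2))
    then show "\<forall>\<^sub>F \<epsilon> in at_right 0. \<forall>x\<in>X. dist (a_bar s \<phi> d \<epsilon> x) (limit_curvature (unit_sphere_area TYPE('m)) s \<phi> d x) < e"
      using eventually_at_right_less[of 0]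
      by eventually_elim (auto simp: dist_real_def intro: le_less_trans[OF err])
  qed
qed

end

section \<open>The curvature limit for \<open>s < 1/2\<close>\<close>

definition tail_constant :: "nat \<Rightarrow> real \<Rightarrow> real" where
  "tail_constant n P = real n * unit_ball_vol (real n) / (P - real n)"

lemma nn_integral_kernel_tail:
  assumes "real DIM('a::euclidean_space) < P" "0 < r"
  shows "(\<integral>\<^sup>+y. ennreal (indicator {r..} (norm y) * norm (y::'a) powr - P) \<partial>lborel)
    = ennreal (tail_constant DIM('a) P * r powr (real DIM('a) - P))"
  using nn_integral_powr_at_infinity[OF assms] by (simp add: tail_constant_def)

definition near_disagreement :: "('a::euclidean_space \<Rightarrow> real) \<Rightarrow> 'a \<Rightarrow> real \<Rightarrow> real \<Rightarrow> 'a set" where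
  "near_disagreement D e r t = {y. norm y < r \<and> (t < D y) \<noteq> (t < e \<bullet> y)}"

lemma near_disagreement_measurable[measurable]:
  assumes [measurable]: "D \<in> borel_measurable borel"
  shows "near_disagreement D e r t \<in> sets borel"
proof -
  have "near_disagreement D e r t = {y \<in> space borel. norm y < r \<and> (t < D y) \<noteq> (t < e \<bullet> y)}"
    by (simp add: near_disagreement_def)
  also have "\<dots> \<in> sets borel" by measurable
  finally show ?thesis .
qed

lemma level_excess_integrand_le:
  "ennreal \<bar>(indicator {y. t < D y} y - indicator {y. t < e \<bullet> y} y) * norm y powr - P\<bar>
    \<le> ennreal (indicator (near_disagreement D e r t) y * norm y powr - P)
      + ennreal (indicator {r..} (norm y) * norm y powr - P)"
  by (auto simp: indicator_def near_disagreement_def)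

lemma level_excess_bound:
  fixes D :: "'a::euclidean_space \<Rightarrow> real"
  assumes [measurable]: "D \<in> borel_measurable borel" and P: "real DIM('a) < P" and r: "0 < r" and b: "0 \<le> b"
    and near: "(\<integral>\<^sup>+y. ennreal (indicator (near_disagreement D e r t) y * norm y powr - P) \<partial>lborel) \<le> ennreal b"
  shows "integrable lborel (\<lambda>y. (indicator {y. t < D y} y - indicator {y. t < e \<bullet> y} y) * norm y powr - P)"
    and "\<bar>level_excess P D e t\<bar> \<le> b + tail_constant DIM('a) P * r powr (real DIM('a) - P)"
proof -
  let ?f = "\<lambda>y. (indicator {y. t < D y} y - indicator {y. t < e \<bullet> y} y) * norm y powr - P"
  let ?B = "b + tail_constant DIM('a) P * r powr (real DIM('a) - P)"
  have c: "0 \<le> tail_constant DIM('a) P" using P by (simp add: tail_constant_def)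
  have "(\<integral>\<^sup>+y. ennreal \<bar>?f y\<bar> \<partial>lborel) \<le> (\<integral>\<^sup>+y. ennreal (indicator (near_disagreement D e r t) y * norm y powr - P)
      + ennreal (indicator {r..} (norm y) * norm y powr - P) \<partial>lborel)"
    by (intro nn_integral_mono level_excess_integrand_le)
  also have "\<dots> = (\<integral>\<^sup>+y. ennreal (indicator (near_disagreement D e r t) y * norm y powr - P) \<partial>lborel)
      + (\<integral>\<^sup>+y. ennreal (indicator {r..} (norm y) * norm (y::'a) powr - P) \<partial>lborel)"
    by (rule nn_integral_add) measurable
  also have "\<dots> \<le> ennreal b + ennreal (tail_constant DIM('a) P * r powr (real DIM('a) - P))"
    using near by (intro add_mono) (simp_all add: nn_integral_kernel_tail[OF P r])
  also have "\<dots> = ennreal ?B" using b c by simp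
  finally have le: "(\<integral>\<^sup>+y. ennreal \<bar>?f y\<bar> \<partial>lborel) \<le> ennreal ?B" .
  have m: "?f \<in> borel_measurable lborel" by measurable
  show i: "integrable lborel ?f"
    using m le by (intro integrableI_bounded) (auto simp: top.not_eq_extremum intro: le_less_trans[OF _ ennreal_less_top])
  have "ennreal \<bar>level_excess P D e t\<bar> \<le> ennreal ?B"
    using integral_norm_bound_ennreal[OF i] le unfolding level_excess_def real_norm_def by (rule order_trans)
  then show "\<bar>level_excess P D e t\<bar> \<le> ?B" using b c by (subst (asm) ennreal_le_iff) auto
qed

text \<open>The indicators at the levels \<open>t\<close> and 0 are compared in three regions. Within distance \<open>r\<close> each level is bounded by its own near part;
between \<open>r\<close> and \<open>A\<close> the integrand is nonzero only where \<open>D y\<close> or \<open>e \<bullet> y\<close> is within \<open>\<delta>\<close> of 0; beyond \<open>A\<close>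
the kernel is integrable.\<close>

lemma level_excess_diff_integrand_le:
  fixes D :: "'a::euclidean_space \<Rightarrow> real"
  assumes r: "0 < r" and A: "r \<le> A" and t: "\<bar>t\<bar> \<le> \<delta>" and P: "0 \<le> P"
  shows "ennreal \<bar>(indicator {y. t < D y} y - indicator {y. t < e \<bullet> y} y) * norm y powr - P
      - (indicator {y. 0 < D y} y - indicator {y. 0 < e \<bullet> y} y) * norm y powr - P\<bar>
    \<le> (ennreal (indicator (near_disagreement D e r t) y * norm y powr - P)
        + ennreal (indicator (near_disagreement D e r 0) y * norm y powr - P))
      + (ennreal (r powr - P) * (indicator {y \<in> cball 0 A. \<bar>D y\<bar> \<le> \<delta>} y + indicator {y \<in> cball 0 A. \<bar>e \<bullet> y\<bar> \<le> \<delta>} y)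
      + ennreal 2 * ennreal (indicator {A..} (norm y) * norm y powr - P))"
proof -
  define k where "k = norm y powr - P"
  have k0: "0 \<le> k" by (simp add: k_def)
  define a1 a2 c1 c2 :: real where "a1 = indicator {y. t < D y} y" and "a2 = indicator {y. t < e \<bullet> y} y"
    and "c1 = indicator {y. 0 < D y} y" and "c2 = indicator {y. 0 < e \<bullet> y} y"
  note defs = a1_def a2_def c1_def c2_def
  have whole: "(a1 - a2) * norm y powr - P - (c1 - c2) * norm y powr - P = (a1 - a2 - (c1 - c2)) * k"
    by (simp add: k_def algebra_simps)
  have abs: "\<bar>(a1 - a2 - (c1 - c2)) * k\<bar> = \<bar>a1 - a2 - (c1 - c2)\<bar> * k" using k0 by (simp add: abs_mult)
  consider "norm y < r" | "r \<le> norm y" "norm y < A" | "A \<le> norm y" by linarith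
  then have "ennreal (\<bar>a1 - a2 - (c1 - c2)\<bar> * k)
    \<le> (ennreal (indicator (near_disagreement D e r t) y * k) + ennreal (indicator (near_disagreement D e r 0) y * k))
      + (ennreal (r powr - P) * (indicator {y \<in> cball 0 A. \<bar>D y\<bar> \<le> \<delta>} y + indicator {y \<in> cball 0 A. \<bar>e \<bullet> y\<bar> \<le> \<delta>} y)
      + ennreal 2 * ennreal (indicator {A..} (norm y) * k))"
  proof cases
    case 1
    have "\<bar>a1 - a2 - (c1 - c2)\<bar> * k \<le> (indicator (near_disagreement D e r t) y + indicator (near_disagreement D e r 0) y) * k"
      using 1 k0 by (intro mult_right_mono) (auto simp: defs near_disagreement_def indicator_def)
    then have "ennreal (\<bar>a1 - a2 - (c1 - c2)\<bar> * k)
      \<le> ennreal (indicator (near_disagreement D e r t) y * k + indicator (near_disagreement D e r 0) y * k)"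
      by (intro ennreal_leI) (simp add: distrib_right)
    also have "\<dots> = ennreal (indicator (near_disagreement D e r t) y * k) + ennreal (indicator (near_disagreement D e r 0) y * k)"
      using k0 by (intro ennreal_plus) auto
    finally show ?thesis by (rule order_trans) simp
  next
    case 2
    have kr: "k \<le> r powr - P" unfolding k_def using r 2 P by (intro powr_mono2') auto
    let ?u = "indicator {y \<in> cball 0 A. \<bar>D y\<bar> \<le> \<delta>} y + indicator {y \<in> cball 0 A. \<bar>e \<bullet> y\<bar> \<le> \<delta>} y :: real"
    have "\<bar>a1 - a2 - (c1 - c2)\<bar> \<le> \<bar>a1 - c1\<bar> + \<bar>a2 - c2\<bar>" by linarith
    also have "\<dots> \<le> ?u" using 2 t by (intro add_mono) (auto simp: defs indicator_def)
    finally have "\<bar>a1 - a2 - (c1 - c2)\<bar> * k \<le> ?u * r powr - P" using kr k0 by (intro mult_mono) auto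
    then have "ennreal (\<bar>a1 - a2 - (c1 - c2)\<bar> * k) \<le> ennreal (r powr - P * ?u)" by (intro ennreal_leI) (simp add: mult.commute)
    also have "ennreal (r powr - P * ?u) = ennreal (r powr - P) * ennreal ?u" by (rule ennreal_mult) (auto simp: indicator_def)
    also have "ennreal ?u = indicator {y \<in> cball 0 A. \<bar>D y\<bar> \<le> \<delta>} y + indicator {y \<in> cball 0 A. \<bar>e \<bullet> y\<bar> \<le> \<delta>} y"
      by (simp add: ennreal_indicator)
    finally show ?thesis by (rule order_trans) (simp add: add_increasing add_increasing2)
  next
    case 3
    have "\<bar>a1 - a2 - (c1 - c2)\<bar> \<le> 2" by (auto simp: defs indicator_def)
    then have "ennreal (\<bar>a1 - a2 - (c1 - c2)\<bar> * k) \<le> ennreal (2 * k)" using k0 by (intro ennreal_leI mult_right_mono) auto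
    also have "\<dots> = ennreal 2 * ennreal (indicator {A..} (norm y) * k)"
      using 3 k0 by (simp add: ennreal_mult')
    finally show ?thesis by (rule order_trans) (simp add: add_increasing add_increasing2)
  qed
  then show ?thesis unfolding k_def[symmetric] using whole abs by (simp only: defs k_def)
qed

lemma level_excess_diff_bound:
  fixes D :: "'a::euclidean_space \<Rightarrow> real"
  assumes [measurable]: "D \<in> borel_measurable borel" and P: "real DIM('a) < P" and r: "0 < r" "r \<le> A"
    and b: "0 \<le> b" and h: "0 \<le> h" and t: "\<bar>t\<bar> \<le> \<delta>"
    and near: "\<And>u. (\<integral>\<^sup>+y. ennreal (indicator (near_disagreement D e r u) y * norm y powr - P) \<partial>lborel) \<le> ennreal b"
    and thin: "emeasure lborel {y \<in> cball 0 A. \<bar>D y\<bar> \<le> \<delta>} \<le> ennreal h"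
      "emeasure lborel {y \<in> cball 0 A. \<bar>e \<bullet> y\<bar> \<le> \<delta>} \<le> ennreal h"
  shows "\<bar>level_excess P D e t - level_excess P D e 0\<bar>
    \<le> 2 * b + 2 * (r powr - P * h) + 2 * (tail_constant DIM('a) P * A powr (real DIM('a) - P))"
proof -
  let ?f = "\<lambda>t y. (indicator {y. t < D y} y - indicator {y. t < e \<bullet> y} y) * norm y powr - P"
  let ?N = "\<lambda>t y. ennreal (indicator (near_disagreement D e r t) y * norm y powr - P)"
  let ?S1 = "{y \<in> cball 0 A. \<bar>D y\<bar> \<le> \<delta>}" and ?S2 = "{y \<in> cball 0 A. \<bar>e \<bullet> y\<bar> \<le> \<delta>}"
  let ?c = "tail_constant DIM('a) P * A powr (real DIM('a) - P)"
  let ?B = "2 * b + 2 * (r powr - P * h) + 2 * ?c"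
  have A: "0 < A" using r by simp
  have P0: "0 \<le> P" using P by linarith
  have c: "0 \<le> ?c" using P by (simp add: tail_constant_def)
  have [measurable]: "?S1 \<in> sets borel" "?S2 \<in> sets borel"
  proof -
    have "?S1 = cball 0 A \<inter> {y \<in> space borel. \<bar>D y\<bar> \<le> \<delta>}" "?S2 = cball 0 A \<inter> {y \<in> space borel. \<bar>e \<bullet> y\<bar> \<le> \<delta>}" by auto
    moreover have "{y \<in> space borel. \<bar>D y\<bar> \<le> \<delta>} \<in> sets borel" "{y \<in> space borel. \<bar>e \<bullet> y\<bar> \<le> \<delta>} \<in> sets (borel :: 'a measure)"
      by measurable
    ultimately show "?S1 \<in> sets borel" "?S2 \<in> sets borel" by auto
  qed
  note i = level_excess_bound(1)[OF assms(1) P r(1) b near]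
  have i2: "integrable lborel (\<lambda>y. ?f t y - ?f 0 y)" using i by (intro Bochner_Integration.integrable_diff)
  have "(\<integral>\<^sup>+y. ennreal \<bar>?f t y - ?f 0 y\<bar> \<partial>lborel)
    \<le> (\<integral>\<^sup>+y. (?N t y + ?N 0 y) + (ennreal (r powr - P) * (indicator ?S1 y + indicator ?S2 y)
      + ennreal 2 * ennreal (indicator {A..} (norm y) * norm y powr - P)) \<partial>lborel)"
    by (intro nn_integral_mono level_excess_diff_integrand_le r t P0)
  also have "\<dots> = ((\<integral>\<^sup>+y. ?N t y \<partial>lborel) + (\<integral>\<^sup>+y. ?N 0 y \<partial>lborel))
    + (ennreal (r powr - P) * (emeasure lborel ?S1 + emeasure lborel ?S2)
      + ennreal 2 * (\<integral>\<^sup>+y. ennreal (indicator {A..} (norm (y::'a)) * norm y powr - P) \<partial>lborel))"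
  proof -
    have "(\<integral>\<^sup>+y. (?N t y + ?N 0 y) + (ennreal (r powr - P) * (indicator ?S1 y + indicator ?S2 y)
      + ennreal 2 * ennreal (indicator {A..} (norm y) * norm y powr - P)) \<partial>lborel)
      = (\<integral>\<^sup>+y. ?N t y + ?N 0 y \<partial>lborel) + (\<integral>\<^sup>+y. ennreal (r powr - P) * (indicator ?S1 y + indicator ?S2 y)
      + ennreal 2 * ennreal (indicator {A..} (norm y) * norm y powr - P) \<partial>lborel)"
      by (rule nn_integral_add) measurable
    also have "(\<integral>\<^sup>+y. ?N t y + ?N 0 y \<partial>lborel) = (\<integral>\<^sup>+y. ?N t y \<partial>lborel) + (\<integral>\<^sup>+y. ?N 0 y \<partial>lborel)"
      by (rule nn_integral_add) measurable
    also have "(\<integral>\<^sup>+y. ennreal (r powr - P) * (indicator ?S1 y + indicator ?S2 y)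
      + ennreal 2 * ennreal (indicator {A..} (norm (y::'a)) * norm y powr - P) \<partial>lborel)
      = (\<integral>\<^sup>+y. ennreal (r powr - P) * (indicator ?S1 y + indicator ?S2 y) \<partial>lborel)
      + (\<integral>\<^sup>+y. ennreal 2 * ennreal (indicator {A..} (norm (y::'a)) * norm y powr - P) \<partial>lborel)"
      by (rule nn_integral_add) measurable
    also have "(\<integral>\<^sup>+y. ennreal 2 * ennreal (indicator {A..} (norm (y::'a)) * norm y powr - P) \<partial>lborel)
      = ennreal 2 * (\<integral>\<^sup>+y. ennreal (indicator {A..} (norm (y::'a)) * norm y powr - P) \<partial>lborel)"
      by (rule nn_integral_cmult) measurable
    also have "(\<integral>\<^sup>+y. ennreal (r powr - P) * (indicator ?S1 y + indicator ?S2 y) \<partial>lborel)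
      = ennreal (r powr - P) * (\<integral>\<^sup>+y. indicator ?S1 y + indicator ?S2 y \<partial>lborel)"
      by (rule nn_integral_cmult) measurable
    also have "(\<integral>\<^sup>+y. indicator ?S1 y + indicator ?S2 y \<partial>lborel) = (\<integral>\<^sup>+y. indicator ?S1 y \<partial>lborel) + (\<integral>\<^sup>+y. indicator ?S2 y \<partial>lborel)"
      by (rule nn_integral_add) measurable
    also have "(\<integral>\<^sup>+y. indicator ?S1 y \<partial>lborel) = emeasure lborel ?S1" by simp
    also have "(\<integral>\<^sup>+y. indicator ?S2 y \<partial>lborel) = emeasure lborel ?S2" by simp
    finally show ?thesis .
  qed
  also have "\<dots> \<le> (ennreal b + ennreal b) + (ennreal (r powr - P) * (ennreal h + ennreal h) + ennreal 2 * ennreal ?c)"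
    unfolding nn_integral_kernel_tail[OF P A]
    by (intro add_mono mult_left_mono near thin order_refl) auto
  also have "\<dots> = ennreal ?B"
  proof -
    have "ennreal (r powr - P) * (ennreal h + ennreal h) = ennreal (r powr - P * (h + h))"
      using h by (subst ennreal_plus[symmetric]) (auto simp: ennreal_mult)
    moreover have "ennreal 2 * ennreal ?c = ennreal (2 * ?c)" using c by (intro ennreal_mult[symmetric]) auto
    moreover have "?B = (b + b) + (r powr - P * (h + h) + 2 * ?c)" by (simp add: algebra_simps)
    moreover have "0 \<le> r powr - P * (h + h)" using h by simp
    moreover have sum3: "ennreal x + ennreal x + (ennreal y + ennreal z) = ennreal ((x + x) + (y + z))" if "0 \<le> x" "0 \<le> y" "0 \<le> z" for x y z
      using that by (simp only: ennreal_plus[symmetric] add_nonneg_nonneg)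
    ultimately show ?thesis using b c by (simp only: sum3 mult_nonneg_nonneg zero_le_numeral)
  qed
  finally have le: "(\<integral>\<^sup>+y. ennreal \<bar>?f t y - ?f 0 y\<bar> \<partial>lborel) \<le> ennreal ?B" .
  have "ennreal \<bar>LINT y|lborel. ?f t y - ?f 0 y\<bar> \<le> ennreal ?B"
    using integral_norm_bound_ennreal[OF i2] le unfolding real_norm_def by (rule order_trans)
  then have "\<bar>LINT y|lborel. ?f t y - ?f 0 y\<bar> \<le> ?B"
    using b c h by (subst (asm) ennreal_le_iff) auto
  then show ?thesis unfolding level_excess_def using i by (subst (asm) Bochner_Integration.integral_diff) auto
qed

text \<open>In adapted coordinates the slab lies in a product of an interval and a ball.\<close>

lemma slab_emeasure_le:
  fixes e :: "real^'n"
  assumes card: "CARD('n) = CARD('m::finite) + 1" and e: "norm e = 1" and \<delta>: "0 \<le> \<delta>"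
  shows "emeasure lborel {y \<in> cball 0 A. \<bar>e \<bullet> y\<bar> \<le> \<delta>} \<le> ennreal (2 * \<delta>) * emeasure lborel (cball (0::real^'m) A)"
proof -
  obtain T :: "real \<times> (real^'m) \<Rightarrow> real^'n" where T: "linear T" "\<And>p. norm (T p) = norm p" "T (1, 0) = e"
    "\<And>p q. T p \<bullet> T q = p \<bullet> q"
    using adapted_isometry[OF card e] by blast
  have dim: "DIM(real \<times> (real^'m)) = DIM(real^'n)" using card by simp
  have Tm: "T \<in> borel_measurable borel"
    using T(1) by (intro borel_measurable_continuous_onI) (simp add: linear_continuous_on linear_conv_bounded_linear)
  have cl: "{y \<in> cball 0 A. \<bar>e \<bullet> y\<bar> \<le> \<delta>} \<in> sets borel"
  proof -
    have "closed {y. \<bar>e \<bullet> y\<bar> \<le> \<delta>}" by (intro closed_Collect_le continuous_intros)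
    then have "closed (cball 0 A \<inter> {y. \<bar>e \<bullet> y\<bar> \<le> \<delta>})" by (intro closed_Int closed_cball)
    moreover have "cball 0 A \<inter> {y. \<bar>e \<bullet> y\<bar> \<le> \<delta>} = {y \<in> cball 0 A. \<bar>e \<bullet> y\<bar> \<le> \<delta>}" by auto
    ultimately show ?thesis by (metis borel_closed)
  qed
  have fst: "e \<bullet> T p = fst p" for p unfolding T(3)[symmetric] T(4) by (simp add: inner_prod_def)
  have "emeasure lborel {y \<in> cball 0 A. \<bar>e \<bullet> y\<bar> \<le> \<delta>} = emeasure (distr lborel borel T) {y \<in> cball 0 A. \<bar>e \<bullet> y\<bar> \<le> \<delta>}"
    unfolding lborel_distr_isometry[OF T(1,2) dim] ..
  also have "\<dots> = emeasure lborel (T -` {y \<in> cball 0 A. \<bar>e \<bullet> y\<bar> \<le> \<delta>})"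
    using Tm cl by (subst emeasure_distr) auto
  also have "\<dots> \<le> emeasure lborel ({-\<delta>..\<delta>} \<times> cball (0::real^'m) A)"
  proof (rule emeasure_mono)
    show "T -` {y \<in> cball 0 A. \<bar>e \<bullet> y\<bar> \<le> \<delta>} \<subseteq> {-\<delta>..\<delta>} \<times> cball (0::real^'m) A"
    proof
      fix p assume "p \<in> T -` {y \<in> cball 0 A. \<bar>e \<bullet> y\<bar> \<le> \<delta>}"
      then have "norm p \<le> A" "\<bar>fst p\<bar> \<le> \<delta>" by (auto simp: T(2) fst)
      moreover have "norm (snd p) \<le> norm p" using norm_snd_le[of "snd p" "fst p"] by simp
      ultimately show "p \<in> {-\<delta>..\<delta>} \<times> cball 0 A" by (cases p) auto
    qed
    show "{-\<delta>..\<delta>} \<times> cball (0::real^'m) A \<in> sets lborel"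
      by (simp add: borel_closed closed_Times)
  qed
  also have "\<dots> = emeasure lborel {-\<delta>..\<delta>} * emeasure lborel (cball (0::real^'m) A)"
    unfolding lborel_prod[symmetric] by (rule lborel.emeasure_pair_measure_Times) auto
  also have "emeasure lborel {-\<delta>..\<delta>} = ennreal (2 * \<delta>)" using \<delta> by simp
  finally show ?thesis .
qed

text \<open>Off the two null sets, the difference of the indicators is 1 on the first set, \<open>-1\<close> on the second and 0 elsewhere. Finiteness of both
masses follows from the integrability of the difference.\<close>

lemma level_excess_0_eq:
  fixes D :: "'a::euclidean_space \<Rightarrow> real"
  assumes [measurable]: "D \<in> borel_measurable borel"
    and i: "integrable lborel (\<lambda>y. (indicator {y. 0 < D y} y - indicator {y. 0 < e \<bullet> y} y) * norm y powr - P)"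
    and ae: "AE y in lborel. D y \<noteq> 0" "AE y in lborel. e \<bullet> y \<noteq> 0"
  shows "level_excess P D e 0 = measure (density lborel (\<lambda>z. ennreal (1 / norm z powr P))) {y. 0 < D y \<and> e \<bullet> y < 0}
    - measure (density lborel (\<lambda>z. ennreal (1 / norm z powr P))) {y. D y < 0 \<and> 0 < e \<bullet> y}"
proof -
  let ?S1 = "{y. 0 < D y \<and> e \<bullet> y < 0}" and ?S2 = "{y. D y < 0 \<and> 0 < e \<bullet> y}"
  have S: "?S1 \<in> sets borel" "?S2 \<in> sets borel"
  proof -
    have "{y \<in> space borel. 0 < D y \<and> e \<bullet> y < 0} \<in> sets borel" "{y \<in> space borel. D y < 0 \<and> 0 < e \<bullet> y} \<in> sets borel"
      by measurable
    then show "?S1 \<in> sets borel" "?S2 \<in> sets borel" by simp_all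
  qed
  have m: "measure (density lborel (\<lambda>z. ennreal (1 / norm z powr P))) A = (LINT y|lborel. indicator A y * norm y powr - P)"
    if A: "A \<in> sets borel" and iA: "integrable lborel (\<lambda>y. indicator A y * norm y powr - P)" for A :: "'a set"
  proof -
    have "emeasure (density lborel (\<lambda>z. ennreal (1 / norm z powr P))) A
      = (\<integral>\<^sup>+z. ennreal (1 / norm z powr P) * indicator A z \<partial>lborel)"
      using A by (intro emeasure_density) auto
    also have "\<dots> = (\<integral>\<^sup>+z. ennreal (indicator A z * norm z powr - P) \<partial>lborel)"
      by (intro nn_integral_cong) (auto simp: indicator_def powr_minus divide_inverse)
    also have "\<dots> = ennreal (LINT y|lborel. indicator A y * norm y powr - P)"
      using iA by (intro nn_integral_eq_integral) auto
    finally show ?thesis by (simp add: measure_def Bochner_Integration.integral_nonneg)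
  qed
  have iS: "integrable lborel (\<lambda>y. indicator ?S1 y * norm y powr - P)" "integrable lborel (\<lambda>y. indicator ?S2 y * norm y powr - P)"
    by (rule Bochner_Integration.integrable_bound[OF i]; use S in \<open>auto simp: indicator_def\<close>)+
  have "level_excess P D e 0 = (LINT y|lborel. indicator ?S1 y * norm y powr - P - indicator ?S2 y * norm y powr - P)"
    unfolding level_excess_def
  proof (rule integral_cong_AE)
    show "AE y in lborel. (indicator {y. 0 < D y} y - indicator {y. 0 < e \<bullet> y} y) * norm y powr - P
      = indicator ?S1 y * norm y powr - P - indicator ?S2 y * norm y powr - P"
      using ae by eventually_elim (auto simp: indicator_def)
  qed (use i iS in auto)
  also have "\<dots> = (LINT y|lborel. indicator ?S1 y * norm y powr - P) - (LINT y|lborel. indicator ?S2 y * norm y powr - P)"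
    using iS by (rule Bochner_Integration.integral_diff)
  finally show ?thesis unfolding m[OF S(1) iS(1)] m[OF S(2) iS(2)] .
qed

context eikonal
begin

lemma shifted_borel: "(\<lambda>y. d (x + y) - d x) \<in> borel_measurable borel"
proof -
  have "d \<in> borel_measurable borel" using continuous_d by (rule borel_measurable_continuous_onI)
  then show ?thesis by measurable
qed

text \<open>This is \<open>symdiff_mass_near_0\<close> in adapted coordinates, with a constant that depends on \<open>x\<close> only through the room \<open>l\<close> inside the
tube. The exponent \<open>1 - 2 * s\<close> is positive exactly in the present range.\<close>

lemma near_disagreement_mass:
  assumes card: "CARD('n) = CARD('m::finite) + 1" and s: "0 < s" "s < 1 / 2" and l: "0 < l"
  shows "\<exists>c\<ge>0. \<forall>x r t. \<bar>d x\<bar> + l < R \<longrightarrow> 0 < r \<longrightarrow> r \<le> l / 4 \<longrightarrow>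
    (\<integral>\<^sup>+y. ennreal (indicator (near_disagreement (\<lambda>y. d (x + y) - d x) (grad d x) r t) y * norm y powr - (real CARD('n) + 2 * s)) \<partial>lborel)
      \<le> ennreal (c * r powr (1 - 2 * s))"
proof -
  let ?P = "real CARD('n) + 2 * s"
  define c where "c = 4 * (1 / (2 * l)) * (6 / 7) powr - ?P * (real CARD('m) * unit_ball_vol (real CARD('m)) / (1 - 2 * s))"
  show ?thesis
  proof (intro exI[of _ c] conjI allI impI)
    show "0 \<le> c" unfolding c_def using s l by (intro mult_nonneg_nonneg divide_nonneg_nonneg) auto
  next
    fix x r t assume x: "\<bar>d x\<bar> + l < R" and r: "0 < r" "r \<le> l / 4"
    let ?D = "\<lambda>y. d (x + y) - d x"
    have e1: "norm (grad d x) = 1" using x l by (intro unit) auto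
    obtain T :: "real \<times> (real^'m) \<Rightarrow> real^'n" where T: "linear T" "\<And>p. norm (T p) = norm p" "T (1, 0) = grad d x"
      "\<And>p q. T p \<bullet> T q = p \<bullet> q"
      using adapted_isometry[OF card e1] by blast
    have dim: "DIM(real \<times> (real^'m)) = DIM(real^'n)" using card by simp
    have Tm: "T \<in> borel_measurable borel"
      using T(1) by (intro borel_measurable_continuous_onI) (simp add: linear_continuous_on linear_conv_bounded_linear)
    have fst: "grad d x \<bullet> T p = fst p" for p unfolding T(3)[symmetric] T(4) by (simp add: inner_prod_def)
    have Dm: "?D \<in> borel_measurable borel" by (rule shifted_borel)
    have DT: "(\<lambda>p. ?D (T p)) \<in> borel_measurable borel" by (rule measurable_compose[OF Tm Dm])
    have fm: "(\<lambda>y. ennreal (indicator (near_disagreement ?D (grad d x) r t) y * norm y powr - ?P)) \<in> borel_measurable borel"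
      using near_disagreement_measurable[OF Dm] by measurable
    have "(\<integral>\<^sup>+y. ennreal (indicator (near_disagreement ?D (grad d x) r t) y * norm y powr - ?P) \<partial>lborel)
      = (\<integral>\<^sup>+y. ennreal (indicator (near_disagreement ?D (grad d x) r t) y * norm y powr - ?P) \<partial>distr lborel borel T)"
      unfolding lborel_distr_isometry[OF T(1,2) dim] ..
    also have "\<dots> = (\<integral>\<^sup>+p. ennreal (indicator (near_disagreement ?D (grad d x) r t) (T p) * norm (T p) powr - ?P) \<partial>lborel)"
      using Tm fm by (intro nn_integral_distr) auto
    also have "\<dots> = (\<integral>\<^sup>+p. ennreal (indicator {p. norm p < r \<and> (t < ?D (T p)) \<noteq> (t < fst p)} p * norm p powr - ?P) \<partial>lborel)"
      by (intro nn_integral_cong) (simp add: near_disagreement_def indicator_def T(2) fst)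
    also have "\<dots> \<le> ennreal (4 * (1 / (2 * l)) * (6 / 7) powr - ?P * (real DIM(real^'m) * unit_ball_vol (real DIM(real^'m))
        * r powr (real DIM(real^'m) - (?P - 2)) / (real DIM(real^'m) - (?P - 2))))"
    proof (rule symdiff_mass_near_0[OF DT _ _ _ _ _ r(1)])
      show "0 \<le> 1 / (2 * l)" using l by simp
      show "1 / (2 * l) * r \<le> 1 / 8" using r l by (simp add: field_simps)
      show "\<bar>?D (T p) - fst p\<bar> \<le> 1 / (2 * l) * (norm p)\<^sup>2" for p
        using quadratic_bound[OF l x, of "T p"] by (simp add: T(2) fst)
      have "0 < CARD('m)" by simp
      then have "2 \<le> real CARD('n)" using card by linarith
      then show "2 \<le> ?P" using s by linarith
      show "?P - 2 < real DIM(real^'m)" using s card by simp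
    qed
    also have "real DIM(real^'m) - (?P - 2) = 1 - 2 * s" using card by simp
    also have "real DIM(real^'m) = real CARD('m)" by simp
    finally show "(\<integral>\<^sup>+y. ennreal (indicator (near_disagreement ?D (grad d x) r t) y * norm y powr - ?P) \<partial>lborel)
      \<le> ennreal (c * r powr (1 - 2 * s))" by (simp add: c_def mult_ac)
  qed
qed

lemma thin_level_set_at:
  assumes \<rho>: "0 < \<rho>" "\<rho> < R" and h: "0 < h"
  shows "\<exists>\<delta>>0. \<forall>x. \<bar>d x\<bar> \<le> \<rho> \<longrightarrow> emeasure lborel {y \<in> cball 0 A. \<bar>d (x + y) - d x\<bar> \<le> \<delta>} \<le> ennreal h"
proof -
  obtain \<delta> where \<delta>: "0 < \<delta>" "\<And>x c. \<bar>c\<bar> \<le> \<rho> \<Longrightarrow> emeasure lborel {q \<in> cball x A. \<bar>d q - c\<bar> \<le> \<delta>} \<le> ennreal h"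
    using thin_level_set[OF \<rho> h, of A] by blast
  have "emeasure lborel {y \<in> cball 0 A. \<bar>d (x + y) - d x\<bar> \<le> \<delta>} \<le> ennreal h" if x: "\<bar>d x\<bar> \<le> \<rho>" for x
  proof -
    let ?S = "{q \<in> cball x A. \<bar>d q - d x\<bar> \<le> \<delta>}"
    have "closed {q. \<bar>d q - d x\<bar> \<le> \<delta>}"
      by (intro closed_Collect_le continuous_intros continuous_d)
    then have "closed (cball x A \<inter> {q. \<bar>d q - d x\<bar> \<le> \<delta>})" by (intro closed_Int closed_cball)
    moreover have "cball x A \<inter> {q. \<bar>d q - d x\<bar> \<le> \<delta>} = ?S" by auto
    ultimately have S: "?S \<in> sets borel" by (metis borel_closed)
    have "emeasure lborel ?S = emeasure (distr lborel borel ((+) x)) ?S" by (simp only: lborel_distr_plus)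
    also have "\<dots> = emeasure lborel ((+) x -` ?S)" using S by (subst emeasure_distr) auto
    also have "(+) x -` ?S = {y \<in> cball 0 A. \<bar>d (x + y) - d x\<bar> \<le> \<delta>}" by (auto simp: dist_norm)
    finally show ?thesis using \<delta>(2)[OF x, of x] by simp
  qed
  then show ?thesis using \<delta>(1) by blast
qed

text \<open>A level set is contained in its thin neighbourhoods, whose volume is arbitrarily small.\<close>

lemma AE_off_level_set:
  assumes x: "\<bar>d x\<bar> < R"
  shows "AE y in lborel. d (x + y) - d x \<noteq> 0"
proof -
  have "AE y in lborel. \<not> (y \<in> cball 0 (real n) \<and> d (x + y) - d x = 0)" for n
  proof -
    let ?S = "{y \<in> cball 0 (real n). d (x + y) - d x = 0}"
    have S: "?S \<in> sets borel"
    proof -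
      have "?S = cball 0 (real n) \<inter> {y \<in> space borel. d (x + y) - d x = 0}" by auto
      moreover have "{y \<in> space borel. d (x + y) - d x = 0} \<in> sets borel" using shifted_borel[of x] by measurable
      ultimately show ?thesis by auto
    qed
    define \<rho> where "\<rho> = (\<bar>d x\<bar> + R) / 2"
    have \<rho>: "0 < \<rho>" "\<rho> < R" "\<bar>d x\<bar> \<le> \<rho>" using x by (auto simp: \<rho>_def)
    have "emeasure lborel ?S \<le> 0"
    proof (rule ennreal_le_epsilon)
      fix h :: real assume "0 < h"
      obtain \<delta> where \<delta>: "0 < \<delta>" "emeasure lborel {y \<in> cball 0 (real n). \<bar>d (x + y) - d x\<bar> \<le> \<delta>} \<le> ennreal h"
        using thin_level_set_at[OF \<rho>(1,2) \<open>0 < h\<close>, of "real n"] \<rho>(3) by blast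
      have T: "{y \<in> cball 0 (real n). \<bar>d (x + y) - d x\<bar> \<le> \<delta>} \<in> sets lborel"
      proof -
        have "{y \<in> cball 0 (real n). \<bar>d (x + y) - d x\<bar> \<le> \<delta>} = cball 0 (real n) \<inter> {y \<in> space borel. \<bar>d (x + y) - d x\<bar> \<le> \<delta>}" by auto
        moreover have "{y \<in> space borel. \<bar>d (x + y) - d x\<bar> \<le> \<delta>} \<in> sets borel" using shifted_borel[of x] by measurable
        ultimately show ?thesis by auto
      qed
      have "emeasure lborel ?S \<le> emeasure lborel {y \<in> cball 0 (real n). \<bar>d (x + y) - d x\<bar> \<le> \<delta>}"
        using \<delta>(1) T by (intro emeasure_mono) auto
      then show "emeasure lborel ?S \<le> 0 + ennreal h" using \<delta>(2) by simp
    qed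
    then have "?S \<in> null_sets lborel" using S by auto
    then show ?thesis by (rule AE_I') auto
  qed
  then have "AE y in lborel. \<forall>n. \<not> (y \<in> cball 0 (real n) \<and> d (x + y) - d x = 0)" unfolding AE_all_countable by blast
  then show ?thesis
  proof eventually_elim
    case (elim y)
    obtain n where "norm y \<le> real n" using real_arch_simple by blast
    then show ?case using elim[rule_format, of n] by simp
  qed
qed

lemma level_excess_0_frac_curvature:
  assumes card: "CARD('n) = CARD('m::finite) + 1" and s: "0 < s" "s < 1 / 2" and x: "\<bar>d x\<bar> < R"
  shows "level_excess (real CARD('n) + 2 * s) (\<lambda>y. d (x + y) - d x) (grad d x) 0 = frac_curvature s x d"
proof -
  let ?P = "real CARD('n) + 2 * s"
  define l where "l = (R - \<bar>d x\<bar>) / 2"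
  have l: "0 < l" "\<bar>d x\<bar> + l < R" using x by (auto simp: l_def field_simps)
  obtain c where c: "0 \<le> c" "\<And>r t. 0 < r \<Longrightarrow> r \<le> l / 4 \<Longrightarrow>
    (\<integral>\<^sup>+y. ennreal (indicator (near_disagreement (\<lambda>y. d (x + y) - d x) (grad d x) r t) y * norm y powr - ?P) \<partial>lborel)
      \<le> ennreal (c * r powr (1 - 2 * s))"
    using near_disagreement_mass[OF card s l(1)] l(2) by blast
  have r: "0 < l / 4" using l by simp
  have P: "real DIM(real^'n) < ?P" using s by simp
  have b: "0 \<le> c * (l / 4) powr (1 - 2 * s)" using c by simp
  note i = level_excess_bound(1)[OF shifted_borel P r b c(2)[OF r order_refl], of 0]
  have e0: "grad d x \<noteq> 0" using unit[OF x] by auto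
  have "negligible {y. grad d x \<bullet> y = 0}" using e0 by (intro negligible_hyperplane) simp
  moreover have "closed {y. grad d x \<bullet> y = 0}" by (rule closed_hyperplane)
  ultimately have "{y. grad d x \<bullet> y = 0} \<in> null_sets lborel"
    by (simp add: negligible_iff_null_sets null_sets_completion_iff borel_closed)
  then have ae: "AE y in lborel. grad d x \<bullet> y \<noteq> 0" by (rule AE_I') auto
  show ?thesis
    unfolding level_excess_0_eq[OF shifted_borel i AE_off_level_set[OF x] ae] frac_curvature_def frac_measure_def by simp
qed

lemma level_excess_uniform_bound:
  assumes card: "CARD('n) = CARD('m::finite) + 1" and s: "0 < s" "s < 1 / 2" and \<rho>: "\<rho> < R"
  shows "\<exists>C\<ge>0. \<forall>x t. \<bar>d x\<bar> \<le> \<rho> \<longrightarrow> \<bar>level_excess (real CARD('n) + 2 * s) (\<lambda>y. d (x + y) - d x) (grad d x) t\<bar> \<le> C"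
proof -
  let ?P = "real CARD('n) + 2 * s"
  define l where "l = (R - \<rho>) / 2"
  have l: "0 < l" "\<rho> + l < R" using \<rho> by (auto simp: l_def field_simps)
  obtain c where c: "0 \<le> c" "\<And>x r t. \<bar>d x\<bar> + l < R \<Longrightarrow> 0 < r \<Longrightarrow> r \<le> l / 4 \<Longrightarrow>
    (\<integral>\<^sup>+y. ennreal (indicator (near_disagreement (\<lambda>y. d (x + y) - d x) (grad d x) r t) y * norm y powr - ?P) \<partial>lborel)
      \<le> ennreal (c * r powr (1 - 2 * s))"
    using near_disagreement_mass[OF card s l(1)] by blast
  have r: "0 < l / 4" using l by simp
  have P: "real DIM(real^'n) < ?P" using s by simp
  have b: "0 \<le> c * (l / 4) powr (1 - 2 * s)" using c by simp
  have "\<bar>level_excess ?P (\<lambda>y. d (x + y) - d x) (grad d x) t\<bar>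
    \<le> c * (l / 4) powr (1 - 2 * s) + tail_constant DIM(real^'n) ?P * (l / 4) powr (real DIM(real^'n) - ?P)"
    if x: "\<bar>d x\<bar> \<le> \<rho>" for x t
  proof -
    have "\<bar>d x\<bar> + l < R" using x l by simp
    from level_excess_bound(2)[OF shifted_borel P r b c(2)[OF this r order_refl]] show ?thesis .
  qed
  moreover have "0 \<le> tail_constant DIM(real^'n) ?P" using s by (simp add: tail_constant_def)
  ultimately show ?thesis using b by (intro exI[of _ "c * (l / 4) powr (1 - 2 * s) + tail_constant DIM(real^'n) ?P * (l / 4) powr (real DIM(real^'n) - ?P)"]) auto
qed

text \<open>The radii are chosen in the order \<open>r\<close>, \<open>A\<close>, \<open>\<delta>\<close>: \<open>r\<close> makes the near part small, \<open>A\<close> the far part, and then \<open>\<delta>\<close> makes the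
neighbourhoods of the level set and of the hyperplane thin enough for the fixed weight \<open>r powr - P\<close> between.\<close>

lemma level_excess_uniformly_continuous_at_0:
  assumes card: "CARD('n) = CARD('m::finite) + 1" and s: "0 < s" "s < 1 / 2" and \<rho>: "0 < \<rho>" "\<rho> < R" and e: "0 < e"
  shows "\<exists>\<delta>>0. \<forall>x t. \<bar>d x\<bar> \<le> \<rho> \<longrightarrow> \<bar>t\<bar> \<le> \<delta> \<longrightarrow>
    \<bar>level_excess (real CARD('n) + 2 * s) (\<lambda>y. d (x + y) - d x) (grad d x) t
      - level_excess (real CARD('n) + 2 * s) (\<lambda>y. d (x + y) - d x) (grad d x) 0\<bar> \<le> e"
proof -
  let ?P = "real CARD('n) + 2 * s"
  define l where "l = (R - \<rho>) / 2"
  have l: "0 < l" "\<rho> + l < R" using \<rho> by (auto simp: l_def field_simps)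
  obtain c where c: "0 \<le> c" "\<And>x r t. \<bar>d x\<bar> + l < R \<Longrightarrow> 0 < r \<Longrightarrow> r \<le> l / 4 \<Longrightarrow>
    (\<integral>\<^sup>+y. ennreal (indicator (near_disagreement (\<lambda>y. d (x + y) - d x) (grad d x) r t) y * norm y powr - ?P) \<partial>lborel)
      \<le> ennreal (c * r powr (1 - 2 * s))"
    using near_disagreement_mass[OF card s l(1)] by blast
  have P: "real DIM(real^'n) < ?P" using s by simp
  let ?T = "tail_constant DIM(real^'n) ?P"
  have T: "0 \<le> ?T" using s by (simp add: tail_constant_def)
  have pz: "((\<lambda>r::real. r powr (1 - 2 * s)) \<longlongrightarrow> 0) (at_right 0)"
    using s by (intro tendsto_zero_powrI[where b="1 - 2 * s"] tendsto_const tendsto_ident_at)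
      (auto intro: eventually_mono[OF eventually_at_right_less[of 0]])
  have "((\<lambda>r. 2 * (c * r powr (1 - 2 * s))) \<longlongrightarrow> 2 * (c * 0)) (at_right 0)"
    by (intro tendsto_intros pz)
  then have "\<forall>\<^sub>F r in at_right 0. 2 * (c * r powr (1 - 2 * s)) < e / 3" using e by (intro order_tendstoD(2)) auto
  moreover have "\<forall>\<^sub>F r in at_right 0. r \<le> l / 4"
    using l by (auto simp: eventually_at_right_field intro!: exI[of _ "l / 4"])
  ultimately have "\<forall>\<^sub>F r in at_right 0. 0 < r \<and> r \<le> l / 4 \<and> 2 * (c * r powr (1 - 2 * s)) < e / 3"
    using eventually_at_right_less[of "0::real"] by eventually_elim auto
  then obtain r where r: "0 < r" "r \<le> l / 4" "2 * (c * r powr (1 - 2 * s)) < e / 3"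
    using eventually_happens'[OF trivial_limit_at_right_real] by blast
  have "((\<lambda>A::real. A powr (real DIM(real^'n) - ?P)) \<longlongrightarrow> 0) at_top"
    using s by (intro tendsto_neg_powr filterlim_ident) simp
  then have "((\<lambda>A::real. 2 * (?T * A powr (real DIM(real^'n) - ?P))) \<longlongrightarrow> 2 * (?T * 0)) at_top"
    by (intro tendsto_intros)
  then have "\<forall>\<^sub>F A in at_top. 2 * (?T * A powr (real DIM(real^'n) - ?P)) < e / 3" using e by (intro order_tendstoD(2)) auto
  then have "\<forall>\<^sub>F A in at_top. r \<le> A \<and> 2 * (?T * A powr (real DIM(real^'n) - ?P)) < e / 3"
    using eventually_ge_at_top[of r] by eventually_elim auto
  then obtain A where A: "r \<le> A" "2 * (?T * A powr (real DIM(real^'n) - ?P)) < e / 3"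
    using eventually_happens'[OF trivial_limit_at_top_linorder] by blast
  define h where "h = e / 6 / r powr - ?P"
  have rp: "0 < r powr - ?P" using r by simp
  have h: "0 < h" "2 * (r powr - ?P * h) = e / 3" using e rp by (auto simp: h_def)
  obtain \<delta>1 where \<delta>1: "0 < \<delta>1" "\<And>x. \<bar>d x\<bar> \<le> \<rho> \<Longrightarrow> emeasure lborel {y \<in> cball 0 A. \<bar>d (x + y) - d x\<bar> \<le> \<delta>1} \<le> ennreal h"
    using thin_level_set_at[OF \<rho> h(1), of A] by blast
  define V where "V = measure lborel (cball (0::real^'m) A)"
  have V: "emeasure lborel (cball (0::real^'m) A) = ennreal V" "0 \<le> V"
  proof -
    have "emeasure lborel (cball (0::real^'m) A) < \<infinity>" by (rule emeasure_bounded_finite) (rule bounded_cball)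
    then show "emeasure lborel (cball (0::real^'m) A) = ennreal V" unfolding V_def by (intro emeasure_eq_ennreal_measure) auto
  qed (simp add: V_def)
  define \<delta> where "\<delta> = min \<delta>1 (h / (2 * (V + 1)))"
  have \<delta>: "0 < \<delta>" "\<delta> \<le> \<delta>1" using \<delta>1 h V by (auto simp: \<delta>_def)
  have "\<delta> * (2 * (V + 1)) \<le> h" using V(2) by (simp add: \<delta>_def pos_le_divide_eq[symmetric])
  then have \<delta>V: "2 * \<delta> * V \<le> h" using \<delta>(1) by (simp add: algebra_simps)
  have "\<bar>level_excess ?P (\<lambda>y. d (x + y) - d x) (grad d x) t - level_excess ?P (\<lambda>y. d (x + y) - d x) (grad d x) 0\<bar> \<le> e"
    if x: "\<bar>d x\<bar> \<le> \<rho>" and t: "\<bar>t\<bar> \<le> \<delta>" for x t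
  proof -
    let ?D = "\<lambda>y. d (x + y) - d x"
    have xl: "\<bar>d x\<bar> + l < R" using x l by simp
    have e1: "norm (grad d x) = 1" using x \<rho> by (intro unit) auto
    have thin1: "emeasure lborel {y \<in> cball 0 A. \<bar>?D y\<bar> \<le> \<delta>} \<le> ennreal h"
    proof (rule order_trans[OF emeasure_mono \<delta>1(2)[OF x]])
      show "{y \<in> cball 0 A. \<bar>?D y\<bar> \<le> \<delta>} \<subseteq> {y \<in> cball 0 A. \<bar>?D y\<bar> \<le> \<delta>1}" using \<delta> by auto
      have "{y \<in> cball 0 A. \<bar>?D y\<bar> \<le> \<delta>1} = cball 0 A \<inter> {y \<in> space borel. \<bar>?D y\<bar> \<le> \<delta>1}" by auto
      moreover have "{y \<in> space borel. \<bar>?D y\<bar> \<le> \<delta>1} \<in> sets borel" using shifted_borel[of x] by measurable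
      ultimately show "{y \<in> cball 0 A. \<bar>?D y\<bar> \<le> \<delta>1} \<in> sets lborel" by auto
    qed
    have "emeasure lborel {y \<in> cball 0 A. \<bar>grad d x \<bullet> y\<bar> \<le> \<delta>} \<le> ennreal (2 * \<delta>) * ennreal V"
      using slab_emeasure_le[OF card e1 less_imp_le[OF \<delta>(1)], of A] by (simp only: V)
    also have "\<dots> = ennreal (2 * \<delta> * V)" using \<delta> V by (intro ennreal_mult[symmetric]) auto
    also have "\<dots> \<le> ennreal h" using \<delta>V by (rule ennreal_leI)
    finally have thin2: "emeasure lborel {y \<in> cball 0 A. \<bar>grad d x \<bullet> y\<bar> \<le> \<delta>} \<le> ennreal h" .
    have "0 \<le> c * r powr (1 - 2 * s)" using c by simp
    from level_excess_diff_bound[OF shifted_borel P r(1) A(1) this less_imp_le[OF h(1)] t c(2)[OF xl r(1,2)] thin1 thin2]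
    show ?thesis using r(3) A(2) h(2) by linarith
  qed
  then show ?thesis using \<delta>(1) by blast
qed

end

lemma (in transition) gap_tail:
  assumes "0 < e"
  obtains B where "0 < B" "measure gap {t. B < \<bar>t\<bar>} < e"
proof -
  have "(\<lambda>n. measure gap {t. real n < \<bar>t\<bar>}) \<longlonglongrightarrow> measure gap (\<Inter>n. {t. real n < \<bar>t\<bar>})"
    by (rule gap.finite_Lim_measure_decseq) (auto simp: decseq_def)
  moreover have "(\<Inter>n. {t. real n < \<bar>t\<bar>}) = {}"
  proof -
    have "\<exists>n. \<not> real n < \<bar>t\<bar>" for t using real_arch_simple[of "\<bar>t\<bar>"] by (auto simp: not_less)
    then show ?thesis by auto
  qed
  ultimately have "(\<lambda>n. measure gap {t. real n < \<bar>t\<bar>}) \<longlonglongrightarrow> 0" by simp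
  then have "\<forall>\<^sub>F n in sequentially. measure gap {t. real n < \<bar>t\<bar>} < e" using assms by (rule order_tendstoD(2))
  then have "\<forall>\<^sub>F n in sequentially. measure gap {t. real n < \<bar>t\<bar>} < e \<and> 0 < n"
    using eventually_gt_at_top[of 0] by eventually_elim auto
  then obtain n :: nat where "measure gap {t. real n < \<bar>t\<bar>} < e" "0 < n"
    using eventually_happens'[OF sequentially_bot] by blast
  then show thesis by (intro that[of "real n"]) auto
qed

text \<open>The average of \<open>E (\<epsilon> * t)\<close> over \<open>gap\<close> is close to \<open>E 0\<close>: for \<open>\<bar>t\<bar> \<le> B\<close> by continuity at 0, and the rest has
small probability while \<open>E\<close> is bounded.\<close>

lemma (in transition) a_bar_uniform_limit_frac_curvature:
  fixes X :: "(real^'n) set"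
  assumes f: "f = deriv \<phi>" and eik: "eikonal d R"
    and card: "CARD('n) = CARD('m::finite) + 1" and s: "0 < s" "s < 1 / 2"
    and \<rho>: "0 < \<rho>" "\<rho> < R" "\<And>x. x \<in> X \<Longrightarrow> \<bar>d x\<bar> \<le> \<rho>"
  shows "uniform_limit X (a_bar s \<phi> d) (limit_curvature A s \<phi> d) (at_right 0)"
proof (rule uniform_limitI)
  fix e :: real assume e: "0 < e"
  let ?E = "\<lambda>x. level_excess (real CARD('n) + 2 * s) (\<lambda>y. d (x + y) - d x) (grad d x)"
  have s1: "s < 1" using s by simp
  have dm: "d \<in> borel_measurable borel" using eikonal.continuous_d[OF eik] by (rule borel_measurable_continuous_onI)
  from eikonal.level_excess_uniform_bound[OF eik card s \<rho>(2)]
  obtain C where C: "0 \<le> C" "\<forall>x t. \<bar>d x\<bar> \<le> \<rho> \<longrightarrow> \<bar>?E x t\<bar> \<le> C" by (elim exE conjE)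
  have "0 < e / 4" using e by simp
  from eikonal.level_excess_uniformly_continuous_at_0[OF eik card s \<rho>(1,2) this]
  obtain \<delta> where \<delta>: "0 < \<delta>" "\<forall>x t. \<bar>d x\<bar> \<le> \<rho> \<longrightarrow> \<bar>t\<bar> \<le> \<delta> \<longrightarrow> \<bar>?E x t - ?E x 0\<bar> \<le> e / 4"
    by (elim exE conjE)
  have "0 < e / (8 * (C + 1))" using e C by simp
  then obtain B where B: "0 < B" "measure gap {t. B < \<bar>t\<bar>} < e / (8 * (C + 1))" by (rule gap_tail)
  have "2 * C * measure gap {t. B < \<bar>t\<bar>} \<le> 2 * C * (e / (8 * (C + 1)))"
    using B C by (intro mult_left_mono) auto
  also have "\<dots> \<le> e / 4" using C e by (simp add: field_simps)
  finally have tail: "2 * C * measure gap {t. B < \<bar>t\<bar>} \<le> e / 4" .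
  have main: "dist (a_bar s \<phi> d \<epsilon> x) (limit_curvature A s \<phi> d x) < e" if \<epsilon>: "0 < \<epsilon>" "\<epsilon> < \<delta> / B" and x: "x \<in> X" for \<epsilon> x
  proof -
    define l where "l = (R - \<rho>) / 2"
    note xr = \<rho>(3)[OF x]
    have l: "0 < l" "\<bar>d x\<bar> + l < R" using \<rho> xr by (auto simp: l_def field_simps)
    have quad: "\<bar>d (x + y) - d x - grad d x \<bullet> y\<bar> \<le> 1 / (2 * l) * (norm y)\<^sup>2" for y
      using eikonal.quadratic_bound[OF eik l] by simp
    have K: "0 \<le> 1 / (2 * l)" using l by simp
    note ab = a_bar_eq_gap_integral[OF f s(1) s1 \<epsilon>(1) dm K quad]
    have pre: "\<epsilon> powr (2 * s) / eta s \<epsilon> = 1" using \<epsilon> s by (simp add: eta_def)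
    then have a: "a_bar s \<phi> d \<epsilon> x = (LINT t|gap. ?E x (\<epsilon> * t))" unfolding ab(1) pre by simp
    have lc: "limit_curvature A s \<phi> d x = ?E x 0"
      using s l by (simp add: limit_curvature_def eikonal.level_excess_0_frac_curvature[OF eik card s])
    have i: "integrable gap (\<lambda>t. ?E x (\<epsilon> * t) - ?E x 0)" using ab(2) by (intro Bochner_Integration.integrable_diff) auto
    have im: "integrable gap (\<lambda>t. e / 4 + 2 * C * indicator {t. B < \<bar>t\<bar>} t)"
      by (intro Bochner_Integration.integrable_add integrable_mult_right integrable_real_indicator) (auto simp: gap.emeasure_finite less_top[symmetric])
    have diff: "a_bar s \<phi> d \<epsilon> x - limit_curvature A s \<phi> d x = (LINT t|gap. ?E x (\<epsilon> * t) - ?E x 0)"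
      unfolding a lc using ab(2) gap.prob_space by (subst Bochner_Integration.integral_diff) auto
    have "\<bar>LINT t|gap. ?E x (\<epsilon> * t) - ?E x 0\<bar> \<le> (LINT t|gap. \<bar>?E x (\<epsilon> * t) - ?E x 0\<bar>)" by (rule integral_abs_bound)
    also have "\<dots> \<le> (LINT t|gap. e / 4 + 2 * C * indicator {t. B < \<bar>t\<bar>} t)"
    proof (rule integral_mono[OF integrable_abs[OF i] im])
      fix t :: real
      show "\<bar>?E x (\<epsilon> * t) - ?E x 0\<bar> \<le> e / 4 + 2 * C * indicator {t. B < \<bar>t\<bar>} t"
      proof (cases "B < \<bar>t\<bar>")
        case True
        have "\<bar>?E x (\<epsilon> * t) - ?E x 0\<bar> \<le> C + C" using C(2)[rule_format, OF xr, of "\<epsilon> * t"] C(2)[rule_format, OF xr, of 0] by linarith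
        then show ?thesis using True e by simp
      next
        case False
        then have "\<bar>\<epsilon> * t\<bar> \<le> \<epsilon> * B" using \<epsilon> by (simp add: abs_mult)
        also have "\<dots> \<le> \<delta>" using \<epsilon> B by (simp add: pos_less_divide_eq less_imp_le)
        finally show ?thesis using \<delta>(2)[rule_format, OF xr] False by simp
      qed
    qed
    also have "\<dots> = e / 4 + 2 * C * measure gap {t. B < \<bar>t\<bar>}"
      using gap.prob_space by (subst Bochner_Integration.integral_add) (auto intro!: integrable_real_indicator simp: gap.emeasure_finite less_top[symmetric])
    also have "\<dots> < e" using tail e by simp
    finally show ?thesis unfolding dist_real_def diff .
  qed
  have "\<forall>\<^sub>F \<epsilon> in at_right 0. \<epsilon> < \<delta> / B"
    using \<delta> B by (auto simp: eventually_at_right_field intro!: exI[of _ "\<delta> / B"])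
  then show "\<forall>\<^sub>F \<epsilon> in at_right 0. \<forall>x\<in>X. dist (a_bar s \<phi> d \<epsilon> x) (limit_curvature A s \<phi> d x) < e"
    using eventually_at_right_less[of "0::real"] by eventually_elim (use main in blast)
qed

section \<open>The limit of the averages\<close>

lemma transition_of_phase_transition:
  assumes "phase_transition s \<beta> W \<phi>"
  obtains Bd where "transition \<phi> (deriv \<phi>) Bd"
proof -
  have C2: "C2_holder_on UNIV \<beta> \<phi>" and pos: "\<And>\<xi>. 0 < deriv \<phi> \<xi>"
    and lim: "(\<phi> \<longlongrightarrow> 0) at_bot" "(\<phi> \<longlongrightarrow> 1) at_top"
    using assms by (auto simp: phase_transition_def)
  obtain Bd where Bd: "\<And>x. norm (deriv \<phi> x) \<le> Bd"
    using C2 by (auto simp: C2_holder_on_def bounded_iff)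
  have "transition \<phi> (deriv \<phi>) Bd"
  proof
    fix x
    show "(\<phi> has_real_derivative deriv \<phi> x) (at x)"
      using C2 by (auto simp: C2_holder_on_def DERIV_deriv_iff_field_differentiable)
    show "isCont (deriv \<phi>) x"
      using C2 by (auto simp: C2_holder_on_def intro: field_differentiable_imp_continuous_at)
    show "0 < deriv \<phi> x" by (rule pos)
    show "deriv \<phi> x \<le> Bd" using Bd[of x] by simp
  qed (rule lim)+
  then show thesis by (rule that)
qed

text \<open>In the range \<open>s \<ge> 1/2\<close>, boundedness of \<open>K\<close> or of the derivatives gives the uniform bounds on second and third
derivatives; smoothness alone does not. Points of \<open>K\<close> have room \<open>\<rho> / 2\<close> in the tube of radius \<open>2 * \<rho>\<close> and balls of radius
\<open>\<rho> / 4\<close> around them stay inside.\<close>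

lemma a_bar_uniform_limit:
  fixes \<Omega> K :: "(real^'n) set"
  assumes card: "CARD('n) = CARD('m::finite) + 1" and s: "0 < s" "s < 1"
    and pt: "phase_transition s \<beta> W \<phi>"
    and ne: "frontier \<Omega> \<noteq> {}" and sb: "smooth_boundary \<Omega>"
    and \<rho>: "0 < \<rho>" and sm: "smooth_on (tube \<Omega> (2 * \<rho>)) (signed_dist \<Omega>)"
    and K: "K \<subseteq> tube \<Omega> \<rho>"
      "s < 1 / 2 \<or> bounded K \<or> (\<forall>r < 2 * \<rho>. bounded_derivs_on (tube \<Omega> r) (signed_dist \<Omega>))"
  shows "uniform_limit K (a_bar s \<phi> (signed_dist \<Omega>))
    (limit_curvature (unit_sphere_area TYPE('m)) s \<phi> (signed_dist \<Omega>)) (at_right 0)"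
proof -
  let ?d = "signed_dist \<Omega>"
  obtain Bd where tr: "transition \<phi> (deriv \<phi>) Bd" using transition_of_phase_transition[OF pt] by blast
  note eik = eikonal_signed_dist[OF ne sb sm]
  have dK: "\<bar>?d x\<bar> < \<rho>" if "x \<in> K" for x using K(1) that by (auto simp: tube_def)
  show ?thesis
  proof (cases "s < 1 / 2")
    case True
    show ?thesis
    proof (rule transition.a_bar_uniform_limit_frac_curvature[OF tr refl eik card s(1) True \<rho>])
      show "\<rho> < 2 * \<rho>" using \<rho> by simp
      show "\<bar>?d x\<bar> \<le> \<rho>" if "x \<in> K" for x using dK[OF that] by simp
    qed
  next
    case False
    then have s2: "1 / 2 \<le> s" by simp
    have K2: "bounded K \<or> (\<forall>r < 2 * \<rho>. bounded_derivs_on (tube \<Omega> r) ?d)" using K(2) False by blast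
    obtain M where M: "M \<ge> 0" "\<And>x z i j. x \<in> K \<Longrightarrow> dist x z \<le> \<rho> / 4 \<Longrightarrow> \<bar>iter_partial [i, j] ?d z\<bar> \<le> M"
      "\<And>x z i j k. x \<in> K \<Longrightarrow> dist x z \<le> \<rho> / 4 \<Longrightarrow> \<bar>iter_partial [k, i, j] ?d z\<bar> \<le> M"
      by (rule derivatives_bounded_near[OF ne \<rho> sm K(1) K2]) blast
    have "\<bar>?d x\<bar> + \<rho> / 2 < 2 * \<rho>" if "x \<in> K" for x using dK[OF that] \<rho> by simp
    moreover have "open (tube \<Omega> (2 * \<rho>))"
      unfolding tube_eq by (intro open_Collect_less continuous_intros)
    moreover have "cball x (\<rho> / 4) \<subseteq> tube \<Omega> (2 * \<rho>)" if "x \<in> K" for x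
    proof
      fix z assume "z \<in> cball x (\<rho> / 4)"
      then have "\<bar>?d x - ?d z\<bar> \<le> \<rho> / 4" using signed_dist_lipschitz[OF ne, of x z] by simp
      then show "z \<in> tube \<Omega> (2 * \<rho>)" using dK[OF that] \<rho> unfolding tube_def mem_Collect_eq by linarith
    qed
    moreover have "0 < \<rho> / 2" "0 < \<rho> / 4" using \<rho> by simp_all
    ultimately show ?thesis
      by (intro transition.a_bar_uniform_limit_laplacian[OF tr refl eik card s2 s(2) _ _ _ sm _ _ M])
  qed
qed

theorem theorem1p3:
  fixes \<Omega> :: "(real^'n) set"
    and s \<beta> \<rho> :: real
    and W \<phi> :: "real \<Rightarrow> real"
  assumes "CARD('n) \<ge> 2" and "CARD('n) = CARD('m::finite) + 1"
    and "0 < s" and "s < 1"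
    and "0 < \<beta>" and "\<beta> < 1"
    and "double_well \<beta> W"
    and "phase_transition s \<beta> W \<phi>"
    and "connected \<Omega>" and "frontier \<Omega> \<noteq> {}" and "smooth_boundary \<Omega>"
    and "\<rho> > 0" and "smooth_on (tube \<Omega> (2 * \<rho>)) (signed_dist \<Omega>)"
  shows
    "(s > 1/2 \<longrightarrow> c_star CARD('n) s \<phi> > 0) \<and>
     (s < 1/2 \<or> bounded (frontier \<Omega>) \<or>
        (\<forall>r < 2 * \<rho>. bounded_derivs_on (tube \<Omega> r) (signed_dist \<Omega>)) \<longrightarrow>
      uniform_limit (tube \<Omega> \<rho>) (a_bar s \<phi> (signed_dist \<Omega>))
        (limit_curvature (unit_sphere_area TYPE('m)) s \<phi> (signed_dist \<Omega>)) (at_right 0)) \<and>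
     (\<forall>K \<subseteq> tube \<Omega> \<rho>. bounded K \<longrightarrow>
      uniform_limit K (a_bar s \<phi> (signed_dist \<Omega>))
        (limit_curvature (unit_sphere_area TYPE('m)) s \<phi> (signed_dist \<Omega>)) (at_right 0))"
proof -
  note lim = a_bar_uniform_limit[OF assms(2,3,4,8,10,11,12,13)]
  obtain Bd where tr: "transition \<phi> (deriv \<phi>) Bd" using transition_of_phase_transition[OF assms(8)] by blast
  have "c_star CARD('n) s \<phi> > 0" if "s > 1/2"
    using transition.c_star_pos[OF tr assms(1) that assms(4)] .
  moreover have "uniform_limit (tube \<Omega> \<rho>) (a_bar s \<phi> (signed_dist \<Omega>))
      (limit_curvature (unit_sphere_area TYPE('m)) s \<phi> (signed_dist \<Omega>)) (at_right 0)"
    if "s < 1/2 \<or> bounded (frontier \<Omega>) \<or> (\<forall>r < 2 * \<rho>. bounded_derivs_on (tube \<Omega> r) (signed_dist \<Omega>))"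
    using that bounded_tube[OF _ assms(10), of \<rho>] by (intro lim) auto
  moreover have "uniform_limit K (a_bar s \<phi> (signed_dist \<Omega>))
      (limit_curvature (unit_sphere_area TYPE('m)) s \<phi> (signed_dist \<Omega>)) (at_right 0)"
    if "K \<subseteq> tube \<Omega> \<rho>" "bounded K" for K
    using that by (intro lim) auto
  ultimately show ?thesis by blast
qed

end
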